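(* Let $T$ be a theory. The 2-category $\mathcal{C}$ of small pseudo $T$-algebras admits weighted bicolimits: for every small 2-category $\mathcal{D}$ and all pseudo functors $J:\mathcal{D}^{op}\to Cat$ and $F:\mathcal{D}\to\mathcal{C}$, there exists a $J$-weighted bicolimit of $F$ in $\mathcal{C}$.
   Context: Weighted bicolimits. $Cat$ is the 2-category of small categories; pseudo functors and pseudo natural transformations have invertible coherence 2-cells. $Hom[\mathcal{E},Cat]$ is the 2-category of pseudo functors $\mathcal{E}\to Cat$, pseudo natural transformations and modifications. An object $W$ of $\mathcal{C}$ is a $J$-weighted bicolimit of $F$ if the strict 2-functors $\mathcal{C}\to Cat$, $C\mapsto\mathcal{C}(W,C)$ and $C\mapsto Hom[\mathcal{D}^{op},Cat](J,\mathcal{C}(F-,C))$, are equivalent in $Hom[\mathcal{C},Cat]$, i.e. there is a pseudo natural transformation from one to the other whose components are equivalences of categories. Theories. A theory $T$ is a category with objects $0,1,2,\dots$ in which $n$ is the product of $n$ copies of $1$, with chosen projections $pr_i:n\to 1$. Put $T(n)=Mor_T(n,1)$ (words of arity $n$). For a function $f:\{1,\dots,k\}\to\{1,\dots,\ell\}$ let $f':\ell\to k$ be the morphism with $pr_i f'=pr_{f(i)}$, and for $w\in T(k)$ put $w_f=w\circ f'\in T(\ell)$. For $w\in T(k)$, $w_i\in T(n_i)$ put $\gamma(w,w_1,\dots,w_k)=w\circ(w_1,\dots,w_k)\in T(n_1+\dots+n_k)$, where $(w_1,\dots,w_k):n_1+\dots+n_k\to k$ has $i$-th component $(w_i)_{\iota_i}$,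 $\iota_i$ being the inclusion onto the $i$-th block. The unit $1\in T(1)$ is the projection $pr_1:1\to1$. For a category $X$, $End(X)$ is the theory with $End(X)(n)=Functors(X^n,X)$; there $\gamma(F,F_1,\dots,F_k)=F\circ(F_1\times\dots\times F_k)$, $F_f(x_1,\dots,x_\ell)=F(x_{f1},\dots,x_{fk})$, and the unit is $1_X$; these operations also apply to natural transformations. Pseudo $T$-algebras. A pseudo $T$-algebra is a category $X$ with functions $\Phi:T(n)\to Functors(X^n,X)$ for all $n\ge 0$ and natural isomorphisms $c_{w,w_1,\dots,w_k}:\Phi(\gamma(w,w_1,\dots,w_k))\Rightarrow\gamma(\Phi(w),\Phi(w_1),\dots,\Phi(w_k))$, $I:\Phi(1)\Rightarrow 1_X$, $s_{w,f}:\Phi(w_f)\Rightarrow\Phi(w)_f$, such that (vertical composition written $\circ$, $i$ = identity 2-cell): (1) $\gamma(c_{w,w_1,\dots,w_k},i,\dots,i)\circ c_{\gamma(w,w_1,\dots,w_k),w_{11},\dots,w_{kn_k}}=\gamma(i_{\Phi(w)},c_{w_1,w_{11},\dots,w_{1n_1}},\dots,c_{w_k,w_{k1},\dots,w_{kn_k}})\circ c_{w,\gamma(w_1,w_{11},\dots),\dots,\gamma(w_k,w_{k1},\dots)}$; (2) $\gamma(i_{\Phi(w)},I,\dots,I)\circ c_{w,1,\dots,1}=i$; (3) $\gamma(I,i_{\Phi(w)})\circ c_{1,w}=i$; (4) for $f:\{1,\dots,k\}\to\{1,\dots,\ell\}$, $w\in T(k)$, $w_j\in T(n_j)$ ($1\le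 j\le\ell$), with $\bar f:\{1,\dots,n_{f1}+\dots+n_{fk}\}\to\{1,\dots,n_1+\dots+n_\ell\}$ carrying the $i$-th block identically onto the $f(i)$-th block: $(c_{w,w_{f1},\dots,w_{fk}})_{\bar f}\circ s_{\gamma(w,w_{f1},\dots,w_{fk}),\bar f}=\gamma(s_{w,f},i,\dots,i)\circ c_{w_f,w_1,\dots,w_\ell}$; (5) for functions $g_i:\{1,\dots,n_i\}\to\{1,\dots,n_i'\}$ with block sum $g=g_1+\dots+g_k$: $(c_{w,w_1,\dots,w_k})_g\circ s_{\gamma(w,w_1,\dots,w_k),g}=\gamma(i_{\Phi(w)},s_{w_1,g_1},\dots,s_{w_k,g_k})\circ c_{w,(w_1)_{g_1},\dots,(w_k)_{g_k}}$; (6) $(s_{w,f})_g\circ s_{w_f,g}=s_{w,g\circ f}$; (7) $s_{w,id}$ is the identity. A morphism $H:(X,\Phi)\to(Y,\Psi)$ of pseudo $T$-algebras is a functor with natural isomorphisms $\rho_w:H\circ\Phi(w)\Rightarrow\Psi(w)\circ(H,\dots,H)$ for all words $w$ such that $(c*i)\circ\rho_{\gamma(w,w_1,\dots,w_k)}=(i_{\Psi(w)}*(\rho_{w_1},\dots,\rho_{w_k}))\circ(\rho_w*i)\circ(i_H*c)$, $(I*i_H)\circ\rho_1=i_H*I$, and $(s_{w,f}*i)\circ\rho_{w_f}=(\rho_w)_f\circ(i_H*s_{w,f})$. Composites have $\rho^{HG}_w=(\rho^H_w*i)\circ(i_H*\rho^G_w)$. A 2-cell $\alpha:G\Rightarrow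 H$ is a natural transformation with $\rho^H_w\circ(\alpha*i_{\Phi(w)})=(i_{\Psi(w)}*(\alpha,\dots,\alpha))\circ\rho^G_w$ for all $w$. *)

theory Defs
  imports Main "HOL-Library.FuncSet"
begin

text \<open>
  Throughout, functions that are part of an object, arrow or cell whose equality matters (functors,
  transformations, modifications, morphisms of algebras) are extensional, i.e. \<^const>\<open>undefined\<close>
  outside their carrier, so that equality in HOL is mathematical equality.
\<close>

section \<open>Universes\<close>

text \<open>
  ``Small'' means: member of a fixed universe \<open>U\<close> of subsets of an ambient type. Only the closure
  properties below are required. The sets of cardinality below a given uncountable regular cardinal
  that is at most the successor of the cardinality of \<open>'u\<close> satisfy them; this covers both the
  small sets of a Grothendieck universe (an inaccessible cardinal) and, for infinite \<open>'u\<close>, the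
  family of all subsets of \<open>'u\<close>. Closure under power sets is not needed, because categories of
  functors and of morphisms are never required to be members of the universe.
\<close>

locale universe =
  fixes U :: "'u set set"
  assumes infinite_small: "\<exists>A\<in>U. infinite A"
    and subset_small: "A \<in> U \<Longrightarrow> B \<subseteq> A \<Longrightarrow> B \<in> U"
    and image_small: "A \<in> U \<Longrightarrow> f ` A \<in> U"
    and Union_small: "I \<in> U \<Longrightarrow> (\<And>i. i \<in> I \<Longrightarrow> V i \<in> U) \<Longrightarrow> (\<Union>i\<in>I. V i) \<in> U"

section \<open>Categories, functors, natural transformations\<close>

record ('o, 'a) cat =
  Obj :: "'o set"
  Arr :: "'a set"
  Dom :: "'a \<Rightarrow> 'o"
  Cod :: "'a \<Rightarrow> 'o"
  Ide :: "'o \<Rightarrow> 'a"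
  Cmp :: "'a \<Rightarrow> 'a \<Rightarrow> 'a"

abbreviation vcomp :: "'a \<Rightarrow> ('o, 'a) cat \<Rightarrow> 'a \<Rightarrow> 'a"  ("(_ /\<cdot>\<^bsub>_\<^esub> _)" [66, 0, 65] 65)
  where "g \<cdot>\<^bsub>C\<^esub> f \<equiv> Cmp C g f"

definition hom :: "('o, 'a) cat \<Rightarrow> 'o \<Rightarrow> 'o \<Rightarrow> 'a set"
  where "hom C a b = {f \<in> Arr C. Dom C f = a \<and> Cod C f = b}"

locale category =
  fixes C :: "('o, 'a) cat"
  assumes Dom_Obj: "f \<in> Arr C \<Longrightarrow> Dom C f \<in> Obj C"
    and Cod_Obj: "f \<in> Arr C \<Longrightarrow> Cod C f \<in> Obj C"
    and Ide_hom: "a \<in> Obj C \<Longrightarrow> Ide C a \<in> hom C a a"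
    and Cmp_hom: "f \<in> hom C a b \<Longrightarrow> g \<in> hom C b c \<Longrightarrow> g \<cdot>\<^bsub>C\<^esub> f \<in> hom C a c"
    and Cmp_Ide_left: "f \<in> hom C a b \<Longrightarrow> Ide C b \<cdot>\<^bsub>C\<^esub> f = f"
    and Cmp_Ide_right: "f \<in> hom C a b \<Longrightarrow> f \<cdot>\<^bsub>C\<^esub> Ide C a = f"
    and Cmp_assoc: "f \<in> hom C a b \<Longrightarrow> g \<in> hom C b c \<Longrightarrow> h \<in> hom C c d \<Longrightarrow>
      h \<cdot>\<^bsub>C\<^esub> (g \<cdot>\<^bsub>C\<^esub> f) = (h \<cdot>\<^bsub>C\<^esub> g) \<cdot>\<^bsub>C\<^esub> f"

definition isos :: "('o, 'a) cat \<Rightarrow> 'o \<Rightarrow> 'o \<Rightarrow> 'a set"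
  where "isos C a b = {f \<in> hom C a b. \<exists>g \<in> hom C b a. g \<cdot>\<^bsub>C\<^esub> f = Ide C a \<and> f \<cdot>\<^bsub>C\<^esub> g = Ide C b}"

record ('o, 'a, 'p, 'b) func =
  fo :: "'o \<Rightarrow> 'p"
  fa :: "'a \<Rightarrow> 'b"

definition functors :: "('o, 'a) cat \<Rightarrow> ('p, 'b) cat \<Rightarrow> ('o, 'a, 'p, 'b) func set" where
  "functors A B = {F.
     fo F \<in> Obj A \<rightarrow>\<^sub>E Obj B \<and> fa F \<in> Arr A \<rightarrow>\<^sub>E Arr B \<and>
     (\<forall>f\<in>Arr A. Dom B (fa F f) = fo F (Dom A f) \<and> Cod B (fa F f) = fo F (Cod A f)) \<and>
     (\<forall>a\<in>Obj A. fa F (Ide A a) = Ide B (fo F a)) \<and>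
     (\<forall>f\<in>Arr A. \<forall>g\<in>Arr A. Dom A g = Cod A f \<longrightarrow> fa F (g \<cdot>\<^bsub>A\<^esub> f) = fa F g \<cdot>\<^bsub>B\<^esub> fa F f)}"

definition id_func :: "('o, 'a) cat \<Rightarrow> ('o, 'a, 'o, 'a) func"
  where "id_func A = \<lparr>fo = (\<lambda>a\<in>Obj A. a), fa = (\<lambda>f\<in>Arr A. f)\<rparr>"

text \<open>\<open>compF A G F\<close> is the composite of \<open>G\<close> after \<open>F\<close>, where \<open>A\<close> is the domain of \<open>F\<close>.\<close>

definition compF ::
  "('o, 'a) cat \<Rightarrow> ('p, 'b, 'q, 'c) func \<Rightarrow> ('o, 'a, 'p, 'b) func \<Rightarrow> ('o, 'a, 'q, 'c) func"
  where "compF A G F = \<lparr>fo = (\<lambda>a\<in>Obj A. fo G (fo F a)), fa = (\<lambda>f\<in>Arr A. fa G (fa F f))\<rparr>"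

text \<open>
  A family of components together with its source and target; used for natural transformations
  (\<open>'f\<close> functors), 2-cells of algebras (\<open>'f\<close> morphisms of algebras) and modifications (\<open>'f\<close> pseudo
  natural transformations).
\<close>

record ('f, 'i, 'a) cell =
  src :: 'f
  tgt :: 'f
  cmp :: "'i \<Rightarrow> 'a"

type_synonym ('o, 'a, 'p, 'b) nt = "(('o, 'a, 'p, 'b) func, 'o, 'b) cell"

definition nat_trans :: "('o, 'a) cat \<Rightarrow> ('p, 'b) cat \<Rightarrow> ('o, 'a, 'p, 'b) nt set" where
  "nat_trans A B = {\<alpha>. src \<alpha> \<in> functors A B \<and> tgt \<alpha> \<in> functors A B \<and>
     cmp \<alpha> \<in> extensional (Obj A) \<and>
     (\<forall>a\<in>Obj A. cmp \<alpha> a \<in> hom B (fo (src \<alpha>) a) (fo (tgt \<alpha>) a)) \<and>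
     (\<forall>f\<in>Arr A. cmp \<alpha> (Cod A f) \<cdot>\<^bsub>B\<^esub> fa (src \<alpha>) f = fa (tgt \<alpha>) f \<cdot>\<^bsub>B\<^esub> cmp \<alpha> (Dom A f))}"

definition fun_cat ::
  "('o, 'a) cat \<Rightarrow> ('p, 'b) cat \<Rightarrow> (('o, 'a, 'p, 'b) func, ('o, 'a, 'p, 'b) nt) cat" where
  "fun_cat A B = \<lparr>
     Obj = functors A B, Arr = nat_trans A B, Dom = src, Cod = tgt,
     Ide = (\<lambda>F. \<lparr>src = F, tgt = F, cmp = (\<lambda>a\<in>Obj A. Ide B (fo F a))\<rparr>),
     Cmp = (\<lambda>\<beta> \<alpha>. \<lparr>src = src \<alpha>, tgt = tgt \<beta>, cmp = (\<lambda>a\<in>Obj A. cmp \<beta> a \<cdot>\<^bsub>B\<^esub> cmp \<alpha> a)\<rparr>)\<rparr>"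

abbreviation idn :: "('o, 'a) cat \<Rightarrow> ('p, 'b) cat \<Rightarrow> ('o, 'a, 'p, 'b) func \<Rightarrow> ('o, 'a, 'p, 'b) nt"
  where "idn A B F \<equiv> Ide (fun_cat A B) F"

text \<open>
  \<open>hcomp A C \<beta> \<alpha>\<close> is the horizontal composite \<open>\<beta> * \<alpha>\<close> of \<open>\<alpha>\<close> between functors from \<open>A\<close> to \<open>B\<close> and
  \<open>\<beta>\<close> between functors from \<open>B\<close> to \<open>C\<close>.
\<close>

definition hcomp ::
  "('o, 'a) cat \<Rightarrow> ('q, 'c) cat \<Rightarrow> ('p, 'b, 'q, 'c) nt \<Rightarrow> ('o, 'a, 'p, 'b) nt \<Rightarrow> ('o, 'a, 'q, 'c) nt"
  where "hcomp A C \<beta> \<alpha> = \<lparr>src = compF A (src \<beta>) (src \<alpha>), tgt = compF A (tgt \<beta>) (tgt \<alpha>),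
     cmp = (\<lambda>a\<in>Obj A. fa (tgt \<beta>) (cmp \<alpha> a) \<cdot>\<^bsub>C\<^esub> cmp \<beta> (fo (src \<alpha>) a))\<rparr>"

definition equivalence :: "('o, 'a) cat \<Rightarrow> ('p, 'b) cat \<Rightarrow> ('o, 'a, 'p, 'b) func \<Rightarrow> bool" where
  "equivalence A B F \<longleftrightarrow> F \<in> functors A B \<and> (\<exists>G \<in> functors B A.
     isos (fun_cat A A) (id_func A) (compF A G F) \<noteq> {} \<and>
     isos (fun_cat B B) (compF B F G) (id_func B) \<noteq> {})"

section \<open>2-categories and pseudo functors\<close>

text \<open>
  Strict 2-categories, presented by their hom-categories: \<open>Hc1 x y z g f\<close> and \<open>Hc2 x y z \<beta> \<alpha>\<close>
  are the composite of 1-cells and the horizontal composite of 2-cells, for \<open>f\<close>, \<open>\<alpha>\<close> in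
  \<open>Hom x y\<close> and \<open>g\<close>, \<open>\<beta>\<close> in \<open>Hom y z\<close>.
\<close>

record ('o, 'f, 'a) twocat =
  Ob :: "'o set"
  Hom :: "'o \<Rightarrow> 'o \<Rightarrow> ('f, 'a) cat"
  One :: "'o \<Rightarrow> 'f"
  Hc1 :: "'o \<Rightarrow> 'o \<Rightarrow> 'o \<Rightarrow> 'f \<Rightarrow> 'f \<Rightarrow> 'f"
  Hc2 :: "'o \<Rightarrow> 'o \<Rightarrow> 'o \<Rightarrow> 'a \<Rightarrow> 'a \<Rightarrow> 'a"

locale two_category =
  fixes C :: "('o, 'f, 'a) twocat"
  assumes category_Hom: "x \<in> Ob C \<Longrightarrow> y \<in> Ob C \<Longrightarrow> category (Hom C x y)"
    and One_Obj: "x \<in> Ob C \<Longrightarrow> One C x \<in> Obj (Hom C x x)"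
    and Hc1_Obj: "\<lbrakk>x \<in> Ob C; y \<in> Ob C; z \<in> Ob C; f \<in> Obj (Hom C x y); g \<in> Obj (Hom C y z)\<rbrakk>
      \<Longrightarrow> Hc1 C x y z g f \<in> Obj (Hom C x z)"
    and Hc2_hom: "\<lbrakk>x \<in> Ob C; y \<in> Ob C; z \<in> Ob C; \<alpha> \<in> hom (Hom C x y) f f'; \<beta> \<in> hom (Hom C y z) g g'\<rbrakk>
      \<Longrightarrow> Hc2 C x y z \<beta> \<alpha> \<in> hom (Hom C x z) (Hc1 C x y z g f) (Hc1 C x y z g' f')"
    and Hc2_Ide: "\<lbrakk>x \<in> Ob C; y \<in> Ob C; z \<in> Ob C; f \<in> Obj (Hom C x y); g \<in> Obj (Hom C y z)\<rbrakk>
      \<Longrightarrow> Hc2 C x y z (Ide (Hom C y z) g) (Ide (Hom C x y) f) = Ide (Hom C x z) (Hc1 C x y z g f)"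
    and Hc2_Cmp: "\<lbrakk>x \<in> Ob C; y \<in> Ob C; z \<in> Ob C;
        \<alpha> \<in> hom (Hom C x y) f f'; \<alpha>' \<in> hom (Hom C x y) f' f'';
        \<beta> \<in> hom (Hom C y z) g g'; \<beta>' \<in> hom (Hom C y z) g' g''\<rbrakk>
      \<Longrightarrow> Hc2 C x y z (\<beta>' \<cdot>\<^bsub>Hom C y z\<^esub> \<beta>) (\<alpha>' \<cdot>\<^bsub>Hom C x y\<^esub> \<alpha>)
        = Hc2 C x y z \<beta>' \<alpha>' \<cdot>\<^bsub>Hom C x z\<^esub> Hc2 C x y z \<beta> \<alpha>"
    and Hc1_One_left: "\<lbrakk>x \<in> Ob C; y \<in> Ob C; f \<in> Obj (Hom C x y)\<rbrakk> \<Longrightarrow> Hc1 C x y y (One C y) f = f"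
    and Hc1_One_right: "\<lbrakk>x \<in> Ob C; y \<in> Ob C; f \<in> Obj (Hom C x y)\<rbrakk> \<Longrightarrow> Hc1 C x x y f (One C x) = f"
    and Hc2_One_left: "\<lbrakk>x \<in> Ob C; y \<in> Ob C; \<alpha> \<in> Arr (Hom C x y)\<rbrakk>
      \<Longrightarrow> Hc2 C x y y (Ide (Hom C y y) (One C y)) \<alpha> = \<alpha>"
    and Hc2_One_right: "\<lbrakk>x \<in> Ob C; y \<in> Ob C; \<alpha> \<in> Arr (Hom C x y)\<rbrakk>
      \<Longrightarrow> Hc2 C x x y \<alpha> (Ide (Hom C x x) (One C x)) = \<alpha>"
    and Hc1_assoc: "\<lbrakk>w \<in> Ob C; x \<in> Ob C; y \<in> Ob C; z \<in> Ob C;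
        f \<in> Obj (Hom C w x); g \<in> Obj (Hom C x y); h \<in> Obj (Hom C y z)\<rbrakk>
      \<Longrightarrow> Hc1 C w y z h (Hc1 C w x y g f) = Hc1 C w x z (Hc1 C x y z h g) f"
    and Hc2_assoc: "\<lbrakk>w \<in> Ob C; x \<in> Ob C; y \<in> Ob C; z \<in> Ob C;
        \<alpha> \<in> Arr (Hom C w x); \<beta> \<in> Arr (Hom C x y); \<gamma> \<in> Arr (Hom C y z)\<rbrakk>
      \<Longrightarrow> Hc2 C w y z \<gamma> (Hc2 C w x y \<beta> \<alpha>) = Hc2 C w x z (Hc2 C x y z \<gamma> \<beta>) \<alpha>"

definition small_twocat :: "'u set set \<Rightarrow> ('u, 'u, 'u) twocat \<Rightarrow> bool" where
  "small_twocat U D \<longleftrightarrow> Ob D \<in> U \<and>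
     (\<forall>x\<in>Ob D. \<forall>y\<in>Ob D. Obj (Hom D x y) \<in> U \<and> Arr (Hom D x y) \<in> U)"

text \<open>The opposite 2-category: 1-cells are reversed, 2-cells are not.\<close>

definition op2 :: "('o, 'f, 'a) twocat \<Rightarrow> ('o, 'f, 'a) twocat" where
  "op2 C = \<lparr>Ob = Ob C, Hom = (\<lambda>x y. Hom C y x), One = One C,
     Hc1 = (\<lambda>x y z g f. Hc1 C z y x f g), Hc2 = (\<lambda>x y z \<beta> \<alpha>. Hc2 C z y x \<alpha> \<beta>)\<rparr>"

definition Cat :: "'u set set \<Rightarrow>
  (('u, 'u) cat, ('u, 'u, 'u, 'u) func, ('u, 'u, 'u, 'u) nt) twocat" where
  "Cat U = \<lparr>Ob = {A. category A \<and> Obj A \<in> U \<and> Arr A \<in> U}, Hom = fun_cat, One = id_func,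
     Hc1 = (\<lambda>A B C. compF A), Hc2 = (\<lambda>A B C. hcomp A C)\<rparr>"

text \<open>
  Pseudo functors: \<open>Pc x y z g f\<close> is the coherence 2-cell from \<open>P g \<circ> P f\<close> to \<open>P (g \<circ> f)\<close> for
  \<open>f\<close> in \<open>Hom x y\<close> and \<open>g\<close> in \<open>Hom y z\<close>, and \<open>Pu x\<close> the one from the identity of \<open>P x\<close> to the
  image of the identity of \<open>x\<close>.
\<close>

record ('d, 'g, 'b, 'o, 'f, 'a) pfun =
  P0 :: "'d \<Rightarrow> 'o"
  P1 :: "'d \<Rightarrow> 'd \<Rightarrow> 'g \<Rightarrow> 'f"
  P2 :: "'d \<Rightarrow> 'd \<Rightarrow> 'b \<Rightarrow> 'a"
  Pc :: "'d \<Rightarrow> 'd \<Rightarrow> 'd \<Rightarrow> 'g \<Rightarrow> 'g \<Rightarrow> 'a"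
  Pu :: "'d \<Rightarrow> 'a"

locale pseudo_functor =
  fixes D :: "('d, 'g, 'b) twocat" and C :: "('o, 'f, 'a) twocat"
    and P :: "('d, 'g, 'b, 'o, 'f, 'a) pfun"
  assumes P0_Ob: "x \<in> Ob D \<Longrightarrow> P0 P x \<in> Ob C"
    and P1_Obj: "\<lbrakk>x \<in> Ob D; y \<in> Ob D; f \<in> Obj (Hom D x y)\<rbrakk>
      \<Longrightarrow> P1 P x y f \<in> Obj (Hom C (P0 P x) (P0 P y))"
    and P2_hom: "\<lbrakk>x \<in> Ob D; y \<in> Ob D; \<alpha> \<in> hom (Hom D x y) f g\<rbrakk>
      \<Longrightarrow> P2 P x y \<alpha> \<in> hom (Hom C (P0 P x) (P0 P y)) (P1 P x y f) (P1 P x y g)"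
    and P2_Ide: "\<lbrakk>x \<in> Ob D; y \<in> Ob D; f \<in> Obj (Hom D x y)\<rbrakk>
      \<Longrightarrow> P2 P x y (Ide (Hom D x y) f) = Ide (Hom C (P0 P x) (P0 P y)) (P1 P x y f)"
    and P2_Cmp: "\<lbrakk>x \<in> Ob D; y \<in> Ob D; \<alpha> \<in> hom (Hom D x y) f g; \<beta> \<in> hom (Hom D x y) g h\<rbrakk>
      \<Longrightarrow> P2 P x y (\<beta> \<cdot>\<^bsub>Hom D x y\<^esub> \<alpha>) = P2 P x y \<beta> \<cdot>\<^bsub>Hom C (P0 P x) (P0 P y)\<^esub> P2 P x y \<alpha>"
    and Pc_iso: "\<lbrakk>x \<in> Ob D; y \<in> Ob D; z \<in> Ob D; f \<in> Obj (Hom D x y); g \<in> Obj (Hom D y z)\<rbrakk>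
      \<Longrightarrow> Pc P x y z g f \<in> isos (Hom C (P0 P x) (P0 P z))
            (Hc1 C (P0 P x) (P0 P y) (P0 P z) (P1 P y z g) (P1 P x y f))
            (P1 P x z (Hc1 D x y z g f))"
    and Pu_iso: "x \<in> Ob D
      \<Longrightarrow> Pu P x \<in> isos (Hom C (P0 P x) (P0 P x)) (One C (P0 P x)) (P1 P x x (One D x))"
    and Pc_natural: "\<lbrakk>x \<in> Ob D; y \<in> Ob D; z \<in> Ob D;
        \<alpha> \<in> hom (Hom D x y) f f'; \<beta> \<in> hom (Hom D y z) g g'\<rbrakk>
      \<Longrightarrow> P2 P x z (Hc2 D x y z \<beta> \<alpha>) \<cdot>\<^bsub>Hom C (P0 P x) (P0 P z)\<^esub> Pc P x y z g f
        = Pc P x y z g' f' \<cdot>\<^bsub>Hom C (P0 P x) (P0 P z)\<^esub>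
            Hc2 C (P0 P x) (P0 P y) (P0 P z) (P2 P y z \<beta>) (P2 P x y \<alpha>)"
    and Pc_assoc: "\<lbrakk>w \<in> Ob D; x \<in> Ob D; y \<in> Ob D; z \<in> Ob D;
        f \<in> Obj (Hom D w x); g \<in> Obj (Hom D x y); h \<in> Obj (Hom D y z)\<rbrakk>
      \<Longrightarrow> Pc P w x z (Hc1 D x y z h g) f \<cdot>\<^bsub>Hom C (P0 P w) (P0 P z)\<^esub>
            Hc2 C (P0 P w) (P0 P x) (P0 P z) (Pc P x y z h g)
              (Ide (Hom C (P0 P w) (P0 P x)) (P1 P w x f))
        = Pc P w y z h (Hc1 D w x y g f) \<cdot>\<^bsub>Hom C (P0 P w) (P0 P z)\<^esub>
            Hc2 C (P0 P w) (P0 P y) (P0 P z) (Ide (Hom C (P0 P y) (P0 P z)) (P1 P y z h))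
              (Pc P w x y g f)"
    and Pc_unit_right: "\<lbrakk>x \<in> Ob D; y \<in> Ob D; f \<in> Obj (Hom D x y)\<rbrakk>
      \<Longrightarrow> Pc P x x y f (One D x) \<cdot>\<^bsub>Hom C (P0 P x) (P0 P y)\<^esub>
            Hc2 C (P0 P x) (P0 P x) (P0 P y) (Ide (Hom C (P0 P x) (P0 P y)) (P1 P x y f)) (Pu P x)
        = Ide (Hom C (P0 P x) (P0 P y)) (P1 P x y f)"
    and Pc_unit_left: "\<lbrakk>x \<in> Ob D; y \<in> Ob D; f \<in> Obj (Hom D x y)\<rbrakk>
      \<Longrightarrow> Pc P x y y (One D y) f \<cdot>\<^bsub>Hom C (P0 P x) (P0 P y)\<^esub>
            Hc2 C (P0 P x) (P0 P y) (P0 P y) (Pu P y) (Ide (Hom C (P0 P x) (P0 P y)) (P1 P x y f))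
        = Ide (Hom C (P0 P x) (P0 P y)) (P1 P x y f)"

section \<open>Pseudo natural transformations and modifications between category-valued pseudo functors\<close>

text \<open>
  A category-valued pseudo functor assigns categories to objects, with composition \<^const>\<open>compF\<close>
  and \<^const>\<open>hcomp\<close> as in \<^const>\<open>Cat\<close>. Source \<open>J\<close> and target \<open>K\<close> of a pseudo natural transformation
  may take values in categories over different types, since the hom-categories of a 2-category
  live over other types than the categories in \<open>Cat U\<close>.
\<close>

type_synonym ('d, 'g, 'b, 'o, 'a) catfun =
  "('d, 'g, 'b, ('o, 'a) cat, ('o, 'a, 'o, 'a) func, ('o, 'a, 'o, 'a) nt) pfun"

text \<open>
  \<open>t1 \<tau> x\<close> is the component at the object \<open>x\<close>; for \<open>f\<close> in \<open>Hom x y\<close>, \<open>t2 \<tau> x y f\<close> is the coherence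
  2-cell from \<open>K f \<circ> \<tau>\<^sub>x\<close> to \<open>\<tau>\<^sub>y \<circ> J f\<close>.
\<close>

record ('d, 'g, 'o, 'a, 'p, 'e) pnat =
  t1 :: "'d \<Rightarrow> ('o, 'a, 'p, 'e) func"
  t2 :: "'d \<Rightarrow> 'd \<Rightarrow> 'g \<Rightarrow> ('o, 'a, 'p, 'e) nt"

definition one_cell :: "('d, 'g, 'b) twocat \<Rightarrow> 'd \<Rightarrow> 'd \<Rightarrow> 'g \<Rightarrow> bool"
  where "one_cell D x y f \<longleftrightarrow> x \<in> Ob D \<and> y \<in> Ob D \<and> f \<in> Obj (Hom D x y)"

definition pseudo_nats :: "('d, 'g, 'b) twocat \<Rightarrow> ('d, 'g, 'b, 'o, 'a) catfun \<Rightarrow>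
  ('d, 'g, 'b, 'p, 'e) catfun \<Rightarrow> ('d, 'g, 'o, 'a, 'p, 'e) pnat set" where
  "pseudo_nats D J K = {\<tau>.
     t1 \<tau> \<in> (\<Pi>\<^sub>E x\<in>Ob D. functors (P0 J x) (P0 K x)) \<and>
     (\<forall>x y f. \<not> one_cell D x y f \<longrightarrow> t2 \<tau> x y f = undefined) \<and>
     (\<forall>x y f. one_cell D x y f \<longrightarrow>
        t2 \<tau> x y f \<in> isos (fun_cat (P0 J x) (P0 K y))
          (compF (P0 J x) (P1 K x y f) (t1 \<tau> x)) (compF (P0 J x) (t1 \<tau> y) (P1 J x y f))) \<and>
     (\<forall>x\<in>Ob D. \<forall>y\<in>Ob D. \<forall>\<theta>\<in>Arr (Hom D x y).
        hcomp (P0 J x) (P0 K y) (idn (P0 J y) (P0 K y) (t1 \<tau> y)) (P2 J x y \<theta>)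
          \<cdot>\<^bsub>fun_cat (P0 J x) (P0 K y)\<^esub> t2 \<tau> x y (Dom (Hom D x y) \<theta>)
        = t2 \<tau> x y (Cod (Hom D x y) \<theta>) \<cdot>\<^bsub>fun_cat (P0 J x) (P0 K y)\<^esub>
          hcomp (P0 J x) (P0 K y) (P2 K x y \<theta>) (idn (P0 J x) (P0 K x) (t1 \<tau> x))) \<and>
     (\<forall>x y z f g. one_cell D x y f \<longrightarrow> one_cell D y z g \<longrightarrow>
        hcomp (P0 J x) (P0 K z) (idn (P0 J z) (P0 K z) (t1 \<tau> z)) (Pc J x y z g f)
          \<cdot>\<^bsub>fun_cat (P0 J x) (P0 K z)\<^esub>
        (hcomp (P0 J x) (P0 K z) (t2 \<tau> y z g) (idn (P0 J x) (P0 J y) (P1 J x y f))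
          \<cdot>\<^bsub>fun_cat (P0 J x) (P0 K z)\<^esub>
        hcomp (P0 J x) (P0 K z) (idn (P0 K y) (P0 K z) (P1 K y z g)) (t2 \<tau> x y f))
        = t2 \<tau> x z (Hc1 D x y z g f)
          \<cdot>\<^bsub>fun_cat (P0 J x) (P0 K z)\<^esub>
        hcomp (P0 J x) (P0 K z) (Pc K x y z g f) (idn (P0 J x) (P0 K x) (t1 \<tau> x))) \<and>
     (\<forall>x\<in>Ob D.
        t2 \<tau> x x (One D x) \<cdot>\<^bsub>fun_cat (P0 J x) (P0 K x)\<^esub>
          hcomp (P0 J x) (P0 K x) (Pu K x) (idn (P0 J x) (P0 K x) (t1 \<tau> x))
        = hcomp (P0 J x) (P0 K x) (idn (P0 J x) (P0 K x) (t1 \<tau> x)) (Pu J x))}"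

type_synonym ('d, 'g, 'o, 'a, 'p, 'e) modif =
  "(('d, 'g, 'o, 'a, 'p, 'e) pnat, 'd, ('o, 'a, 'p, 'e) nt) cell"

definition modifications :: "('d, 'g, 'b) twocat \<Rightarrow> ('d, 'g, 'b, 'o, 'a) catfun \<Rightarrow>
  ('d, 'g, 'b, 'p, 'e) catfun \<Rightarrow> ('d, 'g, 'o, 'a, 'p, 'e) modif set" where
  "modifications D J K = {m.
     src m \<in> pseudo_nats D J K \<and> tgt m \<in> pseudo_nats D J K \<and>
     cmp m \<in> (\<Pi>\<^sub>E x\<in>Ob D. hom (fun_cat (P0 J x) (P0 K x)) (t1 (src m) x) (t1 (tgt m) x)) \<and>
     (\<forall>x y f. one_cell D x y f \<longrightarrow>
        t2 (tgt m) x y f \<cdot>\<^bsub>fun_cat (P0 J x) (P0 K y)\<^esub>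
          hcomp (P0 J x) (P0 K y) (idn (P0 K x) (P0 K y) (P1 K x y f)) (cmp m x)
        = hcomp (P0 J x) (P0 K y) (cmp m y) (idn (P0 J x) (P0 J y) (P1 J x y f))
          \<cdot>\<^bsub>fun_cat (P0 J x) (P0 K y)\<^esub> t2 (src m) x y f)}"

text \<open>The hom-category from \<open>J\<close> to \<open>K\<close> of the 2-category of category-valued pseudo functors on \<open>D\<close>.\<close>

definition PsHom :: "('d, 'g, 'b) twocat \<Rightarrow> ('d, 'g, 'b, 'o, 'a) catfun \<Rightarrow>
  ('d, 'g, 'b, 'p, 'e) catfun \<Rightarrow>
  (('d, 'g, 'o, 'a, 'p, 'e) pnat, ('d, 'g, 'o, 'a, 'p, 'e) modif) cat" where
  "PsHom D J K = \<lparr>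
     Obj = pseudo_nats D J K, Arr = modifications D J K, Dom = src, Cod = tgt,
     Ide = (\<lambda>\<tau>. \<lparr>src = \<tau>, tgt = \<tau>, cmp = (\<lambda>x\<in>Ob D. idn (P0 J x) (P0 K x) (t1 \<tau> x))\<rparr>),
     Cmp = (\<lambda>n m. \<lparr>src = src m, tgt = tgt n,
       cmp = (\<lambda>x\<in>Ob D. cmp n x \<cdot>\<^bsub>fun_cat (P0 J x) (P0 K x)\<^esub> cmp m x)\<rparr>)\<rparr>"

section \<open>Weighted bicolimits\<close>

text \<open>
  Post- and precomposition with a 1-cell, and the transformations induced by 2-cells:
  \<open>postfun C w x y h\<close> is the functor \<open>C(w, h)\<close> from \<open>C(w, x)\<close> to \<open>C(w, y)\<close> and
  \<open>prefun C v w x h\<close> the functor \<open>C(h, x)\<close> from \<open>C(w, x)\<close> to \<open>C(v, x)\<close>.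
\<close>

definition postfun :: "('o, 'f, 'a) twocat \<Rightarrow> 'o \<Rightarrow> 'o \<Rightarrow> 'o \<Rightarrow> 'f \<Rightarrow> ('f, 'a, 'f, 'a) func" where
  "postfun C w x y h = \<lparr>fo = (\<lambda>f\<in>Obj (Hom C w x). Hc1 C w x y h f),
     fa = (\<lambda>\<alpha>\<in>Arr (Hom C w x). Hc2 C w x y (Ide (Hom C x y) h) \<alpha>)\<rparr>"

definition postnat :: "('o, 'f, 'a) twocat \<Rightarrow> 'o \<Rightarrow> 'o \<Rightarrow> 'o \<Rightarrow> 'a \<Rightarrow> ('f, 'a, 'f, 'a) nt" where
  "postnat C w x y \<theta> = \<lparr>src = postfun C w x y (Dom (Hom C x y) \<theta>),
     tgt = postfun C w x y (Cod (Hom C x y) \<theta>),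
     cmp = (\<lambda>f\<in>Obj (Hom C w x). Hc2 C w x y \<theta> (Ide (Hom C w x) f))\<rparr>"

definition prefun :: "('o, 'f, 'a) twocat \<Rightarrow> 'o \<Rightarrow> 'o \<Rightarrow> 'o \<Rightarrow> 'f \<Rightarrow> ('f, 'a, 'f, 'a) func" where
  "prefun C v w x h = \<lparr>fo = (\<lambda>f\<in>Obj (Hom C w x). Hc1 C v w x f h),
     fa = (\<lambda>\<alpha>\<in>Arr (Hom C w x). Hc2 C v w x \<alpha> (Ide (Hom C v w) h))\<rparr>"

definition prenat :: "('o, 'f, 'a) twocat \<Rightarrow> 'o \<Rightarrow> 'o \<Rightarrow> 'o \<Rightarrow> 'a \<Rightarrow> ('f, 'a, 'f, 'a) nt" where
  "prenat C v w x \<theta> = \<lparr>src = prefun C v w x (Dom (Hom C v w) \<theta>),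
     tgt = prefun C v w x (Cod (Hom C v w) \<theta>),
     cmp = (\<lambda>f\<in>Obj (Hom C w x). Hc2 C v w x (Ide (Hom C w x) f) \<theta>)\<rparr>"

text \<open>The strict 2-functor sending \<open>x\<close> to \<open>C(w, x)\<close>.\<close>

definition hom_from :: "('o, 'f, 'a) twocat \<Rightarrow> 'o \<Rightarrow> ('o, 'f, 'a, 'f, 'a) catfun" where
  "hom_from C w = \<lparr>P0 = Hom C w, P1 = postfun C w, P2 = postnat C w,
     Pc = (\<lambda>x y z g f. idn (Hom C w x) (Hom C w z) (postfun C w x z (Hc1 C x y z g f))),
     Pu = (\<lambda>x. idn (Hom C w x) (Hom C w x) (id_func (Hom C w x)))\<rparr>"

text \<open>
  The pseudo functor \<open>C(F-, x)\<close> on \<open>op2 D\<close>, whose coherence cells come from those of \<open>F\<close>. A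
  1-cell \<open>f\<close> from \<open>d\<close> to \<open>e\<close> in \<open>op2 D\<close> is one from \<open>e\<close> to \<open>d\<close> in \<open>D\<close>.
\<close>

definition hom_into :: "('o, 'f, 'a) twocat \<Rightarrow> ('d, 'g, 'b) twocat \<Rightarrow>
  ('d, 'g, 'b, 'o, 'f, 'a) pfun \<Rightarrow> 'o \<Rightarrow> ('d, 'g, 'b, 'f, 'a) catfun" where
  "hom_into C D F x = \<lparr>
     P0 = (\<lambda>d. Hom C (P0 F d) x),
     P1 = (\<lambda>d e f. prefun C (P0 F e) (P0 F d) x (P1 F e d f)),
     P2 = (\<lambda>d e \<theta>. prenat C (P0 F e) (P0 F d) x (P2 F e d \<theta>)),
     Pc = (\<lambda>c d e g f. prenat C (P0 F e) (P0 F c) x (Pc F e d c f g)),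
     Pu = (\<lambda>d. prenat C (P0 F d) (P0 F d) x (Pu F d))\<rparr>"

text \<open>
  The strict 2-functor sending \<open>x\<close> to \<open>Hom[op2 D, Cat](J, C(F-, x))\<close>. On a 1-cell \<open>h\<close> from \<open>x\<close> to
  \<open>y\<close> it is postcomposition with the transformation from \<open>C(F-, x)\<close> to \<open>C(F-, y)\<close> given by the
  functors \<open>C(F d, h)\<close>, whose coherence 2-cells are identities; on a 2-cell \<open>\<theta>\<close> it is whiskering
  with the modification given by the transformations \<open>C(F d, \<theta>)\<close>.
\<close>

definition cocones0 where
  "cocones0 C D J F x = PsHom (op2 D) J (hom_into C D F x)"

definition push_pnat :: "('o, 'f, 'a) twocat \<Rightarrow> ('d, 'g, 'b) twocat \<Rightarrow>
  ('d, 'g, 'b, 'p, 'e) catfun \<Rightarrow> ('d, 'g, 'b, 'o, 'f, 'a) pfun \<Rightarrow> 'o \<Rightarrow> 'o \<Rightarrow> 'f \<Rightarrow>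
  ('d, 'g, 'p, 'e, 'f, 'a) pnat \<Rightarrow> ('d, 'g, 'p, 'e, 'f, 'a) pnat" where
  "push_pnat C D J F x y h \<tau> = \<lparr>
     t1 = (\<lambda>d\<in>Ob D. compF (P0 J d) (postfun C (P0 F d) x y h) (t1 \<tau> d)),
     t2 = (\<lambda>d e f. if one_cell (op2 D) d e f
       then hcomp (P0 J d) (Hom C (P0 F e) y)
         (idn (Hom C (P0 F e) x) (Hom C (P0 F e) y) (postfun C (P0 F e) x y h)) (t2 \<tau> d e f)
       else undefined)\<rparr>"

definition cocones1 :: "('o, 'f, 'a) twocat \<Rightarrow> ('d, 'g, 'b) twocat \<Rightarrow>
  ('d, 'g, 'b, 'p, 'e) catfun \<Rightarrow> ('d, 'g, 'b, 'o, 'f, 'a) pfun \<Rightarrow> 'o \<Rightarrow> 'o \<Rightarrow> 'f \<Rightarrow>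
  (('d, 'g, 'p, 'e, 'f, 'a) pnat, ('d, 'g, 'p, 'e, 'f, 'a) modif,
   ('d, 'g, 'p, 'e, 'f, 'a) pnat, ('d, 'g, 'p, 'e, 'f, 'a) modif) func" where
  "cocones1 C D J F x y h = \<lparr>
     fo = (\<lambda>\<tau>\<in>Obj (cocones0 C D J F x). push_pnat C D J F x y h \<tau>),
     fa = (\<lambda>m\<in>Arr (cocones0 C D J F x). \<lparr>
       src = push_pnat C D J F x y h (src m), tgt = push_pnat C D J F x y h (tgt m),
       cmp = (\<lambda>d\<in>Ob D. hcomp (P0 J d) (Hom C (P0 F d) y)
         (idn (Hom C (P0 F d) x) (Hom C (P0 F d) y) (postfun C (P0 F d) x y h)) (cmp m d))\<rparr>)\<rparr>"

definition cocones2 :: "('o, 'f, 'a) twocat \<Rightarrow> ('d, 'g, 'b) twocat \<Rightarrow>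
  ('d, 'g, 'b, 'p, 'e) catfun \<Rightarrow> ('d, 'g, 'b, 'o, 'f, 'a) pfun \<Rightarrow> 'o \<Rightarrow> 'o \<Rightarrow> 'a \<Rightarrow>
  (('d, 'g, 'p, 'e, 'f, 'a) pnat, ('d, 'g, 'p, 'e, 'f, 'a) modif,
   ('d, 'g, 'p, 'e, 'f, 'a) pnat, ('d, 'g, 'p, 'e, 'f, 'a) modif) nt" where
  "cocones2 C D J F x y \<theta> = \<lparr>
     src = cocones1 C D J F x y (Dom (Hom C x y) \<theta>),
     tgt = cocones1 C D J F x y (Cod (Hom C x y) \<theta>),
     cmp = (\<lambda>\<tau>\<in>Obj (cocones0 C D J F x). \<lparr>
       src = push_pnat C D J F x y (Dom (Hom C x y) \<theta>) \<tau>,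
       tgt = push_pnat C D J F x y (Cod (Hom C x y) \<theta>) \<tau>,
       cmp = (\<lambda>d\<in>Ob D. hcomp (P0 J d) (Hom C (P0 F d) y) (postnat C (P0 F d) x y \<theta>)
         (idn (P0 J d) (Hom C (P0 F d) x) (t1 \<tau> d)))\<rparr>)\<rparr>"

definition cocones :: "('o, 'f, 'a) twocat \<Rightarrow> ('d, 'g, 'b) twocat \<Rightarrow>
  ('d, 'g, 'b, 'p, 'e) catfun \<Rightarrow> ('d, 'g, 'b, 'o, 'f, 'a) pfun \<Rightarrow>
  ('o, 'f, 'a, ('d, 'g, 'p, 'e, 'f, 'a) pnat, ('d, 'g, 'p, 'e, 'f, 'a) modif) catfun" where
  "cocones C D J F = \<lparr>
     P0 = cocones0 C D J F, P1 = cocones1 C D J F, P2 = cocones2 C D J F,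
     Pc = (\<lambda>x y z g f. idn (cocones0 C D J F x) (cocones0 C D J F z)
            (cocones1 C D J F x z (Hc1 C x y z g f))),
     Pu = (\<lambda>x. idn (cocones0 C D J F x) (cocones0 C D J F x) (id_func (cocones0 C D J F x)))\<rparr>"

definition weighted_bicolimit :: "('o, 'f, 'a) twocat \<Rightarrow> ('d, 'g, 'b) twocat \<Rightarrow>
  ('d, 'g, 'b, 'p, 'e) catfun \<Rightarrow> ('d, 'g, 'b, 'o, 'f, 'a) pfun \<Rightarrow> 'o \<Rightarrow> bool" where
  "weighted_bicolimit C D J F W \<longleftrightarrow> W \<in> Ob C \<and>
     (\<exists>\<tau> \<in> pseudo_nats C (hom_from C W) (cocones C D J F).
        \<forall>x\<in>Ob C. equivalence (P0 (hom_from C W) x) (P0 (cocones C D J F) x) (t1 \<tau> x))"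

section \<open>Blocks\<close>

text \<open>
  Index sets are \<open>{..<n}\<close>. Families indexed by \<open>{..<n}\<close>, in particular objects and arrows of
  powers of categories, are lists of length \<open>n\<close>, and a function from \<open>{..<k}\<close> to \<open>{..<l}\<close> is given
  by \<open>l\<close> and its list of values, of length \<open>k\<close> with entries below \<open>l\<close>. If such functions have the
  value lists \<open>fs\<close> and \<open>gs\<close>, then their composite \<open>g \<circ> f\<close> has \<open>map ((!) gs) fs\<close>.

  Given block lengths \<open>ns\<close>, \<open>block ns i\<close> is the inclusion of the \<open>i\<close>-th block into the sum;
  \<open>block_map ns fs\<close> is the function carrying the \<open>i\<close>-th block (of length \<open>ns ! (fs ! i)\<close>)
  identically onto the block with number \<open>fs ! i\<close>; and \<open>block_sum ns gss\<close> is the block sum of the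
  functions with value lists \<open>gss ! i\<close> and codomains \<open>{..<ns ! i}\<close>.
\<close>

fun blocks :: "nat list \<Rightarrow> 'x list \<Rightarrow> 'x list list" where
  "blocks [] xs = []"
| "blocks (n # ns) xs = take n xs # blocks ns (drop n xs)"

definition offset :: "nat list \<Rightarrow> nat \<Rightarrow> nat"
  where "offset ns i = sum_list (take i ns)"

definition block :: "nat list \<Rightarrow> nat \<Rightarrow> nat list"
  where "block ns i = [offset ns i ..< offset ns i + ns ! i]"

definition block_map :: "nat list \<Rightarrow> nat list \<Rightarrow> nat list"
  where "block_map ns fs = concat (map (block ns) fs)"

definition block_sum :: "nat list \<Rightarrow> nat list list \<Rightarrow> nat list"
  where "block_sum ns gss = concat (map (\<lambda>i. map ((+) (offset ns i)) (gss ! i)) [0..<length gss])"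

section \<open>Theories\<close>

record 't lawvere =
  Tcat :: "(nat, 't) cat"
  Proj :: "nat \<Rightarrow> nat \<Rightarrow> 't"

locale lawvere_theory =
  fixes T :: "'t lawvere"
  assumes category_Tcat: "category (Tcat T)"
    and Obj_Tcat: "Obj (Tcat T) = UNIV"
    and Proj_hom: "i < n \<Longrightarrow> Proj T n i \<in> hom (Tcat T) n 1"
    and product: "set gs \<subseteq> hom (Tcat T) m 1 \<Longrightarrow>
      \<exists>!h. h \<in> hom (Tcat T) m (length gs) \<and>
           (\<forall>i<length gs. Proj T (length gs) i \<cdot>\<^bsub>Tcat T\<^esub> h = gs ! i)"

definition tuple :: "'t lawvere \<Rightarrow> nat \<Rightarrow> 't list \<Rightarrow> 't" where
  "tuple T m gs = (THE h. h \<in> hom (Tcat T) m (length gs) \<and>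
     (\<forall>i<length gs. Proj T (length gs) i \<cdot>\<^bsub>Tcat T\<^esub> h = gs ! i))"

definition arity :: "'t lawvere \<Rightarrow> 't \<Rightarrow> nat"
  where "arity T w = Dom (Tcat T) w"

definition words :: "'t lawvere \<Rightarrow> 't set"
  where "words T = {w \<in> Arr (Tcat T). Cod (Tcat T) w = 1}"

text \<open>\<open>wsub T l fs w\<close> is \<open>w\<^sub>f\<close> for the function \<open>f\<close> into \<open>{..<l}\<close> with list of values \<open>fs\<close>.\<close>

definition wsub :: "'t lawvere \<Rightarrow> nat \<Rightarrow> nat list \<Rightarrow> 't \<Rightarrow> 't"
  where "wsub T l fs w = w \<cdot>\<^bsub>Tcat T\<^esub> tuple T l (map (Proj T l) fs)"

definition wgamma :: "'t lawvere \<Rightarrow> 't \<Rightarrow> 't list \<Rightarrow> 't" where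
  "wgamma T w ws = (let ns = map (arity T) ws; N = sum_list ns in
     w \<cdot>\<^bsub>Tcat T\<^esub> tuple T N (map (\<lambda>i. wsub T N (block ns i) (ws ! i)) [0..<length ws]))"

definition wunit :: "'t lawvere \<Rightarrow> 't"
  where "wunit T = Proj T 1 0"

definition composable :: "'t lawvere \<Rightarrow> 't \<Rightarrow> 't list \<Rightarrow> bool"
  where "composable T w ws \<longleftrightarrow> w \<in> words T \<and> set ws \<subseteq> words T \<and> length ws = arity T w"

section \<open>Powers of categories and the operations of the endomorphism theory\<close>

definition pow :: "('o, 'a) cat \<Rightarrow> nat \<Rightarrow> ('o list, 'a list) cat" where
  "pow X n = \<lparr>Obj = {xs. length xs = n \<and> set xs \<subseteq> Obj X}, Arr = {fs. length fs = n \<and> set fs \<subseteq> Arr X},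
     Dom = map (Dom X), Cod = map (Cod X), Ide = map (Ide X), Cmp = map2 (Cmp X)\<rparr>"

text \<open>\<open>(H, \<dots>, H)\<close> on the \<open>n\<close>-th power of \<open>X\<close>, for a functor or a transformation.\<close>

definition powF :: "('o, 'a) cat \<Rightarrow> nat \<Rightarrow> ('o, 'a, 'p, 'b) func \<Rightarrow> ('o list, 'a list, 'p list, 'b list) func"
  where "powF X n H = \<lparr>fo = (\<lambda>xs\<in>Obj (pow X n). map (fo H) xs),
     fa = (\<lambda>fs\<in>Arr (pow X n). map (fa H) fs)\<rparr>"

definition powN :: "('o, 'a) cat \<Rightarrow> nat \<Rightarrow> ('o, 'a, 'p, 'b) nt \<Rightarrow> ('o list, 'a list, 'p list, 'b list) nt"
  where "powN X n \<alpha> = \<lparr>src = powF X n (src \<alpha>), tgt = powF X n (tgt \<alpha>),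
     cmp = (\<lambda>xs\<in>Obj (pow X n). map (cmp \<alpha>) xs)\<rparr>"

text \<open>
  \<open>F\<^sub>1 \<times> \<dots> \<times> F\<^sub>k\<close>, for functors \<open>F\<^sub>i\<close> on the powers of \<open>X\<close> with exponents \<open>ns\<close>, and likewise for
  transformations.
\<close>

definition prodF :: "('o, 'a) cat \<Rightarrow> nat list \<Rightarrow> ('o list, 'a list, 'p, 'b) func list \<Rightarrow>
    ('o list, 'a list, 'p list, 'b list) func"
  where "prodF X ns Fs = \<lparr>fo = (\<lambda>xs\<in>Obj (pow X (sum_list ns)). map2 fo Fs (blocks ns xs)),
     fa = (\<lambda>fs\<in>Arr (pow X (sum_list ns)). map2 fa Fs (blocks ns fs))\<rparr>"

definition prodN :: "('o, 'a) cat \<Rightarrow> nat list \<Rightarrow> ('o list, 'a list, 'p, 'b) nt list \<Rightarrow>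
    ('o list, 'a list, 'p list, 'b list) nt"
  where "prodN X ns \<alpha>s = \<lparr>src = prodF X ns (map src \<alpha>s), tgt = prodF X ns (map tgt \<alpha>s),
     cmp = (\<lambda>xs\<in>Obj (pow X (sum_list ns)). map2 cmp \<alpha>s (blocks ns xs))\<rparr>"

definition gammaF :: "('o, 'a) cat \<Rightarrow> ('o list, 'a list, 'o, 'a) func \<Rightarrow> nat list \<Rightarrow>
    ('o list, 'a list, 'o, 'a) func list \<Rightarrow> ('o list, 'a list, 'o, 'a) func"
  where "gammaF X F ns Fs = compF (pow X (sum_list ns)) F (prodF X ns Fs)"

definition gammaN :: "('o, 'a) cat \<Rightarrow> ('o list, 'a list, 'o, 'a) nt \<Rightarrow> nat list \<Rightarrow>
    ('o list, 'a list, 'o, 'a) nt list \<Rightarrow> ('o list, 'a list, 'o, 'a) nt"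
  where "gammaN X \<beta> ns \<alpha>s = hcomp (pow X (sum_list ns)) X \<beta> (prodN X ns \<alpha>s)"

text \<open>
  \<open>F\<^sub>f\<close> for a functor \<open>F\<close> on a power of \<open>X\<close> and the function \<open>f\<close> into \<open>{..<l}\<close> with list of values
  \<open>fs\<close>, and likewise for transformations.
\<close>

definition subF :: "('o, 'a) cat \<Rightarrow> nat \<Rightarrow> nat list \<Rightarrow> ('o list, 'a list, 'p, 'b) func \<Rightarrow>
    ('o list, 'a list, 'p, 'b) func"
  where "subF X l fs F = \<lparr>fo = (\<lambda>xs\<in>Obj (pow X l). fo F (map ((!) xs) fs)),
     fa = (\<lambda>hs\<in>Arr (pow X l). fa F (map ((!) hs) fs))\<rparr>"

definition subN :: "('o, 'a) cat \<Rightarrow> nat \<Rightarrow> nat list \<Rightarrow> ('o list, 'a list, 'p, 'b) nt \<Rightarrow>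
    ('o list, 'a list, 'p, 'b) nt"
  where "subN X l fs \<alpha> = \<lparr>src = subF X l fs (src \<alpha>), tgt = subF X l fs (tgt \<alpha>),
     cmp = (\<lambda>xs\<in>Obj (pow X l). cmp \<alpha> (map ((!) xs) fs))\<rparr>"

text \<open>The unit of the endomorphism theory is the identity, as a functor on the first power.\<close>

definition unitF :: "('o, 'a) cat \<Rightarrow> ('o list, 'a list, 'o, 'a) func"
  where "unitF X = \<lparr>fo = (\<lambda>xs\<in>Obj (pow X 1). hd xs), fa = (\<lambda>fs\<in>Arr (pow X 1). hd fs)\<rparr>"

section \<open>Pseudo algebras\<close>

record ('t, 'o, 'a) alg =
  Car :: "('o, 'a) cat"
  Phi :: "'t \<Rightarrow> ('o list, 'a list, 'o, 'a) func"
  Cc :: "'t \<Rightarrow> 't list \<Rightarrow> ('o list, 'a list, 'o, 'a) nt"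
  Ii :: "('o list, 'a list, 'o, 'a) nt"
  Ss :: "'t \<Rightarrow> nat \<Rightarrow> nat list \<Rightarrow> ('o list, 'a list, 'o, 'a) nt"

abbreviation opcat :: "('o, 'a) cat \<Rightarrow> nat \<Rightarrow>
    (('o list, 'a list, 'o, 'a) func, ('o list, 'a list, 'o, 'a) nt) cat"
  where "opcat X n \<equiv> fun_cat (pow X n) X"

text \<open>\<open>iPhi T A w\<close> is the identity 2-cell of \<open>\<Phi>(w)\<close>.\<close>

definition iPhi :: "'t lawvere \<Rightarrow> ('t, 'o, 'a) alg \<Rightarrow> 't \<Rightarrow> ('o list, 'a list, 'o, 'a) nt"
  where "iPhi T A w = Ide (opcat (Car A) (arity T w)) (Phi A w)"

locale pseudo_algebra =
  fixes T :: "'t lawvere" and A :: "('t, 'o, 'a) alg"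
  assumes category_Car: "category (Car A)"
    and Phi_functor: "w \<in> words T \<Longrightarrow> Phi A w \<in> functors (pow (Car A) (arity T w)) (Car A)"
    and Cc_iso: "composable T w ws \<Longrightarrow>
      Cc A w ws \<in> isos (opcat (Car A) (sum_list (map (arity T) ws)))
        (Phi A (wgamma T w ws)) (gammaF (Car A) (Phi A w) (map (arity T) ws) (map (Phi A) ws))"
    and Ii_iso: "Ii A \<in> isos (opcat (Car A) 1) (Phi A (wunit T)) (unitF (Car A))"
    and Ss_iso: "\<lbrakk>w \<in> words T; length fs = arity T w; set fs \<subseteq> {..<l}\<rbrakk> \<Longrightarrow>
      Ss A w l fs \<in> isos (opcat (Car A) l) (Phi A (wsub T l fs w)) (subF (Car A) l fs (Phi A w))"
    and Cc_assoc: "\<lbrakk>composable T w ws; length wss = length ws;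
        \<And>i. i < length ws \<Longrightarrow> composable T (ws ! i) (wss ! i)\<rbrakk> \<Longrightarrow>
      gammaN (Car A) (Cc A w ws) (map (arity T) (concat wss)) (map (iPhi T A) (concat wss))
        \<cdot>\<^bsub>opcat (Car A) (sum_list (map (arity T) (concat wss)))\<^esub>
      Cc A (wgamma T w ws) (concat wss)
      = gammaN (Car A) (iPhi T A w) (map (\<lambda>vs. sum_list (map (arity T) vs)) wss) (map2 (Cc A) ws wss)
        \<cdot>\<^bsub>opcat (Car A) (sum_list (map (arity T) (concat wss)))\<^esub>
      Cc A w (map2 (wgamma T) ws wss)"
    and Cc_unit_right: "w \<in> words T \<Longrightarrow>
      gammaN (Car A) (iPhi T A w) (replicate (arity T w) 1) (replicate (arity T w) (Ii A))
        \<cdot>\<^bsub>opcat (Car A) (arity T w)\<^esub> Cc A w (replicate (arity T w) (wunit T)) = iPhi T A w"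
    and Cc_unit_left: "w \<in> words T \<Longrightarrow>
      gammaN (Car A) (Ii A) [arity T w] [iPhi T A w]
        \<cdot>\<^bsub>opcat (Car A) (arity T w)\<^esub> Cc A (wunit T) [w] = iPhi T A w"
    and Cc_Ss_left: "\<lbrakk>w \<in> words T; length fs = arity T w; set fs \<subseteq> {..<length ws}; set ws \<subseteq> words T;
        ns = map (arity T) ws\<rbrakk> \<Longrightarrow>
      subN (Car A) (sum_list ns) (block_map ns fs) (Cc A w (map ((!) ws) fs))
        \<cdot>\<^bsub>opcat (Car A) (sum_list ns)\<^esub>
      Ss A (wgamma T w (map ((!) ws) fs)) (sum_list ns) (block_map ns fs)
      = gammaN (Car A) (Ss A w (length ws) fs) ns (map (iPhi T A) ws)
        \<cdot>\<^bsub>opcat (Car A) (sum_list ns)\<^esub>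
      Cc A (wsub T (length ws) fs w) ws"
    and Cc_Ss_right: "\<lbrakk>composable T w ws; length gss = length ws; length ns = length ws;
        \<And>i. i < length ws \<Longrightarrow> length (gss ! i) = arity T (ws ! i) \<and> set (gss ! i) \<subseteq> {..<ns ! i}\<rbrakk> \<Longrightarrow>
      subN (Car A) (sum_list ns) (block_sum ns gss) (Cc A w ws)
        \<cdot>\<^bsub>opcat (Car A) (sum_list ns)\<^esub>
      Ss A (wgamma T w ws) (sum_list ns) (block_sum ns gss)
      = gammaN (Car A) (iPhi T A w) ns (map (\<lambda>i. Ss A (ws ! i) (ns ! i) (gss ! i)) [0..<length ws])
        \<cdot>\<^bsub>opcat (Car A) (sum_list ns)\<^esub>
      Cc A w (map (\<lambda>i. wsub T (ns ! i) (gss ! i) (ws ! i)) [0..<length ws])"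
    and Ss_comp: "\<lbrakk>w \<in> words T; length fs = arity T w; set fs \<subseteq> {..<length gs}; set gs \<subseteq> {..<m}\<rbrakk> \<Longrightarrow>
      subN (Car A) m gs (Ss A w (length gs) fs)
        \<cdot>\<^bsub>opcat (Car A) m\<^esub> Ss A (wsub T (length gs) fs w) m gs
      = Ss A w m (map ((!) gs) fs)"
    and Ss_id: "w \<in> words T \<Longrightarrow> Ss A w (arity T w) [0..<arity T w] = iPhi T A w"

section \<open>The 2-category of pseudo algebras\<close>

record ('t, 'o, 'a, 'p, 'b) amor =
  Mf :: "('o, 'a, 'p, 'b) func"
  Rho :: "'t \<Rightarrow> ('o list, 'a list, 'p, 'b) nt"

definition alg_mors ::
  "'t lawvere \<Rightarrow> ('t, 'o, 'a) alg \<Rightarrow> ('t, 'p, 'b) alg \<Rightarrow> ('t, 'o, 'a, 'p, 'b) amor set" where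
  "alg_mors T A B = {h. Mf h \<in> functors (Car A) (Car B) \<and> Rho h \<in> extensional (words T) \<and>
     (\<forall>w\<in>words T.
        Rho h w \<in> isos (fun_cat (pow (Car A) (arity T w)) (Car B))
          (compF (pow (Car A) (arity T w)) (Mf h) (Phi A w))
          (compF (pow (Car A) (arity T w)) (Phi B w) (powF (Car A) (arity T w) (Mf h)))) \<and>
     (\<forall>w ws ns N. composable T w ws \<longrightarrow> ns = map (arity T) ws \<longrightarrow> N = sum_list ns \<longrightarrow>
        hcomp (pow (Car A) N) (Car B) (Cc B w ws)
            (idn (pow (Car A) N) (pow (Car B) N) (powF (Car A) N (Mf h)))
          \<cdot>\<^bsub>fun_cat (pow (Car A) N) (Car B)\<^esub> Rho h (wgamma T w ws)
        = hcomp (pow (Car A) N) (Car B) (iPhi T B w) (prodN (Car A) ns (map (Rho h) ws))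
          \<cdot>\<^bsub>fun_cat (pow (Car A) N) (Car B)\<^esub>
          (hcomp (pow (Car A) N) (Car B) (Rho h w)
            (idn (pow (Car A) N) (pow (Car A) (length ws)) (prodF (Car A) ns (map (Phi A) ws)))
          \<cdot>\<^bsub>fun_cat (pow (Car A) N) (Car B)\<^esub>
          hcomp (pow (Car A) N) (Car B) (idn (Car A) (Car B) (Mf h)) (Cc A w ws))) \<and>
     hcomp (pow (Car A) 1) (Car B) (Ii B) (idn (pow (Car A) 1) (pow (Car B) 1) (powF (Car A) 1 (Mf h)))
         \<cdot>\<^bsub>fun_cat (pow (Car A) 1) (Car B)\<^esub> Rho h (wunit T)
       = hcomp (pow (Car A) 1) (Car B) (idn (Car A) (Car B) (Mf h)) (Ii A) \<and>
     (\<forall>w\<in>words T. \<forall>l fs. length fs = arity T w \<longrightarrow> set fs \<subseteq> {..<l} \<longrightarrow>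
        hcomp (pow (Car A) l) (Car B) (Ss B w l fs)
            (idn (pow (Car A) l) (pow (Car B) l) (powF (Car A) l (Mf h)))
          \<cdot>\<^bsub>fun_cat (pow (Car A) l) (Car B)\<^esub> Rho h (wsub T l fs w)
        = subN (Car A) l fs (Rho h w)
          \<cdot>\<^bsub>fun_cat (pow (Car A) l) (Car B)\<^esub>
          hcomp (pow (Car A) l) (Car B) (idn (Car A) (Car B) (Mf h)) (Ss A w l fs))}"

definition alg_id :: "'t lawvere \<Rightarrow> ('t, 'o, 'a) alg \<Rightarrow> ('t, 'o, 'a, 'o, 'a) amor"
  where "alg_id T A = \<lparr>Mf = id_func (Car A), Rho = (\<lambda>w\<in>words T. iPhi T A w)\<rparr>"

text \<open>The composite of \<open>h\<close> from \<open>B\<close> to \<open>C\<close> after \<open>g\<close> from \<open>A\<close> to \<open>B\<close>.\<close>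

definition alg_comp :: "'t lawvere \<Rightarrow> ('t, 'o, 'a) alg \<Rightarrow> ('t, 'p, 'b) alg \<Rightarrow> ('t, 'q, 'c) alg \<Rightarrow>
    ('t, 'p, 'b, 'q, 'c) amor \<Rightarrow> ('t, 'o, 'a, 'p, 'b) amor \<Rightarrow> ('t, 'o, 'a, 'q, 'c) amor" where
  "alg_comp T A B C h g = \<lparr>Mf = compF (Car A) (Mf h) (Mf g),
     Rho = (\<lambda>w\<in>words T.
       hcomp (pow (Car A) (arity T w)) (Car C) (Rho h w)
         (idn (pow (Car A) (arity T w)) (pow (Car B) (arity T w)) (powF (Car A) (arity T w) (Mf g)))
       \<cdot>\<^bsub>fun_cat (pow (Car A) (arity T w)) (Car C)\<^esub>
       hcomp (pow (Car A) (arity T w)) (Car C) (idn (Car B) (Car C) (Mf h)) (Rho g w))\<rparr>"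

type_synonym ('t, 'o, 'a, 'p, 'b) acell = "(('t, 'o, 'a, 'p, 'b) amor, 'o, 'b) cell"

definition cell_nt :: "('t, 'o, 'a, 'p, 'b) acell \<Rightarrow> ('o, 'a, 'p, 'b) nt"
  where "cell_nt \<alpha> = \<lparr>src = Mf (src \<alpha>), tgt = Mf (tgt \<alpha>), cmp = cmp \<alpha>\<rparr>"

definition alg_cells ::
  "'t lawvere \<Rightarrow> ('t, 'o, 'a) alg \<Rightarrow> ('t, 'p, 'b) alg \<Rightarrow> ('t, 'o, 'a, 'p, 'b) acell set" where
  "alg_cells T A B = {\<alpha>. src \<alpha> \<in> alg_mors T A B \<and> tgt \<alpha> \<in> alg_mors T A B \<and>
     cell_nt \<alpha> \<in> nat_trans (Car A) (Car B) \<and>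
     (\<forall>w\<in>words T. \<forall>n. n = arity T w \<longrightarrow>
        Rho (tgt \<alpha>) w \<cdot>\<^bsub>fun_cat (pow (Car A) n) (Car B)\<^esub>
          hcomp (pow (Car A) n) (Car B) (cell_nt \<alpha>) (iPhi T A w)
        = hcomp (pow (Car A) n) (Car B) (iPhi T B w) (powN (Car A) n (cell_nt \<alpha>))
          \<cdot>\<^bsub>fun_cat (pow (Car A) n) (Car B)\<^esub> Rho (src \<alpha>) w)}"

definition alg_hom_cat :: "'t lawvere \<Rightarrow> ('t, 'o, 'a) alg \<Rightarrow> ('t, 'p, 'b) alg \<Rightarrow>
    (('t, 'o, 'a, 'p, 'b) amor, ('t, 'o, 'a, 'p, 'b) acell) cat" where
  "alg_hom_cat T A B = \<lparr>
     Obj = alg_mors T A B, Arr = alg_cells T A B, Dom = src, Cod = tgt,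
     Ide = (\<lambda>h. \<lparr>src = h, tgt = h, cmp = cmp (idn (Car A) (Car B) (Mf h))\<rparr>),
     Cmp = (\<lambda>\<beta> \<alpha>. \<lparr>src = src \<alpha>, tgt = tgt \<beta>,
       cmp = cmp (cell_nt \<beta> \<cdot>\<^bsub>fun_cat (Car A) (Car B)\<^esub> cell_nt \<alpha>)\<rparr>)\<rparr>"

definition Alg :: "'u set set \<Rightarrow> 't lawvere \<Rightarrow>
  (('t, 'u, 'u) alg, ('t, 'u, 'u, 'u, 'u) amor, ('t, 'u, 'u, 'u, 'u) acell) twocat" where
  "Alg U T = \<lparr>
     Ob = {A. pseudo_algebra T A \<and> Obj (Car A) \<in> U \<and> Arr (Car A) \<in> U},
     Hom = alg_hom_cat T, One = alg_id T, Hc1 = alg_comp T,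
     Hc2 = (\<lambda>A B C \<beta> \<alpha>. \<lparr>src = alg_comp T A B C (src \<beta>) (src \<alpha>), tgt = alg_comp T A B C (tgt \<beta>) (tgt \<alpha>),
       cmp = cmp (hcomp (Car A) (Car C) (cell_nt \<beta>) (cell_nt \<alpha>))\<rparr>)\<rparr>"

end

theory Submission
 imports Defs "HOL-Library.Countable_Set"
begin

text \<open>
  A bicolimit of \<open>F\<close> weighted by \<open>J\<close> is a cocone \<open>\<kappa>\<close> with vertex \<open>W\<close> such that composition with \<open>\<kappa>\<close> is an
  equivalence from the morphisms out of \<open>W\<close> to the cocones. We construct \<open>W\<close> from syntax. Its objects are
  the formal terms built by the words of \<open>T\<close> from triples \<open>(d, j, x)\<close> with \<open>j \<in> J d\<close> and \<open>x \<in> F d\<close>. Each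
  term has an interpretation in the vertex of every small cocone. An arrow between terms is a family of
  arrows between these interpretations, indexed by all small cocones, that is obtained from the
  structure arrows (those of the \<open>F d\<close>, of the universal cocone and of a pseudo algebra) by
  composition, inverses and the operations.

  The interpretations are strict and jointly faithful, so every axiom required of \<open>W\<close> and of the
  universal cocone holds because it holds in every cocone. Such families are large, but the arrows
  actually generated are no more numerous than their derivations, so terms and arrows can be encoded
  in the universe. Interpretation in one given cocone is a strict morphism that carries \<open>\<kappa>\<close> to this
  cocone, which gives essential surjectivity. The components of a 2-cell out of \<open>W\<close> are determined by
  those at the generating objects, by induction on terms, which gives faithfulness; conversely a
  modification extends to all terms by recursion, and its naturality follows by induction on the
  generation of arrows, which gives fullness.
\<close>

section \<open>Categories, functors and transformations\<close>

text \<open>Imposing the laws of pseudo algebras on syntax directly would mean dividing the arrows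
  by a generated congruence and arguing about that congruence at every step. Recording an arrow by
  its values in all cocones replaces the quotient by an equality of functions, at a price in two
  places. An isomorphism of the syntactic category needs an inverse that is itself generated;
  therefore arrows are closed under inverses as soon as all their values are invertible, a semantic
  condition, and invertibility can be tested in cocones like equality. Fullness concerns arbitrary
  pseudo morphisms out of \<open>WA\<close>, which need not be interpretations, so values say
  nothing there and the derivations of arrows have to be used. The collection of cocones is fixed
  before \<open>WA\<close> exists and afterwards contains a cocone with vertex \<open>WA\<close>;
  this is not circular, because derivations are counted and not values. Before any of this, the
  definitions, which are equations between horizontal composites of cells, are turned into equations
  between components, since components are what an interpretation preserves.\<close>

notation vcomp  ("(_ /\<cdot>[_] _)" [66, 0, 65] 65)

lemma homD: "f \<in> hom C a b ==> f \<in> Arr C" "f \<in> hom C a b ==> Dom C f = a" "f \<in> hom C a b ==> Cod C f = b"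
 by (auto simp: hom_def)

lemma Arr_hom: "f \<in> Arr C ==> f \<in> hom C (Dom C f) (Cod C f)"
 by (auto simp: hom_def)

lemma isos_hom: "f \<in> isos C a b ==> f \<in> hom C a b"
 by (auto simp: isos_def)

lemma isosI: "f \<in> hom C a b ==> g \<in> hom C b a ==> g \<cdot>[C] f = Ide C a ==> f \<cdot>[C] g = Ide C b
 ==> f \<in> isos C a b"
 by (auto simp: isos_def)

text \<open>Chosen by \<open>SOME\<close>, hence meaningful only for isomorphisms, where
  \<open>inv_arr_unique\<close> makes the choice irrelevant.\<close>

definition inv_arr :: "('o, 'a) cat => 'a => 'a" where
 "inv_arr C f = (SOME g. g \<in> hom C (Cod C f) (Dom C f) \<and> g \<cdot>[C] f = Ide C (Dom C f)
   \<and> f \<cdot>[C] g = Ide C (Cod C f))"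

lemma inv_arr:
 assumes "f \<in> isos C a b"
 shows inv_arr_hom: "inv_arr C f \<in> hom C b a"
  and inv_arr_left: "inv_arr C f \<cdot>[C] f = Ide C a"
  and inv_arr_right: "f \<cdot>[C] inv_arr C f = Ide C b"
proof -
 obtain g where g: "g \<in> hom C b a \<and> g \<cdot>[C] f = Ide C a \<and> f \<cdot>[C] g = Ide C b"
  using assms by (auto simp: isos_def)
 have "Dom C f = a" "Cod C f = b" using isos_hom[OF assms] by (auto simp: hom_def)
 then have "inv_arr C f \<in> hom C b a \<and> inv_arr C f \<cdot>[C] f = Ide C a \<and> f \<cdot>[C] inv_arr C f = Ide C b"
  unfolding inv_arr_def using someI[of "\<lambda>g. g \<in> hom C b a \<and> g \<cdot>[C] f = Ide C a \<and> f \<cdot>[C] g = Ide C b", OF g]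
  by simp
 then show "inv_arr C f \<in> hom C b a" "inv_arr C f \<cdot>[C] f = Ide C a" "f \<cdot>[C] inv_arr C f = Ide C b"
  by auto
qed

context category
begin

lemma hom_Obj: assumes "f \<in> hom C a b" shows "a \<in> Obj C" "b \<in> Obj C"
 using assms Dom_Obj Cod_Obj by (auto simp: hom_def)

lemma Cmp_Arr: assumes "f \<in> Arr C" "g \<in> Arr C" "Dom C g = Cod C f"
 shows "g \<cdot>[C] f \<in> Arr C" "Dom C (g \<cdot>[C] f) = Dom C f" "Cod C (g \<cdot>[C] f) = Cod C g"
proof -
 have "g \<cdot>[C] f \<in> hom C (Dom C f) (Cod C g)"
  using Cmp_hom[of f "Dom C f" "Cod C f" g "Cod C g"] assms Arr_hom by force
 then show "g \<cdot>[C] f \<in> Arr C" "Dom C (g \<cdot>[C] f) = Dom C f" "Cod C (g \<cdot>[C] f) = Cod C g"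
  by (auto simp: hom_def)
qed

lemma Ide_isos: "a \<in> Obj C ==> Ide C a \<in> isos C a a"
 by (rule isosI[of _ _ _ _ "Ide C a"]) (auto simp: Ide_hom Cmp_Ide_left[of _ a])

lemma isos_Cmp: assumes "f \<in> isos C a b" "g \<in> isos C b c" shows "g \<cdot>[C] f \<in> isos C a c"
proof (rule isosI)
 let ?f = "inv_arr C f" and ?g = "inv_arr C g"
 have f: "f \<in> hom C a b" "?f \<in> hom C b a" "?f \<cdot>[C] f = Ide C a" "f \<cdot>[C] ?f = Ide C b"
  using assms by (auto simp: inv_arr isos_hom)
 have g: "g \<in> hom C b c" "?g \<in> hom C c b" "?g \<cdot>[C] g = Ide C b" "g \<cdot>[C] ?g = Ide C c"
  using assms by (auto simp: inv_arr isos_hom)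
 show gf: "g \<cdot>[C] f \<in> hom C a c" and fg: "?f \<cdot>[C] ?g \<in> hom C c a" using f g by (auto intro: Cmp_hom)
 have "(?f \<cdot>[C] ?g) \<cdot>[C] (g \<cdot>[C] f) = ?f \<cdot>[C] (?g \<cdot>[C] (g \<cdot>[C] f))"
  using Cmp_assoc[OF gf g(2) f(2)] by metis
 also have "?g \<cdot>[C] (g \<cdot>[C] f) = f"
  using Cmp_assoc[OF f(1) g(1,2)] g(3) Cmp_Ide_left[OF f(1)] by simp
 finally show "(?f \<cdot>[C] ?g) \<cdot>[C] (g \<cdot>[C] f) = Ide C a" using f by simp
 have "(g \<cdot>[C] f) \<cdot>[C] (?f \<cdot>[C] ?g) = g \<cdot>[C] (f \<cdot>[C] (?f \<cdot>[C] ?g))"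
  using Cmp_assoc[OF fg f(1) g(1)] by metis
 also have "f \<cdot>[C] (?f \<cdot>[C] ?g) = ?g"
  using Cmp_assoc[OF g(2) f(2,1)] f(4) Cmp_Ide_left[OF g(2)] by simp
 finally show "(g \<cdot>[C] f) \<cdot>[C] (?f \<cdot>[C] ?g) = Ide C c" using g by simp
qed

text \<open>Two squares glued along the edge \<open>g\<close>. Naturality of a vertical composite
  and most compatibility laws of composites below are instances, with one square for each
  factor.\<close>

lemma paste:
 assumes h: "f \<in> hom C a b" "x \<in> hom C a c" "y \<in> hom C b d" "g \<in> hom C c d" "x' \<in> hom C c e" "y' \<in> hom C d k" "h \<in> hom C e k"
  and e: "y \<cdot>[C] f = g \<cdot>[C] x" "y' \<cdot>[C] g = h \<cdot>[C] x'"
 shows "(y' \<cdot>[C] y) \<cdot>[C] f = h \<cdot>[C] (x' \<cdot>[C] x)"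
 using Cmp_assoc[OF h(1,3,6)] Cmp_assoc[OF h(2,4,6)] Cmp_assoc[OF h(2,5,7)] e by metis

lemma iso_cancel_left:
 assumes "g \<in> isos C b c" "f \<in> hom C a b" "f' \<in> hom C a b" "g \<cdot>[C] f = g \<cdot>[C] f'"
 shows "f = f'"
proof -
 note g = inv_arr_hom[OF assms(1)] isos_hom[OF assms(1)]
 show ?thesis
  using Cmp_assoc[OF assms(2) g(2,1)] Cmp_assoc[OF assms(3) g(2,1)] assms(4)
   Cmp_Ide_left[OF assms(2)] Cmp_Ide_left[OF assms(3)] inv_arr_left[OF assms(1)] by metis
qed

lemma iso_cancel_right:
 assumes "g \<in> isos C a b" "f \<in> hom C b c" "f' \<in> hom C b c" "f \<cdot>[C] g = f' \<cdot>[C] g"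
 shows "f = f'"
proof -
 note g = inv_arr_hom[OF assms(1)] isos_hom[OF assms(1)]
 show ?thesis
  using Cmp_assoc[OF g assms(2)] Cmp_assoc[OF g assms(3)] assms(4)
   Cmp_Ide_right[OF assms(2)] Cmp_Ide_right[OF assms(3)] inv_arr_right[OF assms(1)] by metis
qed

lemma inv_arr_unique:
 assumes "f \<in> isos C a b" "g \<in> hom C b a" "g \<cdot>[C] f = Ide C a"
 shows "g = inv_arr C f"
 using iso_cancel_right[OF assms(1,2) inv_arr_hom[OF assms(1)]] inv_arr_left[OF assms(1)] assms(3)
 by simp

text \<open>Inverting the parallel sides \<open>f\<close> and \<open>g\<close> of a commuting square
  gives a commuting square. This is how pointwise inverses of natural transformations, of 2-cells of
  algebras and of generated arrows inherit naturality.\<close>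

lemma inv_square:
 assumes "f \<in> isos C a b" "g \<in> isos C c d" "u \<in> hom C a c" "v \<in> hom C b d" "v \<cdot>[C] f = g \<cdot>[C] u"
 shows "u \<cdot>[C] inv_arr C f = inv_arr C g \<cdot>[C] v"
proof -
 let ?f = "inv_arr C f" and ?g = "inv_arr C g"
 have h: "?f \<in> hom C b a" "?g \<in> hom C d c" "f \<in> hom C a b" "g \<in> hom C c d"
  using assms by (auto simp: inv_arr_hom isos_hom)
 have "?g \<cdot>[C] v = (?g \<cdot>[C] v) \<cdot>[C] (f \<cdot>[C] ?f)"
  using Cmp_Ide_right[OF Cmp_hom[OF assms(4) h(2)]] by (simp add: inv_arr_right[OF assms(1)])
 also have "\<dots> = ((?g \<cdot>[C] v) \<cdot>[C] f) \<cdot>[C] ?f"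
  by (rule Cmp_assoc[OF h(1,3) Cmp_hom[OF assms(4) h(2)]])
 also have "(?g \<cdot>[C] v) \<cdot>[C] f = u"
  using Cmp_assoc[OF h(3) assms(4) h(2)] Cmp_assoc[OF assms(3) h(4,2)] assms(5) inv_arr_left[OF assms(2)]
   Cmp_Ide_left[OF assms(3)] by metis
 finally show ?thesis by simp
qed

end

section \<open>Functors, natural transformations and whiskering\<close>

lemma functorsI:
 assumes "fo F \<in> extensional (Obj A)" "fa F \<in> extensional (Arr A)"
  and "\<And>a. a \<in> Obj A ==> fo F a \<in> Obj B"
  and "\<And>f a b. f \<in> hom A a b ==> fa F f \<in> hom B (fo F a) (fo F b)"
  and "\<And>a. a \<in> Obj A ==> fa F (Ide A a) = Ide B (fo F a)"
  and "\<And>f g a b c. f \<in> hom A a b ==> g \<in> hom A b c ==> fa F (g \<cdot>[A] f) = fa F g \<cdot>[B] fa F f"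
 shows "F \<in> functors A B"
proof -
 have "fa F f \<in> Arr B \<and> Dom B (fa F f) = fo F (Dom A f) \<and> Cod B (fa F f) = fo F (Cod A f)" if "f \<in> Arr A" for f
  using assms(4)[OF Arr_hom[OF that]] by (auto simp: hom_def)
 then show ?thesis using assms by (auto simp: functors_def PiE_def hom_def)
qed

lemma fun_fo: "F \<in> functors A B ==> a \<in> Obj A ==> fo F a \<in> Obj B"
 by (auto simp: functors_def)

lemma fun_fa: "F \<in> functors A B ==> f \<in> hom A a b ==> fa F f \<in> hom B (fo F a) (fo F b)"
 by (auto simp: functors_def hom_def PiE_def Pi_def)

lemma fun_Arr: "F \<in> functors A B ==> f \<in> Arr A ==> fa F f \<in> Arr B"
 by (auto simp: functors_def hom_def)

lemma fun_Ide: "F \<in> functors A B ==> a \<in> Obj A ==> fa F (Ide A a) = Ide B (fo F a)"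
 by (auto simp: functors_def)

lemma fun_Cmp: "F \<in> functors A B ==> f \<in> hom A a b ==> g \<in> hom A b c ==>
  fa F (g \<cdot>[A] f) = fa F g \<cdot>[B] fa F f"
 by (auto simp: functors_def hom_def)

lemma functors_ext: "F \<in> functors A B ==> fo F \<in> extensional (Obj A)"
  "F \<in> functors A B ==> fa F \<in> extensional (Arr A)"
 by (auto simp: functors_def PiE_def)

lemma fun_isos: "F \<in> functors A B ==> category A ==> f \<in> isos A a b ==> fa F f \<in> isos B (fo F a) (fo F b)"
 by (rule isosI[of _ _ _ _ "fa F (inv_arr A f)"])
  (auto simp: fun_fa inv_arr isos_hom category.hom_Obj fun_Ide
   fun_Cmp[symmetric, of F A B f a b _ a] fun_Cmp[symmetric, of F A B _ b a f b]
   dest: category.hom_Obj[OF _ isos_hom])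

lemma fun_inv_arr:
 assumes "F \<in> functors A B" "category A" "category B" "f \<in> isos A a b"
 shows "fa F (inv_arr A f) = inv_arr B (fa F f)"
proof (rule category.inv_arr_unique[OF assms(3) fun_isos[OF assms(1,2,4)] fun_fa[OF assms(1) inv_arr_hom[OF assms(4)]]])
 show "fa F (inv_arr A f) \<cdot>[B] fa F f = Ide B (fo F a)"
  using fun_Cmp[OF assms(1) isos_hom[OF assms(4)] inv_arr_hom[OF assms(4)]]
   fun_Ide[OF assms(1) category.hom_Obj(1)[OF assms(2) isos_hom[OF assms(4)]]]
  by (simp add: inv_arr_left[OF assms(4)])
qed

lemma func_eqI:
 assumes "F \<in> functors A B" "G \<in> functors A B'"
  and "\<And>a. a \<in> Obj A ==> fo F a = fo G a" "\<And>f. f \<in> Arr A ==> fa F f = fa G f"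
 shows "F = G"
proof -
 have "fo F = fo G" using functors_ext assms by (metis extensionalityI)
 moreover have "fa F = fa G" using functors_ext assms by (metis extensionalityI)
 ultimately show ?thesis by (cases F; cases G) auto
qed

text \<open>For composites given by a formula, extensionality is immediate from the definition, so
  they can be compared at places where functoriality is not at hand.\<close>

lemma func_eqI':
 fixes F G :: "('o, 'a, 'p, 'b) func"
 assumes "fo F \<in> extensional O1" "fo G \<in> extensional O1" "fa F \<in> extensional A1" "fa G \<in> extensional A1"
  and "\<And>a. a \<in> O1 ==> fo F a = fo G a" "\<And>f. f \<in> A1 ==> fa F f = fa G f"
 shows "F = G"
proof -
 have "fo F = fo G" "fa F = fa G" using assms by (metis extensionalityI)+
 then show ?thesis by (cases F; cases G) simp
qed

lemma compF_ext [simp]: "fo (compF A G F) \<in> extensional (Obj A)" "fa (compF A G F) \<in> extensional (Arr A)"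
 by (auto simp: compF_def)

lemma fo_compF [simp]: "a \<in> Obj A ==> fo (compF A G F) a = fo G (fo F a)"
 by (simp add: compF_def)

lemma fa_compF [simp]: "f \<in> Arr A ==> fa (compF A G F) f = fa G (fa F f)"
 by (simp add: compF_def)

lemma fa_compF_hom: "f \<in> hom A a b ==> fa (compF A G F) f = fa G (fa F f)"
 by (simp add: compF_def homD)

lemma compF_functors:
 assumes "category A" "F \<in> functors A B" "G \<in> functors B C"
 shows "compF A G F \<in> functors A C"
proof (rule functorsI)
 interpret A: category A by fact
 show "fa (compF A G F) f \<in> hom C (fo (compF A G F) a) (fo (compF A G F) b)" if "f \<in> hom A a b" for f a b
  using that fun_fa[OF assms(3) fun_fa[OF assms(2) that]] by (simp add: A.hom_Obj fa_compF_hom)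
 show "fa (compF A G F) (g \<cdot>[A] f) = fa (compF A G F) g \<cdot>[C] fa (compF A G F) f"
  if "f \<in> hom A a b" "g \<in> hom A b c" for f g a b c
  using that A.Cmp_hom[OF that] fun_Cmp[OF assms(2) that]
   fun_Cmp[OF assms(3) fun_fa[OF assms(2) that(1)] fun_fa[OF assms(2) that(2)]]
  by (simp add: fa_compF_hom)
qed (use assms in \<open>auto simp: fun_fo fun_Ide category.Ide_hom[THEN homD(1)]\<close>)

lemma compF_assoc: "F \<in> functors A B ==> compF A (compF B H G) F = compF A H (compF A G F)"
 by (rule func_eqI'[of _ "Obj A" _ "Arr A"]) (auto simp: fun_fo fun_Arr)

lemma id_func_functors: "category A ==> id_func A \<in> functors A A"
 by (rule functorsI) (auto simp: id_func_def category.hom_Obj category.Ide_hom[THEN homD(1)]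
   homD category.Cmp_hom[THEN homD(1)])

lemma fo_id_func [simp]: "a \<in> Obj A ==> fo (id_func A) a = a"
 and fa_id_func [simp]: "f \<in> Arr A ==> fa (id_func A) f = f"
 by (auto simp: id_func_def)

lemma compF_id_left: "F \<in> functors A B ==> compF A (id_func B) F = F"
 by (rule func_eqI'[of _ "Obj A" _ "Arr A"]) (auto simp: fun_fo fun_Arr functors_ext)

lemma compF_id_right: "F \<in> functors A B ==> compF A F (id_func A) = F"
 by (rule func_eqI'[of _ "Obj A" _ "Arr A"]) (auto simp: fun_fo fun_Arr functors_ext)

lemma cell_eqI: "src \<alpha> = src \<beta> ==> tgt \<alpha> = tgt \<beta> ==> cmp \<alpha> \<in> extensional I ==> cmp \<beta> \<in> extensional I ==>
  (\<And>i. i \<in> I ==> cmp \<alpha> i = cmp \<beta> i) ==> \<alpha> = (\<beta> :: ('f, 'i, 'a) cell)"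
 by (cases \<alpha>; cases \<beta>) (auto intro: extensionalityI)

lemma fun_cat_simps [simp]:
 "Obj (fun_cat A B) = functors A B" "Arr (fun_cat A B) = nat_trans A B"
 "Dom (fun_cat A B) = src" "Cod (fun_cat A B) = tgt"
 "src (Ide (fun_cat A B) F) = F" "tgt (Ide (fun_cat A B) F) = F"
 "src (\<beta> \<cdot>[fun_cat A B] \<alpha>) = src \<alpha>" "tgt (\<beta> \<cdot>[fun_cat A B] \<alpha>) = tgt \<beta>"
 "cmp (Ide (fun_cat A B) F) \<in> extensional (Obj A)" "cmp (\<beta> \<cdot>[fun_cat A B] \<alpha>) \<in> extensional (Obj A)"
 by (auto simp: fun_cat_def)

lemma cmp_idn [simp]: "a \<in> Obj A ==> cmp (Ide (fun_cat A B) F) a = Ide B (fo F a)"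
 and cmp_Cmp [simp]: "a \<in> Obj A ==> cmp (\<beta> \<cdot>[fun_cat A B] \<alpha>) a = cmp \<beta> a \<cdot>[B] cmp \<alpha> a"
 by (auto simp: fun_cat_def)

lemma hcomp_simps [simp]:
 "src (hcomp A C \<beta> \<alpha>) = compF A (src \<beta>) (src \<alpha>)" "tgt (hcomp A C \<beta> \<alpha>) = compF A (tgt \<beta>) (tgt \<alpha>)"
 "cmp (hcomp A C \<beta> \<alpha>) \<in> extensional (Obj A)"
 "a \<in> Obj A ==> cmp (hcomp A C \<beta> \<alpha>) a = fa (tgt \<beta>) (cmp \<alpha> a) \<cdot>[C] cmp \<beta> (fo (src \<alpha>) a)"
 by (auto simp: hcomp_def)

lemma nt_homI:
 assumes "F \<in> functors A B" "G \<in> functors A B" "src \<alpha> = F" "tgt \<alpha> = G" "cmp \<alpha> \<in> extensional (Obj A)"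
  and "\<And>a. a \<in> Obj A ==> cmp \<alpha> a \<in> hom B (fo F a) (fo G a)"
  and "\<And>f a b. f \<in> hom A a b ==> cmp \<alpha> b \<cdot>[B] fa F f = fa G f \<cdot>[B] cmp \<alpha> a"
 shows "\<alpha> \<in> hom (fun_cat A B) F G"
 using assms by (auto simp: hom_def nat_trans_def)

lemma nt_homD:
 assumes "\<alpha> \<in> hom (fun_cat A B) F G"
 shows "F \<in> functors A B" "G \<in> functors A B" "src \<alpha> = F" "tgt \<alpha> = G" "cmp \<alpha> \<in> extensional (Obj A)"
  and "\<And>a. a \<in> Obj A ==> cmp \<alpha> a \<in> hom B (fo F a) (fo G a)"
  and "\<And>f a b. f \<in> hom A a b ==> cmp \<alpha> b \<cdot>[B] fa F f = fa G f \<cdot>[B] cmp \<alpha> a"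
 using assms by (auto simp: hom_def nat_trans_def)

lemma nt_eqI:
 assumes "\<alpha> \<in> hom (fun_cat A B) F G" "\<beta> \<in> hom (fun_cat A B) F G" "\<And>a. a \<in> Obj A ==> cmp \<alpha> a = cmp \<beta> a"
 shows "\<alpha> = \<beta>"
 by (rule cell_eqI[of _ _ "Obj A"]) (use assms in \<open>auto dest: nt_homD\<close>)

lemma category_fun_cat:
 assumes "category A" "category B" shows "category (fun_cat A B)"
proof -
 interpret A: category A by fact
 interpret B: category B by fact
 show ?thesis
 proof
  show ide: "Ide (fun_cat A B) F \<in> hom (fun_cat A B) F F" if "F \<in> Obj (fun_cat A B)" for F
   by (rule nt_homI) (use that in \<open>auto simp: fun_fo B.Ide_hom A.hom_Obj intro!: trans[OF B.Cmp_Ide_left B.Cmp_Ide_right[symmetric]] fun_fa\<close>)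
  show comp: "\<beta> \<cdot>[fun_cat A B] \<alpha> \<in> hom (fun_cat A B) F H"
   if \<alpha>: "\<alpha> \<in> hom (fun_cat A B) F G" and \<beta>: "\<beta> \<in> hom (fun_cat A B) G H" for \<alpha> \<beta> F G H
  proof (rule nt_homI)
   fix f a b assume f: "f \<in> hom A a b"
   note a = A.hom_Obj[OF f]
   note t = nt_homD(6)[OF \<alpha> a(1)] nt_homD(6)[OF \<alpha> a(2)] nt_homD(6)[OF \<beta> a(1)] nt_homD(6)[OF \<beta> a(2)]
    fun_fa[OF nt_homD(1)[OF \<alpha>] f] fun_fa[OF nt_homD(2)[OF \<alpha>] f] fun_fa[OF nt_homD(2)[OF \<beta>] f]
   let ?A = "\<beta> \<cdot>[fun_cat A B] \<alpha>"
   show "cmp ?A b \<cdot>[B] fa F f = fa H f \<cdot>[B] cmp ?A a"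
    using a B.paste[OF t(5,1,2,6,3,4,7) nt_homD(7)[OF \<alpha> f] nt_homD(7)[OF \<beta> f]] by simp
  qed (use that in \<open>auto dest: nt_homD intro!: B.Cmp_hom\<close>)
  fix \<alpha> F G assume \<alpha>: "\<alpha> \<in> hom (fun_cat A B) F G"
  note obj = nt_homD(1,2)[OF \<alpha>]
  show "Ide (fun_cat A B) G \<cdot>[fun_cat A B] \<alpha> = \<alpha>"
   by (rule nt_eqI[OF comp[OF \<alpha> ide] \<alpha>]) (use obj nt_homD[OF \<alpha>] in \<open>auto intro: B.Cmp_Ide_left\<close>)
  show "\<alpha> \<cdot>[fun_cat A B] Ide (fun_cat A B) F = \<alpha>"
   by (rule nt_eqI[OF comp[OF ide \<alpha>] \<alpha>]) (use obj nt_homD[OF \<alpha>] in \<open>auto intro: B.Cmp_Ide_right\<close>)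
  fix \<beta> \<gamma> H K assume \<beta>: "\<beta> \<in> hom (fun_cat A B) G H" and \<gamma>: "\<gamma> \<in> hom (fun_cat A B) H K"
  show "\<gamma> \<cdot>[fun_cat A B] (\<beta> \<cdot>[fun_cat A B] \<alpha>) = (\<gamma> \<cdot>[fun_cat A B] \<beta>) \<cdot>[fun_cat A B] \<alpha>"
   by (rule nt_eqI[OF comp[OF comp[OF \<alpha> \<beta>] \<gamma>] comp[OF \<alpha> comp[OF \<beta> \<gamma>]]])
    (use nt_homD(6)[OF \<alpha>] nt_homD(6)[OF \<beta>] nt_homD(6)[OF \<gamma>] in \<open>auto intro: B.Cmp_assoc\<close>)
 qed (auto simp: nat_trans_def)
qed

lemma isos_fun_catD:
 assumes "\<alpha> \<in> isos (fun_cat A B) F G" "a \<in> Obj A"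
 shows "cmp \<alpha> a \<in> isos B (fo F a) (fo G a)"
proof -
 obtain \<beta> where b: "\<beta> \<in> hom (fun_cat A B) G F" "\<beta> \<cdot>[fun_cat A B] \<alpha> = Ide (fun_cat A B) F"
  "\<alpha> \<cdot>[fun_cat A B] \<beta> = Ide (fun_cat A B) G" and a: "\<alpha> \<in> hom (fun_cat A B) F G"
  using assms by (auto simp: isos_def)
 have "cmp \<beta> a \<cdot>[B] cmp \<alpha> a = Ide B (fo F a)" "cmp \<alpha> a \<cdot>[B] cmp \<beta> a = Ide B (fo G a)"
  using b(2,3)[THEN arg_cong, of "\<lambda>x. cmp x a"] assms by simp_all
 then show ?thesis using nt_homD(6)[OF a] nt_homD(6)[OF b(1)] assms by (auto intro: isosI)
qed

text \<open>The inverses of the components form a natural transformation by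
  \<open>inv_square\<close>.\<close>

lemma isos_fun_catI:
 assumes "category A" "category B" "\<alpha> \<in> hom (fun_cat A B) F G"
  and "\<And>a. a \<in> Obj A ==> cmp \<alpha> a \<in> isos B (fo F a) (fo G a)"
 shows "\<alpha> \<in> isos (fun_cat A B) F G"
proof -
 interpret A: category A by fact
 interpret B: category B by fact
 interpret category "fun_cat A B" by (rule category_fun_cat) fact+
 let ?\<beta> = "\<lparr>src = G, tgt = F, cmp = (\<lambda>a\<in>Obj A. inv_arr B (cmp \<alpha> a))\<rparr>"
 have \<beta>: "?\<beta> \<in> hom (fun_cat A B) G F"
  by (rule nt_homI) (use assms nt_homD[OF assms(3)] in
   \<open>auto simp: inv_arr_hom A.hom_Obj intro!: B.inv_square[symmetric] fun_fa\<close>)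
 show ?thesis
  by (rule isosI[OF assms(3) \<beta>]; rule nt_eqI[OF Cmp_hom Ide_hom])
    (use \<beta> assms(3) hom_Obj[OF \<beta>] in \<open>auto simp: inv_arr_left[OF assms(4)] inv_arr_right[OF assms(4)]\<close>)
qed

lemma idn_hom: "category A ==> category B ==> F \<in> functors A B ==> idn A B F \<in> hom (fun_cat A B) F F"
 by (simp add: category.Ide_hom category_fun_cat)

lemma idn_isos: "category A ==> category B ==> F \<in> functors A B ==> idn A B F \<in> isos (fun_cat A B) F F"
 by (simp add: category.Ide_isos category_fun_cat)

lemma hcomp_hom:
 assumes "category A" "category C"
  and \<alpha>: "\<alpha> \<in> hom (fun_cat A B) F F'" and \<beta>: "\<beta> \<in> hom (fun_cat B C) G G'"
 shows "hcomp A C \<beta> \<alpha> \<in> hom (fun_cat A C) (compF A G F) (compF A G' F')"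
proof (rule nt_homI)
 interpret A: category A by fact
 interpret C: category C by fact
 note F = nt_homD(1,2)[OF \<alpha>] and G = nt_homD(1,2)[OF \<beta>]
 note [simp] = nt_homD(3,4)[OF \<alpha>] nt_homD(3,4)[OF \<beta>]
 have c: "fa G' (cmp \<alpha> a) \<in> hom C (fo G' (fo F a)) (fo G' (fo F' a))" "cmp \<beta> (fo F a) \<in> hom C (fo G (fo F a)) (fo G' (fo F a))"
  if "a \<in> Obj A" for a
  using F G that nt_homD(6)[OF \<alpha> that] by (auto intro!: fun_fa nt_homD(6)[OF \<beta>] fun_fo)
 then show "cmp (hcomp A C \<beta> \<alpha>) a \<in> hom C (fo (compF A G F) a) (fo (compF A G' F') a)" if "a \<in> Obj A" for a
  using that by (auto intro: C.Cmp_hom)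
 fix f a b assume f: "f \<in> hom A a b"
 note ab [simp] = A.hom_Obj[OF f]
 note Ff = fun_fa[OF F(1) f] fun_fa[OF F(2) f]
 have "fa G' (cmp \<alpha> b) \<cdot>[C] fa G' (fa F f) = fa G' (fa F' f) \<cdot>[C] fa G' (cmp \<alpha> a)"
  using fun_Cmp[OF G(2) Ff(1) nt_homD(6)[OF \<alpha> ab(2)]] fun_Cmp[OF G(2) nt_homD(6)[OF \<alpha> ab(1)] Ff(2)]
   nt_homD(7)[OF \<alpha> f] by simp
 with C.paste[OF fun_fa[OF G(1) Ff(1)] c(2)[OF ab(1)] c(2)[OF ab(2)] fun_fa[OF G(2) Ff(1)]
   c(1)[OF ab(1)] c(1)[OF ab(2)] fun_fa[OF G(2) Ff(2)] nt_homD(7)[OF \<beta> Ff(1)]]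
 show "cmp (hcomp A C \<beta> \<alpha>) b \<cdot>[C] fa (compF A G F) f = fa (compF A G' F') f \<cdot>[C] cmp (hcomp A C \<beta> \<alpha>) a"
  by (simp add: fa_compF_hom[OF f])
qed (use assms nt_homD[OF \<alpha>] nt_homD[OF \<beta>] in \<open>auto intro: compF_functors\<close>)

text \<open>The component of an identity is sent to an identity, so one of the two factors of the
  horizontal composite disappears. These two rules, used in place of the general formula
  \<open>hcomp_simps(4)\<close>, turn diagrams of cells into equations of components.\<close>

lemma cmp_whisker_right:
 assumes "category C" "F \<in> functors A B" "\<beta> \<in> hom (fun_cat B C) G G'" "a \<in> Obj A"
 shows "cmp (hcomp A C \<beta> (idn A B F)) a = cmp \<beta> (fo F a)"
 using assms nt_homD(1-5)[OF assms(3)] fun_fo[OF assms(2,4)] nt_homD(6)[OF assms(3) fun_fo[OF assms(2,4)]]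
 by (simp add: fun_Ide category.Cmp_Ide_left[of C])

lemma cmp_whisker_left:
 assumes "category C" "G \<in> functors B C" "\<alpha> \<in> hom (fun_cat A B) F F'" "a \<in> Obj A"
 shows "cmp (hcomp A C (idn B C G) \<alpha>) a = fa G (cmp \<alpha> a)"
 using assms nt_homD(1-5)[OF assms(3)] nt_homD(6)[OF assms(3,4)]
 by (simp add: fun_fo category.Cmp_Ide_right[OF _ fun_fa])

section \<open>Pseudo natural transformations and modifications in components\<close>

lemma cell_eq_iff: "cmp \<alpha> \<in> extensional I ==> cmp \<beta> \<in> extensional I ==>
  \<alpha> = (\<beta> :: ('f, 'i, 'a) cell) \<longleftrightarrow> src \<alpha> = src \<beta> \<and> tgt \<alpha> = tgt \<beta> \<and> (\<forall>i\<in>I. cmp \<alpha> i = cmp \<beta> i)"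
 by (auto intro: cell_eqI)

lemma (in two_category) one_cell_Hc1: "one_cell C x y f ==> one_cell C y z g ==> one_cell C x z (Hc1 C x y z g f)"
 by (auto simp: one_cell_def Hc1_Obj)

lemma (in two_category) one_cell_One: "x \<in> Ob C ==> one_cell C x x (One C x)"
 by (auto simp: one_cell_def One_Obj)

lemma (in two_category) one_cell_hom: "x \<in> Ob C ==> y \<in> Ob C ==> \<theta> \<in> hom (Hom C x y) f g ==>
  one_cell C x y f \<and> one_cell C x y g"
 by (auto simp: one_cell_def category.hom_Obj[OF category_Hom])

text \<open>Records the typing of all cells, which is what the passage from diagrams to components
  relies on. The values may be categories over any type, so that \<open>hom_into\<close> and
  \<open>cocones\<close>, whose values are not objects of \<open>Cat U\<close>, are covered together
  with \<open>J\<close>.\<close>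

locale cat_valued =
 fixes D :: "('d, 'g, 'b) twocat" and K :: "('d, 'g, 'b, 'o, 'a) catfun"
 assumes category_P0: "x \<in> Ob D ==> category (P0 K x)"
  and P1_functors: "one_cell D x y f ==> P1 K x y f \<in> functors (P0 K x) (P0 K y)"
  and P2_nt: "x \<in> Ob D ==> y \<in> Ob D ==> \<theta> \<in> hom (Hom D x y) f g ==>
   P2 K x y \<theta> \<in> hom (fun_cat (P0 K x) (P0 K y)) (P1 K x y f) (P1 K x y g)"
  and Pc_nt: "one_cell D x y f ==> one_cell D y z g ==>
   Pc K x y z g f \<in> hom (fun_cat (P0 K x) (P0 K z)) (compF (P0 K x) (P1 K y z g) (P1 K x y f))
    (P1 K x z (Hc1 D x y z g f))"
  and Pu_nt: "x \<in> Ob D ==> Pu K x \<in> hom (fun_cat (P0 K x) (P0 K x)) (id_func (P0 K x)) (P1 K x x (One D x))"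

lemma Cat_simps [simp]:
 "Ob (Cat U) = {A. category A \<and> Obj A \<in> U \<and> Arr A \<in> U}" "Hom (Cat U) = fun_cat" "One (Cat U) = id_func"
 "Hc1 (Cat U) A B C G F = compF A G F" "Hc2 (Cat U) A B C \<beta> \<alpha> = hcomp A C \<beta> \<alpha>"
 by (auto simp: Cat_def)

lemma pseudo_functor_Cat_cat_valued:
 assumes "pseudo_functor D (Cat U) J" shows "cat_valued D J"
proof -
 interpret pseudo_functor D "Cat U" J by fact
 show ?thesis
 proof (rule cat_valued.intro)
  show "category (P0 J x)" if "x \<in> Ob D" for x using P0_Ob[OF that] by simp
  show "P1 J x y f \<in> functors (P0 J x) (P0 J y)" if "one_cell D x y f" for x y f
   using P1_Obj[of x y f] that by (simp add: one_cell_def)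
  show "P2 J x y \<theta> \<in> hom (fun_cat (P0 J x) (P0 J y)) (P1 J x y f) (P1 J x y g)"
   if "x \<in> Ob D" "y \<in> Ob D" "\<theta> \<in> hom (Hom D x y) f g" for x y \<theta> f g
   using P2_hom[OF that] by simp
  show "Pc J x y z g f \<in> hom (fun_cat (P0 J x) (P0 J z)) (compF (P0 J x) (P1 J y z g) (P1 J x y f))
    (P1 J x z (Hc1 D x y z g f))" if "one_cell D x y f" "one_cell D y z g" for x y z f g
   using Pc_iso[of x y z f g] that by (auto simp: one_cell_def isos_hom)
  show "Pu J x \<in> hom (fun_cat (P0 J x) (P0 J x)) (id_func (P0 J x)) (P1 J x x (One D x))" if "x \<in> Ob D" for x
   using Pu_iso[OF that] by (simp add: isos_hom)
 qed
qed

locale cat_valued_pair = two_category D + J: cat_valued D J + K: cat_valued D K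
 for D :: "('d, 'g, 'b) twocat" and J :: "('d, 'g, 'b, 'o, 'a) catfun" and K :: "('d, 'g, 'b, 'p, 'e) catfun"
begin

text \<open>The typing conditions of \<open>pseudo_nats\<close>; what is left are the three
  equations treated in \<open>pseudo_nats_iff\<close>.\<close>

definition pnat_data :: "('d, 'g, 'o, 'a, 'p, 'e) pnat => bool" where
 "pnat_data \<tau> \<longleftrightarrow> t1 \<tau> \<in> (\<Pi>\<^sub>E x\<in>Ob D. functors (P0 J x) (P0 K x)) \<and>
   (\<forall>x y f. \<not> one_cell D x y f --> t2 \<tau> x y f = undefined) \<and>
   (\<forall>x y f. one_cell D x y f -->
    t2 \<tau> x y f \<in> isos (fun_cat (P0 J x) (P0 K y))
     (compF (P0 J x) (P1 K x y f) (t1 \<tau> x)) (compF (P0 J x) (t1 \<tau> y) (P1 J x y f)))"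

lemma pnat_dataD:
 assumes "pnat_data \<tau>"
 shows "x \<in> Ob D ==> t1 \<tau> x \<in> functors (P0 J x) (P0 K x)"
  and "one_cell D x y f ==> t2 \<tau> x y f \<in> hom (fun_cat (P0 J x) (P0 K y))
     (compF (P0 J x) (P1 K x y f) (t1 \<tau> x)) (compF (P0 J x) (t1 \<tau> y) (P1 J x y f))"
  and "one_cell D x y f ==> j \<in> Obj (P0 J x) ==> cmp (t2 \<tau> x y f) j \<in> isos (P0 K y)
     (fo (P1 K x y f) (fo (t1 \<tau> x) j)) (fo (t1 \<tau> y) (fo (P1 J x y f) j))"
proof -
 show "t1 \<tau> x \<in> functors (P0 J x) (P0 K x)" if "x \<in> Ob D"
  using assms that by (auto simp: pnat_data_def)
 let ?A = "compF (P0 J x) (t1 \<tau> y) (P1 J x y f)" and ?B = "compF (P0 J x) (P1 K x y f) (t1 \<tau> x)"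
 have i: "t2 \<tau> x y f \<in> isos (fun_cat (P0 J x) (P0 K y))
   ?B ?A" if "one_cell D x y f"
  using assms that by (simp add: pnat_data_def)
 show "t2 \<tau> x y f \<in> hom (fun_cat (P0 J x) (P0 K y))
     ?B ?A" if "one_cell D x y f"
  by (rule isos_hom[OF i[OF that]])
 show "cmp (t2 \<tau> x y f) j \<in> isos (P0 K y) (fo (P1 K x y f) (fo (t1 \<tau> x) j)) (fo (t1 \<tau> y) (fo (P1 J x y f) j))"
  if "one_cell D x y f" "j \<in> Obj (P0 J x)"
  using isos_fun_catD[OF i[OF that(1)] that(2)] that(2) by simp
qed

lemma one_cellD: "one_cell D x y f ==> x \<in> Ob D" "one_cell D x y f ==> y \<in> Ob D"
 "one_cell D x y f ==> f \<in> Obj (Hom D x y)"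
 by (auto simp: one_cell_def)

text \<open>In each of the three diagrams both sides are cells with the same source and the same
  target, by associativity and unit laws of \<open>compF\<close>. So they agree iff their components
  do, and the whiskering rules compute these.\<close>

lemma pseudo_nats_iff:
 "\<tau> \<in> pseudo_nats D J K \<longleftrightarrow> pnat_data \<tau> \<and>
  (\<forall>x\<in>Ob D. \<forall>y\<in>Ob D. \<forall>\<theta>\<in>Arr (Hom D x y). \<forall>j\<in>Obj (P0 J x).
   fa (t1 \<tau> y) (cmp (P2 J x y \<theta>) j) \<cdot>[P0 K y] cmp (t2 \<tau> x y (Dom (Hom D x y) \<theta>)) j
   = cmp (t2 \<tau> x y (Cod (Hom D x y) \<theta>)) j \<cdot>[P0 K y] cmp (P2 K x y \<theta>) (fo (t1 \<tau> x) j)) \<and>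
  (\<forall>x y z f g. one_cell D x y f --> one_cell D y z g --> (\<forall>j\<in>Obj (P0 J x).
   fa (t1 \<tau> z) (cmp (Pc J x y z g f) j) \<cdot>[P0 K z] (cmp (t2 \<tau> y z g) (fo (P1 J x y f) j)
    \<cdot>[P0 K z] fa (P1 K y z g) (cmp (t2 \<tau> x y f) j))
   = cmp (t2 \<tau> x z (Hc1 D x y z g f)) j \<cdot>[P0 K z] cmp (Pc K x y z g f) (fo (t1 \<tau> x) j))) \<and>
  (\<forall>x\<in>Ob D. \<forall>j\<in>Obj (P0 J x).
   cmp (t2 \<tau> x x (One D x)) j \<cdot>[P0 K x] cmp (Pu K x) (fo (t1 \<tau> x) j)
   = fa (t1 \<tau> x) (cmp (Pu J x) j))"
proof (cases "pnat_data \<tau>")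
 case data: True
 note t1 = pnat_dataD(1)[OF data] and t2 = pnat_dataD(2)[OF data]
 have nat: "hcomp (P0 J x) (P0 K y) (idn (P0 J y) (P0 K y) (t1 \<tau> y)) (P2 J x y \<theta>)
     \<cdot>[fun_cat (P0 J x) (P0 K y)] t2 \<tau> x y (Dom (Hom D x y) \<theta>)
    = t2 \<tau> x y (Cod (Hom D x y) \<theta>) \<cdot>[fun_cat (P0 J x) (P0 K y)]
     hcomp (P0 J x) (P0 K y) (P2 K x y \<theta>) (idn (P0 J x) (P0 K x) (t1 \<tau> x)) \<longleftrightarrow>
   (\<forall>j\<in>Obj (P0 J x).
   fa (t1 \<tau> y) (cmp (P2 J x y \<theta>) j) \<cdot>[P0 K y] cmp (t2 \<tau> x y (Dom (Hom D x y) \<theta>)) j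
   = cmp (t2 \<tau> x y (Cod (Hom D x y) \<theta>)) j \<cdot>[P0 K y] cmp (P2 K x y \<theta>) (fo (t1 \<tau> x) j))"
  if xy: "x \<in> Ob D" "y \<in> Ob D" and th: "\<theta> \<in> Arr (Hom D x y)" for x y \<theta>
 proof -
  note h = Arr_hom[OF th]
  note oc = one_cell_hom[OF xy h, THEN conjunct1] one_cell_hom[OF xy h, THEN conjunct2]
  note J2 = J.P2_nt[OF xy h] and K2 = K.P2_nt[OF xy h]
  show ?thesis
   by (subst cell_eq_iff[of _ "Obj (P0 J x)"])
    (auto simp: nt_homD(3,4)[OF J2] nt_homD(3,4)[OF K2] nt_homD(3,4)[OF t2[OF oc(1)]] nt_homD(3,4)[OF t2[OF oc(2)]]
     cmp_whisker_left[OF K.category_P0[OF xy(2)] t1[OF xy(2)] J2] cmp_whisker_right[OF K.category_P0[OF xy(2)] t1[OF xy(1)] K2]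
     simp del: hcomp_simps(4))
 qed
 have comp: "hcomp (P0 J x) (P0 K z) (idn (P0 J z) (P0 K z) (t1 \<tau> z)) (Pc J x y z g f)
     \<cdot>[fun_cat (P0 J x) (P0 K z)]
    (hcomp (P0 J x) (P0 K z) (t2 \<tau> y z g) (idn (P0 J x) (P0 J y) (P1 J x y f))
     \<cdot>[fun_cat (P0 J x) (P0 K z)]
    hcomp (P0 J x) (P0 K z) (idn (P0 K y) (P0 K z) (P1 K y z g)) (t2 \<tau> x y f))
    = t2 \<tau> x z (Hc1 D x y z g f)
     \<cdot>[fun_cat (P0 J x) (P0 K z)]
    hcomp (P0 J x) (P0 K z) (Pc K x y z g f) (idn (P0 J x) (P0 K x) (t1 \<tau> x))
  \<longleftrightarrow> (\<forall>j\<in>Obj (P0 J x).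
   fa (t1 \<tau> z) (cmp (Pc J x y z g f) j) \<cdot>[P0 K z] (cmp (t2 \<tau> y z g) (fo (P1 J x y f) j)
    \<cdot>[P0 K z] fa (P1 K y z g) (cmp (t2 \<tau> x y f) j))
   = cmp (t2 \<tau> x z (Hc1 D x y z g f)) j \<cdot>[P0 K z] cmp (Pc K x y z g f) (fo (t1 \<tau> x) j))"
  if f: "one_cell D x y f" and g: "one_cell D y z g" for x y z f g
 proof -
  note Jc = J.Pc_nt[OF f g] and Kc = K.Pc_nt[OF f g] and ob = one_cellD[OF f] one_cellD[OF g]
  note K1 = K.P1_functors[OF f] K.P1_functors[OF g] and J1 = J.P1_functors[OF f]
  note tf = t2[OF f] and tg = t2[OF g] and tgf = t2[OF one_cell_Hc1[OF f g]]
  note cz = K.category_P0[OF ob(5)]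
  show ?thesis
   by (subst cell_eq_iff[of _ "Obj (P0 J x)"])
    (auto simp: nt_homD(3,4)[OF Jc] nt_homD(3,4)[OF Kc] nt_homD(3,4)[OF tf] nt_homD(3,4)[OF tg] nt_homD(3,4)[OF tgf]
     cmp_whisker_left[OF cz t1[OF ob(5)] Jc] cmp_whisker_right[OF cz t1[OF ob(1)] Kc]
     cmp_whisker_right[OF cz J1 tg] cmp_whisker_left[OF cz K1(2) tf] compF_assoc[OF t1[OF ob(1)]]
     simp del: hcomp_simps(4))
 qed
 have unit: "t2 \<tau> x x (One D x) \<cdot>[fun_cat (P0 J x) (P0 K x)]
     hcomp (P0 J x) (P0 K x) (Pu K x) (idn (P0 J x) (P0 K x) (t1 \<tau> x))
    = hcomp (P0 J x) (P0 K x) (idn (P0 J x) (P0 K x) (t1 \<tau> x)) (Pu J x)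
   \<longleftrightarrow> (\<forall>j\<in>Obj (P0 J x).
   cmp (t2 \<tau> x x (One D x)) j \<cdot>[P0 K x] cmp (Pu K x) (fo (t1 \<tau> x) j)
   = fa (t1 \<tau> x) (cmp (Pu J x) j))" if x: "x \<in> Ob D" for x
 proof -
  note c = K.category_P0[OF x] and tt = t2[OF one_cell_One[OF x]] and t1x = t1[OF x]
  note Jc = J.Pu_nt[OF x] and Kc = K.Pu_nt[OF x]
  show ?thesis
   by (subst cell_eq_iff[of _ "Obj (P0 J x)"])
    (auto simp: nt_homD(3,4)[OF Jc] nt_homD(3,4)[OF Kc] nt_homD(3,4)[OF tt]
     cmp_whisker_left[OF c t1x Jc] cmp_whisker_right[OF c t1x Kc]
     compF_id_left[OF t1x] compF_id_right[OF t1x]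
     simp del: hcomp_simps(4))
 qed
 show ?thesis
  using data unfolding pseudo_nats_def pnat_data_def
  by (simp add: nat comp unit cong: ball_cong)
next
 case False
 then show ?thesis by (auto simp: pnat_data_def pseudo_nats_def)
qed

lemma pseudo_natsD:
 assumes "\<tau> \<in> pseudo_nats D J K"
 shows pnats_data: "pnat_data \<tau>"
  and pseudo_nats_natural: "[|x \<in> Ob D; y \<in> Ob D; \<theta> \<in> hom (Hom D x y) f g; j \<in> Obj (P0 J x)|] ==>
   fa (t1 \<tau> y) (cmp (P2 J x y \<theta>) j) \<cdot>[P0 K y] cmp (t2 \<tau> x y f) j
   = cmp (t2 \<tau> x y g) j \<cdot>[P0 K y] cmp (P2 K x y \<theta>) (fo (t1 \<tau> x) j)"
  and pseudo_nats_comp: "[|one_cell D x y f; one_cell D y z g; j \<in> Obj (P0 J x)|] ==>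
   fa (t1 \<tau> z) (cmp (Pc J x y z g f) j) \<cdot>[P0 K z] (cmp (t2 \<tau> y z g) (fo (P1 J x y f) j)
    \<cdot>[P0 K z] fa (P1 K y z g) (cmp (t2 \<tau> x y f) j))
   = cmp (t2 \<tau> x z (Hc1 D x y z g f)) j \<cdot>[P0 K z] cmp (Pc K x y z g f) (fo (t1 \<tau> x) j)"
  and pseudo_nats_unit: "[|x \<in> Ob D; j \<in> Obj (P0 J x)|] ==>
   cmp (t2 \<tau> x x (One D x)) j \<cdot>[P0 K x] cmp (Pu K x) (fo (t1 \<tau> x) j)
   = fa (t1 \<tau> x) (cmp (Pu J x) j)"
 using assms by (auto simp: pseudo_nats_iff hom_def)

lemma pseudo_natsI:
 assumes "pnat_data \<tau>"
  and "\<And>x y \<theta> f g j. [|x \<in> Ob D; y \<in> Ob D; \<theta> \<in> hom (Hom D x y) f g; one_cell D x y f; one_cell D x y g; j \<in> Obj (P0 J x)|] ==>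
   fa (t1 \<tau> y) (cmp (P2 J x y \<theta>) j) \<cdot>[P0 K y] cmp (t2 \<tau> x y f) j
   = cmp (t2 \<tau> x y g) j \<cdot>[P0 K y] cmp (P2 K x y \<theta>) (fo (t1 \<tau> x) j)"
  and "\<And>x y z f g j. [|one_cell D x y f; one_cell D y z g; j \<in> Obj (P0 J x)|] ==>
   fa (t1 \<tau> z) (cmp (Pc J x y z g f) j) \<cdot>[P0 K z] (cmp (t2 \<tau> y z g) (fo (P1 J x y f) j)
    \<cdot>[P0 K z] fa (P1 K y z g) (cmp (t2 \<tau> x y f) j))
   = cmp (t2 \<tau> x z (Hc1 D x y z g f)) j \<cdot>[P0 K z] cmp (Pc K x y z g f) (fo (t1 \<tau> x) j)"
  and "\<And>x j. [|x \<in> Ob D; j \<in> Obj (P0 J x)|] ==>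
   cmp (t2 \<tau> x x (One D x)) j \<cdot>[P0 K x] cmp (Pu K x) (fo (t1 \<tau> x) j)
   = fa (t1 \<tau> x) (cmp (Pu J x) j)"
 shows "\<tau> \<in> pseudo_nats D J K"
 using assms Arr_hom one_cell_hom unfolding pseudo_nats_iff by (metis (no_types, lifting))

lemma pnat_eqI:
 assumes "\<tau> \<in> pseudo_nats D J K" "\<sigma> \<in> pseudo_nats D J K" "\<And>x. x \<in> Ob D ==> t1 \<tau> x = t1 \<sigma> x"
  and "\<And>x y f j. one_cell D x y f ==> j \<in> Obj (P0 J x) ==> cmp (t2 \<tau> x y f) j = cmp (t2 \<sigma> x y f) j"
 shows "\<tau> = \<sigma>"
proof -
 note d = pnats_data[OF assms(1)] pnats_data[OF assms(2)]
 have e1: "t1 \<tau> = t1 \<sigma>"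
  using d assms(3) unfolding pnat_data_def PiE_def by (blast intro: extensionalityI)
 have "t2 \<tau> x y f = t2 \<sigma> x y f" for x y f
 proof (cases "one_cell D x y f")
  case True
  show ?thesis
   by (rule nt_eqI[OF pnat_dataD(2)[OF d(1) True] pnat_dataD(2)[OF d(2) True, folded e1] assms(4)[OF True]])
 qed (use d in \<open>auto simp: pnat_data_def\<close>)
 then show ?thesis using e1 by (cases \<tau>; cases \<sigma>) (auto intro!: ext)
qed

lemma modifications_iff:
 "m \<in> modifications D J K \<longleftrightarrow> src m \<in> pseudo_nats D J K \<and> tgt m \<in> pseudo_nats D J K \<and>
   cmp m \<in> (\<Pi>\<^sub>E x\<in>Ob D. hom (fun_cat (P0 J x) (P0 K x)) (t1 (src m) x) (t1 (tgt m) x)) \<and>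
   (\<forall>x y f. one_cell D x y f --> (\<forall>j\<in>Obj (P0 J x).
    cmp (t2 (tgt m) x y f) j \<cdot>[P0 K y] fa (P1 K x y f) (cmp (cmp m x) j)
    = cmp (cmp m y) (fo (P1 J x y f) j) \<cdot>[P0 K y] cmp (t2 (src m) x y f) j))"
proof -
 have "t2 (tgt m) x y f \<cdot>[fun_cat (P0 J x) (P0 K y)]
     hcomp (P0 J x) (P0 K y) (idn (P0 K x) (P0 K y) (P1 K x y f)) (cmp m x)
    = hcomp (P0 J x) (P0 K y) (cmp m y) (idn (P0 J x) (P0 J y) (P1 J x y f))
     \<cdot>[fun_cat (P0 J x) (P0 K y)] t2 (src m) x y f \<longleftrightarrow> (\<forall>j\<in>Obj (P0 J x).
    cmp (t2 (tgt m) x y f) j \<cdot>[P0 K y] fa (P1 K x y f) (cmp (cmp m x) j)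
    = cmp (cmp m y) (fo (P1 J x y f) j) \<cdot>[P0 K y] cmp (t2 (src m) x y f) j)"
  if f: "one_cell D x y f" and m: "src m \<in> pseudo_nats D J K" "tgt m \<in> pseudo_nats D J K"
   "cmp m \<in> (\<Pi>\<^sub>E x\<in>Ob D. hom (fun_cat (P0 J x) (P0 K x)) (t1 (src m) x) (t1 (tgt m) x))" for x y f
 proof -
  note s = pnat_dataD(2)[OF pnats_data[OF m(1)] f] and t = pnat_dataD(2)[OF pnats_data[OF m(2)] f]
  note ob = one_cellD[OF f]
  have mx: "cmp m x \<in> hom (fun_cat (P0 J x) (P0 K x)) (t1 (src m) x) (t1 (tgt m) x)"
   and my: "cmp m y \<in> hom (fun_cat (P0 J y) (P0 K y)) (t1 (src m) y) (t1 (tgt m) y)"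
   using m ob by auto
  note cy = K.category_P0[OF ob(2)]
  show ?thesis
   by (subst cell_eq_iff[of _ "Obj (P0 J x)"])
    (auto simp: nt_homD(3,4)[OF s] nt_homD(3,4)[OF t] nt_homD(3,4)[OF mx] nt_homD(3,4)[OF my]
     cmp_whisker_left[OF cy K.P1_functors[OF f] mx] cmp_whisker_right[OF cy J.P1_functors[OF f] my]
     simp del: hcomp_simps(4))
 qed
 then show ?thesis unfolding modifications_def by blast
qed

lemma PsHom_simps [simp]:
 "Obj (PsHom D J K) = pseudo_nats D J K" "Arr (PsHom D J K) = modifications D J K"
 "Dom (PsHom D J K) = src" "Cod (PsHom D J K) = tgt"
 "src (Ide (PsHom D J K) \<tau>) = \<tau>" "tgt (Ide (PsHom D J K) \<tau>) = \<tau>"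
 "src (n \<cdot>[PsHom D J K] m) = src m" "tgt (n \<cdot>[PsHom D J K] m) = tgt n"
 "cmp (Ide (PsHom D J K) \<tau>) = (\<lambda>x\<in>Ob D. idn (P0 J x) (P0 K x) (t1 \<tau> x))"
 "cmp (n \<cdot>[PsHom D J K] m) = (\<lambda>x\<in>Ob D. cmp n x \<cdot>[fun_cat (P0 J x) (P0 K x)] cmp m x)"
 by (auto simp: PsHom_def)

lemma modif_homI:
 assumes "\<tau> \<in> pseudo_nats D J K" "\<sigma> \<in> pseudo_nats D J K" "src m = \<tau>" "tgt m = \<sigma>" "cmp m \<in> extensional (Ob D)"
  and "\<And>x. x \<in> Ob D ==> cmp m x \<in> hom (fun_cat (P0 J x) (P0 K x)) (t1 \<tau> x) (t1 \<sigma> x)"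
  and "\<And>x y f j. one_cell D x y f ==> j \<in> Obj (P0 J x) ==>
    cmp (t2 \<sigma> x y f) j \<cdot>[P0 K y] fa (P1 K x y f) (cmp (cmp m x) j)
    = cmp (cmp m y) (fo (P1 J x y f) j) \<cdot>[P0 K y] cmp (t2 \<tau> x y f) j"
 shows "m \<in> hom (PsHom D J K) \<tau> \<sigma>"
 using assms by (simp add: hom_def modifications_iff PiE_def)

lemma modif_homD:
 assumes "m \<in> hom (PsHom D J K) \<tau> \<sigma>"
 shows "\<tau> \<in> pseudo_nats D J K" "\<sigma> \<in> pseudo_nats D J K" "src m = \<tau>" "tgt m = \<sigma>" "cmp m \<in> extensional (Ob D)"
  and "x \<in> Ob D ==> cmp m x \<in> hom (fun_cat (P0 J x) (P0 K x)) (t1 \<tau> x) (t1 \<sigma> x)"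
  and "one_cell D x y f ==> j \<in> Obj (P0 J x) ==>
    cmp (t2 \<sigma> x y f) j \<cdot>[P0 K y] fa (P1 K x y f) (cmp (cmp m x) j)
    = cmp (cmp m y) (fo (P1 J x y f) j) \<cdot>[P0 K y] cmp (t2 \<tau> x y f) j"
proof -
 have m: "m \<in> modifications D J K" "src m = \<tau>" "tgt m = \<sigma>" using assms by (auto simp: hom_def)
 then show "\<tau> \<in> pseudo_nats D J K" "\<sigma> \<in> pseudo_nats D J K" "src m = \<tau>" "tgt m = \<sigma>" "cmp m \<in> extensional (Ob D)"
  by (auto simp: modifications_iff PiE_def)
 show "cmp m x \<in> hom (fun_cat (P0 J x) (P0 K x)) (t1 \<tau> x) (t1 \<sigma> x)" if "x \<in> Ob D"
  using m that by (auto simp: modifications_iff PiE_def)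
 show "cmp (t2 \<sigma> x y f) j \<cdot>[P0 K y] fa (P1 K x y f) (cmp (cmp m x) j)
    = cmp (cmp m y) (fo (P1 J x y f) j) \<cdot>[P0 K y] cmp (t2 \<tau> x y f) j"
  if "one_cell D x y f" "j \<in> Obj (P0 J x)"
  using m that unfolding modifications_iff by blast
qed

lemma modif_eqI:
 assumes m: "m \<in> hom (PsHom D J K) \<tau> \<sigma>" and n: "n \<in> hom (PsHom D J K) \<tau> \<sigma>"
  and "\<And>x j. x \<in> Ob D ==> j \<in> Obj (P0 J x) ==> cmp (cmp m x) j = cmp (cmp n x) j"
 shows "m = n"
proof (rule cell_eqI[of _ _ "Ob D"])
 show "cmp m x = cmp n x" if "x \<in> Ob D" for x
  by (rule nt_eqI[OF modif_homD(6)[OF m that] modif_homD(6)[OF n that] assms(3)[OF that]])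
qed (use modif_homD[OF m] modif_homD[OF n] in auto)

lemma category_PsHom: "category (PsHom D J K)"
proof
 show ide: "Ide (PsHom D J K) \<tau> \<in> hom (PsHom D J K) \<tau> \<tau>" if "\<tau> \<in> Obj (PsHom D J K)" for \<tau>
 proof (rule modif_homI)
  have t: "\<tau> \<in> pseudo_nats D J K" using that by simp
  note d = pnats_data[OF t]
  fix x y f j assume f: "one_cell D x y f" and j: "j \<in> Obj (P0 J x)"
  interpret K: category "P0 K y" using K.category_P0 one_cellD[OF f] by auto
  show "cmp (t2 \<tau> x y f) j \<cdot>[P0 K y] fa (P1 K x y f) (cmp (cmp (Ide (PsHom D J K) \<tau>) x) j)
    = cmp (cmp (Ide (PsHom D J K) \<tau>) y) (fo (P1 J x y f) j) \<cdot>[P0 K y] cmp (t2 \<tau> x y f) j"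
   using one_cellD[OF f] j fun_fo[OF pnat_dataD(1)[OF d] j] fun_fo[OF J.P1_functors[OF f] j]
   isos_hom[OF pnat_dataD(3)[OF d f j]] fun_Ide[OF K.P1_functors[OF f]]
   by (simp add: K.Cmp_Ide_left K.Cmp_Ide_right)
 qed (use that in \<open>auto intro!: idn_hom J.category_P0 K.category_P0 pnat_dataD pnats_data\<close>)
 show comp: "n \<cdot>[PsHom D J K] m \<in> hom (PsHom D J K) \<tau> \<rho>"
  if m: "m \<in> hom (PsHom D J K) \<tau> \<sigma>" and n: "n \<in> hom (PsHom D J K) \<sigma> \<rho>" for m n \<tau> \<sigma> \<rho>
 proof (rule modif_homI)
  fix x y f j assume f: "one_cell D x y f" and j: "j \<in> Obj (P0 J x)"
  interpret K: category "P0 K y" using K.category_P0 one_cellD[OF f] by auto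
  note ob = one_cellD[OF f] and Jf = fun_fo[OF J.P1_functors[OF f] j]
  note mx = nt_homD(6)[OF modif_homD(6)[OF m ob(1)] j] and my = nt_homD(6)[OF modif_homD(6)[OF m ob(2)] Jf]
  note nx = nt_homD(6)[OF modif_homD(6)[OF n ob(1)] j] and ny = nt_homD(6)[OF modif_homD(6)[OF n ob(2)] Jf]
  note t = isos_hom[OF pnat_dataD(3)[OF pnats_data[OF modif_homD(1)[OF m]] f j]]
    isos_hom[OF pnat_dataD(3)[OF pnats_data[OF modif_homD(1)[OF n]] f j]]
    isos_hom[OF pnat_dataD(3)[OF pnats_data[OF modif_homD(2)[OF n]] f j]]
  note Kf = K.P1_functors[OF f]
  show "cmp (t2 \<rho> x y f) j \<cdot>[P0 K y] fa (P1 K x y f) (cmp (cmp (n \<cdot>[PsHom D J K] m) x) j)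
    = cmp (cmp (n \<cdot>[PsHom D J K] m) y) (fo (P1 J x y f) j) \<cdot>[P0 K y] cmp (t2 \<tau> x y f) j"
   using K.paste[OF t(1) fun_fa[OF Kf mx] my t(2) fun_fa[OF Kf nx] ny t(3)
     modif_homD(7)[OF m f j, symmetric] modif_homD(7)[OF n f j, symmetric]] fun_Cmp[OF Kf mx nx] ob j Jf
   by simp
 qed (use that modif_homD[OF m] modif_homD[OF n] in
   \<open>auto intro!: category.Cmp_hom[OF category_fun_cat] J.category_P0 K.category_P0\<close>)
 fix m \<tau> \<sigma> assume m: "m \<in> hom (PsHom D J K) \<tau> \<sigma>"
 have ob: "\<tau> \<in> Obj (PsHom D J K)" "\<sigma> \<in> Obj (PsHom D J K)" using modif_homD[OF m] by auto
 show "Ide (PsHom D J K) \<sigma> \<cdot>[PsHom D J K] m = m"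
  by (rule modif_eqI[OF comp[OF m ide[OF ob(2)]] m])
   (use nt_homD(6)[OF modif_homD(6)[OF m]] in \<open>auto intro!: category.Cmp_Ide_left K.category_P0\<close>)
 show "m \<cdot>[PsHom D J K] Ide (PsHom D J K) \<tau> = m"
  by (rule modif_eqI[OF comp[OF ide[OF ob(1)] m] m])
   (use nt_homD(6)[OF modif_homD(6)[OF m]] in \<open>auto intro!: category.Cmp_Ide_right K.category_P0\<close>)
 fix n l \<rho> \<mu> assume n: "n \<in> hom (PsHom D J K) \<sigma> \<rho>" and l: "l \<in> hom (PsHom D J K) \<rho> \<mu>"
 show "l \<cdot>[PsHom D J K] (n \<cdot>[PsHom D J K] m) = (l \<cdot>[PsHom D J K] n) \<cdot>[PsHom D J K] m"
  by (rule modif_eqI[OF comp[OF comp[OF m n] l] comp[OF m comp[OF n l]]])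
   (use nt_homD(6)[OF modif_homD(6)[OF m]] nt_homD(6)[OF modif_homD(6)[OF n]] nt_homD(6)[OF modif_homD(6)[OF l]]
    in \<open>auto intro!: category.Cmp_assoc K.category_P0\<close>)
qed (auto simp: modifications_def)

end

section \<open>Equivalences from full faithfulness\<close>

text \<open>The usual construction of a quasi-inverse: choose objects and isomorphisms by essential
  surjectivity, lift arrows by fullness, and obtain all equations from faithfulness.\<close>

lemma equivalenceI:
 assumes "category A" "category B" and F: "F \<in> functors A B"
  and full: "\<And>a a' g. a \<in> Obj A ==> a' \<in> Obj A ==> g \<in> hom B (fo F a) (fo F a') ==> \<exists>f \<in> hom A a a'. fa F f = g"
  and faithful: "\<And>a a' f f'. f \<in> hom A a a' ==> f' \<in> hom A a a' ==> fa F f = fa F f' ==> f = f'"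
  and eso: "\<And>b. b \<in> Obj B ==> \<exists>a \<in> Obj A. isos B (fo F a) b \<noteq> {}"
 shows "equivalence A B F"
proof -
 interpret A: category A by fact
 interpret B: category B by fact
 obtain g0 where g0: "\<And>b. b \<in> Obj B ==> g0 b \<in> Obj A \<and> isos B (fo F (g0 b)) b \<noteq> {}"
  using eso by metis
 then have "\<And>b. b \<in> Obj B ==> \<exists>e. e \<in> isos B (fo F (g0 b)) b" by blast
 then obtain e where e: "\<And>b. b \<in> Obj B ==> e b \<in> isos B (fo F (g0 b)) b"
  by metis
 note eh = isos_hom[OF e] and ei = inv_arr_hom[OF e]
 \<comment> \<open>Preimages of arrows under \<open>F\<close>, chosen by fullness. Faithfulness
   makes them unique, so equations between lifts may be checked in \<open>B\<close>.\<close>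
 define lift where "lift a a' g = (SOME f. f \<in> hom A a a' \<and> fa F f = g)" for a a' g
 have lift: "lift a a' g \<in> hom A a a' \<and> fa F (lift a a' g) = g"
  if "a \<in> Obj A" "a' \<in> Obj A" "g \<in> hom B (fo F a) (fo F a')" for a a' g
  unfolding lift_def using full[OF that] by (rule_tac someI_ex) auto
 \<comment> \<open>This is \<open>g\<close> conjugated by the chosen isomorphisms, so that it runs
   between objects in the image of \<open>F\<close>. By \<open>c_unique\<close> it is the only arrow
   compatible with \<open>e\<close>, and this uniqueness gives functoriality of the lifts.\<close>
 define c where "c b b' g = (inv_arr B (e b') \<cdot>[B] (g \<cdot>[B] e b))" for b b' g
 have c: "c b b' g \<in> hom B (fo F (g0 b)) (fo F (g0 b'))" "e b' \<cdot>[B] c b b' g = g \<cdot>[B] e b"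
  if g: "g \<in> hom B b b'" for b b' g
 proof -
  note o = B.hom_Obj[OF g]
  have ge: "g \<cdot>[B] e b \<in> hom B (fo F (g0 b)) b'" by (rule B.Cmp_hom[OF eh[OF o(1)] g])
  show "c b b' g \<in> hom B (fo F (g0 b)) (fo F (g0 b'))"
   unfolding c_def by (rule B.Cmp_hom[OF ge ei[OF o(2)]])
  show "e b' \<cdot>[B] c b b' g = g \<cdot>[B] e b"
   unfolding c_def using B.Cmp_assoc[OF ge ei[OF o(2)] eh[OF o(2)]] inv_arr_right[OF e[OF o(2)]] B.Cmp_Ide_left[OF ge]
   by simp
 qed
 have c_unique: "h = c b b' g" if "h \<in> hom B (fo F (g0 b)) (fo F (g0 b'))" "e b' \<cdot>[B] h = g \<cdot>[B] e b" "g \<in> hom B b b'" for h b b' g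
  using B.iso_cancel_left[OF e[OF B.hom_Obj(2)[OF that(3)]] that(1) c(1)[OF that(3)]] that(2) c(2)[OF that(3)]
  by simp
 define G where "G = \<lparr>fo = (\<lambda>b\<in>Obj B. g0 b),
  fa = (\<lambda>g\<in>Arr B. lift (g0 (Dom B g)) (g0 (Cod B g)) (c (Dom B g) (Cod B g) g))\<rparr>"
 have Gfo: "fo G b = g0 b" if "b \<in> Obj B" for b using that by (simp add: G_def)
 have Gfa: "fa G g \<in> hom A (g0 b) (g0 b')" "fa F (fa G g) = c b b' g" if "g \<in> hom B b b'" for g b b'
  using lift[OF _ _ c(1)[OF that]] g0[THEN conjunct1] B.hom_Obj[OF that] that by (auto simp: G_def hom_def)
 have G: "G \<in> functors B A"
 proof (rule functorsI)
  show "fa G (Ide B b) = Ide A (fo G b)" (is "?l = ?r") if b: "b \<in> Obj B" for b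
  proof (rule faithful[OF Gfa(1)[OF B.Ide_hom[OF b]]])
   show "Ide A (fo G b) \<in> hom A (g0 b) (g0 b)" using b g0 by (simp add: Gfo A.Ide_hom)
   have "Ide B (fo F (g0 b)) = c b b (Ide B b)"
    by (rule c_unique) (use b g0 eh in \<open>auto intro!: B.Ide_hom fun_fo[OF F] simp: B.Cmp_Ide_left[OF eh] B.Cmp_Ide_right[OF eh]\<close>)
   then show "fa F ?l = fa F ?r"
    using b g0 by (simp add: Gfo Gfa(2)[OF B.Ide_hom[OF b]] fun_Ide[OF F])
  qed
  show "fa G (h \<cdot>[B] g) = fa G h \<cdot>[A] fa G g" (is "?l = ?r") if g: "g \<in> hom B b b'" and h: "h \<in> hom B b' b''" for g h b b' b''
  proof (rule faithful[OF Gfa(1)[OF B.Cmp_hom[OF g h]] A.Cmp_hom[OF Gfa(1)[OF g] Gfa(1)[OF h]]])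
   note o = B.hom_Obj[OF g] B.hom_Obj[OF h]
   have "c b' b'' h \<cdot>[B] c b b' g = c b b'' (h \<cdot>[B] g)"
   proof (rule c_unique[OF B.Cmp_hom[OF c(1)[OF g] c(1)[OF h]] _ B.Cmp_hom[OF g h]])
    show "e b'' \<cdot>[B] (c b' b'' h \<cdot>[B] c b b' g) = (h \<cdot>[B] g) \<cdot>[B] e b"
     by (rule B.paste[OF eh[OF o(1)] c(1)[OF g] g eh[OF o(2)] c(1)[OF h] h eh[OF o(4)]
        c(2)[OF g, symmetric] c(2)[OF h, symmetric], symmetric])
   qed
   then show "fa F ?l = fa F ?r"
    by (simp add: Gfa(2)[OF B.Cmp_hom[OF g h]] fun_Cmp[OF F Gfa(1)[OF g] Gfa(1)[OF h]] Gfa(2)[OF g] Gfa(2)[OF h])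
  qed
 qed (use g0 B.hom_Obj Gfa(1) in \<open>auto simp: Gfo G_def\<close>)
 let ?\<epsilon> = "\<lparr>src = compF B F G, tgt = id_func B, cmp = (\<lambda>b\<in>Obj B. e b)\<rparr>"
 have "?\<epsilon> \<in> isos (fun_cat B B) (compF B F G) (id_func B)"
 proof (rule isos_fun_catI[OF assms(2,2) nt_homI])
  show "cmp ?\<epsilon> b' \<cdot>[B] fa (compF B F G) g = fa (id_func B) g \<cdot>[B] cmp ?\<epsilon> b" if g: "g \<in> hom B b b'" for g b b'
   using B.hom_Obj[OF g] c(2)[OF g] Gfa(2)[OF g] homD(1)[OF g] by simp
 qed (use e eh Gfo in \<open>auto intro: compF_functors[OF assms(2) G F] id_func_functors[OF assms(2)]\<close>)
 moreover
 \<comment> \<open>The unit at \<open>a\<close> is the lift of the inverse of the counit component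
   at \<open>fo F a\<close>.\<close>
 let ?u = "\<lambda>a. inv_arr B (e (fo F a))"
 let ?\<eta> = "\<lparr>src = id_func A, tgt = compF A G F, cmp = (\<lambda>a\<in>Obj A. lift a (g0 (fo F a)) (?u a))\<rparr>"
 have Fo: "fo F a \<in> Obj B" "g0 (fo F a) \<in> Obj A" if "a \<in> Obj A" for a using fun_fo[OF F that] g0 by auto
 have eta: "cmp ?\<eta> a \<in> hom A a (g0 (fo F a))" "fa F (cmp ?\<eta> a) = ?u a" if "a \<in> Obj A" for a
  using lift[OF that Fo(2)[OF that] ei[OF Fo(1)[OF that]]] that by auto
 have "?\<eta> \<in> isos (fun_cat A A) (id_func A) (compF A G F)"
 proof (rule isos_fun_catI[OF assms(1,1) nt_homI])
  fix f a b assume f: "f \<in> hom A a b"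
  note o = A.hom_Obj[OF f] and Ff = fun_fa[OF F f]
  have "cmp ?\<eta> b \<cdot>[A] f = fa G (fa F f) \<cdot>[A] cmp ?\<eta> a" (is "?l = ?r")
  proof (rule faithful[OF A.Cmp_hom[OF f eta(1)[OF o(2)]] A.Cmp_hom[OF eta(1)[OF o(1)] Gfa(1)[OF Ff]]])
   show "fa F ?l = fa F ?r"
    unfolding fun_Cmp[OF F f eta(1)[OF o(2)]] fun_Cmp[OF F eta(1)[OF o(1)] Gfa(1)[OF Ff]]
     eta(2)[OF o(1)] eta(2)[OF o(2)] Gfa(2)[OF Ff]
    by (rule B.inv_square[OF e[OF Fo(1)[OF o(1)]] e[OF Fo(1)[OF o(2)]] c(1)[OF Ff] Ff c(2)[OF Ff, symmetric], symmetric])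
  qed
  then show "cmp ?\<eta> b \<cdot>[A] fa (id_func A) f = fa (compF A G F) f \<cdot>[A] cmp ?\<eta> a"
   using homD(1)[OF f] by simp
 next
  fix a assume a: "a \<in> Obj A"
  show "cmp ?\<eta> a \<in> hom A (fo (id_func A) a) (fo (compF A G F) a)" using eta(1)[OF a] a Fo(1)[OF a] by (simp add: Gfo)
  let ?v = "lift (g0 (fo F a)) a (e (fo F a))"
  have v: "?v \<in> hom A (g0 (fo F a)) a" "fa F ?v = e (fo F a)"
   using lift[OF Fo(2)[OF a] a eh[OF Fo(1)[OF a]]] by auto
  have "cmp ?\<eta> a \<in> isos A a (g0 (fo F a))"
  proof (rule isosI[OF eta(1)[OF a] v(1)])
   show "?v \<cdot>[A] cmp ?\<eta> a = Ide A a"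
    by (rule faithful[OF A.Cmp_hom[OF eta(1)[OF a] v(1)] A.Ide_hom[OF a]])
     (simp only: fun_Cmp[OF F eta(1)[OF a] v(1)] v(2) eta(2)[OF a] inv_arr_right[OF e[OF Fo(1)[OF a]]] fun_Ide[OF F a])
   show "cmp ?\<eta> a \<cdot>[A] ?v = Ide A (g0 (fo F a))"
    by (rule faithful[OF A.Cmp_hom[OF v(1) eta(1)[OF a]] A.Ide_hom[OF Fo(2)[OF a]]])
     (simp only: fun_Cmp[OF F v(1) eta(1)[OF a]] v(2) eta(2)[OF a] inv_arr_left[OF e[OF Fo(1)[OF a]]] fun_Ide[OF F Fo(2)[OF a]])
  qed
  then show "cmp ?\<eta> a \<in> isos A (fo (id_func A) a) (fo (compF A G F) a)" using a Fo(1)[OF a] by (simp add: Gfo)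
 qed (auto intro: compF_functors[OF assms(1) F G] id_func_functors[OF assms(1)])
 ultimately show ?thesis unfolding equivalence_def using F G by blast
qed

section \<open>Representables of a 2-category\<close>

lemma op2_simps [simp]:
 "Ob (op2 D) = Ob D" "Hom (op2 D) x y = Hom D y x" "One (op2 D) = One D"
 "Hc1 (op2 D) x y z g f = Hc1 D z y x f g" "Hc2 (op2 D) x y z \<beta> \<alpha> = Hc2 D z y x \<alpha> \<beta>"
 "one_cell (op2 D) x y f = one_cell D y x f"
 by (auto simp: op2_def one_cell_def)

lemma two_category_op2: assumes "two_category D" shows "two_category (op2 D)"
proof -
 interpret D: two_category D by fact
 show ?thesis
  by (rule two_category.intro; (simp only: op2_simps)?)
   (auto intro: D.category_Hom D.One_Obj D.Hc1_Obj D.Hc2_hom D.Hc2_Ide D.Hc2_Cmp D.Hc1_One_left D.Hc1_One_right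
    D.Hc2_One_left D.Hc2_One_right D.Hc1_assoc[symmetric] D.Hc2_assoc[symmetric])
qed

lemma whisker_left_isos:
 assumes "category A" "category B" "category C" "G \<in> functors B C" "\<alpha> \<in> isos (fun_cat A B) F F'"
 shows "hcomp A C (idn B C G) \<alpha> \<in> isos (fun_cat A C) (compF A G F) (compF A G F')"
proof (rule isos_fun_catI[OF assms(1,3) hcomp_hom[OF assms(1,3) isos_hom[OF assms(5)] idn_hom[OF assms(2,3,4)]]])
 show "cmp (hcomp A C (idn B C G) \<alpha>) a \<in> isos C (fo (compF A G F) a) (fo (compF A G F') a)" if "a \<in> Obj A" for a
  using that fun_isos[OF assms(4,2) isos_fun_catD[OF assms(5) that]]
  by (simp add: cmp_whisker_left[OF assms(3,4) isos_hom[OF assms(5)]] del: hcomp_simps(4))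
qed

context two_category
begin

lemma fo_postfun [simp]: "f \<in> Obj (Hom C w x) ==> fo (postfun C w x y h) f = Hc1 C w x y h f"
 and fa_postfun [simp]: "\<alpha> \<in> Arr (Hom C w x) ==> fa (postfun C w x y h) \<alpha> = Hc2 C w x y (Ide (Hom C x y) h) \<alpha>"
 and fo_prefun [simp]: "f \<in> Obj (Hom C w x) ==> fo (prefun C v w x k) f = Hc1 C v w x f k"
 and fa_prefun [simp]: "\<alpha> \<in> Arr (Hom C w x) ==> fa (prefun C v w x k) \<alpha> = Hc2 C v w x \<alpha> (Ide (Hom C v w) k)"
 and cmp_postnat [simp]: "f \<in> Obj (Hom C w x) ==> cmp (postnat C w x y \<theta>) f = Hc2 C w x y \<theta> (Ide (Hom C w x) f)"
 and cmp_prenat [simp]: "f \<in> Obj (Hom C w x) ==> cmp (prenat C v w x \<eta>) f = Hc2 C v w x (Ide (Hom C w x) f) \<eta>"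
 by (auto simp: postfun_def prefun_def postnat_def prenat_def)

lemma Ide_Hom: "x \<in> Ob C ==> y \<in> Ob C ==> f \<in> Obj (Hom C x y) ==> Ide (Hom C x y) f \<in> hom (Hom C x y) f f"
 by (rule category.Ide_hom[OF category_Hom])

lemma Hc2_Cmp_left:
 assumes "x \<in> Ob C" "y \<in> Ob C" "z \<in> Ob C" "f \<in> Obj (Hom C x y)" "\<beta> \<in> hom (Hom C y z) g g'" "\<beta>' \<in> hom (Hom C y z) g' g''"
 shows "Hc2 C x y z (\<beta>' \<cdot>[Hom C y z] \<beta>) (Ide (Hom C x y) f)
  = Hc2 C x y z \<beta>' (Ide (Hom C x y) f) \<cdot>[Hom C x z] Hc2 C x y z \<beta> (Ide (Hom C x y) f)"
 using Hc2_Cmp[OF assms(1-3) Ide_Hom[OF assms(1,2,4)] Ide_Hom[OF assms(1,2,4)] assms(5,6)]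
  category.Cmp_Ide_left[OF category_Hom[OF assms(1,2)] Ide_Hom[OF assms(1,2,4)]] by simp

lemma Hc2_Cmp_right:
 assumes "x \<in> Ob C" "y \<in> Ob C" "z \<in> Ob C" "g \<in> Obj (Hom C y z)" "\<alpha> \<in> hom (Hom C x y) f f'" "\<alpha>' \<in> hom (Hom C x y) f' f''"
 shows "Hc2 C x y z (Ide (Hom C y z) g) (\<alpha>' \<cdot>[Hom C x y] \<alpha>)
  = Hc2 C x y z (Ide (Hom C y z) g) \<alpha>' \<cdot>[Hom C x z] Hc2 C x y z (Ide (Hom C y z) g) \<alpha>"
 using Hc2_Cmp[OF assms(1-3) assms(5,6) Ide_Hom[OF assms(2,3,4)] Ide_Hom[OF assms(2,3,4)]]
  category.Cmp_Ide_left[OF category_Hom[OF assms(2,3)] Ide_Hom[OF assms(2,3,4)]] by simp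

text \<open>Both sides equal \<open>Hc2 C x y z \<beta> \<alpha>\<close> by the interchange law with
  identities.\<close>

lemma Hc2_interchange:
 assumes "x \<in> Ob C" "y \<in> Ob C" "z \<in> Ob C" and \<alpha>: "\<alpha> \<in> hom (Hom C x y) f f'" and \<beta>: "\<beta> \<in> hom (Hom C y z) g g'"
 shows "Hc2 C x y z \<beta> (Ide (Hom C x y) f') \<cdot>[Hom C x z] Hc2 C x y z (Ide (Hom C y z) g) \<alpha>
  = Hc2 C x y z (Ide (Hom C y z) g') \<alpha> \<cdot>[Hom C x z] Hc2 C x y z \<beta> (Ide (Hom C x y) f)"
proof -
 interpret xy: category "Hom C x y" by (rule category_Hom[OF assms(1,2)])
 interpret yz: category "Hom C y z" by (rule category_Hom[OF assms(2,3)])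
 note o = xy.hom_Obj[OF \<alpha>] yz.hom_Obj[OF \<beta>]
 show ?thesis
  using Hc2_Cmp[OF assms(1-3) \<alpha> xy.Ide_hom[OF o(2)] yz.Ide_hom[OF o(3)] \<beta>]
   Hc2_Cmp[OF assms(1-3) xy.Ide_hom[OF o(1)] \<alpha> \<beta> yz.Ide_hom[OF o(4)]]
  by (simp add: xy.Cmp_Ide_left[OF \<alpha>] xy.Cmp_Ide_right[OF \<alpha>] yz.Cmp_Ide_left[OF \<beta>] yz.Cmp_Ide_right[OF \<beta>])
qed

lemma Hc2_Arr: "x \<in> Ob C ==> y \<in> Ob C ==> z \<in> Ob C ==> \<alpha> \<in> Arr (Hom C x y) ==> \<beta> \<in> Arr (Hom C y z) ==>
  Hc2 C x y z \<beta> \<alpha> \<in> Arr (Hom C x z)"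
 using Hc2_hom[OF _ _ _ Arr_hom Arr_hom, THEN homD(1)] by blast

lemma Ide_Arr: "x \<in> Ob C ==> y \<in> Ob C ==> f \<in> Obj (Hom C x y) ==> Ide (Hom C x y) f \<in> Arr (Hom C x y)"
 by (rule homD(1)[OF Ide_Hom])

lemma postfun_functors:
 assumes "w \<in> Ob C" "x \<in> Ob C" "y \<in> Ob C" "h \<in> Obj (Hom C x y)"
 shows "postfun C w x y h \<in> functors (Hom C w x) (Hom C w y)"
proof (rule functorsI)
 interpret wx: category "Hom C w x" by (rule category_Hom[OF assms(1,2)])
 let ?A = "postfun C w x y h"
 show "fa ?A \<alpha> \<in> hom (Hom C w y) (fo ?A f) (fo ?A g)"
  if "\<alpha> \<in> hom (Hom C w x) f g" for \<alpha> f g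
  using that assms wx.hom_Obj[OF that] homD(1)[OF that] by (simp add: Hc2_hom Ide_Hom)
 show "fa ?A (\<beta> \<cdot>[Hom C w x] \<alpha>) = fa ?A \<beta> \<cdot>[Hom C w y] fa ?A \<alpha>"
  if "\<alpha> \<in> hom (Hom C w x) f g" "\<beta> \<in> hom (Hom C w x) g k" for \<alpha> \<beta> f g k
  using that assms wx.Cmp_hom[OF that, THEN homD(1)] by (simp add: Hc2_Cmp_right homD(1))
qed (use assms in \<open>auto simp: postfun_def Hc1_Obj Ide_Arr Hc2_Ide\<close>)

lemma prefun_functors:
 assumes "v \<in> Ob C" "w \<in> Ob C" "x \<in> Ob C" "k \<in> Obj (Hom C v w)"
 shows "prefun C v w x k \<in> functors (Hom C w x) (Hom C v x)"
proof (rule functorsI)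
 interpret wx: category "Hom C w x" by (rule category_Hom[OF assms(2,3)])
 let ?A = "prefun C v w x k"
 show "fa ?A \<alpha> \<in> hom (Hom C v x) (fo ?A f) (fo ?A g)"
  if "\<alpha> \<in> hom (Hom C w x) f g" for \<alpha> f g
  using that assms wx.hom_Obj[OF that] homD(1)[OF that] by (simp add: Hc2_hom Ide_Hom)
 show "fa ?A (\<beta> \<cdot>[Hom C w x] \<alpha>) = fa ?A \<beta> \<cdot>[Hom C v x] fa ?A \<alpha>"
  if "\<alpha> \<in> hom (Hom C w x) f g" "\<beta> \<in> hom (Hom C w x) g h" for \<alpha> \<beta> f g h
  using that assms wx.Cmp_hom[OF that, THEN homD(1)] by (simp add: Hc2_Cmp_left homD(1))
qed (use assms in \<open>auto simp: prefun_def Hc1_Obj Ide_Arr Hc2_Ide\<close>)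

lemma postnat_hom:
 assumes "w \<in> Ob C" "x \<in> Ob C" "y \<in> Ob C" "\<theta> \<in> hom (Hom C x y) h k"
 shows "postnat C w x y \<theta> \<in> hom (fun_cat (Hom C w x) (Hom C w y)) (postfun C w x y h) (postfun C w x y k)"
proof (rule nt_homI)
 interpret wx: category "Hom C w x" by (rule category_Hom[OF assms(1,2)])
 note o = category.hom_Obj[OF category_Hom[OF assms(2,3)] assms(4)]
 show "postfun C w x y h \<in> functors (Hom C w x) (Hom C w y)" "postfun C w x y k \<in> functors (Hom C w x) (Hom C w y)"
  using o assms by (auto intro: postfun_functors)
 let ?A = "postnat C w x y \<theta>"
 show "cmp ?A f \<in> hom (Hom C w y) (fo (postfun C w x y h) f) (fo (postfun C w x y k) f)"
  if "f \<in> Obj (Hom C w x)" for f using that assms by (simp add: Hc2_hom Ide_Hom)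
 show "cmp ?A g \<cdot>[Hom C w y] fa (postfun C w x y h) \<alpha> = fa (postfun C w x y k) \<alpha> \<cdot>[Hom C w y] cmp ?A f"
  if "\<alpha> \<in> hom (Hom C w x) f g" for \<alpha> f g
  using that assms wx.hom_Obj[OF that] homD(1)[OF that] Hc2_interchange[OF assms(1-3) that assms(4)] by simp
qed (use assms(4) in \<open>auto simp: postnat_def homD\<close>)

lemma prenat_hom:
 assumes "v \<in> Ob C" "w \<in> Ob C" "x \<in> Ob C" "\<theta> \<in> hom (Hom C v w) h k"
 shows "prenat C v w x \<theta> \<in> hom (fun_cat (Hom C w x) (Hom C v x)) (prefun C v w x h) (prefun C v w x k)"
proof (rule nt_homI)
 interpret wx: category "Hom C w x" by (rule category_Hom[OF assms(2,3)])
 note o = category.hom_Obj[OF category_Hom[OF assms(1,2)] assms(4)]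
 show "prefun C v w x h \<in> functors (Hom C w x) (Hom C v x)" "prefun C v w x k \<in> functors (Hom C w x) (Hom C v x)"
  using o assms by (auto intro: prefun_functors)
 let ?A = "prenat C v w x \<theta>"
 show "cmp ?A f \<in> hom (Hom C v x) (fo (prefun C v w x h) f) (fo (prefun C v w x k) f)"
  if "f \<in> Obj (Hom C w x)" for f using that assms by (simp add: Hc2_hom Ide_Hom)
 show "cmp ?A g \<cdot>[Hom C v x] fa (prefun C v w x h) \<alpha> = fa (prefun C v w x k) \<alpha> \<cdot>[Hom C v x] cmp ?A f"
  if "\<alpha> \<in> hom (Hom C w x) f g" for \<alpha> f g
  using that assms wx.hom_Obj[OF that] homD(1)[OF that] Hc2_interchange[OF assms(1-3) assms(4) that] by simp
qed (use assms(4) in \<open>auto simp: prenat_def homD\<close>)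

lemma fun_extensional: "fo (postfun C w x y h) \<in> extensional (Obj (Hom C w x))"
 "fa (postfun C w x y h) \<in> extensional (Arr (Hom C w x))"
 "fo (prefun C v w x k) \<in> extensional (Obj (Hom C w x))"
 "fa (prefun C v w x k) \<in> extensional (Arr (Hom C w x))"
 by (auto simp: postfun_def prefun_def)

lemma postfun_comp:
 assumes "w \<in> Ob C" "x \<in> Ob C" "y \<in> Ob C" "z \<in> Ob C" "h \<in> Obj (Hom C x y)" "k \<in> Obj (Hom C y z)"
 shows "compF (Hom C w x) (postfun C w y z k) (postfun C w x y h) = postfun C w x z (Hc1 C x y z k h)"
 by (rule func_eqI'[of _ "Obj (Hom C w x)" _ "Arr (Hom C w x)"])
  (use assms in \<open>auto simp: fun_extensional Hc1_Obj Hc2_Arr Ide_Arr Hc1_assoc Hc2_assoc Hc2_Ide[symmetric]\<close>)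

lemma prefun_comp:
 assumes "u \<in> Ob C" "v \<in> Ob C" "w \<in> Ob C" "x \<in> Ob C" "h \<in> Obj (Hom C v w)" "k \<in> Obj (Hom C u v)"
 shows "compF (Hom C w x) (prefun C u v x k) (prefun C v w x h) = prefun C u w x (Hc1 C u v w h k)"
 by (rule func_eqI'[of _ "Obj (Hom C w x)" _ "Arr (Hom C w x)"])
  (use assms in \<open>auto simp: fun_extensional Hc1_Obj Hc2_Arr Ide_Arr Hc1_assoc Hc2_assoc Hc2_Ide[symmetric]\<close>)

text \<open>Strict associativity makes post- and precomposition commute on the nose. Because of this
  a cocone can be pushed along a 1-cell by whiskering its coherence cells, with no further cell to
  insert.\<close>

lemma postfun_prefun:
 assumes "v \<in> Ob C" "w \<in> Ob C" "x \<in> Ob C" "y \<in> Ob C" "h \<in> Obj (Hom C x y)" "k \<in> Obj (Hom C v w)"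
 shows "compF (Hom C w x) (postfun C v x y h) (prefun C v w x k)
  = compF (Hom C w x) (prefun C v w y k) (postfun C w x y h)"
 by (rule func_eqI'[of _ "Obj (Hom C w x)" _ "Arr (Hom C w x)"])
  (use assms in \<open>auto simp: Hc1_Obj Hc2_Arr Ide_Arr Hc1_assoc Hc2_assoc\<close>)

lemma postfun_One: "w \<in> Ob C ==> x \<in> Ob C ==> postfun C w x x (One C x) = id_func (Hom C w x)"
 by (rule func_eqI'[of _ "Obj (Hom C w x)" _ "Arr (Hom C w x)"])
  (auto simp: fun_extensional Hc1_One_left Hc2_One_left, auto simp: id_func_def)

lemma prefun_One: "w \<in> Ob C ==> x \<in> Ob C ==> prefun C w w x (One C w) = id_func (Hom C w x)"
 by (rule func_eqI'[of _ "Obj (Hom C w x)" _ "Arr (Hom C w x)"])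
  (auto simp: fun_extensional Hc1_One_right Hc2_One_right, auto simp: id_func_def)

lemma hom_from_simps [simp]:
 "P0 (hom_from C w) = Hom C w" "P1 (hom_from C w) = postfun C w" "P2 (hom_from C w) = postnat C w"
 "Pc (hom_from C w) x y z g f = idn (Hom C w x) (Hom C w z) (postfun C w x z (Hc1 C x y z g f))"
 "Pu (hom_from C w) x = idn (Hom C w x) (Hom C w x) (id_func (Hom C w x))"
 by (auto simp: hom_from_def)

lemma cat_valued_hom_from: assumes w: "w \<in> Ob C" shows "cat_valued C (hom_from C w)"
proof (rule cat_valued.intro)
 fix x y z f g assume f: "one_cell C x y f" and g: "one_cell C y z g"
 have "postfun C w x z (Hc1 C x y z g f) \<in> functors (Hom C w x) (Hom C w z)"
  using f g w by (auto simp: one_cell_def intro: postfun_functors Hc1_Obj)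
 then show "Pc (hom_from C w) x y z g f \<in> hom (fun_cat (P0 (hom_from C w) x) (P0 (hom_from C w) z))
   (compF (P0 (hom_from C w) x) (P1 (hom_from C w) y z g) (P1 (hom_from C w) x y f))
    (P1 (hom_from C w) x z (Hc1 C x y z g f))"
  using f g w by (simp add: one_cell_def postfun_comp idn_hom category_Hom)
next
 fix x assume x: "x \<in> Ob C"
 let ?A = "P0 (hom_from C w) x"
 show "Pu (hom_from C w) x \<in> hom (fun_cat ?A ?A) (id_func ?A)
   (P1 (hom_from C w) x x (One C x))"
  using x w by (simp add: postfun_One idn_hom category_Hom id_func_functors)
qed (use w in \<open>auto simp: one_cell_def category_Hom intro: postfun_functors postnat_hom\<close>)

end

section \<open>Recognising weighted bicolimits\<close>

text \<open>Cocones are studied over an arbitrary strict 2-category \<open>C\<close>; pseudo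
  algebras enter only when \<open>C\<close> is instantiated to \<open>Alg U T\<close>.\<close>

locale bicolimit_data = C: two_category C + D: two_category D + F: pseudo_functor D C F + J: cat_valued "op2 D" J
 for C :: "('o, 'f, 'a) twocat" and D :: "('d, 'g, 'b) twocat"
  and F :: "('d, 'g, 'b, 'o, 'f, 'a) pfun" and J :: "('d, 'g, 'b, 'p, 'e) catfun"
begin

abbreviation "HF d == Hom C (P0 F d)"
abbreviation "Hc2F d == Hc2 C (P0 F d)"
abbreviation "pre e d x f == prefun C (P0 F e) (P0 F d) x (P1 F e d f)"
abbreviation "ideF e d f == Ide (HF e (P0 F d)) (P1 F e d f)"
abbreviation "preJ d e f x \<tau> == compF (P0 J d) (pre e d x f) (t1 \<tau> d)"

lemma hom_into_simps [simp]:
 "P0 (hom_into C D F x) d = HF d x"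
 "P1 (hom_into C D F x) d e f = pre e d x f"
 "P2 (hom_into C D F x) d e \<theta> = prenat C (P0 F e) (P0 F d) x (P2 F e d \<theta>)"
 "Pc (hom_into C D F x) c d e g f = prenat C (P0 F e) (P0 F c) x (Pc F e d c f g)"
 "Pu (hom_into C D F x) d = prenat C (P0 F d) (P0 F d) x (Pu F d)"
 by (auto simp: hom_into_def)

lemma F1_Obj: "one_cell D x y f ==> P1 F x y f \<in> Obj (HF x (P0 F y))"
 by (auto simp: one_cell_def F.P1_Obj)

lemma cat_valued_hom_into: assumes x: "x \<in> Ob C" shows "cat_valued (op2 D) (hom_into C D F x)"
proof (rule cat_valued.intro; simp only: op2_simps hom_into_simps)
 show "category (HF d x)" if "d \<in> Ob D" for d using that x by (simp add: C.category_Hom F.P0_Ob)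
 show "pre e d x f \<in> functors (HF d x) (HF e x)"
  if "one_cell D e d f" for d e f
  using that x by (auto simp: one_cell_def F.P0_Ob F.P1_Obj intro!: C.prefun_functors)
 show "prenat C (P0 F e) (P0 F d) x (P2 F e d \<theta>) \<in> hom (fun_cat (HF d x) (HF e x))
   (pre e d x f) (pre e d x g)"
  if "d \<in> Ob D" "e \<in> Ob D" "\<theta> \<in> hom (Hom D e d) f g" for d e \<theta> f g
  using that x by (auto simp: F.P0_Ob F.P2_hom intro!: C.prenat_hom)
 show "prenat C (P0 F e) (P0 F c) x (Pc F e d c f g) \<in> hom (fun_cat (HF c x) (HF e x))
   (compF (HF c x) (pre e d x g) (pre d c x f))
   (prefun C (P0 F e) (P0 F c) x (P1 F e c (Hc1 D e d c f g)))"
  if "one_cell D d c f" "one_cell D e d g" for c d e f g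
  using that x by (auto simp: one_cell_def F.P0_Ob C.prefun_comp F.P1_Obj isos_hom[OF F.Pc_iso] intro!: C.prenat_hom)
 show "prenat C (P0 F d) (P0 F d) x (Pu F d) \<in> hom (fun_cat (HF d x) (HF d x))
   (id_func (HF d x)) (prefun C (P0 F d) (P0 F d) x (P1 F d d (One D d)))" if "d \<in> Ob D" for d
  using that x C.prenat_hom[OF F.P0_Ob F.P0_Ob x isos_hom[OF F.Pu_iso]] by (simp add: C.prefun_One F.P0_Ob)
qed

abbreviation K where "K x == hom_into C D F x"
abbreviation cones where "cones x == pseudo_nats (op2 D) J (K x)"
abbreviation push where "push x y h == push_pnat C D J F x y h"

lemma cat_valued_pair: "x \<in> Ob C ==> cat_valued_pair (op2 D) J (K x)"
 by (intro cat_valued_pair.intro two_category_op2 cat_valued_hom_into) unfold_locales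

context
 fixes x assumes x: "x \<in> Ob C"
begin

lemmas pnat_dataD = cat_valued_pair.pnat_dataD[OF cat_valued_pair[OF x] cat_valued_pair.pnats_data[OF cat_valued_pair[OF x]], unfolded op2_simps]
lemmas modif_homD = cat_valued_pair.modif_homD[OF cat_valued_pair[OF x], unfolded op2_simps]
lemmas modif_homI = cat_valued_pair.modif_homI[OF cat_valued_pair[OF x], unfolded op2_simps]
lemmas modif_eqI = cat_valued_pair.modif_eqI[OF cat_valued_pair[OF x], unfolded op2_simps]
lemmas pnat_eqI = cat_valued_pair.pnat_eqI[OF cat_valued_pair[OF x], unfolded op2_simps]
lemmas pseudo_natsD = cat_valued_pair.pseudo_natsD[OF cat_valued_pair[OF x], unfolded op2_simps hom_into_simps]
lemmas category_cones = cat_valued_pair.category_PsHom[OF cat_valued_pair[OF x]]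

end

lemma one_cellD: "one_cell D x y f ==> x \<in> Ob D" "one_cell D x y f ==> y \<in> Ob D"
 "one_cell D x y f ==> f \<in> Obj (Hom D x y)"
 by (auto simp: one_cell_def)

lemma cone_fo: "[|x \<in> Ob C; \<tau> \<in> cones x; d \<in> Ob D; j \<in> Obj (P0 J d)|] ==> fo (t1 \<tau> d) j \<in> Obj (HF d x)"
 using fun_fo[OF pnat_dataD(1)] by simp

lemma cone_fa: "[|x \<in> Ob C; \<tau> \<in> cones x; d \<in> Ob D; u \<in> hom (P0 J d) j j'|] ==>
  fa (t1 \<tau> d) u \<in> hom (HF d x) (fo (t1 \<tau> d) j) (fo (t1 \<tau> d) j')"
 using fun_fa[OF pnat_dataD(1)] by simp

lemma cone_t2: "[|x \<in> Ob C; \<tau> \<in> cones x; one_cell D e d f; j \<in> Obj (P0 J d)|] ==>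
  cmp (t2 \<tau> d e f) j \<in> isos (HF e x) (Hc1 C (P0 F e) (P0 F d) x (fo (t1 \<tau> d) j) (P1 F e d f))
   (fo (t1 \<tau> e) (fo (P1 J d e f) j))"
 using pnat_dataD(3)[of x \<tau> e d f j] cone_fo one_cellD by simp

lemma J1: "one_cell D e d f ==> j \<in> Obj (P0 J d) ==> fo (P1 J d e f) j \<in> Obj (P0 J e)"
 using fun_fo[OF J.P1_functors] by simp

lemma t1_push [simp]: "d \<in> Ob D ==> t1 (push x y h \<tau>) d = compF (P0 J d) (postfun C (P0 F d) x y h) (t1 \<tau> d)"
 by (simp add: push_pnat_def)

lemma fo_push: "[|x \<in> Ob C; \<tau> \<in> cones x; d \<in> Ob D; j \<in> Obj (P0 J d)|] ==>
  fo (t1 (push x y h \<tau>) d) j = Hc1 C (P0 F d) x y h (fo (t1 \<tau> d) j)"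
 by (simp add: cone_fo)

text \<open>Whiskering preserves invertibility. The source of the whiskered cell is brought into the
  required form by \<open>postfun_prefun\<close>, the target by associativity.\<close>

lemma push_t2_isos:
 assumes "x \<in> Ob C" "y \<in> Ob C" "h \<in> Obj (Hom C x y)" "\<tau> \<in> cones x" "one_cell D e d f"
 shows "t2 (push x y h \<tau>) d e f \<in> isos (fun_cat (P0 J d) (HF e y))
   (compF (P0 J d) (pre e d y f) (t1 (push x y h \<tau>) d))
   (compF (P0 J d) (t1 (push x y h \<tau>) e) (P1 J d e f))"
proof -
 note ob = one_cellD[OF assms(5)] and Fo = F.P0_Ob[OF one_cellD(1)[OF assms(5)]] F.P0_Ob[OF one_cellD(2)[OF assms(5)]]
 note t = pnat_dataD(1)[OF assms(1,4) ob(1)] pnat_dataD(1)[OF assms(1,4) ob(2)]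
 let ?A = "compF (P0 J d) (t1 \<tau> e) (P1 J d e f)" and ?C = "preJ d e f x \<tau>"
 have s: "t2 \<tau> d e f \<in> isos (fun_cat (P0 J d) (HF e x))
     ?C ?A"
  using cat_valued_pair.pnats_data[OF cat_valued_pair[OF assms(1)] assms(4)] assms(5)
  by (simp add: cat_valued_pair.pnat_data_def[OF cat_valued_pair[OF assms(1)]])
 let ?B = "postfun C (P0 F e) x y h" and ?D = "push x y h \<tau>"
 have "t2 ?D d e f \<in> isos (fun_cat (P0 J d) (HF e y))
   (compF (P0 J d) ?B ?C)
   (compF (P0 J d) ?B ?A)"
  using whisker_left_isos[OF _ C.category_Hom[OF Fo(1) assms(1)] C.category_Hom[OF Fo(1) assms(2)]
   C.postfun_functors[OF Fo(1) assms(1-3)] s] J.category_P0 ob assms(5) by (simp add: push_pnat_def)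
 also have "compF (P0 J d) ?B ?C
  = compF (P0 J d) (pre e d y f) (t1 ?D d)"
  using C.postfun_prefun[OF Fo(1,2) assms(1-3) F1_Obj[OF assms(5)]] ob t
  by (simp add: compF_assoc[of _ _ "HF d x", symmetric])
 also have "compF (P0 J d) ?B ?A
  = compF (P0 J d) (t1 ?D e) (P1 J d e f)"
  using compF_assoc[OF J.P1_functors[of d e f], symmetric] ob assms(5) by simp
 finally show ?thesis .
qed

lemma cmp_push_t2:
 assumes "x \<in> Ob C" "y \<in> Ob C" "h \<in> Obj (Hom C x y)" "\<tau> \<in> cones x" "one_cell D e d f" "j \<in> Obj (P0 J d)"
 shows "cmp (t2 (push x y h \<tau>) d e f) j = Hc2F e x y (Ide (Hom C x y) h) (cmp (t2 \<tau> d e f) j)"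
proof -
 note ob = one_cellD[OF assms(5)] and Fo = F.P0_Ob[OF one_cellD(1)[OF assms(5)]]
 have s: "t2 \<tau> d e f \<in> hom (fun_cat (P0 J d) (HF e x))
     (preJ d e f x \<tau>) (compF (P0 J d) (t1 \<tau> e) (P1 J d e f))"
  using pnat_dataD(2)[OF assms(1,4,5)] by simp
 show ?thesis
  using assms(5,6) isos_hom[OF cone_t2[OF assms(1,4,5,6)]]
  by (simp add: push_pnat_def homD cmp_whisker_left[OF C.category_Hom[OF Fo(1) assms(2)] C.postfun_functors[OF Fo(1) assms(1-3)] s]
   del: hcomp_simps(4))
qed

text \<open>Each of the three equations is the image of the one for \<open>\<tau>\<close> under
  composition with \<open>h\<close>: this operation preserves vertical composites, and by
  \<open>Hc2_assoc\<close> it commutes with whiskering on the other side.\<close>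

lemma push_cones:
 assumes x: "x \<in> Ob C" and y: "y \<in> Ob C" and h: "h \<in> Obj (Hom C x y)" and \<tau>: "\<tau> \<in> cones x"
 shows "push x y h \<tau> \<in> cones y"
proof (rule cat_valued_pair.pseudo_natsI[OF cat_valued_pair[OF y]], unfold op2_simps hom_into_simps, goal_cases)
 case 1
 show ?case
  unfolding cat_valued_pair.pnat_data_def[OF cat_valued_pair[OF y]]
 proof (intro conjI allI impI; (simp only: op2_simps hom_into_simps)?)
  show "t1 (push x y h \<tau>) \<in> (\<Pi>\<^sub>E d\<in>Ob D. functors (P0 J d) (HF d y))"
   using pnat_dataD(1)[OF x \<tau>] J.category_P0 C.postfun_functors[OF F.P0_Ob x y h]
   by (auto simp: PiE_def push_pnat_def intro!: compF_functors)
  show "t2 (push x y h \<tau>) d e f = undefined" if "\<not> one_cell D e d f" for d e f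
   using that by (simp add: push_pnat_def)
 qed (rule push_t2_isos[OF assms])
next
 case hyp: (2 d e \<theta> f g j)
 note de = hyp(1,2) and \<theta> = hyp(3) and f = hyp(4) and g = hyp(5) and j = hyp(6)
 let ?p = "fo (t1 \<tau> d) j"
 note Fo = F.P0_Ob[OF de(1)] F.P0_Ob[OF de(2)] and p = cone_fo[OF x \<tau> de(1) j]
 let ?E = "P2 J d e \<theta>"
 have J2: "cmp ?E j \<in> hom (P0 J e) (fo (P1 J d e f) j) (fo (P1 J d e g) j)"
  using nt_homD(6)[OF J.P2_nt j] de \<theta> by simp
 note t2f = isos_hom[OF cone_t2[OF x \<tau> f j]] and t2g = isos_hom[OF cone_t2[OF x \<tau> g j]]
 note tJ = cone_fa[OF x \<tau> de(2) J2]
 note P = C.Hc2_hom[OF Fo(2,1) x F.P2_hom[OF de(2,1) \<theta>] C.Ide_Hom[OF Fo(1) x p]]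
 let ?C = "push x y h \<tau>"
 have "fa (t1 ?C e) (cmp ?E j) \<cdot>[HF e y] cmp (t2 ?C d e f) j
  = Hc2F e x y (Ide (Hom C x y) h) (fa (t1 \<tau> e) (cmp ?E j) \<cdot>[HF e x] cmp (t2 \<tau> d e f) j)"
  using de homD(1)[OF J2] homD(1)[OF tJ] C.Hc2_Cmp_right[OF Fo(2) x y h t2f tJ] by (simp add: cmp_push_t2[OF assms f j])
 also have "fa (t1 \<tau> e) (cmp ?E j) \<cdot>[HF e x] cmp (t2 \<tau> d e f) j
  = cmp (t2 \<tau> d e g) j \<cdot>[HF e x] Hc2F e (P0 F d) x (Ide (HF d x) ?p) (P2 F e d \<theta>)"
  using pseudo_natsD(2)[OF x \<tau> de \<theta> j] p by simp
 also have "Hc2F e x y (Ide (Hom C x y) h) \<dots> =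
  cmp (t2 ?C d e g) j \<cdot>[HF e y] cmp (prenat C (P0 F e) (P0 F d) y (P2 F e d \<theta>)) (fo (t1 ?C d) j)"
  using p h x y Fo de j F.P2_hom[OF de(2,1) \<theta>]
  by (simp add: C.Hc2_Cmp_right[OF Fo(2) x y h P t2g] cmp_push_t2[OF assms g j] C.Hc1_Obj C.Hc2_assoc C.Hc2_Ide C.Ide_Arr homD)
 finally show ?case .
next
 case hyp: (3 c d e f g j)
 note f = hyp(1) and g = hyp(2) and j = hyp(3)
 note ob = one_cellD[OF f] one_cellD[OF g]
 let ?p = "fo (t1 \<tau> c) j"
 note Fo = F.P0_Ob[OF ob(2)] F.P0_Ob[OF ob(1)] F.P0_Ob[OF ob(4)] and p = cone_fo[OF x \<tau> ob(2) j]
 have gf: "one_cell D e c (Hc1 D e d c f g)" using f g by (simp add: D.one_cell_Hc1)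
 note jf = J1[OF f j]
 let ?A = "fo (P1 J c d f) j"
 have Jc: "cmp (Pc J c d e g f) j \<in> hom (P0 J e) (fo (P1 J d e g) ?A) (fo (P1 J c e (Hc1 D e d c f g)) j)"
  using nt_homD(6)[OF J.Pc_nt j, of d f e g] f g j by simp
 note tf = isos_hom[OF cone_t2[OF x \<tau> f j]] and tg = isos_hom[OF cone_t2[OF x \<tau> g jf]] and tgf = isos_hom[OF cone_t2[OF x \<tau> gf j]]
 note tJ = cone_fa[OF x \<tau> ob(4) Jc]
 let ?B = "Hc1 C (P0 F e) (P0 F d) (P0 F c) (P1 F d c f) (P1 F e d g)"
 have Fc: "Pc F e d c f g \<in> hom (HF e (P0 F c)) ?B
   (P1 F e c (Hc1 D e d c f g))"
  using isos_hom[OF F.Pc_iso] ob by blast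
 note P = C.Hc2_hom[OF Fo(3,1) x Fc C.Ide_Hom[OF Fo(1) x p]]
 let ?G = "cmp (t2 \<tau> c d f) j"
 have tfg: "Hc2F e (P0 F d) x ?G (ideF e d g) \<in>
  hom (HF e x) (Hc1 C (P0 F e) (P0 F c) x ?p ?B)
   (Hc1 C (P0 F e) (P0 F d) x (fo (t1 \<tau> d) ?A) (P1 F e d g))"
  using C.Hc2_hom[OF Fo(3,2) x C.Ide_Hom[OF Fo(3,2) F1_Obj[OF g]] tf] C.Hc1_assoc[OF Fo(3,2,1) x F1_Obj[OF g] F1_Obj[OF f] p]
  by simp
 note tgfg = category.Cmp_hom[OF C.category_Hom[OF Fo(3) x] tfg tg]
 let ?D = "push x y h \<tau>" and ?H = "cmp (Pc J c d e g f) j"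
 have "fa (t1 ?D e) ?H \<cdot>[HF e y]
   (cmp (t2 ?D d e g) ?A \<cdot>[HF e y]
    fa (pre e d y g) (cmp (t2 ?D c d f) j))
  = Hc2F e x y (Ide (Hom C x y) h) (fa (t1 \<tau> e) ?H \<cdot>[HF e x]
   (cmp (t2 \<tau> d e g) ?A \<cdot>[HF e x]
    Hc2F e (P0 F d) x ?G (ideF e d g)))"
  using ob Fo x y h homD(1)[OF Jc] homD(1)[OF tJ] homD(1)[OF tf] F1_Obj[OF g]
  by (simp add: cmp_push_t2[OF assms f j] cmp_push_t2[OF assms g jf] C.Hc2_Cmp_right[OF Fo(3) x y h tgfg tJ]
   C.Hc2_Cmp_right[OF Fo(3) x y h tfg tg] C.Hc2_Arr C.Ide_Arr C.Hc2_assoc)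
 also have "fa (t1 \<tau> e) ?H \<cdot>[HF e x]
   (cmp (t2 \<tau> d e g) ?A \<cdot>[HF e x]
    Hc2F e (P0 F d) x ?G (ideF e d g))
  = cmp (t2 \<tau> c e (Hc1 D e d c f g)) j \<cdot>[HF e x]
   Hc2F e (P0 F c) x (Ide (HF c x) ?p) (Pc F e d c f g)"
  using pseudo_natsD(3)[OF x \<tau> f g j] p homD(1)[OF tf] by simp
 also have "Hc2F e x y (Ide (Hom C x y) h) \<dots> = cmp (t2 ?D c e (Hc1 D e d c f g)) j \<cdot>[HF e y]
  cmp (prenat C (P0 F e) (P0 F c) y (Pc F e d c f g)) (fo (t1 ?D c) j)"
  using p h x y Fo ob j homD(1)[OF Fc]
  by (simp add: C.Hc2_Cmp_right[OF Fo(3) x y h P tgf] cmp_push_t2[OF assms gf j] C.Hc1_Obj C.Hc2_assoc C.Hc2_Ide C.Ide_Arr)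
 finally show ?case .
next
 case hyp: (4 d j)
 note d = hyp(1) and j = hyp(2)
 let ?p = "fo (t1 \<tau> d) j"
 note Fo = F.P0_Ob[OF d] and p = cone_fo[OF x \<tau> d j] and o1 = D.one_cell_One[OF d]
 have Jj: "cmp (Pu J d) j \<in> hom (P0 J d) j (fo (P1 J d d (One D d)) j)"
  using nt_homD(6)[OF J.Pu_nt j] d j by simp
 note Fu = isos_hom[OF F.Pu_iso[OF d]]
 note P = C.Hc2_hom[OF Fo Fo x Fu C.Ide_Hom[OF Fo x p]]
 let ?K = "push x y h \<tau>"
 have "fa (t1 ?K d) (cmp (Pu J d) j) = Hc2F d x y (Ide (Hom C x y) h) (fa (t1 \<tau> d) (cmp (Pu J d) j))"
  using d homD(1)[OF Jj] homD(1)[OF cone_fa[OF x \<tau> d Jj]] by simp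
 also have "fa (t1 \<tau> d) (cmp (Pu J d) j) = cmp (t2 \<tau> d d (One D d)) j \<cdot>[HF d x]
   Hc2F d (P0 F d) x (Ide (HF d x) ?p) (Pu F d)"
  using pseudo_natsD(4)[OF x \<tau> d j] p by simp
 also have "Hc2F d x y (Ide (Hom C x y) h) \<dots> = cmp (t2 ?K d d (One D d)) j \<cdot>[HF d y]
   cmp (prenat C (P0 F d) (P0 F d) y (Pu F d)) (fo (t1 ?K d) j)"
  using p h x y Fo d j homD(1)[OF Fu] C.Hc2_Cmp_right[OF Fo x y h P isos_hom[OF cone_t2[OF x \<tau> o1 j]]]
  by (simp add: cmp_push_t2[OF assms o1 j] C.Hc1_Obj C.Hc2_assoc C.Hc2_Ide C.Ide_Arr)
 finally show ?case ..
qed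

end

section \<open>Cocones as a strict 2-functor of the vertex, and the transformation induced by one
  cocone\<close>

context bicolimit_data
begin

abbreviation ccat where "ccat x == cocones0 C D J F x"
abbreviation K1 where "K1 x y h == cocones1 C D J F x y h"
abbreviation K2 where "K2 x y \<theta> == cocones2 C D J F x y \<theta>"

lemma ccat_simps [simp]:
 "Obj (ccat x) = cones x" "Arr (ccat x) = modifications (op2 D) J (K x)"
 by (auto simp: cocones0_def PsHom_def)

lemma ccat_def: "ccat x = PsHom (op2 D) J (K x)"
 by (simp add: cocones0_def)

lemma category_cc: "x \<in> Ob C ==> category (ccat x)"
 unfolding ccat_def by (rule category_cones)

lemma modif_cmp:
 "[|x \<in> Ob C; m \<in> hom (ccat x) \<tau> \<sigma>; d \<in> Ob D; j \<in> Obj (P0 J d)|] ==>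
  cmp (cmp m d) j \<in> hom (HF d x) (fo (t1 \<tau> d) j) (fo (t1 \<sigma> d) j)"
 using nt_homD(6)[OF modif_homD(6)] unfolding ccat_def by simp

lemma cmp_Cmp_cone: "[|d \<in> Ob D; j \<in> Obj (P0 J d)|] ==>
  cmp (cmp (n \<cdot>[ccat x] m) d) j = cmp (cmp n d) j \<cdot>[HF d x] cmp (cmp m d) j"
 and cmp_Ide_cone: "[|d \<in> Ob D; j \<in> Obj (P0 J d)|] ==>
  cmp (cmp (Ide (ccat x) \<tau>) d) j = Ide (HF d x) (fo (t1 \<tau> d) j)"
 by (auto simp: ccat_def PsHom_def)

lemma cone_eqI:
 assumes "x \<in> Ob C" "m \<in> hom (ccat x) \<tau> \<sigma>" "n \<in> hom (ccat x) \<tau> \<sigma>"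
  and "\<And>d j. d \<in> Ob D ==> j \<in> Obj (P0 J d) ==> cmp (cmp m d) j = cmp (cmp n d) j"
 shows "m = n"
 using modif_eqI[OF assms(1) assms(2)[unfolded ccat_def] assms(3)[unfolded ccat_def]] assms(4) by blast

lemma fa_K1_eq: "m \<in> hom (ccat x) \<tau> \<sigma> ==> fa (K1 x y h) m = \<lparr>src = push x y h \<tau>, tgt = push x y h \<sigma>,
    cmp = (\<lambda>d\<in>Ob D. hcomp (P0 J d) (HF d y)
     (idn (HF d x) (HF d y) (postfun C (P0 F d) x y h)) (cmp m d))\<rparr>"
 by (auto simp: cocones1_def hom_def cocones0_def PsHom_def)

lemma cmp_K1:
 assumes "x \<in> Ob C" "y \<in> Ob C" "h \<in> Obj (Hom C x y)" "m \<in> hom (ccat x) \<tau> \<sigma>" "d \<in> Ob D" "j \<in> Obj (P0 J d)"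
 shows "cmp (cmp (fa (K1 x y h) m) d) j = Hc2F d x y (Ide (Hom C x y) h) (cmp (cmp m d) j)"
proof -
 note Fo = F.P0_Ob[OF assms(5)]
 note md = modif_homD(6)[OF assms(1) assms(4)[unfolded ccat_def] assms(5), unfolded hom_into_simps]
 show ?thesis
  using assms(5,6) homD(1)[OF modif_cmp[OF assms(1,4,5,6)]]
  by (simp add: fa_K1_eq[OF assms(4)] cmp_whisker_left[OF C.category_Hom[OF Fo assms(2)] C.postfun_functors[OF Fo assms(1-3)] md]
   del: hcomp_simps(4))
qed

lemma fa_K1_hom:
 assumes x: "x \<in> Ob C" and y: "y \<in> Ob C" and h: "h \<in> Obj (Hom C x y)" and m: "m \<in> hom (ccat x) \<tau> \<sigma>"
 shows "fa (K1 x y h) m \<in> hom (ccat y) (push x y h \<tau>) (push x y h \<sigma>)"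
 unfolding ccat_def
proof (rule modif_homI[OF y]; (simp only: hom_into_simps)?)
 note mm = m[unfolded ccat_def]
 note \<tau> = modif_homD(1)[OF x mm] and \<sigma> = modif_homD(2)[OF x mm]
 show "push x y h \<tau> \<in> cones y" "push x y h \<sigma> \<in> cones y" using push_cones[OF x y h] \<tau> \<sigma> by auto
 show "cmp (fa (K1 x y h) m) d \<in> hom (fun_cat (P0 J d) (HF d y)) (t1 (push x y h \<tau>) d) (t1 (push x y h \<sigma>) d)"
  if d: "d \<in> Ob D" for d
  using d hcomp_hom[OF _ C.category_Hom[OF F.P0_Ob[OF d] y] modif_homD(6)[OF x mm d, unfolded hom_into_simps]
   idn_hom[OF C.category_Hom[OF F.P0_Ob[OF d] x] C.category_Hom[OF F.P0_Ob[OF d] y] C.postfun_functors[OF F.P0_Ob[OF d] x y h]]]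
   J.category_P0 by (simp add: fa_K1_eq[OF m])
 fix d e f j assume f: "one_cell D e d f" and j: "j \<in> Obj (P0 J d)"
 note ob = one_cellD[OF f] and Fo = F.P0_Ob[OF one_cellD(1)[OF f]] F.P0_Ob[OF one_cellD(2)[OF f]]
 note mj = modif_cmp[OF x m ob(2) j] and mfj = modif_cmp[OF x m ob(1) J1[OF f j]]
 note tf = isos_hom[OF cone_t2[OF x \<tau> f j]] isos_hom[OF cone_t2[OF x \<sigma> f j]]
 note mm1 = C.Hc2_hom[OF Fo x C.Ide_Hom[OF Fo F1_Obj[OF f]] mj]
 have e: "cmp (t2 \<sigma> d e f) j \<cdot>[HF e x] Hc2F e (P0 F d) x (cmp (cmp m d) j) (ideF e d f)
   = cmp (cmp m e) (fo (P1 J d e f) j) \<cdot>[HF e x] cmp (t2 \<tau> d e f) j"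
  using modif_homD(7)[OF x mm f j] homD(1)[OF mj] by simp
 show "cmp (t2 (push x y h \<sigma>) d e f) j \<cdot>[HF e y] fa (pre e d y f) (cmp (cmp (fa (K1 x y h) m) d) j)
  = cmp (cmp (fa (K1 x y h) m) e) (fo (P1 J d e f) j) \<cdot>[HF e y] cmp (t2 (push x y h \<tau>) d e f) j"
  using e[THEN arg_cong, of "Hc2F e x y (Ide (Hom C x y) h)"] homD(1)[OF mj] Fo x y h F1_Obj[OF f]
  by (simp add: cmp_K1[OF x y h m ob(2) j] cmp_K1[OF x y h m ob(1) J1[OF f j]] cmp_push_t2[OF x y h \<tau> f j] cmp_push_t2[OF x y h \<sigma> f j]
   C.Hc2_Cmp_right[OF Fo(1) x y h mm1 tf(2)] C.Hc2_Cmp_right[OF Fo(1) x y h tf(1) mfj] C.Hc2_assoc C.Hc2_Arr C.Ide_Arr)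
qed (auto simp: fa_K1_eq[OF m])

lemma fo_K1 [simp]: "\<tau> \<in> cones x ==> fo (K1 x y h) \<tau> = push x y h \<tau>"
 by (simp add: cocones1_def)

lemma K1_functors:
 assumes x: "x \<in> Ob C" and y: "y \<in> Ob C" and h: "h \<in> Obj (Hom C x y)"
 shows "K1 x y h \<in> functors (ccat x) (ccat y)"
proof (rule functorsI)
 interpret X: category "ccat x" by (rule category_cc[OF x])
 interpret Y: category "ccat y" by (rule category_cc[OF y])
 show "fa (K1 x y h) m \<in> hom (ccat y) (fo (K1 x y h) \<tau>) (fo (K1 x y h) \<sigma>)" if "m \<in> hom (ccat x) \<tau> \<sigma>" for m \<tau> \<sigma>
  using fa_K1_hom[OF assms that] X.hom_Obj[OF that] by simp
 show "fa (K1 x y h) (Ide (ccat x) \<tau>) = Ide (ccat y) (fo (K1 x y h) \<tau>)" if \<tau>: "\<tau> \<in> Obj (ccat x)" for \<tau>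
 proof (rule cone_eqI[OF y fa_K1_hom[OF assms X.Ide_hom[OF \<tau>]]])
  show "Ide (ccat y) (fo (K1 x y h) \<tau>) \<in> hom (ccat y) (push x y h \<tau>) (push x y h \<tau>)"
   using \<tau> by (auto intro!: Y.Ide_hom push_cones[OF assms])
  show "cmp (cmp (fa (K1 x y h) (Ide (ccat x) \<tau>)) d) j = cmp (cmp (Ide (ccat y) (fo (K1 x y h) \<tau>)) d) j"
   if "d \<in> Ob D" "j \<in> Obj (P0 J d)" for d j
   using that \<tau> x y h cone_fo[OF x _ that]
   by (simp add: cmp_K1[OF assms X.Ide_hom[OF \<tau>] that] cmp_Ide_cone[OF that] C.Hc2_Ide F.P0_Ob)
 qed
 show "fa (K1 x y h) (n \<cdot>[ccat x] m) = fa (K1 x y h) n \<cdot>[ccat y] fa (K1 x y h) m"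
  if m: "m \<in> hom (ccat x) \<tau> \<sigma>" and n: "n \<in> hom (ccat x) \<sigma> \<rho>" for m n \<tau> \<sigma> \<rho>
 proof (rule cone_eqI[OF y fa_K1_hom[OF assms X.Cmp_hom[OF m n]] Y.Cmp_hom[OF fa_K1_hom[OF assms m] fa_K1_hom[OF assms n]]])
  show "cmp (cmp (fa (K1 x y h) (n \<cdot>[ccat x] m)) d) j = cmp (cmp (fa (K1 x y h) n \<cdot>[ccat y] fa (K1 x y h) m) d) j"
   if dj: "d \<in> Ob D" "j \<in> Obj (P0 J d)" for d j
   using C.Hc2_Cmp_right[OF F.P0_Ob[OF dj(1)] assms modif_cmp[OF x m dj] modif_cmp[OF x n dj]]
   by (simp add: cmp_K1[OF assms X.Cmp_hom[OF m n] dj] cmp_Cmp_cone[OF dj] cmp_K1[OF assms m dj] cmp_K1[OF assms n dj])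
 qed
qed (auto simp: cocones1_def push_cones[OF assms, unfolded cocones1_def])

lemma cmp_K2_eq: "\<tau> \<in> cones x ==> \<theta> \<in> hom (Hom C x y) h k ==> cmp (K2 x y \<theta>) \<tau> = \<lparr>src = push x y h \<tau>, tgt = push x y k \<tau>,
    cmp = (\<lambda>d\<in>Ob D. hcomp (P0 J d) (HF d y) (postnat C (P0 F d) x y \<theta>)
     (idn (P0 J d) (HF d x) (t1 \<tau> d)))\<rparr>"
 by (auto simp: cocones2_def hom_def)

lemma cmp_K2:
 assumes "x \<in> Ob C" "y \<in> Ob C" "\<theta> \<in> hom (Hom C x y) h k" "\<tau> \<in> cones x" "d \<in> Ob D" "j \<in> Obj (P0 J d)"
 shows "cmp (cmp (cmp (K2 x y \<theta>) \<tau>) d) j = Hc2F d x y \<theta> (Ide (HF d x) (fo (t1 \<tau> d) j))"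
proof -
 note Fo = F.P0_Ob[OF assms(5)]
 show ?thesis
  using assms(5,6) cone_fo[OF assms(1,4,5,6)]
  by (simp add: cmp_K2_eq[OF assms(4,3)] cmp_whisker_right[OF C.category_Hom[OF Fo assms(2)] pnat_dataD(1)[OF assms(1,4,5), simplified]
   C.postnat_hom[OF Fo assms(1-3)]] del: hcomp_simps(4))
qed

lemma cmp_K2_hom:
 assumes x: "x \<in> Ob C" and y: "y \<in> Ob C" and \<theta>: "\<theta> \<in> hom (Hom C x y) h k" and \<tau>: "\<tau> \<in> cones x"
 shows "cmp (K2 x y \<theta>) \<tau> \<in> hom (ccat y) (push x y h \<tau>) (push x y k \<tau>)"
 unfolding ccat_def
proof (rule modif_homI[OF y]; (simp only: hom_into_simps)?)
 note hk = category.hom_Obj[OF C.category_Hom[OF x y] \<theta>]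
 show "push x y h \<tau> \<in> cones y" "push x y k \<tau> \<in> cones y" using push_cones[OF x y _ \<tau>] hk by auto
 let ?A = "cmp (K2 x y \<theta>) \<tau>"
 show "cmp ?A d \<in> hom (fun_cat (P0 J d) (HF d y)) (t1 (push x y h \<tau>) d) (t1 (push x y k \<tau>) d)"
  if d: "d \<in> Ob D" for d
  using d hcomp_hom[OF _ C.category_Hom[OF F.P0_Ob[OF d] y] idn_hom[OF _ C.category_Hom[OF F.P0_Ob[OF d] x]]
    C.postnat_hom[OF F.P0_Ob[OF d] x y \<theta>], of "P0 J d" "t1 \<tau> d"] pnat_dataD(1)[OF x \<tau> d]
   J.category_P0 by (simp add: cmp_K2_eq[OF \<tau> \<theta>])
 fix d e f j assume f: "one_cell D e d f" and j: "j \<in> Obj (P0 J d)"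
 note ob = one_cellD[OF f] and Fo = F.P0_Ob[OF one_cellD(1)[OF f]] F.P0_Ob[OF one_cellD(2)[OF f]]
 note tf = isos_hom[OF cone_t2[OF x \<tau> f j]] and p = cone_fo[OF x \<tau> ob(2) j]
 note P = C.Hc2_hom[OF Fo(2) x y C.Ide_Hom[OF Fo(2) x p] \<theta>]
 have "Hc2F e (P0 F d) y (Hc2F d x y \<theta> (Ide (HF d x) (fo (t1 \<tau> d) j))) (ideF e d f)
  = Hc2F e x y \<theta> (Ide (HF e x) (Hc1 C (P0 F e) (P0 F d) x (fo (t1 \<tau> d) j) (P1 F e d f)))"
  using C.Hc2_assoc[OF Fo x y C.Ide_Arr[OF Fo F1_Obj[OF f]] C.Ide_Arr[OF Fo(2) x p] homD(1)[OF \<theta>]]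
   C.Hc2_Ide[OF Fo x F1_Obj[OF f] p] by simp
 then show "cmp (t2 (push x y k \<tau>) d e f) j \<cdot>[HF e y] fa (pre e d y f) (cmp (cmp ?A d) j)
  = cmp (cmp ?A e) (fo (P1 J d e f) j) \<cdot>[HF e y] cmp (t2 (push x y h \<tau>) d e f) j"
  using C.Hc2_interchange[OF Fo(1) x y tf \<theta>] homD(1)[OF P]
  by (simp add: cmp_K2[OF x y \<theta> \<tau> ob(2) j] cmp_K2[OF x y \<theta> \<tau> ob(1) J1[OF f j]] cmp_push_t2[OF x y hk(1) \<tau> f j] cmp_push_t2[OF x y hk(2) \<tau> f j])
qed (auto simp: cmp_K2_eq[OF \<tau> \<theta>])

text \<open>Naturality in the cocone is \<open>Hc2_interchange\<close>: a modification may be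
  applied before or after the 2-cell \<open>\<theta>\<close>.\<close>

lemma K2_hom:
 assumes x: "x \<in> Ob C" and y: "y \<in> Ob C" and \<theta>: "\<theta> \<in> hom (Hom C x y) h k"
 shows "K2 x y \<theta> \<in> hom (fun_cat (ccat x) (ccat y)) (K1 x y h) (K1 x y k)"
proof (rule nt_homI)
 interpret X: category "ccat x" by (rule category_cc[OF x])
 interpret Y: category "ccat y" by (rule category_cc[OF y])
 note hk = category.hom_Obj[OF C.category_Hom[OF x y] \<theta>]
 show "K1 x y h \<in> functors (ccat x) (ccat y)" "K1 x y k \<in> functors (ccat x) (ccat y)"
  using K1_functors x y hk by auto
 show "cmp (K2 x y \<theta>) \<tau> \<in> hom (ccat y) (fo (K1 x y h) \<tau>) (fo (K1 x y k) \<tau>)" if "\<tau> \<in> Obj (ccat x)" for \<tau>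
  using that cmp_K2_hom[OF assms] by simp
 fix m \<tau> \<sigma> assume m: "m \<in> hom (ccat x) \<tau> \<sigma>"
 have \<tau>: "\<tau> \<in> cones x" and \<sigma>: "\<sigma> \<in> cones x" using X.hom_Obj[OF m] by auto
 show "cmp (K2 x y \<theta>) \<sigma> \<cdot>[ccat y] fa (K1 x y h) m = fa (K1 x y k) m \<cdot>[ccat y] cmp (K2 x y \<theta>) \<tau>"
 proof (rule cone_eqI[OF y Y.Cmp_hom[OF fa_K1_hom[OF x y hk(1) m] cmp_K2_hom[OF x y \<theta> \<sigma>]]
    Y.Cmp_hom[OF cmp_K2_hom[OF x y \<theta> \<tau>] fa_K1_hom[OF x y hk(2) m]]])
  show "cmp (cmp (cmp (K2 x y \<theta>) \<sigma> \<cdot>[ccat y] fa (K1 x y h) m) d) j =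
    cmp (cmp (fa (K1 x y k) m \<cdot>[ccat y] cmp (K2 x y \<theta>) \<tau>) d) j" if dj: "d \<in> Ob D" "j \<in> Obj (P0 J d)" for d j
   using C.Hc2_interchange[OF F.P0_Ob[OF dj(1)] x y modif_cmp[OF x m dj] \<theta>]
   by (simp add: cmp_Cmp_cone[OF dj] cmp_K1[OF x y hk(1) m dj] cmp_K1[OF x y hk(2) m dj] cmp_K2[OF x y \<theta> \<tau> dj] cmp_K2[OF x y \<theta> \<sigma> dj])
 qed
qed (use \<theta> in \<open>auto simp: cocones2_def homD\<close>)

text \<open>Holds strictly because composition in \<open>C\<close> is strictly associative. It makes
  cocones a strict 2-functor, as the identity coherence cells in \<open>cocones\<close>
  require.\<close>

lemma push_push:
 assumes x: "x \<in> Ob C" and y: "y \<in> Ob C" and z: "z \<in> Ob C" and h: "h \<in> Obj (Hom C x y)" and k: "k \<in> Obj (Hom C y z)"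
  and \<tau>: "\<tau> \<in> cones x"
 shows "push y z k (push x y h \<tau>) = push x z (Hc1 C x y z k h) \<tau>"
proof -
 note kh = C.Hc1_Obj[OF x y z h k] and p = push_cones[OF x y h \<tau>]
 show ?thesis
 proof (rule pnat_eqI[OF z push_cones[OF y z k p] push_cones[OF x z kh \<tau>]])
  show "t1 (push y z k (push x y h \<tau>)) d = t1 (push x z (Hc1 C x y z k h) \<tau>) d" if d: "d \<in> Ob D" for d
   using d pnat_dataD(1)[OF x \<tau> d] C.postfun_comp[OF F.P0_Ob[OF d] x y z h k]
    compF_assoc[of "t1 \<tau> d" "P0 J d" "HF d x" "postfun C (P0 F d) y z k" "postfun C (P0 F d) x y h"]
   by simp
  fix d e f j assume f: "one_cell D e d f" and j: "j \<in> Obj (P0 J d)"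
  note Fo = F.P0_Ob[OF one_cellD(1)[OF f]]
  show "cmp (t2 (push y z k (push x y h \<tau>)) d e f) j = cmp (t2 (push x z (Hc1 C x y z k h) \<tau>) d e f) j"
   using isos_hom[OF cone_t2[OF x \<tau> f j], THEN homD(1)] Fo x y z h k
   by (simp add: cmp_push_t2[OF y z k p f j] cmp_push_t2[OF x y h \<tau> f j] cmp_push_t2[OF x z kh \<tau> f j]
    C.Hc2_assoc C.Ide_Arr C.Hc2_Ide)
 qed
qed

lemma push_One:
 assumes x: "x \<in> Ob C" and \<tau>: "\<tau> \<in> cones x"
 shows "push x x (One C x) \<tau> = \<tau>"
proof (rule pnat_eqI[OF x push_cones[OF x x C.One_Obj[OF x] \<tau>] \<tau>])
 show "t1 (push x x (One C x) \<tau>) d = t1 \<tau> d" if d: "d \<in> Ob D" for d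
  using d pnat_dataD(1)[OF x \<tau> d] C.postfun_One[OF F.P0_Ob[OF d] x] by (simp add: compF_id_left)
 fix d e f j assume f: "one_cell D e d f" and j: "j \<in> Obj (P0 J d)"
 show "cmp (t2 (push x x (One C x) \<tau>) d e f) j = cmp (t2 \<tau> d e f) j"
  using isos_hom[OF cone_t2[OF x \<tau> f j], THEN homD(1)] F.P0_Ob[OF one_cellD(1)[OF f]] x
  by (simp add: cmp_push_t2[OF x x C.One_Obj[OF x] \<tau> f j] C.Hc2_One_left)
qed

lemma K1_comp:
 assumes x: "x \<in> Ob C" and y: "y \<in> Ob C" and z: "z \<in> Ob C" and h: "h \<in> Obj (Hom C x y)" and k: "k \<in> Obj (Hom C y z)"
 shows "compF (ccat x) (K1 y z k) (K1 x y h) = K1 x z (Hc1 C x y z k h)"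
proof (rule func_eqI[OF compF_functors[OF category_cc[OF x] K1_functors[OF x y h] K1_functors[OF y z k]]
   K1_functors[OF x z C.Hc1_Obj[OF x y z h k]]])
 let ?A = "K1 x z (Hc1 C x y z k h)" and ?B = "compF (ccat x) (K1 y z k) (K1 x y h)"
 show "fo ?B \<tau> = fo ?A \<tau>" if "\<tau> \<in> Obj (ccat x)" for \<tau>
  using that push_push[OF assms] push_cones[OF x y h] by simp
 fix m assume "m \<in> Arr (ccat x)"
 then obtain \<tau> \<sigma> where m: "m \<in> hom (ccat x) \<tau> \<sigma>" by (auto simp: hom_def)
 have \<tau>: "\<tau> \<in> cones x" and \<sigma>: "\<sigma> \<in> cones x" using category.hom_Obj[OF category_cc[OF x] m] by auto
 note kh = C.Hc1_Obj[OF x y z h k]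
 have "fa (K1 y z k) (fa (K1 x y h) m) = fa ?A m"
 proof (rule cone_eqI[OF z fa_K1_hom[OF y z k fa_K1_hom[OF x y h m]]])
  show "fa ?A m \<in> hom (ccat z) (push y z k (push x y h \<tau>)) (push y z k (push x y h \<sigma>))"
   using fa_K1_hom[OF x z kh m] push_push[OF assms \<tau>] push_push[OF assms \<sigma>] by simp
  show "cmp (cmp (fa (K1 y z k) (fa (K1 x y h) m)) d) j = cmp (cmp (fa ?A m) d) j"
   if dj: "d \<in> Ob D" "j \<in> Obj (P0 J d)" for d j
   using F.P0_Ob[OF dj(1)] x y z h k homD(1)[OF modif_cmp[OF x m dj]]
   by (simp add: cmp_K1[OF y z k fa_K1_hom[OF x y h m] dj] cmp_K1[OF x y h m dj] cmp_K1[OF x z kh m dj]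
    C.Hc2_assoc C.Ide_Arr C.Hc2_Ide)
 qed
 then show "fa ?B m = fa ?A m"
  using homD(1)[OF m] by simp
qed

lemma K1_One:
 assumes x: "x \<in> Ob C" shows "K1 x x (One C x) = id_func (ccat x)"
proof (rule func_eqI[OF K1_functors[OF x x C.One_Obj[OF x]] id_func_functors[OF category_cc[OF x]]])
 let ?A = "K1 x x (One C x)"
 show "fo ?A \<tau> = fo (id_func (ccat x)) \<tau>" if "\<tau> \<in> Obj (ccat x)" for \<tau>
  using that push_One[OF x] by simp
 fix m assume mA: "m \<in> Arr (ccat x)"
 then obtain \<tau> \<sigma> where m: "m \<in> hom (ccat x) \<tau> \<sigma>" by (auto simp: hom_def)
 have \<tau>: "\<tau> \<in> cones x" and \<sigma>: "\<sigma> \<in> cones x" using category.hom_Obj[OF category_cc[OF x] m] by auto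
 have "fa ?A m = m"
 proof (rule cone_eqI[OF x fa_K1_hom[OF x x C.One_Obj[OF x] m]])
  show "m \<in> hom (ccat x) (push x x (One C x) \<tau>) (push x x (One C x) \<sigma>)"
   using m push_One[OF x \<tau>] push_One[OF x \<sigma>] by simp
  show "cmp (cmp (fa ?A m) d) j = cmp (cmp m d) j" if dj: "d \<in> Ob D" "j \<in> Obj (P0 J d)" for d j
   using F.P0_Ob[OF dj(1)] x homD(1)[OF modif_cmp[OF x m dj]]
   by (simp add: cmp_K1[OF x x C.One_Obj[OF x] m dj] C.Hc2_One_left)
 qed
 then show "fa ?A m = fa (id_func (ccat x)) m" using mA by simp
qed

lemma cocones_simps [simp]:
 "P0 (cocones C D J F) = cocones0 C D J F" "P1 (cocones C D J F) = cocones1 C D J F" "P2 (cocones C D J F) = cocones2 C D J F"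
 "Pc (cocones C D J F) x y z g f = idn (ccat x) (ccat z) (K1 x z (Hc1 C x y z g f))"
 "Pu (cocones C D J F) x = idn (ccat x) (ccat x) (id_func (ccat x))"
 by (auto simp: cocones_def)

lemma cat_valued_cocones: "cat_valued C (cocones C D J F)"
proof (rule cat_valued.intro; simp only: cocones_simps)
 fix x y z f g assume f: "one_cell C x y f" and g: "one_cell C y z g"
 show "idn (ccat x) (ccat z) (K1 x z (Hc1 C x y z g f)) \<in> hom (fun_cat (ccat x) (ccat z))
   (compF (ccat x) (K1 y z g) (K1 x y f)) (K1 x z (Hc1 C x y z g f))"
  using f g K1_functors[of x z "Hc1 C x y z g f"] C.Hc1_Obj
  by (auto simp: one_cell_def K1_comp intro!: idn_hom category_cc)
next
 fix x assume x: "x \<in> Ob C"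
 show "idn (ccat x) (ccat x) (id_func (ccat x)) \<in> hom (fun_cat (ccat x) (ccat x)) (id_func (ccat x))
   (K1 x x (One C x))"
  using x by (auto simp: K1_One intro!: idn_hom category_cc id_func_functors)
qed (auto simp: category_cc one_cell_def K1_functors K2_hom)

text \<open>The component at \<open>x\<close> of the transformation that the Yoneda lemma attaches
  to the element \<open>\<kappa>\<close> of the cocones with vertex \<open>W\<close>.\<close>

definition yon :: "'o => _ => 'o => _" where
 "yon W \<kappa> x = \<lparr>fo = (\<lambda>h\<in>Obj (Hom C W x). push W x h \<kappa>), fa = (\<lambda>\<alpha>\<in>Arr (Hom C W x). cmp (K2 W x \<alpha>) \<kappa>)\<rparr>"

lemma fo_yon [simp]: "h \<in> Obj (Hom C W x) ==> fo (yon W \<kappa> x) h = push W x h \<kappa>"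
 and fa_yon [simp]: "\<alpha> \<in> Arr (Hom C W x) ==> fa (yon W \<kappa> x) \<alpha> = cmp (K2 W x \<alpha>) \<kappa>"
 by (auto simp: yon_def)

lemma yon_functors:
 assumes W: "W \<in> Ob C" and x: "x \<in> Ob C" and \<kappa>: "\<kappa> \<in> cones W"
 shows "yon W \<kappa> x \<in> functors (Hom C W x) (ccat x)"
proof (rule functorsI)
 interpret WX: category "Hom C W x" by (rule C.category_Hom[OF W x])
 interpret X: category "ccat x" by (rule category_cc[OF x])
 let ?A = "yon W \<kappa> x"
 show "fa ?A \<alpha> \<in> hom (ccat x) (fo ?A h) (fo ?A k)" if "\<alpha> \<in> hom (Hom C W x) h k" for \<alpha> h k
  using that WX.hom_Obj[OF that] homD(1)[OF that] cmp_K2_hom[OF W x that \<kappa>] by simp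
 show "fa ?A (Ide (Hom C W x) h) = Ide (ccat x) (fo ?A h)" if h: "h \<in> Obj (Hom C W x)" for h
 proof (rule cone_eqI[OF x, of _ "push W x h \<kappa>" "push W x h \<kappa>"])
  note i = WX.Ide_hom[OF h]
  let ?B = "push W x h \<kappa>"
  show "fa ?A (Ide (Hom C W x) h) \<in> hom (ccat x) ?B ?B"
   using homD(1)[OF i] cmp_K2_hom[OF W x i \<kappa>] by simp
  show "Ide (ccat x) (fo ?A h) \<in> hom (ccat x) ?B ?B"
   using h by (auto intro!: X.Ide_hom push_cones[OF W x h \<kappa>])
  show "cmp (cmp (fa ?A (Ide (Hom C W x) h)) d) j = cmp (cmp (Ide (ccat x) (fo ?A h)) d) j"
   if dj: "d \<in> Ob D" "j \<in> Obj (P0 J d)" for d j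
   using homD(1)[OF i] h cone_fo[OF W \<kappa> dj] C.Hc2_Ide[OF F.P0_Ob[OF dj(1)] W x]
   by (simp add: cmp_K2[OF W x i \<kappa> dj] cmp_Ide_cone[OF dj] fo_push[OF W \<kappa> dj] dj del: t1_push)
 qed
 show "fa ?A (\<beta> \<cdot>[Hom C W x] \<alpha>) = fa ?A \<beta> \<cdot>[ccat x] fa ?A \<alpha>"
  if \<alpha>: "\<alpha> \<in> hom (Hom C W x) f g" and \<beta>: "\<beta> \<in> hom (Hom C W x) g h" for \<alpha> \<beta> f g h
 proof (rule cone_eqI[OF x, of _ "push W x f \<kappa>" "push W x h \<kappa>"])
  note \<beta>\<alpha> = WX.Cmp_hom[OF \<alpha> \<beta>]
  let ?C = "\<beta> \<cdot>[Hom C W x] \<alpha>"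
  show "fa ?A ?C \<in> hom (ccat x) (push W x f \<kappa>) (push W x h \<kappa>)"
   using homD(1)[OF \<beta>\<alpha>] cmp_K2_hom[OF W x \<beta>\<alpha> \<kappa>] by simp
  show "fa ?A \<beta> \<cdot>[ccat x] fa ?A \<alpha> \<in> hom (ccat x) (push W x f \<kappa>) (push W x h \<kappa>)"
   using homD(1)[OF \<alpha>] homD(1)[OF \<beta>] X.Cmp_hom[OF cmp_K2_hom[OF W x \<alpha> \<kappa>] cmp_K2_hom[OF W x \<beta> \<kappa>]] by simp
  show "cmp (cmp (fa ?A ?C) d) j = cmp (cmp (fa ?A \<beta> \<cdot>[ccat x] fa ?A \<alpha>) d) j"
   if dj: "d \<in> Ob D" "j \<in> Obj (P0 J d)" for d j
   using homD(1)[OF \<alpha>] homD(1)[OF \<beta>] homD(1)[OF \<beta>\<alpha>] C.Hc2_Cmp_left[OF F.P0_Ob[OF dj(1)] W x cone_fo[OF W \<kappa> dj] \<alpha> \<beta>]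
   by (simp add: cmp_K2[OF W x \<beta>\<alpha> \<kappa> dj] cmp_K2[OF W x \<alpha> \<kappa> dj] cmp_K2[OF W x \<beta> \<kappa> dj] cmp_Cmp_cone[OF dj])
 qed
qed (auto simp: yon_def push_cones[OF W x _ \<kappa>])

text \<open>The naturality square commutes strictly, so identities can serve as the coherence cells
  of \<open>yon_nat\<close>.\<close>

lemma yon_postfun:
 assumes W: "W \<in> Ob C" and x: "x \<in> Ob C" and y: "y \<in> Ob C" and h: "h \<in> Obj (Hom C x y)" and \<kappa>: "\<kappa> \<in> cones W"
 shows "compF (Hom C W x) (yon W \<kappa> y) (postfun C W x y h) = compF (Hom C W x) (K1 x y h) (yon W \<kappa> x)"
proof (rule func_eqI[OF compF_functors[OF C.category_Hom[OF W x] C.postfun_functors[OF W x y h] yon_functors[OF W y \<kappa>]]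
   compF_functors[OF C.category_Hom[OF W x] yon_functors[OF W x \<kappa>] K1_functors[OF x y h]]])
 let ?B = "compF (Hom C W x) (yon W \<kappa> y) (postfun C W x y h)" and ?D = "compF (Hom C W x) (K1 x y h) (yon W \<kappa> x)"
 show "fo ?B f = fo ?D f"
  if f: "f \<in> Obj (Hom C W x)" for f
  using f h W x y \<kappa> by (simp add: push_push push_cones C.Hc1_Obj)
 fix \<alpha> assume \<alpha>A: "\<alpha> \<in> Arr (Hom C W x)"
 then obtain f g where \<alpha>: "\<alpha> \<in> hom (Hom C W x) f g" by (auto simp: hom_def)
 note fg = category.hom_Obj[OF C.category_Hom[OF W x] \<alpha>]
 note h\<alpha> = C.Hc2_hom[OF W x y \<alpha> C.Ide_Hom[OF x y h]]
 note \<alpha>K = cmp_K2_hom[OF W x \<alpha> \<kappa>]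
 let ?A = "cmp (K2 W x \<alpha>) \<kappa>" and ?C = "K2 W y (Hc2 C W x y (Ide (Hom C x y) h) \<alpha>)"
 have "cmp ?C \<kappa> = fa (K1 x y h) ?A"
 proof (rule cone_eqI[OF y cmp_K2_hom[OF W y h\<alpha> \<kappa>]])
  show "fa (K1 x y h) ?A \<in> hom (ccat y) (push W y (Hc1 C W x y h f) \<kappa>) (push W y (Hc1 C W x y h g) \<kappa>)"
   using fa_K1_hom[OF x y h \<alpha>K] push_push[OF W x y _ h \<kappa>] fg by simp
  show "cmp (cmp (cmp ?C \<kappa>) d) j = cmp (cmp (fa (K1 x y h) ?A) d) j"
   if dj: "d \<in> Ob D" "j \<in> Obj (P0 J d)" for d j
   using C.Hc2_assoc[OF F.P0_Ob[OF dj(1)] W x y C.Ide_Arr[OF F.P0_Ob[OF dj(1)] W cone_fo[OF W \<kappa> dj]] homD(1)[OF \<alpha>] C.Ide_Arr[OF x y h]]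
   by (simp add: cmp_K2[OF W y h\<alpha> \<kappa> dj] cmp_K1[OF x y h \<alpha>K dj] cmp_K2[OF W x \<alpha> \<kappa> dj])
 qed
 then show "fa ?B \<alpha> = fa ?D \<alpha>"
  using \<alpha>A homD(1)[OF h\<alpha>] homD(1)[OF \<alpha>K] by simp
qed

definition yon_nat where
 "yon_nat W \<kappa> = \<lparr>t1 = (\<lambda>x\<in>Ob C. yon W \<kappa> x),
   t2 = (\<lambda>x y h. if one_cell C x y h then idn (Hom C W x) (ccat y) (compF (Hom C W x) (K1 x y h) (yon W \<kappa> x)) else undefined)\<rparr>"

lemma yon_nat_pseudo_nats:
 assumes W: "W \<in> Ob C" and \<kappa>: "\<kappa> \<in> cones W"
 shows "yon_nat W \<kappa> \<in> pseudo_nats C (hom_from C W) (cocones C D J F)"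
proof -
 interpret P: cat_valued_pair C "hom_from C W" "cocones C D J F"
  by (intro cat_valued_pair.intro C.cat_valued_hom_from[OF W] cat_valued_cocones) unfold_locales
 let ?A = "yon_nat W \<kappa>"
 have t1: "t1 ?A x = yon W \<kappa> x" if "x \<in> Ob C" for x using that by (simp add: yon_nat_def)
 have t2: "cmp (t2 ?A x y h) f = Ide (ccat y) (push W y (Hc1 C W x y h f) \<kappa>)"
  if "one_cell C x y h" "f \<in> Obj (Hom C W x)" for x y h f
  using that W \<kappa> by (auto simp: yon_nat_def one_cell_def push_cones push_push)
 have po: "push W y (Hc1 C W x y h f) \<kappa> \<in> Obj (ccat y)"
  if "one_cell C x y h" "f \<in> Obj (Hom C W x)" for x y h f
  using that W \<kappa> by (auto simp: one_cell_def push_cones C.Hc1_Obj)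
 show ?thesis
 proof (rule P.pseudo_natsI, unfold cocones_simps C.hom_from_simps, goal_cases)
  case 1
  show ?case
   unfolding P.pnat_data_def
  proof (intro conjI allI impI; (simp only: cocones_simps C.hom_from_simps)?)
   show "t1 ?A \<in> (\<Pi>\<^sub>E x\<in>Ob C. functors (Hom C W x) (ccat x))"
    using yon_functors[OF W _ \<kappa>] by (auto simp: yon_nat_def)
   show "t2 ?A x y h \<in> isos (fun_cat (Hom C W x) (ccat y))
    (compF (Hom C W x) (K1 x y h) (t1 ?A x)) (compF (Hom C W x) (t1 ?A y) (postfun C W x y h))"
    if "one_cell C x y h" for x y h
    using that W \<kappa> by (auto simp: yon_nat_def one_cell_def yon_postfun
      intro!: idn_isos C.category_Hom category_cc compF_functors yon_functors K1_functors)
  qed (simp add: yon_nat_def)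
 next
  case H: (2 x y \<theta> h k f)
  note x = H(1) and y = H(2) and \<theta> = H(3) and h = H(4) and k = H(5) and f = H(6)
  interpret Y: category "ccat y" by (rule category_cc[OF y])
  have fC: "push W x f \<kappa> \<in> cones x" by (rule push_cones[OF W x f \<kappa>])
  note \<theta>f = C.Hc2_hom[OF W x y C.Ide_Hom[OF W x f] \<theta>]
  have oh: "h \<in> Obj (Hom C x y)" "k \<in> Obj (Hom C x y)" using h k by (auto simp: one_cell_def)
  let ?C = "push W x f \<kappa>"
  have a: "cmp (K2 x y \<theta>) ?C \<in> hom (ccat y) (push W y (Hc1 C W x y h f) \<kappa>) (push W y (Hc1 C W x y k f) \<kappa>)"
   using cmp_K2_hom[OF x y \<theta> fC] push_push[OF W x y f _ \<kappa>] oh by simp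
  let ?B = "K2 W y (Hc2 C W x y \<theta> (Ide (Hom C W x) f))"
  \<comment> \<open>The legs of the pushed cocone are composites with \<open>f\<close>, so by
    \<open>Hc2_assoc\<close> it makes no difference whether \<open>\<theta>\<close> is whiskered
    with \<open>f\<close> first or with these composites at once.\<close>
  have e: "cmp ?B \<kappa> = cmp (K2 x y \<theta>) ?C"
  proof (rule cone_eqI[OF y cmp_K2_hom[OF W y \<theta>f \<kappa>] a])
   show "cmp (cmp (cmp ?B \<kappa>) d) j = cmp (cmp (cmp (K2 x y \<theta>) ?C) d) j"
    if dj: "d \<in> Ob D" "j \<in> Obj (P0 J d)" for d j
    using F.P0_Ob[OF dj(1)] cone_fo[OF W \<kappa> dj] W x y f homD(1)[OF \<theta>]
    by (simp add: cmp_K2[OF W y \<theta>f \<kappa> dj] cmp_K2[OF x y \<theta> fC dj] fo_push[OF W \<kappa> dj] C.Hc2_assoc[symmetric] C.Ide_Arr C.Hc2_Ide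
     del: t1_push)
  qed
  show ?case
   using f homD(1)[OF \<theta>f] by (simp add: t1 x y t2[OF h f] t2[OF k f] e Y.Cmp_Ide_left[OF a] Y.Cmp_Ide_right[OF a])
 next
  case H: (3 x y z h k f)
  note h = H(1) and k = H(2) and f = H(3)
  have o: "x \<in> Ob C" "y \<in> Ob C" "z \<in> Ob C" "h \<in> Obj (Hom C x y)" "k \<in> Obj (Hom C y z)" using h k by (auto simp: one_cell_def)
  interpret Z: category "ccat z" by (rule category_cc[OF o(3)])
  note kh = C.one_cell_Hc1[OF h k] and hf = C.Hc1_Obj[OF W o(1,2) f o(4)]
  have e: "Hc1 C W y z k (Hc1 C W x y h f) = Hc1 C W x z (Hc1 C x y z k h) f"
   using C.Hc1_assoc[OF W o(1-3) f o(4,5)] by simp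
   have i: "Ide (Hom C W z) (Hc1 C W x z (Hc1 C x y z k h) f) \<in> Arr (Hom C W z)" "Hc1 C W x z (Hc1 C x y z k h) f \<in> Obj (Hom C W z)"
   using C.Hc1_Obj[OF W o(2,3) hf o(5)] W o by (auto simp: e C.Ide_Arr)
  show ?case
   using o f hf push_cones[OF W o(1) f \<kappa>] push_cones[OF W o(2) hf \<kappa>] C.one_cell_Hc1[OF h k] push_cones[OF W o(3) i(2) \<kappa>]
    fun_Ide[OF yon_functors[OF W o(3) \<kappa>] i(2)] i
   by (simp add: t1 t2[OF h f] t2[OF k hf] t2[OF kh f] e fun_Ide[OF K1_functors[OF o(2,3,5)]] push_push[OF W o(2,3) hf o(5) \<kappa>]
    push_push[OF W o(1,3) f _ \<kappa>] C.Hc1_Obj Z.Cmp_Ide_left[OF Z.Ide_hom] del: fa_yon)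
 next
  case H: (4 x f)
  note x = H(1) and f = H(2)
  interpret X: category "ccat x" by (rule category_cc[OF x])
  have c: "push W x f \<kappa> \<in> cones x" by (rule push_cones[OF W x f \<kappa>])
  show ?case
   using f c fun_Ide[OF yon_functors[OF W x \<kappa>] f]
   by (simp add: t1 x t2[OF C.one_cell_One[OF x] f] C.Hc1_One_left[OF W x f] X.Cmp_Ide_left[OF X.Ide_hom] del: fa_yon)
 qed
qed

text \<open>
 The transformation induced by a cocone \<open>\<kappa>\<close> is strictly natural, because \<open>push_pnat\<close> is strictly
 functorial; so only its components have to be examined.
\<close>

lemma weighted_bicolimitI:
 assumes W: "W \<in> Ob C" and \<kappa>: "\<kappa> \<in> cones W"
  and eso: "\<And>x \<tau>. x \<in> Ob C ==> \<tau> \<in> cones x ==> \<exists>h \<in> Obj (Hom C W x). push W x h \<kappa> = \<tau>"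
  and faithful: "\<And>x h k \<alpha> \<beta>. x \<in> Ob C ==> \<alpha> \<in> hom (Hom C W x) h k ==> \<beta> \<in> hom (Hom C W x) h k ==>
    (\<And>d j. d \<in> Ob D ==> j \<in> Obj (P0 J d) ==> Hc2F d W x \<alpha> (Ide (HF d W) (fo (t1 \<kappa> d) j))
     = Hc2F d W x \<beta> (Ide (HF d W) (fo (t1 \<kappa> d) j))) ==> \<alpha> = \<beta>"
  and full: "\<And>x h k m. x \<in> Ob C ==> h \<in> Obj (Hom C W x) ==> k \<in> Obj (Hom C W x) ==>
    m \<in> hom (PsHom (op2 D) J (K x)) (push W x h \<kappa>) (push W x k \<kappa>) ==>
    \<exists>\<alpha> \<in> hom (Hom C W x) h k. \<forall>d\<in>Ob D. \<forall>j\<in>Obj (P0 J d).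
     Hc2F d W x \<alpha> (Ide (HF d W) (fo (t1 \<kappa> d) j)) = cmp (cmp m d) j"
 shows "weighted_bicolimit C D J F W"
proof -
 have "equivalence (Hom C W x) (ccat x) (yon W \<kappa> x)" if x: "x \<in> Ob C" for x
 proof (rule equivalenceI[OF C.category_Hom[OF W x] category_cc[OF x] yon_functors[OF W x \<kappa>]])
  fix h k m assume h: "h \<in> Obj (Hom C W x)" and k: "k \<in> Obj (Hom C W x)"
   and "m \<in> hom (ccat x) (fo (yon W \<kappa> x) h) (fo (yon W \<kappa> x) k)"
  then have m: "m \<in> hom (ccat x) (push W x h \<kappa>) (push W x k \<kappa>)" by simp
  obtain \<alpha> where \<alpha>: "\<alpha> \<in> hom (Hom C W x) h k" "\<forall>d\<in>Ob D. \<forall>j\<in>Obj (P0 J d).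
     Hc2F d W x \<alpha> (Ide (HF d W) (fo (t1 \<kappa> d) j)) = cmp (cmp m d) j"
   using full[OF x h k m[unfolded ccat_def]] by blast
  have "cmp (K2 W x \<alpha>) \<kappa> = m"
   by (rule cone_eqI[OF x cmp_K2_hom[OF W x \<alpha>(1) \<kappa>] m]) (use \<alpha>(2) in \<open>simp add: cmp_K2[OF W x \<alpha>(1) \<kappa>]\<close>)
  then show "\<exists>\<alpha>\<in>hom (Hom C W x) h k. fa (yon W \<kappa> x) \<alpha> = m"
   using \<alpha>(1) homD(1)[OF \<alpha>(1)] by (auto intro!: bexI[of _ \<alpha>])
 next
  fix h k \<alpha> \<beta> assume \<alpha>: "\<alpha> \<in> hom (Hom C W x) h k" and \<beta>: "\<beta> \<in> hom (Hom C W x) h k" and e: "fa (yon W \<kappa> x) \<alpha> = fa (yon W \<kappa> x) \<beta>"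
  show "\<alpha> = \<beta>"
  proof (rule faithful[OF x \<alpha> \<beta>])
   fix d j assume dj: "d \<in> Ob D" "j \<in> Obj (P0 J d)"
   let ?A = "Ide (HF d W) (fo (t1 \<kappa> d) j)"
   show "Hc2F d W x \<alpha> ?A
     = Hc2F d W x \<beta> ?A"
    using e homD(1)[OF \<alpha>] homD(1)[OF \<beta>] cmp_K2[OF W x \<alpha> \<kappa> dj] cmp_K2[OF W x \<beta> \<kappa> dj] by simp
  qed
 next
  fix \<tau> assume "\<tau> \<in> Obj (ccat x)"
  then obtain h where "h \<in> Obj (Hom C W x)" "push W x h \<kappa> = \<tau>" "\<tau> \<in> Obj (ccat x)" using eso[OF x] by auto
  then show "\<exists>h\<in>Obj (Hom C W x). isos (ccat x) (fo (yon W \<kappa> x) h) \<tau> \<noteq> {}"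
   using category.Ide_isos[OF category_cc[OF x], of \<tau>] by (auto intro!: bexI[of _ h])
 qed
 then show ?thesis
  unfolding weighted_bicolimit_def using W yon_nat_pseudo_nats[OF W \<kappa>]
  by (auto intro!: bexI[of _ "yon_nat W \<kappa>"] simp: yon_nat_def)
qed

end

section \<open>Smallness\<close>

text \<open>Operations take lists of every length, which avoids bookkeeping of arities. The closure
  may be larger than the set of interest, but only an upper bound for sizes is drawn from
  it.\<close>

inductive_set clos :: "'x set => ('x list => 'x) set => 'x set" for G Ops where
 gen: "x \<in> G ==> x \<in> clos G Ops"
| op: "f \<in> Ops ==> \<forall>x\<in>set xs. x \<in> clos G Ops ==> f xs \<in> clos G Ops"

context universe
begin

text \<open>Carries smallness over to sets of other types, such as terms and arrows: a set is small
  if members of \<open>U\<close> suffice to index it.\<close>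

definition small :: "'x set => bool" where
 "small S \<longleftrightarrow> (\<exists>A\<in>U. \<exists>f :: 'u => 'x. S \<subseteq> f ` A)"

lemma small_subset: "small S ==> S' \<subseteq> S ==> small S'"
 unfolding small_def by (meson subset_trans)

lemma small_image: "small S ==> small (f ` S)"
 unfolding small_def by (metis image_comp image_mono)

lemma U_small: "A \<in> U ==> small A"
 unfolding small_def by (rule bexI[of _ A], rule exI[of _ "\<lambda>x. x"]) auto

text \<open>An infinite member of \<open>U\<close> contains a copy of the natural numbers, which is
  in \<open>U\<close> as a subset.\<close>

lemma small_nat: "small (UNIV :: nat set)"
proof -
 obtain A where A: "A \<in> U" "infinite A" using infinite_small by blast
 then obtain f :: "nat => 'u" where f: "inj f" "range f \<subseteq> A" using infinite_countable_subset by blast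
 then have "UNIV = inv f ` range f" by (simp add: image_image)
 then show ?thesis unfolding small_def using subset_small[OF A(1) f(2)] by blast
qed

lemma small_countable: "countable S ==> small S"
 using small_subset[OF small_image[OF small_nat, of "from_nat_into S"], of S]
 by (cases "S = {}") (auto simp: range_from_nat_into small_def intro: infinite_small[THEN bexE])

lemma small_UN:
 assumes I: "small I" and V: "\<And>i. i \<in> I ==> small (V i)"
 shows "small (\<Union>i\<in>I. V i)"
proof -
 \<comment> \<open>An infinite type has as many elements as its square, which provides a pairing
   function on codes.\<close>
 have "infinite (UNIV :: 'u set)" using infinite_small by (meson finite_subset subset_UNIV)
 then obtain p :: "'u \<times> 'u => 'u" where p: "inj p"
  using card_of_Times_same_infinite unfolding card_of_ordIso[symmetric] by (force simp: bij_betw_def)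
 obtain A f where A: "A \<in> U" "I \<subseteq> f ` A" using I by (auto simp: small_def)
 \<comment> \<open>The set indexed by \<open>A\<close> may be larger than \<open>I\<close>, and
   outside \<open>I\<close> nothing is known about \<open>V\<close>.\<close>
 let ?A = "{a \<in> A. f a \<in> I}"
 have "\<exists>B g. B \<in> U \<and> V (f a) \<subseteq> g ` B" if "a \<in> ?A" for a using V[of "f a"] that by (auto simp: small_def)
 then obtain B g where B: "\<And>a. a \<in> ?A ==> B a \<in> U \<and> V (f a) \<subseteq> g a ` B a" by metis
 let ?P = "\<Union>a\<in>?A. (\<lambda>b. p (a, b)) ` B a"
 have "?A \<in> U" by (rule subset_small[OF A(1)]) auto
 then have "?P \<in> U" using B by (intro Union_small image_small) auto
 moreover have "(\<Union>i\<in>I. V i) \<subseteq> (\<lambda>c. case inv p c of (a, b) => g a b) ` ?P"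
 proof
  fix v assume "v \<in> (\<Union>i\<in>I. V i)"
  then obtain a where a: "a \<in> ?A" "v \<in> V (f a)" using A(2) by blast
  then obtain b where b: "b \<in> B a" "v = g a b" using B by blast
  then have "v = (case inv p (p (a, b)) of (a, b) => g a b)" using p by simp
  then show "v \<in> (\<lambda>c. case inv p c of (a, b) => g a b) ` ?P" using a b by blast
 qed
 ultimately show ?thesis unfolding small_def by blast
qed

lemma small_Un: "small A ==> small B ==> small (A \<union> B)"
 by (rule small_subset[OF small_UN[OF small_countable[of "{True, False}"], of "\<lambda>b. if b then A else B"]]) auto

lemma small_Times: "small A ==> small B ==> small (A \<times> B)"
 by (rule small_subset[OF small_UN[of A "\<lambda>a. Pair a ` B"]]) (auto intro: small_image)

lemma small_lists: assumes "small S" shows "small (lists S)"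
proof -
 have n: "small {xs \<in> lists S. length xs = n}" for n
 proof (induction n)
  case 0
  show ?case by (rule small_subset[OF small_countable[of "{[]}"]]) auto
 next
  case (Suc n)
  have "{xs \<in> lists S. length xs = Suc n} \<subseteq> (\<lambda>(x, xs). x # xs) ` (S \<times> {xs \<in> lists S. length xs = n})"
   by (auto simp: length_Suc_conv image_iff)
  then show ?case using small_image[OF small_Times[OF assms Suc]] small_subset by blast
 qed
 show ?thesis by (rule small_subset[OF small_UN[OF small_nat n]]) auto
qed

lemma small_clos:
 assumes G: "small G" and Ops: "small Ops" shows "small (clos G Ops)"
proof -
 \<comment> \<open>Stage \<open>Suc n\<close> adds all values of operations on lists from stage
   \<open>n\<close>. Countably many stages suffice: a list is finite and the stages increase, so its
   entries lie in a common stage.\<close>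
 define L where "L = rec_nat G (\<lambda>_ S. S \<union> (\<lambda>(f, xs). f xs) ` (Ops \<times> lists S))"
 have L0: "L 0 = G" and LS: "L (Suc n) = L n \<union> (\<lambda>(f, xs). f xs) ` (Ops \<times> lists (L n))" for n
  by (auto simp: L_def)
 have small: "small (L n)" for n
  by (induction n) (auto simp: L0 LS G intro!: small_Un small_image small_Times Ops small_lists)
 have mono: "L n \<subseteq> L m" if "n \<le> m" for n m using lift_Suc_mono_le[of L n m] that LS by auto
 have "x \<in> (\<Union>n. L n)" if "x \<in> clos G Ops" for x
  using that
 proof induction
  case (gen x) then show ?case using L0 by blast
 next
  case (op f xs)
  have "\<forall>x\<in>set xs. x \<in> (\<Union>n. L n)" using op by blast
  then have "\<exists>n. set xs \<subseteq> L n"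
  proof (induction xs)
   case (Cons x xs)
   then obtain n m where "x \<in> L n" "set xs \<subseteq> L m" by auto
   then have "set (x # xs) \<subseteq> L (max n m)" using mono[of n "max n m"] mono[of m "max n m"] by auto
   then show ?case by blast
  qed auto
  then obtain n where "set xs \<subseteq> L n" by blast
  then have "f xs \<in> L (Suc n)" using op(1) unfolding LS by force
  then show ?case by blast
 qed
 then show ?thesis by (intro small_subset[OF small_UN[OF small_nat small]] subsetI)
qed

text \<open>Picking one index for every element is injective, and the chosen indices form a subset
  of a member of \<open>U\<close>.\<close>

lemma small_code:
 assumes "small S" obtains e :: "'x => 'u" where "inj_on e S" "e ` S \<in> U"
proof -
 obtain A f where A: "A \<in> U" "S \<subseteq> f ` A" using assms by (auto simp: small_def)
 have "inv_into A f ` S \<subseteq> A" using A(2) by (auto intro: inv_into_into)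
 then show ?thesis using that[of "inv_into A f"] inj_on_inv_into[OF A(2)] subset_small[OF A(1)] by blast
qed

end

section \<open>Blocks\<close>

lemma length_blocks [simp]: "length (blocks ns xs) = length ns"
 by (induction ns arbitrary: xs) auto

lemma blocks_map: "blocks ns (map f xs) = map (map f) (blocks ns xs)"
 by (induction ns arbitrary: xs) (auto simp: take_map drop_map)

lemma blocks_append: "blocks (ms @ ns) xs = blocks ms (take (sum_list ms) xs) @ blocks ns (drop (sum_list ms) xs)"
 by (induction ms arbitrary: xs) (auto simp: drop_take add.commute)

lemma blocks_concat [simp]: "blocks (map length xss) (concat xss) = xss"
 by (induction xss) auto

lemma blocks_concat': "ns = map length xss ==> blocks ns (concat xss) = xss"
 by simp

lemma map_length_blocks: "length xs = sum_list ns ==> map length (blocks ns xs) = ns"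
 by (induction ns arbitrary: xs) auto

lemma length_blocks_nth [simp]: "length xs = sum_list ns ==> i < length ns ==> length (blocks ns xs ! i) = ns ! i"
 using map_length_blocks[of xs ns] by (metis length_blocks nth_map)

lemma set_blocks_subset: "ys \<in> set (blocks ns xs) ==> set ys \<subseteq> set xs"
 by (induction ns arbitrary: xs) (auto dest: in_set_takeD in_set_dropD)

lemma set_blocks_nth: "i < length ns ==> set (blocks ns xs ! i) \<subseteq> set xs"
 by (rule set_blocks_subset[OF nth_mem]) simp

lemma blocks_nth: "i < length ns ==> blocks ns xs ! i = take (ns ! i) (drop (offset ns i) xs)"
proof (induction ns arbitrary: xs i)
 case (Cons n ns)
 then show ?case by (cases i) (auto simp: offset_def add.commute)
qed simp

lemma offset_bound: "i < length ns ==> offset ns i + ns ! i \<le> sum_list ns"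
proof (induction ns arbitrary: i)
 case (Cons n ns)
 then show ?case by (cases i) (auto simp: offset_def)
qed simp

lemma map_nth_block:
 assumes "i < length ns" "length xs = sum_list ns"
 shows "map ((!) xs) (block ns i) = blocks ns xs ! i"
 using offset_bound[OF assms(1)] assms
 by (auto simp: block_def blocks_nth intro!: nth_equalityI)

lemma blocks_replicate: "length xs = n ==> blocks (replicate n (Suc 0)) xs = map (\<lambda>x. [x]) xs"
proof (induction n arbitrary: xs)
 case (Suc n)
 then show ?case by (cases xs) auto
qed simp

text \<open>Combinatorial core of the associativity laws: a two-level composite can be evaluated by
  cutting the arguments once into the finest blocks, or first into coarse blocks and then each of
  these again.\<close>

lemma blocks_assoc:
 "blocks (map length wss) (map2 ap (concat wss) (blocks (map ar (concat wss)) xs))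
  = map2 (\<lambda>ws ys. map2 ap ws (blocks (map ar ws) ys)) wss (blocks (map (\<lambda>ws. sum_list (map ar ws)) wss) xs)"
 by (induction wss arbitrary: xs) (auto simp: blocks_append zip_append)

lemma map_nth_block_map:
 assumes "set fs \<subseteq> {..<length ns}" "length xs = sum_list ns"
 shows "map ((!) xs) (block_map ns fs) = concat (map ((!) (blocks ns xs)) fs)"
 using assms(1) by (induction fs) (auto simp: block_map_def map_nth_block assms(2))

text \<open>Combinatorial core of substitution in the outer word: reindexing along
  \<open>block_map\<close> moves whole blocks.\<close>

lemma blocks_block_map:
 assumes "set fs \<subseteq> {..<length ns}" "length xs = sum_list ns"
 shows "blocks (map ((!) ns) fs) (map ((!) xs) (block_map ns fs)) = map ((!) (blocks ns xs)) fs"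
 unfolding map_nth_block_map[OF assms]
 by (rule blocks_concat') (use assms in \<open>auto simp: subset_iff\<close>)

lemma map_nth_block_sum:
 assumes "length gss = length ns" "\<forall>i<length ns. set (gss ! i) \<subseteq> {..<ns ! i}" "length xs = sum_list ns"
 shows "map ((!) xs) (block_sum ns gss) = concat (map2 (\<lambda>gs ys. map ((!) ys) gs) gss (blocks ns xs))"
proof -
 have "map (\<lambda>i. map ((!) xs) (map ((+) (offset ns i)) (gss ! i))) [0..<length gss]
  = map2 (\<lambda>gs ys. map ((!) ys) gs) gss (blocks ns xs)"
 proof (rule nth_equalityI)
  fix i assume "i < length (map (\<lambda>i. map ((!) xs) (map ((+) (offset ns i)) (gss ! i))) [0..<length gss])"
  then have i: "i < length ns" using assms by simp
  have "xs ! (offset ns i + g) = blocks ns xs ! i ! g" if "g \<in> set (gss ! i)" for g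
   using that assms(2)[rule_format, OF i] i offset_bound[OF i] assms(3) by (auto simp: blocks_nth)
  then show "map (\<lambda>i. map ((!) xs) (map ((+) (offset ns i)) (gss ! i))) [0..<length gss] ! i =
   map2 (\<lambda>gs ys. map ((!) ys) gs) gss (blocks ns xs) ! i" using i assms(1) by simp
 qed (use assms in simp)
 then show ?thesis by (simp add: block_sum_def map_concat comp_def)
qed

text \<open>Combinatorial core of substitution in the inner words: reindexing along
  \<open>block_sum\<close> acts inside each block separately.\<close>

lemma blocks_block_sum:
 assumes "length gss = length ns" "\<forall>i<length ns. set (gss ! i) \<subseteq> {..<ns ! i}" "length xs = sum_list ns"
 shows "blocks (map length gss) (map ((!) xs) (block_sum ns gss)) = map2 (\<lambda>gs ys. map ((!) ys) gs) gss (blocks ns xs)"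
 unfolding map_nth_block_sum[OF assms]
 by (rule blocks_concat') (use assms in \<open>auto intro!: nth_equalityI\<close>)

lemma block_bound: "i < length ns ==> k \<in> set (block ns i) ==> k < sum_list ns"
 using offset_bound[of i ns] by (simp add: block_def)

lemma length_block_map: "set fs \<subseteq> {..<length ns} ==> length (block_map ns fs) = sum_list (map ((!) ns) fs)"
 by (induction fs) (auto simp: block_map_def block_def)

lemma set_block_map: "set fs \<subseteq> {..<length ns} ==> set (block_map ns fs) \<subseteq> {..<sum_list ns}"
proof
 fix k assume "set fs \<subseteq> {..<length ns}" "k \<in> set (block_map ns fs)"
 then obtain i where "i < length ns" "k \<in> set (block ns i)" by (auto simp: block_map_def)
 then show "k \<in> {..<sum_list ns}" using block_bound by simp
qed

lemma length_block_sum: "length (block_sum ns gss) = sum_list (map length gss)"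
 proof -
 have "map (\<lambda>i. length (gss ! i)) [0..<length gss] = map length gss" by (rule nth_equalityI) auto
 then show ?thesis by (simp add: block_sum_def length_concat comp_def)
qed

lemma set_block_sum:
 assumes "length gss = length ns" "\<forall>i<length ns. set (gss ! i) \<subseteq> {..<ns ! i}"
 shows "set (block_sum ns gss) \<subseteq> {..<sum_list ns}"
proof
 fix k assume "k \<in> set (block_sum ns gss)"
 then obtain i g where "i < length ns" "g \<in> set (gss ! i)" "k = offset ns i + g" using assms(1) by (auto simp: block_sum_def)
 then show "k \<in> {..<sum_list ns}" using assms(2)[rule_format, of i] offset_bound[of i ns] by fastforce
qed

section \<open>Laws of substitution in a theory\<close>

context lawvere_theory
begin

interpretation category "Tcat T" by (rule category_Tcat)

abbreviation "ars == map (arity T)"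
abbreviation "tot ws == sum_list (ars ws)"
abbreviation "pw A w == pow (Car A) (arity T w)"
abbreviation "acat == alg_hom_cat T"
abbreviation "acomp == alg_comp T"
abbreviation "ops m == hom (Tcat T) m 1"

text \<open>Evaluation of the word \<open>w\<close> at generalized elements \<open>gs\<close> of a
  power, defined on the object \<open>m\<close>. Words are compared by their values, so calculations
  with tuples of projections are avoided.\<close>

definition ap :: "nat => 't => 't list => 't" where
 "ap m w gs = w \<cdot>[Tcat T] tuple T m gs"

lemma words_iff: "w \<in> words T \<and> arity T w = n \<longleftrightarrow> w \<in> ops n"
 by (auto simp: words_def arity_def hom_def)

lemma words_hom: "w \<in> words T ==> w \<in> ops (arity T w)"
 using words_iff by blast

lemma tuple:
 assumes "set gs \<subseteq> ops m"
 shows tuple_hom: "tuple T m gs \<in> hom (Tcat T) m (length gs)"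
  and Proj_tuple: "i < length gs ==> Proj T (length gs) i \<cdot>[Tcat T] tuple T m gs = gs ! i"
 using theI'[OF product[OF assms]] by (auto simp: tuple_def)

lemma tuple_unique:
 assumes "set gs \<subseteq> ops m" "h \<in> hom (Tcat T) m (length gs)"
  "\<And>i. i < length gs ==> Proj T (length gs) i \<cdot>[Tcat T] h = gs ! i"
 shows "h = tuple T m gs"
 using product[OF assms(1)] tuple[OF assms(1)] assms(2,3) by blast

lemma ap_hom: "w \<in> ops (length gs) ==> set gs \<subseteq> ops m ==> ap m w gs \<in> ops m"
 unfolding ap_def by (rule Cmp_hom[OF tuple_hom])

text \<open>Precomposing a tuple with a morphism is done componentwise, by uniqueness in the
  product.\<close>

lemma ap_ap:
 assumes w: "w \<in> ops (length gs)" and gs: "set gs \<subseteq> ops (length hs)" and hs: "set hs \<subseteq> ops l"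
 shows "ap l (ap (length hs) w gs) hs = ap l w (map (\<lambda>g. ap l g hs) gs)"
proof -
 have "ap l g hs \<in> ops l" if "g \<in> set gs" for g by (rule ap_hom[OF _ hs]) (use gs that in blast)
 then have s: "set (map (\<lambda>g. ap l g hs) gs) \<subseteq> ops l" by auto
 have "tuple T (length hs) gs \<cdot>[Tcat T] tuple T l hs = tuple T l (map (\<lambda>g. ap l g hs) gs)"
 proof (rule tuple_unique[OF s])
  show "tuple T (length hs) gs \<cdot>[Tcat T] tuple T l hs \<in> hom (Tcat T) l (length (map (\<lambda>g. ap l g hs) gs))"
   using Cmp_hom[OF tuple_hom[OF hs] tuple_hom[OF gs]] by simp
  fix i assume "i < length (map (\<lambda>g. ap l g hs) gs)"
  then have i: "i < length gs" by simp
  show "Proj T (length (map (\<lambda>g. ap l g hs) gs)) i \<cdot>[Tcat T] (tuple T (length hs) gs \<cdot>[Tcat T] tuple T l hs) = map (\<lambda>g. ap l g hs) gs ! i"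
   using Cmp_assoc[OF tuple_hom[OF hs] tuple_hom[OF gs] Proj_hom[OF i]] Proj_tuple[OF gs i] i by (simp add: ap_def)
 qed
 then show ?thesis unfolding ap_def using Cmp_assoc[OF tuple_hom[OF hs] tuple_hom[OF gs] w] by simp
qed

lemma ap_Proj: "set hs \<subseteq> ops m ==> i < length hs ==> ap m (Proj T (length hs) i) hs = hs ! i"
 by (simp add: ap_def Proj_tuple)

lemma Proj_ops: "set fs \<subseteq> {..<l} ==> set (map (Proj T l) fs) \<subseteq> ops l"
 using Proj_hom by auto

lemma ap_id: assumes w: "w \<in> ops n" shows "ap n w (map (Proj T n) [0..<n]) = w"
proof -
 let ?A = "map (Proj T n) [0..<n]"
 have "Ide (Tcat T) n = tuple T n ?A"
 proof (rule tuple_unique)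
  show "set ?A \<subseteq> ops n" by (rule Proj_ops) auto
  have n: "n \<in> Obj (Tcat T)" by (simp add: Obj_Tcat)
  then show "Ide (Tcat T) n \<in> hom (Tcat T) n (length ?A)" by (simp add: Ide_hom)
  show "Proj T (length ?A) i \<cdot>[Tcat T] Ide (Tcat T) n = map (Proj T n) [0..<n] ! i"
   if "i < length ?A" for i using that Cmp_Ide_right[OF Proj_hom] by simp
 qed
 then show ?thesis unfolding ap_def using Cmp_Ide_right[OF w] by simp
qed

text \<open>Evaluation at the projections returns the word itself, so values determine
  words.\<close>

lemma word_eqI:
 assumes "v \<in> ops n" "w \<in> ops n" "\<And>hs. length hs = n ==> set hs \<subseteq> ops n ==> ap n v hs = ap n w hs"
 shows "v = w"
proof -
 have "set (map (Proj T n) [0..<n]) \<subseteq> ops n" by (rule Proj_ops) auto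
 then show ?thesis using assms(3)[of "map (Proj T n) [0..<n]"] ap_id[OF assms(1)] ap_id[OF assms(2)] by simp
qed

lemma wsub_ops: "w \<in> ops (length fs) ==> set fs \<subseteq> {..<l} ==> wsub T l fs w \<in> ops l"
 using ap_hom[of w "map (Proj T l) fs" l] Proj_ops[of fs l] by (simp add: wsub_def ap_def)

lemma ap_wsub:
 assumes "w \<in> ops (length fs)" "set fs \<subseteq> {..<length hs}" "set hs \<subseteq> ops m"
 shows "ap m (wsub T (length hs) fs w) hs = ap m w (map ((!) hs) fs)"
proof -
 have e: "map (\<lambda>g. ap m g hs) (map (Proj T (length hs)) fs) = map ((!) hs) fs" using ap_Proj[OF assms(3)] assms(2) by auto
 have "ap m (ap (length hs) w (map (Proj T (length hs)) fs)) hs = ap m w (map ((!) hs) fs)"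
  unfolding e[symmetric] by (rule ap_ap[OF _ Proj_ops[OF assms(2)] assms(3)]) (use assms(1) in simp)
 then show ?thesis by (simp add: wsub_def ap_def)
qed

lemma composableD:
 assumes "composable T w ws"
 shows "w \<in> ops (length ws)" "i < length ws ==> ws ! i \<in> ops (ars ws ! i)" "w \<in> words T" "set ws \<subseteq> words T"
  "length ws = arity T w"
proof -
 show w: "w \<in> words T" "set ws \<subseteq> words T" "length ws = arity T w" using assms by (auto simp: composable_def)
 show "w \<in> ops (length ws)" using words_hom[OF w(1)] w(3) by simp
 show "ws ! i \<in> ops (ars ws ! i)" if "i < length ws"
  using words_hom[of "ws ! i"] subsetD[OF w(2) nth_mem[OF that]] that by simp
qed

lemma block_subset: "i < length ns ==> set (block ns i) \<subseteq> {..<sum_list ns}"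
 using offset_bound[of i ns] by (auto simp: block_def)

lemma length_block: "i < length ns ==> length (block ns i) = ns ! i"
 by (simp add: block_def)

lemma wgamma_parts:
 assumes c: "composable T w ws"
 shows "set (map (\<lambda>i. wsub T (tot ws) (block (ars ws) i) (ws ! i)) [0..<length ws])
   \<subseteq> ops (tot ws)"
proof -
 have "wsub T (tot ws) (block (ars ws) i) (ws ! i) \<in> ops (tot ws)"
  if "i < length ws" for i
  using that composableD(2)[OF c that] by (intro wsub_ops block_subset) (simp_all add: length_block)
 then show ?thesis by auto
qed

lemma wgamma_ops: assumes c: "composable T w ws" shows "wgamma T w ws \<in> ops (tot ws)"
 using ap_hom[OF _ wgamma_parts[OF c], of w] composableD(1)[OF c] by (simp add: wgamma_def Let_def ap_def)

text \<open>With \<open>ap_wsub\<close> this gives the values of all words occurring in the laws;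
  the laws of a theory then become statements about blocks.\<close>

lemma ap_wgamma:
 assumes c: "composable T w ws" and hs: "length hs = tot ws" "set hs \<subseteq> ops m"
 shows "ap m (wgamma T w ws) hs = ap m w (map2 (ap m) ws (blocks (ars ws) hs))"
proof -
 let ?ns = "ars ws"
 let ?gs = "map (\<lambda>i. wsub T (sum_list ?ns) (block ?ns i) (ws ! i)) [0..<length ws]"
 have "map (\<lambda>g. ap m g hs) ?gs = map2 (ap m) ws (blocks ?ns hs)"
 proof (rule nth_equalityI)
  fix i assume "i < length (map (\<lambda>g. ap m g hs) ?gs)"
  then have i: "i < length ws" by simp
  show "map (\<lambda>g. ap m g hs) ?gs ! i = map2 (ap m) ws (blocks ?ns hs) ! i"
   using i composableD(2)[OF c i] ap_wsub[of "ws ! i" "block ?ns i" hs m] block_subset[of i ?ns] hs map_nth_block[of i ?ns hs]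
   by (simp add: length_block)
 qed simp
 then show ?thesis
  using ap_ap[of w ?gs hs m] wgamma_parts[OF c] composableD(1)[OF c] hs by (simp add: wgamma_def Let_def ap_def)
qed

lemma wunit_ops: "wunit T \<in> ops 1"
 unfolding wunit_def by (rule Proj_hom) simp

lemma map2_ap_ops:
 assumes "set ws \<subseteq> words T" "length hs = tot ws" "set hs \<subseteq> ops m"
 shows "set (map2 (ap m) ws (blocks (ars ws) hs)) \<subseteq> ops m"
proof -
 have "ap m (ws ! i) (blocks (ars ws) hs ! i) \<in> ops m" if "i < length ws" for i
  using that assms words_hom[of "ws ! i"] subsetD[OF assms(1) nth_mem[OF that]] set_blocks_nth[of i "ars ws" hs]
  by (intro ap_hom) (auto simp: assms(2))
 then show ?thesis by (auto simp: set_conv_nth)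
qed

lemma words_wgamma: assumes "composable T w ws" shows "wgamma T w ws \<in> words T" "arity T (wgamma T w ws) = tot ws"
 using wgamma_ops[OF assms] words_iff by blast+

lemma words_wsub: assumes "w \<in> words T" "length fs = arity T w" "set fs \<subseteq> {..<l}"
 shows "wsub T l fs w \<in> words T" "arity T (wsub T l fs w) = l"
 using wsub_ops[of w fs l] words_hom[of w] assms words_iff[of "wsub T l fs w" l] by auto

lemma words_wunit: "wunit T \<in> words T" "arity T (wunit T) = 1"
 using wunit_ops words_iff by blast+

lemma composable_assoc:
 assumes c: "composable T w ws" and l: "length wss = length ws"
  and cs: "\<forall>i<length ws. composable T (ws ! i) (wss ! i)"
 shows "composable T (wgamma T w ws) (concat wss)" "composable T w (map2 (wgamma T) ws wss)"
  "ars (map2 (wgamma T) ws wss) = map (\<lambda>vs. tot vs) wss"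
  "ars ws = map length wss"
proof -
 have ar: "ars ws = map length wss" using l composableD(5)[OF cs[rule_format]] by (auto intro!: nth_equalityI)
 then show "ars ws = map length wss" .
 have w: "set vs \<subseteq> words T" if "vs \<in> set wss" for vs using that composableD(4)[OF cs[rule_format]] l by (auto simp: in_set_conv_nth)
 show "composable T (wgamma T w ws) (concat wss)"
  unfolding composable_def using words_wgamma[OF c] ar w by (auto simp: length_concat)
 have "map2 (wgamma T) ws wss ! i \<in> words T" if "i < length ws" for i using words_wgamma(1)[OF cs[rule_format, OF that]] that l by simp
 then show "composable T w (map2 (wgamma T) ws wss)"
  using composableD[OF c] l unfolding composable_def by (auto simp: set_conv_nth)
 show "ars (map2 (wgamma T) ws wss) = map (\<lambda>vs. tot vs) wss"
  using words_wgamma(2)[OF cs[rule_format]] l by (auto intro!: nth_equalityI)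
qed

text \<open>On generalized elements both sides are \<open>w\<close> applied to the same list, by
  \<open>blocks_assoc\<close>. The law makes the sources of the two sides of the associativity axiom
  for pseudo algebras agree.\<close>

lemma wgamma_assoc:
 assumes c: "composable T w ws" and l: "length wss = length ws"
  and cs: "\<forall>i<length ws. composable T (ws ! i) (wss ! i)"
 shows "wgamma T (wgamma T w ws) (concat wss) = wgamma T w (map2 (wgamma T) ws wss)"
proof -
 note a = composable_assoc[OF assms]
 let ?n = "tot (concat wss)"
 have n: "sum_list (ars (map2 (wgamma T) ws wss)) = ?n" unfolding a(3) by (induction wss) auto
 show ?thesis
 proof (rule word_eqI[of _ ?n])
  show "wgamma T (wgamma T w ws) (concat wss) \<in> ops ?n" by (rule wgamma_ops[OF a(1)])
  show "wgamma T w (map2 (wgamma T) ws wss) \<in> ops ?n" using wgamma_ops[OF a(2)] n by simp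
  fix hs assume hs: "length hs = ?n" "set hs \<subseteq> ops ?n"
  let ?ys = "map2 (ap ?n) (concat wss) (blocks (ars (concat wss)) hs)"
  have y: "set ?ys \<subseteq> ops ?n" "length ?ys = tot ws"
   using map2_ap_ops[OF composableD(4)[OF a(1)] hs] a(4) by (auto simp: length_concat)
  have "map2 (ap ?n) ws (map2 (\<lambda>ws ys. map2 (ap ?n) ws (blocks (ars ws) ys)) wss
    (blocks (map (\<lambda>vs. tot vs) wss) hs))
   = map2 (ap ?n) (map2 (wgamma T) ws wss) (blocks (map (\<lambda>vs. tot vs) wss) hs)" (is "?L = ?R")
  proof (rule nth_equalityI)
   fix i assume "i < length ?L"
   then have i: "i < length ws" using l by simp
   let ?h = "blocks (map (\<lambda>vs. tot vs) wss) hs ! i"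
   have s: "tot (concat wss) = sum_list (map (\<lambda>vs. tot vs) wss)"
    by (induction wss) auto
   have "ap ?n (wgamma T (ws ! i) (wss ! i)) ?h = ap ?n (ws ! i) (map2 (ap ?n) (wss ! i) (blocks (ars (wss ! i)) ?h))"
    using i l hs s set_blocks_nth[of i "map (\<lambda>vs. tot vs) wss" hs] by (intro ap_wgamma cs[rule_format]) auto
   then show "?L ! i = ?R ! i" using i l by simp
  qed (use l in simp)
  moreover have "ap ?n (wgamma T (wgamma T w ws) (concat wss)) hs = ap ?n w (map2 (ap ?n) ws (blocks (ars ws) ?ys))"
   unfolding ap_wgamma[OF a(1) hs] ap_wgamma[OF c y(2,1)] ..
  moreover have "ap ?n (wgamma T w (map2 (wgamma T) ws wss)) hs
   = ap ?n w (map2 (ap ?n) (map2 (wgamma T) ws wss) (blocks (map (\<lambda>vs. tot vs) wss) hs))"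
   using ap_wgamma[OF a(2), of hs ?n] n hs unfolding a(3) by simp
  ultimately show "ap ?n (wgamma T (wgamma T w ws) (concat wss)) hs = ap ?n (wgamma T w (map2 (wgamma T) ws wss)) hs"
   unfolding a(4) blocks_assoc by simp
 qed
qed

lemma composable_unit: "w \<in> words T ==> composable T w (replicate (arity T w) (wunit T))"
 "w \<in> words T ==> composable T (wunit T) [w]"
 by (auto simp: composable_def words_wunit)

lemma wgamma_unit_right: assumes w: "w \<in> words T" shows "wgamma T w (replicate (arity T w) (wunit T)) = w"
proof (rule word_eqI[of _ "arity T w"])
 let ?A = "replicate (arity T w) (wunit T)"
 have s: "sum_list (ars ?A) = arity T w"
  using words_wunit by (simp add: sum_list_replicate)
 show "wgamma T w ?A \<in> ops (arity T w)"
  using wgamma_ops[OF composable_unit(1)[OF w]] s by simp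
 show "w \<in> ops (arity T w)" by (rule words_hom[OF w])
 fix hs assume hs: "length hs = arity T w" "set hs \<subseteq> ops (arity T w)"
 have "map2 (ap (arity T w)) ?A (map (\<lambda>x. [x]) hs) = hs"
  using hs ap_Proj[of "[_]" "arity T w" 0] by (auto simp: wunit_def subset_iff intro!: nth_equalityI)
 then show "ap (arity T w) (wgamma T w ?A) hs = ap (arity T w) w hs"
  using ap_wgamma[OF composable_unit(1)[OF w], of hs] hs s words_wunit by (simp add: blocks_replicate)
qed

lemma wgamma_unit_left: assumes w: "w \<in> words T" shows "wgamma T (wunit T) [w] = w"
proof (rule word_eqI[of _ "arity T w"])
 show "wgamma T (wunit T) [w] \<in> ops (arity T w)" using wgamma_ops[OF composable_unit(2)[OF w]] by simp
 show "w \<in> ops (arity T w)" by (rule words_hom[OF w])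
 fix hs assume hs: "length hs = arity T w" "set hs \<subseteq> ops (arity T w)"
 then show "ap (arity T w) (wgamma T (wunit T) [w]) hs = ap (arity T w) w hs"
  using ap_wgamma[OF composable_unit(2)[OF w], of hs] ap_Proj[of "[ap (arity T w) w hs]" "arity T w" 0] ap_hom[of w hs "arity T w"] words_hom[OF w]
  by (simp add: wunit_def)
qed

text \<open>Makes the sources of the two sides of the axiom relating \<open>Cc\<close> and
  \<open>Ss\<close> of the outer word agree. \<open>wsub_wgamma_right\<close> does the same for the
  inner words.\<close>

lemma wsub_wgamma_left:
 assumes w: "w \<in> words T" and fs: "length fs = arity T w" "set fs \<subseteq> {..<length ws}" and ws: "set ws \<subseteq> words T"
  and ns: "ns = ars ws"
 shows "composable T w (map ((!) ws) fs)" "composable T (wsub T (length ws) fs w) ws"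
  "wsub T (sum_list ns) (block_map ns fs) (wgamma T w (map ((!) ws) fs)) = wgamma T (wsub T (length ws) fs w) ws"
  "ars (map ((!) ws) fs) = map ((!) ns) fs"
proof -
 show c: "composable T w (map ((!) ws) fs)"
  using w fs(1) by (auto simp: composable_def dest!: subsetD[OF fs(2)] intro!: subsetD[OF ws] nth_mem)
 let ?A = "wsub T (length ws) fs w"
 show c': "composable T ?A ws" using words_wsub[OF w fs] ws by (auto simp: composable_def)
 show ar: "ars (map ((!) ws) fs) = map ((!) ns) fs" using fs ns by auto
 have fn: "set fs \<subseteq> {..<length ns}" using fs ns by simp
 have wg: "wgamma T w (map ((!) ws) fs) \<in> ops (length (block_map ns fs))"
  using wgamma_ops[OF c] unfolding ar length_block_map[OF fn] .
 let ?B = "wgamma T w (map ((!) ws) fs)"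
 show "wsub T (sum_list ns) (block_map ns fs) ?B = wgamma T ?A ws"
 proof (rule word_eqI[of _ "sum_list ns"])
  show "wsub T (sum_list ns) (block_map ns fs) ?B \<in> ops (sum_list ns)"
   by (rule wsub_ops[OF wg set_block_map[OF fn]])
  show "wgamma T ?A ws \<in> ops (sum_list ns)" using wgamma_ops[OF c'] ns by simp
  fix hs assume hs: "length hs = sum_list ns" "set hs \<subseteq> ops (sum_list ns)"
  let ?h = "map ((!) hs) (block_map ns fs)" and ?m = "sum_list ns"
  have h: "set ?h \<subseteq> ops ?m" using set_block_map[OF fn] hs by (auto simp: subset_iff)
  have "ap ?m (wsub T ?m (block_map ns fs) ?B) hs = ap ?m ?B ?h"
   using ap_wsub[OF wg, of hs ?m] set_block_map[OF fn] hs by simp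
  also have "\<dots> = ap ?m w (map2 (ap ?m) (map ((!) ws) fs) (blocks (map ((!) ns) fs) ?h))"
   using ap_wgamma[OF c _ h] length_block_map[OF fn] unfolding ar by simp
  also have "map2 (ap ?m) (map ((!) ws) fs) (blocks (map ((!) ns) fs) ?h) = map ((!) (map2 (ap ?m) ws (blocks ns hs))) fs"
   unfolding blocks_block_map[OF fn hs(1)] using fs ns by (auto intro!: nth_equalityI simp: subset_iff)
  also have "ap ?m w \<dots> = ap ?m ?A (map2 (ap ?m) ws (blocks ns hs))"
   using ap_wsub[of w fs "map2 (ap ?m) ws (blocks ns hs)" ?m] map2_ap_ops[OF ws, of hs ?m] hs words_hom[OF w] fs ns by simp
  also have "\<dots> = ap ?m (wgamma T ?A ws) hs" using ap_wgamma[OF c', of hs ?m] hs ns by simp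
  finally show "ap ?m (wsub T ?m (block_map ns fs) ?B) hs = ap ?m (wgamma T ?A ws) hs" .
 qed
qed

lemma wsub_wgamma_right:
 assumes c: "composable T w ws" and l: "length gss = length ws" "length ns = length ws"
  and g: "\<forall>i<length ws. length (gss ! i) = arity T (ws ! i) \<and> set (gss ! i) \<subseteq> {..<ns ! i}"
 defines "vs == map (\<lambda>i. wsub T (ns ! i) (gss ! i) (ws ! i)) [0..<length ws]"
 shows "composable T w vs" "ars vs = ns" "map length gss = ars ws"
  "wsub T (sum_list ns) (block_sum ns gss) (wgamma T w ws) = wgamma T w vs"
proof -
 have wi: "ws ! i \<in> words T" if "i < length ws" for i using composableD(4)[OF c] that by auto
 note v = words_wsub[OF wi g[rule_format, THEN conjunct1] g[rule_format, THEN conjunct2]]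
 show c': "composable T w vs" using v(1) composableD[OF c] by (auto simp: composable_def vs_def)
 show ar: "ars vs = ns" using v(2) l by (auto simp: vs_def intro!: nth_equalityI)
 show ar': "map length gss = ars ws" using g l by (auto intro!: nth_equalityI)
 have g': "\<forall>i<length ns. set (gss ! i) \<subseteq> {..<ns ! i}" using g l by auto
 have lg: "length gss = length ns" using l by simp
 note sb = set_block_sum[OF lg g']
 let ?A = "block_sum ns gss"
 have wg: "wgamma T w ws \<in> ops (length ?A)" using wgamma_ops[OF c] by (simp add: length_block_sum ar')
 show "wsub T (sum_list ns) ?A (wgamma T w ws) = wgamma T w vs"
 proof (rule word_eqI[of _ "sum_list ns"])
  show "wsub T (sum_list ns) ?A (wgamma T w ws) \<in> ops (sum_list ns)" by (rule wsub_ops[OF wg sb])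
  show "wgamma T w vs \<in> ops (sum_list ns)" using wgamma_ops[OF c'] ar by simp
  fix hs assume hs: "length hs = sum_list ns" "set hs \<subseteq> ops (sum_list ns)"
  let ?h = "map ((!) hs) ?A" and ?m = "sum_list ns"
  have h: "set ?h \<subseteq> ops ?m" using sb hs by (auto simp: subset_iff)
  have "ap ?m (wsub T ?m ?A (wgamma T w ws)) hs = ap ?m (wgamma T w ws) ?h"
   using ap_wsub[OF wg, of hs ?m] sb hs by simp
  also have "\<dots> = ap ?m w (map2 (ap ?m) ws (blocks (map length gss) ?h))"
   using ap_wgamma[OF c _ h] by (simp add: length_block_sum ar')
  also have "map2 (ap ?m) ws (blocks (map length gss) ?h) = map2 (ap ?m) vs (blocks ns hs)" (is "?L = ?R")
   unfolding blocks_block_sum[OF lg g' hs(1)]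
  proof (rule nth_equalityI)
   fix i assume "i < length (map2 (ap ?m) ws (map2 (\<lambda>gs ys. map ((!) ys) gs) gss (blocks ns hs)))"
   then have i: "i < length ws" by simp
   have "ap ?m (wsub T (ns ! i) (gss ! i) (ws ! i)) (blocks ns hs ! i) = ap ?m (ws ! i) (map ((!) (blocks ns hs ! i)) (gss ! i))"
    using ap_wsub[of "ws ! i" "gss ! i" "blocks ns hs ! i" ?m] words_hom[OF wi[OF i]] g[rule_format, OF i] i l hs set_blocks_nth[of i ns hs] by auto
   then show "map2 (ap ?m) ws (map2 (\<lambda>gs ys. map ((!) ys) gs) gss (blocks ns hs)) ! i = map2 (ap ?m) vs (blocks ns hs) ! i"
    using i l by (simp add: vs_def)
  qed (use l in \<open>simp add: vs_def\<close>)
  also have "ap ?m w \<dots> = ap ?m (wgamma T w vs) hs" using ap_wgamma[OF c', of hs ?m] hs ar by simp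
  finally show "ap ?m (wsub T ?m ?A (wgamma T w ws)) hs = ap ?m (wgamma T w vs) hs" .
 qed
qed

lemma wsub_wsub:
 assumes w: "w \<in> words T" and fs: "length fs = arity T w" "set fs \<subseteq> {..<length gs}" and gs: "set gs \<subseteq> {..<m}"
 shows "wsub T m gs (wsub T (length gs) fs w) = wsub T m (map ((!) gs) fs) w"
proof (rule word_eqI[of _ m])
 have w': "w \<in> ops (length fs)" "w \<in> ops (length (map ((!) gs) fs))" using words_hom[OF w] fs by auto
 have s: "set (map ((!) gs) fs) \<subseteq> {..<m}" using fs gs by (auto simp: subset_iff)
 note wf = wsub_ops[OF w'(1) fs(2)]
 show "wsub T m gs (wsub T (length gs) fs w) \<in> ops m" "wsub T m (map ((!) gs) fs) w \<in> ops m"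
  using wsub_ops[OF wf gs] wsub_ops[OF w'(2) s] by auto
 fix hs assume hs: "length hs = m" "set hs \<subseteq> ops m"
 have "set (map ((!) hs) gs) \<subseteq> ops m" using hs gs by (auto simp: subset_iff)
 moreover have e: "map ((!) (map ((!) hs) gs)) fs = map ((!) hs) (map ((!) gs) fs)" using fs by (auto simp: subset_iff)
 ultimately show "ap m (wsub T m gs (wsub T (length gs) fs w)) hs = ap m (wsub T m (map ((!) gs) fs) w) hs"
  using ap_wsub[OF wf, of hs m] ap_wsub[OF w'(1), of "map ((!) hs) gs" m] ap_wsub[OF w'(2), of hs m] s hs gs fs unfolding e by simp
qed

lemma wsub_id: "w \<in> words T ==> wsub T (arity T w) [0..<arity T w] w = w"
 using ap_id[OF words_hom] by (simp add: wsub_def ap_def)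

end

section \<open>Powers of categories\<close>

lemma pow_simps [simp]:
 "xs \<in> Obj (pow X n) \<longleftrightarrow> length xs = n \<and> set xs \<subseteq> Obj X"
 "fs \<in> Arr (pow X n) \<longleftrightarrow> length fs = n \<and> set fs \<subseteq> Arr X"
 "Dom (pow X n) = map (Dom X)" "Cod (pow X n) = map (Cod X)" "Ide (pow X n) = map (Ide X)"
 "Cmp (pow X n) = map2 (Cmp X)"
 by (auto simp: pow_def)

lemma hom_pow_iff: "fs \<in> hom (pow X n) xs ys \<longleftrightarrow> length fs = n \<and> length xs = n \<and> length ys = n \<and>
  (\<forall>i<n. fs ! i \<in> hom X (xs ! i) (ys ! i))"
 by (auto simp: hom_def list_eq_iff_nth_eq set_conv_nth)

lemma hom_powD: "fs \<in> hom (pow X n) xs ys ==> length fs = n \<and> set fs \<subseteq> Arr X \<and> xs = map (Dom X) fs \<and> ys = map (Cod X) fs"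
 by (auto simp: hom_def)

lemma category_pow: assumes "category X" shows "category (pow X n)"
proof -
 interpret category X by fact
 show ?thesis
 proof
  show "Dom (pow X n) fs \<in> Obj (pow X n)" "Cod (pow X n) fs \<in> Obj (pow X n)" if "fs \<in> Arr (pow X n)" for fs
   using that by (auto intro: Dom_Obj Cod_Obj)
  show "Ide (pow X n) xs \<in> hom (pow X n) xs xs" if "xs \<in> Obj (pow X n)" for xs
   unfolding hom_pow_iff using that Ide_hom by (auto simp: subset_iff)
  show "gs \<cdot>[pow X n] fs \<in> hom (pow X n) xs zs" if "fs \<in> hom (pow X n) xs ys" "gs \<in> hom (pow X n) ys zs" for fs gs xs ys zs
   using that unfolding hom_pow_iff by (auto intro: Cmp_hom)
  show "Ide (pow X n) ys \<cdot>[pow X n] fs = fs" "fs \<cdot>[pow X n] Ide (pow X n) xs = fs" if "fs \<in> hom (pow X n) xs ys" for fs xs ys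
   using that unfolding hom_pow_iff by (auto intro!: nth_equalityI simp: Cmp_Ide_left Cmp_Ide_right)
  show "hs \<cdot>[pow X n] (gs \<cdot>[pow X n] fs) = (hs \<cdot>[pow X n] gs) \<cdot>[pow X n] fs"
   if "fs \<in> hom (pow X n) us xs" "gs \<in> hom (pow X n) xs ys" "hs \<in> hom (pow X n) ys zs" for fs gs hs us xs ys zs
   using that unfolding hom_pow_iff by (auto intro!: nth_equalityI Cmp_assoc)
 qed
qed

lemma isos_powI:
 assumes "category X" "length fs = n" "length xs = n" "length ys = n" "\<And>i. i < n ==> fs ! i \<in> isos X (xs ! i) (ys ! i)"
 shows "fs \<in> isos (pow X n) xs ys"
proof (rule isosI[of _ _ _ _ "map (inv_arr X) fs"])
 show "fs \<in> hom (pow X n) xs ys" "map (inv_arr X) fs \<in> hom (pow X n) ys xs"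
  unfolding hom_pow_iff using assms inv_arr_hom isos_hom by fastforce+
 show "map (inv_arr X) fs \<cdot>[pow X n] fs = Ide (pow X n) xs" "fs \<cdot>[pow X n] map (inv_arr X) fs = Ide (pow X n) ys"
  using assms inv_arr_left inv_arr_right by (fastforce intro!: nth_equalityI)+
qed

lemma blocks_Obj: "xs \<in> Obj (pow X (sum_list ns)) ==> i < length ns ==> blocks ns xs ! i \<in> Obj (pow X (ns ! i))"
 using set_blocks_nth[of i ns xs] by auto

lemma blocks_hom:
 assumes "fs \<in> hom (pow X (sum_list ns)) xs ys" "i < length ns"
 shows "blocks ns fs ! i \<in> hom (pow X (ns ! i)) (blocks ns xs ! i) (blocks ns ys ! i)"
 using hom_powD[OF assms(1)] assms(2) set_blocks_nth[of i ns fs] by (auto simp: hom_def blocks_map)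

lemma blocks_Cmp:
 "length gs = length fs ==> i < length ns ==> blocks ns (map2 c gs fs) ! i = map2 c (blocks ns gs ! i) (blocks ns fs ! i)"
 by (simp add: blocks_nth take_map drop_map take_zip drop_zip)

lemma fo_powF [simp]: "xs \<in> Obj (pow A n) ==> fo (powF A n H) xs = map (fo H) xs"
 and fa_powF [simp]: "fs \<in> Arr (pow A n) ==> fa (powF A n H) fs = map (fa H) fs"
 and cmp_powN [simp]: "xs \<in> Obj (pow A n) ==> cmp (powN A n \<alpha>) xs = map (cmp \<alpha>) xs"
 and fo_prodF [simp]: "xs \<in> Obj (pow A (sum_list ns)) ==> fo (prodF A ns Fs) xs = map2 fo Fs (blocks ns xs)"
 and fa_prodF [simp]: "fs \<in> Arr (pow A (sum_list ns)) ==> fa (prodF A ns Fs) fs = map2 fa Fs (blocks ns fs)"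
 and cmp_prodN [simp]: "xs \<in> Obj (pow A (sum_list ns)) ==> cmp (prodN A ns \<alpha>s) xs = map2 cmp \<alpha>s (blocks ns xs)"
 and fo_subF [simp]: "xs \<in> Obj (pow A l) ==> fo (subF A l ks F) xs = fo F (map ((!) xs) ks)"
 and fa_subF [simp]: "fs \<in> Arr (pow A l) ==> fa (subF A l ks F) fs = fa F (map ((!) fs) ks)"
 and cmp_subN [simp]: "xs \<in> Obj (pow A l) ==> cmp (subN A l ks \<beta>) xs = cmp \<beta> (map ((!) xs) ks)"
 by (auto simp: powF_def powN_def prodF_def prodN_def subF_def subN_def simp del: pow_simps)

lemma src_tgt_simps [simp]:
 "src (powN A n \<alpha>) = powF A n (src \<alpha>)" "tgt (powN A n \<alpha>) = powF A n (tgt \<alpha>)"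
 "src (prodN A ns \<alpha>s) = prodF A ns (map src \<alpha>s)" "tgt (prodN A ns \<alpha>s) = prodF A ns (map tgt \<alpha>s)"
 "src (subN A l ks \<beta>) = subF A l ks (src \<beta>)" "tgt (subN A l ks \<beta>) = subF A l ks (tgt \<beta>)"
 by (auto simp: powN_def prodN_def subN_def)

lemma ext_simps:
 "fo (powF A n H) \<in> extensional (Obj (pow A n))" "fa (powF A n H) \<in> extensional (Arr (pow A n))"
 "fo (prodF A ns Fs) \<in> extensional (Obj (pow A (sum_list ns)))" "fa (prodF A ns Fs) \<in> extensional (Arr (pow A (sum_list ns)))"
 "fo (subF A l ks F) \<in> extensional (Obj (pow A l))" "fa (subF A l ks F) \<in> extensional (Arr (pow A l))"
 "fo (unitF A) \<in> extensional (Obj (pow A 1))" "fa (unitF A) \<in> extensional (Arr (pow A 1))"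
 "cmp (powN A n \<alpha>) \<in> extensional (Obj (pow A n))" "cmp (prodN A ns \<alpha>s) \<in> extensional (Obj (pow A (sum_list ns)))"
 "cmp (subN A l ks \<beta>) \<in> extensional (Obj (pow A l))"
 by (auto simp: powF_def powN_def prodF_def prodN_def subF_def subN_def unitF_def simp del: pow_simps)

lemma fo_unitF [simp]: "x \<in> Obj A ==> fo (unitF A) [x] = x"
 and fa_unitF [simp]: "f \<in> Arr A ==> fa (unitF A) [f] = f"
 by (auto simp: unitF_def)

lemma powF_functors:
 assumes "category A" "H \<in> functors A B" shows "powF A n H \<in> functors (pow A n) (pow B n)"
proof (rule functorsI)
 interpret category A by fact
 interpret P: category "pow A n" by (rule category_pow) fact
 show "fo (powF A n H) xs \<in> Obj (pow B n)" if "xs \<in> Obj (pow A n)" for xs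
  using that fun_fo[OF assms(2)] by auto
 show "fa (powF A n H) fs \<in> hom (pow B n) (fo (powF A n H) xs) (fo (powF A n H) ys)"
  if fs: "fs \<in> hom (pow A n) xs ys" for fs xs ys
  using fs homD(1)[OF fs] P.hom_Obj[OF fs] fun_fa[OF assms(2)]
  by (simp del: pow_simps) (auto simp: hom_pow_iff)
 show "fa (powF A n H) (Ide (pow A n) xs) = Ide (pow B n) (fo (powF A n H) xs)" if xs: "xs \<in> Obj (pow A n)" for xs
  using xs fun_Ide[OF assms(2)] homD(1)[OF P.Ide_hom[OF xs]] by (auto simp: subset_iff simp del: pow_simps(2))
 show "fa (powF A n H) (gs \<cdot>[pow A n] fs) = fa (powF A n H) gs \<cdot>[pow B n] fa (powF A n H) fs"
  if fs: "fs \<in> hom (pow A n) xs ys" and gs: "gs \<in> hom (pow A n) ys zs" for fs gs xs ys zs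
 proof -
  have "map (fa H) (map2 (Cmp A) gs fs) = map2 (Cmp B) (map (fa H) gs) (map (fa H) fs)"
   using fs gs by (auto simp: hom_pow_iff intro!: nth_equalityI fun_Cmp[OF assms(2)])
  then show ?thesis
   using homD(1)[OF fs] homD(1)[OF gs] homD(1)[OF P.Cmp_hom[OF fs gs]] by (simp del: pow_simps(1,2))
 qed
qed (auto simp: ext_simps)

lemma powN_hom:
 assumes "category A" "category B" "\<alpha> \<in> hom (fun_cat A B) F G"
 shows "powN A n \<alpha> \<in> hom (fun_cat (pow A n) (pow B n)) (powF A n F) (powF A n G)"
proof (rule nt_homI)
 interpret category A by fact
 note F = nt_homD(1,2)[OF assms(3)]
 show "powF A n F \<in> functors (pow A n) (pow B n)" "powF A n G \<in> functors (pow A n) (pow B n)"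
  using F assms(1) powF_functors by auto
 let ?A = "powN A n \<alpha>"
 show "cmp ?A xs \<in> hom (pow B n) (fo (powF A n F) xs) (fo (powF A n G) xs)" if "xs \<in> Obj (pow A n)" for xs
  using that nt_homD(6)[OF assms(3)] by (simp del: pow_simps) (auto simp: hom_pow_iff subset_iff)
 fix fs xs ys assume fs: "fs \<in> hom (pow A n) xs ys"
 have "map2 (Cmp B) (map (cmp \<alpha>) ys) (map (fa F) fs) = map2 (Cmp B) (map (fa G) fs) (map (cmp \<alpha>) xs)"
  using fs nt_homD(7)[OF assms(3)] by (auto simp: hom_pow_iff intro!: nth_equalityI)
 then show "cmp ?A ys \<cdot>[pow B n] fa (powF A n F) fs = fa (powF A n G) fs \<cdot>[pow B n] cmp ?A xs"
  using homD(1)[OF fs] category.hom_Obj[OF category_pow[OF assms(1)] fs] by (simp del: pow_simps(1,2))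
qed (use nt_homD[OF assms(3)] in \<open>auto simp: ext_simps\<close>)

lemma prodF_functors:
 assumes "category A" and l: "length Fs = length ns" and F: "\<forall>i<length ns. Fs ! i \<in> functors (pow A (ns ! i)) B"
 shows "prodF A ns Fs \<in> functors (pow A (sum_list ns)) (pow B (length ns))"
proof (rule functorsI)
 interpret category A by fact
 interpret P: category "pow A n" for n by (rule category_pow) fact
 let ?A = "pow A (sum_list ns)" and ?B = "pow B (length ns)"
 show "fo (prodF A ns Fs) xs \<in> Obj ?B" if xs: "xs \<in> Obj ?A" for xs
 proof -
  have "fo (Fs ! i) (blocks ns xs ! i) \<in> Obj B" if "i < length ns" for i
   using fun_fo[OF F[rule_format, OF that] blocks_Obj[OF xs that]] .
  then show ?thesis using xs l by (auto simp: set_conv_nth)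
 qed
 show "fa (prodF A ns Fs) fs \<in> hom ?B (fo (prodF A ns Fs) xs) (fo (prodF A ns Fs) ys)"
  if fs: "fs \<in> hom ?A xs ys" for fs xs ys
  using homD(1)[OF fs] P.hom_Obj[OF fs] fun_fa[OF F[rule_format] blocks_hom[OF fs]] l
  by (simp del: pow_simps) (auto simp: hom_pow_iff)
 show "fa (prodF A ns Fs) (Ide ?A xs) = Ide ?B (fo (prodF A ns Fs) xs)"
  if xs: "xs \<in> Obj ?A" for xs
  using xs fun_Ide[OF F[rule_format] blocks_Obj[OF xs]] homD(1)[OF P.Ide_hom[OF xs]] l
  by (auto simp: blocks_map simp del: pow_simps(1,2) intro!: nth_equalityI)
 show "fa (prodF A ns Fs) (gs \<cdot>[pow A (sum_list ns)] fs) = fa (prodF A ns Fs) gs \<cdot>[pow B (length ns)] fa (prodF A ns Fs) fs"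
  if fs: "fs \<in> hom ?A xs ys" and gs: "gs \<in> hom ?A ys zs" for fs gs xs ys zs
 proof -
  have "map2 fa Fs (blocks ns (map2 (Cmp A) gs fs)) = map2 (Cmp B) (map2 fa Fs (blocks ns gs)) (map2 fa Fs (blocks ns fs))"
   using l hom_powD[OF fs] hom_powD[OF gs] fun_Cmp[OF F[rule_format] blocks_hom[OF fs] blocks_hom[OF gs]]
   by (auto simp: blocks_Cmp intro!: nth_equalityI)
  then show ?thesis
   using homD(1)[OF fs] homD(1)[OF gs] homD(1)[OF P.Cmp_hom[OF fs gs]] by (simp del: pow_simps(1,2))
 qed
qed (auto simp: ext_simps)

lemma prodN_hom:
 assumes "category A" "category B" and l: "length \<alpha>s = length ns" "length Fs = length ns" "length Gs = length ns"
  and \<alpha>: "\<forall>i<length ns. \<alpha>s ! i \<in> hom (fun_cat (pow A (ns ! i)) B) (Fs ! i) (Gs ! i)"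
 shows "prodN A ns \<alpha>s \<in> hom (fun_cat (pow A (sum_list ns)) (pow B (length ns))) (prodF A ns Fs) (prodF A ns Gs)"
proof (rule nt_homI)
 note a = \<alpha>[rule_format]
 let ?A = "pow A (sum_list ns)" and ?C = "pow B (length ns)"
 show "prodF A ns Fs \<in> functors ?A ?C"
  "prodF A ns Gs \<in> functors ?A ?C"
  using nt_homD(1,2)[OF a] l assms(1) by (auto intro!: prodF_functors)
 have "map src \<alpha>s = Fs" "map tgt \<alpha>s = Gs" using nt_homD(3,4)[OF a] l by (auto intro!: nth_equalityI)
 then show "src (prodN A ns \<alpha>s) = prodF A ns Fs" "tgt (prodN A ns \<alpha>s) = prodF A ns Gs" by auto
 let ?B = "prodN A ns \<alpha>s"
 show "cmp ?B xs \<in> hom ?C (fo (prodF A ns Fs) xs) (fo (prodF A ns Gs) xs)"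
  if xs: "xs \<in> Obj ?A" for xs
  using xs nt_homD(6)[OF a blocks_Obj[OF xs]] l by (simp del: pow_simps) (auto simp: hom_pow_iff)
 fix fs xs ys assume fs: "fs \<in> hom ?A xs ys"
 have "map2 (Cmp B) (map2 cmp \<alpha>s (blocks ns ys)) (map2 fa Fs (blocks ns fs)) = map2 (Cmp B) (map2 fa Gs (blocks ns fs)) (map2 cmp \<alpha>s (blocks ns xs))"
  using l nt_homD(7)[OF a blocks_hom[OF fs]] by (auto intro!: nth_equalityI)
 then show "cmp ?B ys \<cdot>[pow B (length ns)] fa (prodF A ns Fs) fs
   = fa (prodF A ns Gs) fs \<cdot>[pow B (length ns)] cmp ?B xs"
  using homD(1)[OF fs] category.hom_Obj[OF category_pow[OF assms(1)] fs] by (simp del: pow_simps(1,2))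
qed (auto simp: ext_simps)

lemma gammaF_functors:
 assumes "category X" "length Fs = length ns" "\<forall>i<length ns. Fs ! i \<in> functors (pow X (ns ! i)) X"
  "F \<in> functors (pow X (length ns)) X"
 shows "gammaF X F ns Fs \<in> functors (pow X (sum_list ns)) X"
 unfolding gammaF_def by (rule compF_functors[OF category_pow[OF assms(1)] prodF_functors[OF assms(1-3)] assms(4)])

lemma gammaN_hom:
 assumes "category X" "length \<alpha>s = length ns" "length Fs = length ns" "length Gs = length ns"
  and \<alpha>: "\<forall>i<length ns. \<alpha>s ! i \<in> hom (opcat X (ns ! i)) (Fs ! i) (Gs ! i)"
  and \<beta>: "\<beta> \<in> hom (opcat X (length ns)) F G"
 shows "gammaN X \<beta> ns \<alpha>s \<in> hom (opcat X (sum_list ns)) (gammaF X F ns Fs) (gammaF X G ns Gs)"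
 unfolding gammaF_def gammaN_def by (rule hcomp_hom[OF category_pow[OF assms(1)] assms(1) prodN_hom[OF assms(1,1-5)] \<beta>])

lemma map_nth_Obj: "xs \<in> Obj (pow X l) ==> set ks \<subseteq> {..<l} ==> map ((!) xs) ks \<in> Obj (pow X (length ks))"
 by (auto simp: subset_iff)

lemma map_nth_hom: "fs \<in> hom (pow X l) xs ys ==> set ks \<subseteq> {..<l} ==>
  map ((!) fs) ks \<in> hom (pow X (length ks)) (map ((!) xs) ks) (map ((!) ys) ks)"
 unfolding hom_pow_iff by (simp add: subset_iff)

lemma map_nth_map2: "set ks \<subseteq> {..<length xs} ==> length ys = length xs ==>
  map ((!) (map2 c xs ys)) ks = map2 c (map ((!) xs) ks) (map ((!) ys) ks)"
 by (auto intro!: nth_equalityI simp: subset_iff)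

lemma subF_functors:
 assumes "category X" "F \<in> functors (pow X (length ks)) B" "set ks \<subseteq> {..<l}"
 shows "subF X l ks F \<in> functors (pow X l) B"
proof (rule functorsI)
 interpret P: category "pow X n" for n by (rule category_pow) fact
 show "fo (subF X l ks F) xs \<in> Obj B" if "xs \<in> Obj (pow X l)" for xs
  using fun_fo[OF assms(2) map_nth_Obj[OF that assms(3)]] that by (simp del: pow_simps)
 show "fa (subF X l ks F) fs \<in> hom B (fo (subF X l ks F) xs) (fo (subF X l ks F) ys)"
  if fs: "fs \<in> hom (pow X l) xs ys" for fs xs ys
  using fun_fa[OF assms(2) map_nth_hom[OF fs assms(3)]] homD(1)[OF fs] P.hom_Obj[OF fs] by (simp del: pow_simps)
 show "fa (subF X l ks F) (Ide (pow X l) xs) = Ide B (fo (subF X l ks F) xs)" if xs: "xs \<in> Obj (pow X l)" for xs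
 proof -
  have "map ((!) (map (Ide X) xs)) ks = map (Ide X) (map ((!) xs) ks)" using xs assms(3) by (auto simp: subset_iff)
  then show ?thesis
   using fun_Ide[OF assms(2) map_nth_Obj[OF xs assms(3)]] homD(1)[OF P.Ide_hom[OF xs]] xs
   by (simp del: pow_simps(1,2) map_map)
 qed
 show "fa (subF X l ks F) (gs \<cdot>[pow X l] fs) = fa (subF X l ks F) gs \<cdot>[B] fa (subF X l ks F) fs"
  if fs: "fs \<in> hom (pow X l) xs ys" and gs: "gs \<in> hom (pow X l) ys zs" for fs gs xs ys zs
  using fun_Cmp[OF assms(2) map_nth_hom[OF fs assms(3)] map_nth_hom[OF gs assms(3)]]
   homD(1)[OF fs] homD(1)[OF gs] homD(1)[OF P.Cmp_hom[OF fs gs]] map_nth_map2[of ks gs fs "Cmp X"] hom_powD[OF fs] hom_powD[OF gs] assms(3)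
  by (simp del: pow_simps(1,2))
qed (auto simp: ext_simps)

lemma subN_hom:
 assumes "category X" "set ks \<subseteq> {..<l}" "\<alpha> \<in> hom (fun_cat (pow X (length ks)) B) F G"
 shows "subN X l ks \<alpha> \<in> hom (fun_cat (pow X l) B) (subF X l ks F) (subF X l ks G)"
proof (rule nt_homI)
 show "subF X l ks F \<in> functors (pow X l) B" "subF X l ks G \<in> functors (pow X l) B"
  using subF_functors[OF assms(1)] assms(2) nt_homD(1,2)[OF assms(3)] by auto
 let ?A = "subN X l ks \<alpha>"
 show "cmp ?A xs \<in> hom B (fo (subF X l ks F) xs) (fo (subF X l ks G) xs)" if "xs \<in> Obj (pow X l)" for xs
  using nt_homD(6)[OF assms(3) map_nth_Obj[OF that assms(2)]] that by (simp del: pow_simps)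
 show "cmp ?A ys \<cdot>[B] fa (subF X l ks F) fs = fa (subF X l ks G) fs \<cdot>[B] cmp ?A xs"
  if fs: "fs \<in> hom (pow X l) xs ys" for fs xs ys
  using nt_homD(7)[OF assms(3) map_nth_hom[OF fs assms(2)]] homD(1)[OF fs] category.hom_Obj[OF category_pow[OF assms(1)] fs]
  by (simp del: pow_simps)
qed (use nt_homD[OF assms(3)] in \<open>auto simp: ext_simps\<close>)

lemma unitF_functors: assumes "category X" shows "unitF X \<in> functors (pow X 1) X"
proof (rule functorsI)
 interpret category X by fact
 show "fo (unitF X) xs \<in> Obj X" if "xs \<in> Obj (pow X 1)" for xs using that by (cases xs) auto
 show "fa (unitF X) fs \<in> hom X (fo (unitF X) xs) (fo (unitF X) ys)" if "fs \<in> hom (pow X 1) xs ys" for fs xs ys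
  using hom_powD[OF that] Arr_hom[of _ X] Dom_Obj Cod_Obj by (cases fs) auto
 show "fa (unitF X) (Ide (pow X 1) xs) = Ide X (fo (unitF X) xs)" if "xs \<in> Obj (pow X 1)" for xs
  using that Ide_hom[THEN homD(1)] by (cases xs) auto
 show "fa (unitF X) (gs \<cdot>[pow X 1] fs) = fa (unitF X) gs \<cdot>[X] fa (unitF X) fs"
  if "fs \<in> hom (pow X 1) xs ys" "gs \<in> hom (pow X 1) ys zs" for fs gs xs ys zs
  using hom_powD[OF that(1)] hom_powD[OF that(2)] Cmp_Arr(1) by (cases fs; cases gs) auto
qed (rule ext_simps)+

text \<open>Together with \<open>unitF_powF\<close> and \<open>subF_powF\<close> this identifies the
  targets of the two sides of the laws for morphisms of algebras, which has to be done before their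
  components can be compared.\<close>

lemma gammaF_powF:
 assumes "length Fs = length ns" "H \<in> functors A B"
 shows "compF (pow A (sum_list ns)) (gammaF B F ns Fs) (powF A (sum_list ns) H)
  = compF (pow A (sum_list ns)) F (prodF A ns (map2 (\<lambda>n G. compF (pow A n) G (powF A n H)) ns Fs))"
proof (rule func_eqI'[OF compF_ext(1) compF_ext(1) compF_ext(2) compF_ext(2)])
 let ?A = "pow A (sum_list ns)"
 fix xs assume xs: "xs \<in> Obj ?A"
 have "map2 fo Fs (blocks ns (map (fo H) xs)) = map2 fo (map2 (\<lambda>n G. compF (pow A n) G (powF A n H)) ns Fs) (blocks ns xs)"
  using assms blocks_Obj[OF xs] by (auto simp: blocks_map intro!: nth_equalityI simp del: pow_simps)
 moreover have "map (fo H) xs \<in> Obj (pow B (sum_list ns))" using xs fun_fo[OF assms(2)] by auto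
 ultimately show "fo (compF ?A (gammaF B F ns Fs) (powF A (sum_list ns) H)) xs
  = fo (compF ?A F (prodF A ns (map2 (\<lambda>n G. compF (pow A n) G (powF A n H)) ns Fs))) xs"
  using xs by (simp add: gammaF_def del: pow_simps)
next
 let ?B = "pow A (sum_list ns)"
 fix fs assume fs: "fs \<in> Arr ?B"
 have bl: "blocks ns fs ! i \<in> Arr (pow A (ns ! i))" if "i < length ns" for i
  using homD(1)[OF blocks_hom[OF Arr_hom[OF fs] that]] .
 have "map2 fa Fs (blocks ns (map (fa H) fs)) = map2 fa (map2 (\<lambda>n G. compF (pow A n) G (powF A n H)) ns Fs) (blocks ns fs)"
  using assms bl by (auto simp: blocks_map intro!: nth_equalityI simp del: pow_simps)
 moreover have "map (fa H) fs \<in> Arr (pow B (sum_list ns))" using fs fun_Arr[OF assms(2)] by auto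
 ultimately show "fa (compF ?B (gammaF B F ns Fs) (powF A (sum_list ns) H)) fs
  = fa (compF ?B F (prodF A ns (map2 (\<lambda>n G. compF (pow A n) G (powF A n H)) ns Fs))) fs"
  using fs by (simp add: gammaF_def del: pow_simps)
qed

lemma unitF_powF:
 assumes "H \<in> functors A B"
 shows "compF (pow A 1) (unitF B) (powF A 1 H) = compF (pow A 1) H (unitF A)"
proof (rule func_eqI'[OF compF_ext(1) compF_ext(1) compF_ext(2) compF_ext(2)])
 let ?A = "compF (pow A 1) (unitF B) (powF A 1 H)"
 show "fo ?A xs = fo (compF (pow A 1) H (unitF A)) xs" if "xs \<in> Obj (pow A 1)" for xs
  using that fun_fo[OF assms] by (cases xs) auto
 show "fa ?A xs = fa (compF (pow A 1) H (unitF A)) xs" if "xs \<in> Arr (pow A 1)" for xs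
  using that fun_Arr[OF assms] by (cases xs) auto
qed

lemma subF_powF:
 assumes "H \<in> functors A B" "set ks \<subseteq> {..<l}"
 shows "compF (pow A l) (subF B l ks F) (powF A l H) = subF A l ks (compF (pow A (length ks)) F (powF A (length ks) H))"
proof (rule func_eqI'[OF compF_ext(1) ext_simps(5) compF_ext(2) ext_simps(6)])
 let ?A = "subF A l ks (compF (pow A (length ks)) F (powF A (length ks) H))" and ?B = "compF (pow A l) (subF B l ks F) (powF A l H)"
 show "fo ?B xs = fo ?A xs"
  if xs: "xs \<in> Obj (pow A l)" for xs
 proof -
  have "map ((!) (map (fo H) xs)) ks = map (fo H) (map ((!) xs) ks)" using xs assms(2) by (auto simp: subset_iff)
  moreover have "map (fo H) xs \<in> Obj (pow B l)" using xs fun_fo[OF assms(1)] by auto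
  ultimately show ?thesis using xs map_nth_Obj[OF xs assms(2)] by (simp del: pow_simps map_map)
 qed
 show "fa ?B xs = fa ?A xs"
  if xs: "xs \<in> Arr (pow A l)" for xs
 proof -
  have "map ((!) (map (fa H) xs)) ks = map (fa H) (map ((!) xs) ks)" using xs assms(2) by (auto simp: subset_iff)
  moreover have "map (fa H) xs \<in> Arr (pow B l)" using xs fun_Arr[OF assms(1)] by auto
  moreover have "map ((!) xs) ks \<in> Arr (pow A (length ks))" using xs assms(2) by (auto simp: subset_iff)
  ultimately show ?thesis using xs by (simp del: pow_simps map_map)
 qed
qed

section \<open>Substitution laws for functors on powers\<close>

text \<open>Only functors on powers are assumed. So the laws of the endomorphism theory are
  available for the syntactic category before it is known to be an algebra.\<close>

locale operations =
 fixes X :: "('o, 'a) cat" and ar :: "'w => nat" and ph :: "'w => ('o list, 'a list, 'o, 'a) func" and V :: "'w set"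
 assumes catX: "category X" and ph: "v \<in> V ==> ph v \<in> functors (pow X (ar v)) X"
begin

lemma map2_ph_Obj:
 assumes "set ws \<subseteq> V" "xs \<in> Obj (pow X (sum_list (map ar ws)))"
 shows "map2 (\<lambda>v. fo (ph v)) ws (blocks (map ar ws) xs) \<in> Obj (pow X (length ws))"
proof -
 have "fo (ph (ws ! i)) (blocks (map ar ws) xs ! i) \<in> Obj X" if "i < length ws" for i
  using fun_fo[OF ph[OF subsetD[OF assms(1) nth_mem[OF that]]]] blocks_Obj[OF assms(2), of i] that by simp
 then show ?thesis by (auto simp: set_conv_nth)
qed

lemma map2_ph_hom:
 assumes "set ws \<subseteq> V" "fs \<in> hom (pow X (sum_list (map ar ws))) xs ys"
 shows "map2 (\<lambda>v. fa (ph v)) ws (blocks (map ar ws) fs) \<in> hom (pow X (length ws))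
   (map2 (\<lambda>v. fo (ph v)) ws (blocks (map ar ws) xs)) (map2 (\<lambda>v. fo (ph v)) ws (blocks (map ar ws) ys))"
proof -
 have "fa (ph (ws ! i)) (blocks (map ar ws) fs ! i) \<in> hom X (fo (ph (ws ! i)) (blocks (map ar ws) xs ! i)) (fo (ph (ws ! i)) (blocks (map ar ws) ys ! i))"
  if "i < length ws" for i
  using fun_fa[OF ph[OF subsetD[OF assms(1) nth_mem[OF that]]]] blocks_hom[OF assms(2), of i] that by simp
 then show ?thesis unfolding hom_pow_iff by simp
qed

lemma map2_ph_Arr:
 assumes "set ws \<subseteq> V" "fs \<in> Arr (pow X (sum_list (map ar ws)))"
 shows "map2 (\<lambda>v. fa (ph v)) ws (blocks (map ar ws) fs) \<in> Arr (pow X (length ws))"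
 using homD(1)[OF map2_ph_hom[OF assms(1) Arr_hom[OF assms(2)]]] .

lemma fo_gammaF_ph: "xs \<in> Obj (pow X (sum_list (map ar ws))) ==>
  fo (gammaF X F (map ar ws) (map ph ws)) xs = fo F (map2 (\<lambda>v. fo (ph v)) ws (blocks (map ar ws) xs))"
 by (auto simp: gammaF_def simp del: pow_simps intro!: arg_cong[of _ _ "fo F"] arg_cong[of _ _ "fa F"] nth_equalityI)

lemma fa_gammaF_ph: "fs \<in> Arr (pow X (sum_list (map ar ws))) ==>
  fa (gammaF X F (map ar ws) (map ph ws)) fs = fa F (map2 (\<lambda>v. fa (ph v)) ws (blocks (map ar ws) fs))"
 by (auto simp: gammaF_def simp del: pow_simps intro!: arg_cong[of _ _ "fo F"] arg_cong[of _ _ "fa F"] nth_equalityI)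

lemma gammaF_ph_functors:
 assumes "set ws \<subseteq> V" "F \<in> functors (pow X (length ws)) X"
 shows "gammaF X F (map ar ws) (map ph ws) \<in> functors (pow X (sum_list (map ar ws))) X"
 by (rule gammaF_functors[OF catX]) (use assms ph in \<open>auto simp: subset_iff\<close>)

text \<open>Counterpart of \<open>wgamma_assoc\<close> for functors: it makes the targets of the two
  sides of the associativity axiom agree. The laws below have the same role for the other
  axioms.\<close>

lemma gammaF_assoc:
 assumes ws: "set ws \<subseteq> V" and wss: "set (concat wss) \<subseteq> V" and l: "map length wss = map ar ws"
  and F: "F \<in> functors (pow X (length ws)) X"
 shows "gammaF X (gammaF X F (map ar ws) (map ph ws)) (map ar (concat wss)) (map ph (concat wss))
  = gammaF X F (map (\<lambda>vs. sum_list (map ar vs)) wss) (map2 (\<lambda>v vs. gammaF X (ph v) (map ar vs) (map ph vs)) ws wss)"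
  (is "?L = ?R")
proof -
 have ln: "length wss = length ws" using l by (metis length_map)
 have li: "length (wss ! i) = ar (ws ! i)" if "i < length ws" for i using l that ln by (metis nth_map)
 have wi: "set (wss ! i) \<subseteq> V" if "i < length ws" for i proof -
  have "wss ! i \<in> set wss" using that ln by simp
  then show ?thesis using wss by auto
 qed
 have wv: "ws ! i \<in> V" if "i < length ws" for i using subsetD[OF ws nth_mem[OF that]] .
 let ?A = "map ar (concat wss)"
 have sl: "sum_list ?A = sum_list (map (\<lambda>vs. sum_list (map ar vs)) wss)"
  by (induction wss) auto
 have sw: "length (concat wss) = sum_list (map ar ws)" using l by (simp add: length_concat)
 have L: "?L \<in> functors (pow X (sum_list ?A)) X"
  by (rule gammaF_ph_functors[OF wss]) (use gammaF_ph_functors[OF ws F] sw in simp)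
 have "gammaF X F (map (\<lambda>vs. sum_list (map ar vs)) wss) (map2 (\<lambda>v vs. gammaF X (ph v) (map ar vs) (map ph vs)) ws wss)
   \<in> functors (pow X (sum_list (map (\<lambda>vs. sum_list (map ar vs)) wss))) X"
 proof (rule gammaF_functors[OF catX])
  show "\<forall>i<length (map (\<lambda>vs. sum_list (map ar vs)) wss). map2 (\<lambda>v vs. gammaF X (ph v) (map ar vs) (map ph vs)) ws wss ! i
    \<in> functors (pow X (map (\<lambda>vs. sum_list (map ar vs)) wss ! i)) X"
  proof (intro allI impI)
   fix i assume "i < length (map (\<lambda>vs. sum_list (map ar vs)) wss)"
   then have i: "i < length ws" using ln by simp
   have "ph (ws ! i) \<in> functors (pow X (length (wss ! i))) X" using ph[OF wv[OF i]] li[OF i] by simp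
   from gammaF_ph_functors[OF wi[OF i] this] show "map2 (\<lambda>v vs. gammaF X (ph v) (map ar vs) (map ph vs)) ws wss ! i
    \<in> functors (pow X (map (\<lambda>vs. sum_list (map ar vs)) wss ! i)) X" using i ln by simp
  qed
 qed (use F ln in auto)
 note R = this[folded sl]
 show ?thesis
 proof (rule func_eqI[OF L R])
  fix xs assume xs: "xs \<in> Obj (pow X (sum_list ?A))"
  note xs' = xs[unfolded sl]
  have y: "map2 (\<lambda>v. fo (ph v)) (concat wss) (blocks ?A xs) \<in> Obj (pow X (sum_list (map ar ws)))"
   using map2_ph_Obj[OF wss xs] sw by simp
  have "fo (gammaF X (ph (ws ! i)) (map ar (wss ! i)) (map ph (wss ! i))) (blocks (map (\<lambda>vs. sum_list (map ar vs)) wss) xs ! i)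
    = fo (ph (ws ! i)) (map2 (\<lambda>v. fo (ph v)) (wss ! i) (blocks (map ar (wss ! i)) (blocks (map (\<lambda>vs. sum_list (map ar vs)) wss) xs ! i)))"
   if "i < length ws" for i using fo_gammaF_ph[of "blocks (map (\<lambda>vs. sum_list (map ar vs)) wss) xs ! i" "wss ! i"] blocks_Obj[OF xs', of i] that ln by simp
  then have "map2 (\<lambda>v. fo (ph v)) ws (blocks (map length wss) (map2 (\<lambda>v. fo (ph v)) (concat wss) (blocks ?A xs)))
   = map2 fo (map2 (\<lambda>v vs. gammaF X (ph v) (map ar vs) (map ph vs)) ws wss) (blocks (map (\<lambda>vs. sum_list (map ar vs)) wss) xs)"
   unfolding blocks_assoc using ln by (auto intro!: nth_equalityI)
  then show "fo ?L xs = fo ?R xs"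
   unfolding fo_gammaF_ph[OF xs] fo_gammaF_ph[OF y] unfolding l[symmetric] using xs'
   by (simp add: gammaF_def del: pow_simps)
 next
  fix xs assume xs: "xs \<in> Arr (pow X (sum_list ?A))"
  note xs' = xs[unfolded sl]
  have y: "map2 (\<lambda>v. fa (ph v)) (concat wss) (blocks ?A xs) \<in> Arr (pow X (sum_list (map ar ws)))"
   using map2_ph_Arr[OF wss xs] sw by simp
  have "fa (gammaF X (ph (ws ! i)) (map ar (wss ! i)) (map ph (wss ! i))) (blocks (map (\<lambda>vs. sum_list (map ar vs)) wss) xs ! i)
    = fa (ph (ws ! i)) (map2 (\<lambda>v. fa (ph v)) (wss ! i) (blocks (map ar (wss ! i)) (blocks (map (\<lambda>vs. sum_list (map ar vs)) wss) xs ! i)))"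
   if "i < length ws" for i using fa_gammaF_ph[of "blocks (map (\<lambda>vs. sum_list (map ar vs)) wss) xs ! i" "wss ! i"]
    homD(1)[OF blocks_hom[OF Arr_hom[OF xs'], of i]] that ln by simp
  then have "map2 (\<lambda>v. fa (ph v)) ws (blocks (map length wss) (map2 (\<lambda>v. fa (ph v)) (concat wss) (blocks ?A xs)))
   = map2 fa (map2 (\<lambda>v vs. gammaF X (ph v) (map ar vs) (map ph vs)) ws wss) (blocks (map (\<lambda>vs. sum_list (map ar vs)) wss) xs)"
   unfolding blocks_assoc using ln by (auto intro!: nth_equalityI)
  then show "fa ?L xs = fa ?R xs"
   unfolding fa_gammaF_ph[OF xs] fa_gammaF_ph[OF y] unfolding l[symmetric] using xs'
   by (simp add: gammaF_def del: pow_simps)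
 qed
qed

lemma gammaF_unit_right:
 assumes F: "F \<in> functors (pow X n) X"
 shows "gammaF X F (replicate n 1) (replicate n (unitF X)) = F"
proof -
 have s: "sum_list (replicate n (1 :: nat)) = n" by (simp add: sum_list_replicate)
 let ?A = "replicate n (unitF X)"
 have G: "gammaF X F (replicate n 1) ?A \<in> functors (pow X n) X"
  using gammaF_functors[OF catX, of "replicate n (unitF X)" "replicate n 1" F] F unitF_functors[OF catX] unfolding s by simp
 show ?thesis
 proof (rule func_eqI[OF G F])
  fix xs assume xs: "xs \<in> Obj (pow X n)"
  have "map2 fo ?A (map (\<lambda>x. [x]) xs) = xs" using xs by (auto intro!: nth_equalityI simp: subset_iff)
  then show "fo (gammaF X F (replicate n 1) ?A) xs = fo F xs"
   using xs s by (simp add: gammaF_def blocks_replicate)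
 next
  fix xs assume xs: "xs \<in> Arr (pow X n)"
  have "map2 fa ?A (map (\<lambda>x. [x]) xs) = xs" using xs by (auto intro!: nth_equalityI simp: subset_iff)
  then show "fa (gammaF X F (replicate n 1) ?A) xs = fa F xs"
   using xs s by (simp add: gammaF_def blocks_replicate)
 qed
qed

lemma gammaF_unit_left:
 assumes F: "F \<in> functors (pow X n) X"
 shows "gammaF X (unitF X) [n] [F] = F"
proof -
 have G: "gammaF X (unitF X) [n] [F] \<in> functors (pow X n) X"
  using gammaF_functors[OF catX, of "[F]" "[n]" "unitF X"] F unitF_functors[OF catX] by simp
 show ?thesis
  by (rule func_eqI[OF G F]) (use fun_fo[OF F] fun_Arr[OF F] in \<open>auto simp: gammaF_def\<close>)
qed

lemma subF_gammaF_left: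
 assumes ws: "set ws \<subseteq> V" and fs: "set fs \<subseteq> {..<length ws}" and F: "F \<in> functors (pow X (length fs)) X"
  and ns: "ns = map ar ws"
 shows "subF X (sum_list ns) (block_map ns fs) (gammaF X F (map ar (map ((!) ws) fs)) (map ph (map ((!) ws) fs)))
  = gammaF X (subF X (length ws) fs F) ns (map ph ws)" (is "?L = ?R")
proof -
 have fn: "set fs \<subseteq> {..<length ns}" using fs ns by simp
 have ar: "map ar (map ((!) ws) fs) = map ((!) ns) fs" using fs ns by auto
 have ws': "set (map ((!) ws) fs) \<subseteq> V" by (auto dest!: subsetD[OF fs] intro!: subsetD[OF ws] nth_mem)
 let ?A = "pow X (sum_list ns)" and ?B = "map ar (map ((!) ws) fs)"
 have L: "?L \<in> functors ?A X"
  using subF_functors[OF catX, of "gammaF X F ?B (map ph (map ((!) ws) fs))" "block_map ns fs" X "sum_list ns"]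
   gammaF_ph_functors[OF ws', of F] F set_block_map[OF fn] unfolding length_block_map[OF fn] ar by simp
 have R: "?R \<in> functors ?A X"
  unfolding ns by (rule gammaF_ph_functors[OF ws subF_functors[OF catX F fs]])
 show ?thesis
 proof (rule func_eqI[OF L R])
  fix xs assume xs: "xs \<in> Obj ?A"
  have h: "map ((!) xs) (block_map ns fs) \<in> Obj (pow X (sum_list ?B))"
   using map_nth_Obj[OF xs set_block_map[OF fn]] unfolding length_block_map[OF fn] ar .
  have m: "map2 (\<lambda>v. fo (ph v)) (map ((!) ws) fs) (map ((!) (blocks ns xs)) fs) = map ((!) (map2 (\<lambda>v. fo (ph v)) ws (blocks ns xs))) fs"
   using fs ns by (auto intro!: nth_equalityI simp: subset_iff)
  have xl: "length xs = sum_list ns" using xs by simp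
  show "fo ?L xs = fo ?R xs"
   using fo_gammaF_ph[OF h, of F] fo_gammaF_ph[OF xs[unfolded ns], of "subF X (length ws) fs F"] xs
    map2_ph_Obj[OF ws xs[unfolded ns]] m
   unfolding ar blocks_block_map[OF fn xl] unfolding ns[symmetric] by (simp del: pow_simps map_map)
 next
  fix xs assume xs: "xs \<in> Arr ?A"
  have h: "map ((!) xs) (block_map ns fs) \<in> Arr (pow X (sum_list ?B))"
   using homD(1)[OF map_nth_hom[OF Arr_hom[OF xs] set_block_map[OF fn]]] unfolding length_block_map[OF fn] ar .
  have m: "map2 (\<lambda>v. fa (ph v)) (map ((!) ws) fs) (map ((!) (blocks ns xs)) fs) = map ((!) (map2 (\<lambda>v. fa (ph v)) ws (blocks ns xs))) fs"
   using fs ns by (auto intro!: nth_equalityI simp: subset_iff)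
  have xl: "length xs = sum_list ns" using xs by simp
  show "fa ?L xs = fa ?R xs"
   using fa_gammaF_ph[OF h, of F] fa_gammaF_ph[OF xs[unfolded ns], of "subF X (length ws) fs F"] xs
    map2_ph_Arr[OF ws xs[unfolded ns]] m
   unfolding ar blocks_block_map[OF fn xl] unfolding ns[symmetric] by (simp del: pow_simps map_map)
 qed
qed

lemma subF_gammaF_right:
 assumes ws: "set ws \<subseteq> V" and F: "F \<in> functors (pow X (length ws)) X"
  and l: "length gss = length ws" "length ns = length ws"
  and g: "\<forall>i<length ws. length (gss ! i) = ar (ws ! i) \<and> set (gss ! i) \<subseteq> {..<ns ! i}"
 shows "subF X (sum_list ns) (block_sum ns gss) (gammaF X F (map ar ws) (map ph ws))
  = gammaF X F ns (map (\<lambda>i. subF X (ns ! i) (gss ! i) (ph (ws ! i))) [0..<length ws])" (is "?L = ?R")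
proof -
 have ar': "map length gss = map ar ws" using g l by (auto intro!: nth_equalityI)
 have lg: "length gss = length ns" using l by simp
 have g': "\<forall>i<length ns. set (gss ! i) \<subseteq> {..<ns ! i}" using g l by auto
 note sb = set_block_sum[OF lg g']
 have lb: "length (block_sum ns gss) = sum_list (map ar ws)" by (simp add: length_block_sum ar')
 have L: "?L \<in> functors (pow X (sum_list ns)) X"
  using subF_functors[OF catX _ sb] gammaF_ph_functors[OF ws F] lb by simp
 have wv: "ws ! i \<in> V" if "i < length ws" for i using subsetD[OF ws nth_mem[OF that]] .
 have R: "?R \<in> functors (pow X (sum_list ns)) X"
 proof (rule gammaF_functors[OF catX])
  show "\<forall>i<length ns. map (\<lambda>i. subF X (ns ! i) (gss ! i) (ph (ws ! i))) [0..<length ws] ! i \<in> functors (pow X (ns ! i)) X"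
   using l g ph[OF wv] by (auto intro!: subF_functors[OF catX])
 qed (use l F in auto)
 show ?thesis
 proof (rule func_eqI[OF L R])
  fix xs assume xs: "xs \<in> Obj (pow X (sum_list ns))"
  have h: "map ((!) xs) (block_sum ns gss) \<in> Obj (pow X (sum_list (map ar ws)))"
   using map_nth_Obj[OF xs sb] unfolding lb .
  have xl: "length xs = sum_list ns" using xs by simp
  have "map2 (\<lambda>v. fo (ph v)) ws (map2 (\<lambda>gs ys. map ((!) ys) gs) gss (blocks ns xs))
   = map2 fo (map (\<lambda>i. subF X (ns ! i) (gss ! i) (ph (ws ! i))) [0..<length ws]) (blocks ns xs)"
   using l blocks_Obj[OF xs] by (auto intro!: nth_equalityI simp del: pow_simps)
  then show "fo ?L xs = fo ?R xs"
   using fo_gammaF_ph[OF h, of F] xs unfolding ar'[symmetric] blocks_block_sum[OF lg g' xl] by (simp add: gammaF_def del: pow_simps)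
 next
  fix xs assume xs: "xs \<in> Arr (pow X (sum_list ns))"
  have h: "map ((!) xs) (block_sum ns gss) \<in> Arr (pow X (sum_list (map ar ws)))"
   using homD(1)[OF map_nth_hom[OF Arr_hom[OF xs] sb]] unfolding lb .
  have xl: "length xs = sum_list ns" using xs by simp
  have "map2 (\<lambda>v. fa (ph v)) ws (map2 (\<lambda>gs ys. map ((!) ys) gs) gss (blocks ns xs))
   = map2 fa (map (\<lambda>i. subF X (ns ! i) (gss ! i) (ph (ws ! i))) [0..<length ws]) (blocks ns xs)"
   using l homD(1)[OF blocks_hom[OF Arr_hom[OF xs]]] by (auto intro!: nth_equalityI simp del: pow_simps)
  then show "fa ?L xs = fa ?R xs"
   using fa_gammaF_ph[OF h, of F] xs unfolding ar'[symmetric] blocks_block_sum[OF lg g' xl] by (simp add: gammaF_def del: pow_simps)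
 qed
qed

lemma subF_subF:
 assumes "F \<in> functors (pow X (length fs)) X" and fs: "set fs \<subseteq> {..<length gs}" and gs: "set gs \<subseteq> {..<m}"
 shows "subF X m gs (subF X (length gs) fs F) = subF X m (map ((!) gs) fs) F"
proof (rule func_eqI'[OF ext_simps(5) ext_simps(5) ext_simps(6) ext_simps(6)])
 have e: "map ((!) (map ((!) xs) gs)) fs = map ((!) xs) (map ((!) gs) fs)" for xs :: "'x list" using fs by (auto simp: subset_iff)
 let ?A = "subF X m gs (subF X (length gs) fs F)"
 show "fo ?A xs = fo (subF X m (map ((!) gs) fs) F) xs" if "xs \<in> Obj (pow X m)" for xs
  using map_nth_Obj[OF that gs] that e[of xs] by (simp del: pow_simps map_map)
 show "fa ?A xs = fa (subF X m (map ((!) gs) fs) F) xs" if "xs \<in> Arr (pow X m)" for xs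
  using homD(1)[OF map_nth_hom[OF Arr_hom[OF that] gs]] that e[of xs] by (simp del: pow_simps map_map)
qed

lemma subF_id:
 assumes F: "F \<in> functors (pow X n) X" shows "subF X n [0..<n] F = F"
proof (rule func_eqI[OF _ F])
 show "subF X n [0..<n] F \<in> functors (pow X n) X" using subF_functors[OF catX, of F "[0..<n]" X n] F by (auto simp: lessThan_atLeast0)
qed (auto simp: map_nth)

end

section \<open>Algebras and their morphisms in components\<close>

context lawvere_theory
begin

text \<open>The two sides of the axioms as functions of the structure \<open>Y\<close>, so that they
  can be formed in the syntactic structure and in an algebra alike and then be compared along an
  interpretation.\<close>

abbreviation "assoc_l Y w ws wss == gammaN (Car Y) (Cc Y w ws) (ars (concat wss)) (map (iPhi T Y) (concat wss))
  \<cdot>[opcat (Car Y) (tot (concat wss))] Cc Y (wgamma T w ws) (concat wss)"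
abbreviation "assoc_r Y w ws wss == gammaN (Car Y) (iPhi T Y w) (map (\<lambda>vs. tot vs) wss) (map2 (Cc Y) ws wss)
  \<cdot>[opcat (Car Y) (tot (concat wss))] Cc Y w (map2 (wgamma T) ws wss)"
abbreviation "unit_r Y w == gammaN (Car Y) (iPhi T Y w) (replicate (arity T w) 1) (replicate (arity T w) (Ii Y))
  \<cdot>[opcat (Car Y) (arity T w)] Cc Y w (replicate (arity T w) (wunit T))"
abbreviation "unit_l Y w == gammaN (Car Y) (Ii Y) [arity T w] [iPhi T Y w] \<cdot>[opcat (Car Y) (arity T w)] Cc Y (wunit T) [w]"
abbreviation "sub_left_l Y w fs ws ns == subN (Car Y) (sum_list ns) (block_map ns fs) (Cc Y w (map ((!) ws) fs))
  \<cdot>[opcat (Car Y) (sum_list ns)] Ss Y (wgamma T w (map ((!) ws) fs)) (sum_list ns) (block_map ns fs)"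
abbreviation "sub_left_r Y w fs ws ns == gammaN (Car Y) (Ss Y w (length ws) fs) ns (map (iPhi T Y) ws)
  \<cdot>[opcat (Car Y) (sum_list ns)] Cc Y (wsub T (length ws) fs w) ws"
abbreviation "sub_right_l Y w ws gss ns == subN (Car Y) (sum_list ns) (block_sum ns gss) (Cc Y w ws)
  \<cdot>[opcat (Car Y) (sum_list ns)] Ss Y (wgamma T w ws) (sum_list ns) (block_sum ns gss)"
abbreviation "sub_right_r Y w ws gss ns == gammaN (Car Y) (iPhi T Y w) ns (map (\<lambda>i. Ss Y (ws ! i) (ns ! i) (gss ! i)) [0..<length ws])
  \<cdot>[opcat (Car Y) (sum_list ns)] Cc Y w (map (\<lambda>i. wsub T (ns ! i) (gss ! i) (ws ! i)) [0..<length ws])"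
abbreviation "sub_sub Y w fs gs m == subN (Car Y) m gs (Ss Y w (length gs) fs) \<cdot>[opcat (Car Y) m] Ss Y (wsub T (length gs) fs w) m gs"
abbreviation "PhiB A ws xs == map2 (\<lambda>v. fo (Phi A v)) ws (blocks (ars ws) xs)"
abbreviation "RhoB h ws xs == map2 (\<lambda>v. cmp (Rho h v)) ws (blocks (ars ws) xs)"
abbreviation "Cc_law A B h w ws xs == cmp (Cc B w ws) (map (fo (Mf h)) xs) \<cdot>[Car B] cmp (Rho h (wgamma T w ws)) xs
   = fa (Phi B w) (RhoB h ws xs) \<cdot>[Car B]
     (cmp (Rho h w) (PhiB A ws xs) \<cdot>[Car B] fa (Mf h) (cmp (Cc A w ws) xs))"
abbreviation "Ii_law A B h x == cmp (Ii B) [fo (Mf h) x] \<cdot>[Car B] cmp (Rho h (wunit T)) [x] = fa (Mf h) (cmp (Ii A) [x])"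
abbreviation "Ss_law A B h w l fs xs == cmp (Ss B w l fs) (map (fo (Mf h)) xs) \<cdot>[Car B] cmp (Rho h (wsub T l fs w)) xs
   = cmp (Rho h w) (map ((!) xs) fs) \<cdot>[Car B] fa (Mf h) (cmp (Ss A w l fs) xs)"
abbreviation "Rho_law A B \<alpha> h k w xs == cmp (Rho k w) xs \<cdot>[Car B] cmp \<alpha> (fo (Phi A w) xs) = fa (Phi B w) (map (cmp \<alpha>) xs) \<cdot>[Car B] cmp (Rho h w) xs"

lemmas Phi_fun = pseudo_algebra.Phi_functor and cat_Car = pseudo_algebra.category_Car

lemma alg_operations: "pseudo_algebra T A ==> operations (Car A) (arity T) (Phi A) (words T)"
 by (simp add: operations_def cat_Car Phi_fun)

context
 fixes A :: "('t, 'o, 'a) alg" assumes A: "pseudo_algebra T A"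
begin

interpretation A: pseudo_algebra T A by (rule A)
interpretation O: operations "Car A" "arity T" "Phi A" "words T" by (rule alg_operations[OF A])

lemma Cc_hom: "composable T w ws ==> Cc A w ws \<in> hom (opcat (Car A) (tot ws))
  (Phi A (wgamma T w ws)) (gammaF (Car A) (Phi A w) (ars ws) (map (Phi A) ws))"
 by (rule isos_hom[OF A.Cc_iso])

lemma cmp_Cc:
 assumes "composable T w ws" "xs \<in> Obj (pow (Car A) (tot ws))"
 shows "cmp (Cc A w ws) xs \<in> isos (Car A) (fo (Phi A (wgamma T w ws)) xs)
  (fo (Phi A w) (PhiB A ws xs))"
 using isos_fun_catD[OF A.Cc_iso[OF assms(1)] assms(2)] O.fo_gammaF_ph[OF assms(2)] by simp

lemma Cc_nat:
 assumes "composable T w ws" "fs \<in> hom (pow (Car A) (tot ws)) xs ys"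
 shows "cmp (Cc A w ws) ys \<cdot>[Car A] fa (Phi A (wgamma T w ws)) fs
  = fa (Phi A w) (map2 (\<lambda>v. fa (Phi A v)) ws (blocks (ars ws) fs)) \<cdot>[Car A] cmp (Cc A w ws) xs"
 using nt_homD(7)[OF Cc_hom[OF assms(1)] assms(2)] O.fa_gammaF_ph[OF homD(1)[OF assms(2)]] by simp

lemma Ii_hom: "Ii A \<in> hom (opcat (Car A) 1) (Phi A (wunit T)) (unitF (Car A))"
 by (rule isos_hom[OF A.Ii_iso])

lemma cmp_Ii: "x \<in> Obj (Car A) ==> cmp (Ii A) [x] \<in> isos (Car A) (fo (Phi A (wunit T)) [x]) x"
 using isos_fun_catD[OF A.Ii_iso, of "[x]"] by simp

lemma Ii_nat: "f \<in> hom (Car A) x y ==>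
  cmp (Ii A) [y] \<cdot>[Car A] fa (Phi A (wunit T)) [f] = f \<cdot>[Car A] cmp (Ii A) [x]"
 using nt_homD(7)[OF Ii_hom, of "[f]" "[x]" "[y]"] by (simp add: hom_pow_iff homD(1))

lemma Ss_hom: "[|w \<in> words T; length fs = arity T w; set fs \<subseteq> {..<l}|] ==>
  Ss A w l fs \<in> hom (opcat (Car A) l) (Phi A (wsub T l fs w)) (subF (Car A) l fs (Phi A w))"
 by (rule isos_hom[OF A.Ss_iso])

lemma cmp_Ss: "[|w \<in> words T; length fs = arity T w; set fs \<subseteq> {..<l}; xs \<in> Obj (pow (Car A) l)|] ==>
  cmp (Ss A w l fs) xs \<in> isos (Car A) (fo (Phi A (wsub T l fs w)) xs) (fo (Phi A w) (map ((!) xs) fs))"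
 using isos_fun_catD[OF A.Ss_iso, of w fs l xs] by simp

lemma Ss_nat: "[|w \<in> words T; length fs = arity T w; set fs \<subseteq> {..<l}; hs \<in> hom (pow (Car A) l) xs ys|] ==>
  cmp (Ss A w l fs) ys \<cdot>[Car A] fa (Phi A (wsub T l fs w)) hs = fa (Phi A w) (map ((!) hs) fs) \<cdot>[Car A] cmp (Ss A w l fs) xs"
 using nt_homD(7)[OF Ss_hom, of w fs l hs xs ys] homD(1)[of hs "pow (Car A) l" xs ys] by (simp del: pow_simps)

end

section \<open>Morphisms and 2-cells of algebras in components\<close>

lemma cell_nt_simps [simp]: "src (cell_nt \<alpha>) = Mf (src \<alpha>)" "tgt (cell_nt \<alpha>) = Mf (tgt \<alpha>)" "cmp (cell_nt \<alpha>) = cmp \<alpha>"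
 by (auto simp: cell_nt_def)

lemma acat_simps [simp]:
 "Obj (acat A B) = alg_mors T A B" "Arr (acat A B) = alg_cells T A B"
 "Dom (acat A B) = src" "Cod (acat A B) = tgt"
 "src (Ide (acat A B) k) = k" "tgt (Ide (acat A B) k) = k"
 "src (\<beta> \<cdot>[acat A B] \<alpha>) = src \<alpha>" "tgt (\<beta> \<cdot>[acat A B] \<alpha>) = tgt \<beta>"
 "cmp (Ide (acat A B) k) \<in> extensional (Obj (Car A))" "cmp (\<beta> \<cdot>[acat A B] \<alpha>) \<in> extensional (Obj (Car A))"
 "a \<in> Obj (Car A) ==> cmp (Ide (acat A B) k) a = Ide (Car B) (fo (Mf k) a)"
 "a \<in> Obj (Car A) ==> cmp (\<beta> \<cdot>[acat A B] \<alpha>) a = cmp \<beta> a \<cdot>[Car B] cmp \<alpha> a"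
 by (auto simp: alg_hom_cat_def)

lemma map_cmp_hom:
 assumes "\<And>a. a \<in> Obj (Car A) ==> \<alpha> a \<in> hom (Car B) (F a) (G a)" "xs \<in> Obj (pow (Car A) n)"
 shows "map \<alpha> xs \<in> hom (pow (Car B) n) (map F xs) (map G xs)"
 using assms by (auto simp: hom_pow_iff subset_iff)

definition mor_data :: "('t, 'o, 'a) alg => ('t, 'p, 'b) alg => ('t, 'o, 'a, 'p, 'b) amor => bool" where
 "mor_data A B h \<longleftrightarrow> Mf h \<in> functors (Car A) (Car B) \<and> Rho h \<in> extensional (words T) \<and>
   (\<forall>w\<in>words T.
    Rho h w \<in> isos (fun_cat (pw A w) (Car B))
     (compF (pw A w) (Mf h) (Phi A w))
     (compF (pw A w) (Phi B w) (powF (Car A) (arity T w) (Mf h))))"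

context
 fixes A :: "('t, 'o, 'a) alg" and B :: "('t, 'p, 'b) alg"
 assumes A: "pseudo_algebra T A" and B: "pseudo_algebra T B"
begin

interpretation A: pseudo_algebra T A by (rule A)
interpretation B: pseudo_algebra T B by (rule B)
interpretation OA: operations "Car A" "arity T" "Phi A" "words T" by (rule alg_operations[OF A])
interpretation OB: operations "Car B" "arity T" "Phi B" "words T" by (rule alg_operations[OF B])
interpretation catA: category "Car A" by (rule A.category_Car)
interpretation catB: category "Car B" by (rule B.category_Car)
interpretation powA: category "pow (Car A) n" for n by (rule category_pow) unfold_locales
interpretation powB: category "pow (Car B) n" for n by (rule category_pow) unfold_locales

lemma mor_dataI:
 assumes "Mf h \<in> functors (Car A) (Car B)" "Rho h \<in> extensional (words T)"
  and "\<And>w. w \<in> words T ==> src (Rho h w) = compF (pw A w) (Mf h) (Phi A w)"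
  and "\<And>w. w \<in> words T ==> tgt (Rho h w) = compF (pw A w) (Phi B w) (powF (Car A) (arity T w) (Mf h))"
  and "\<And>w. w \<in> words T ==> cmp (Rho h w) \<in> extensional (Obj (pw A w))"
  and isos: "\<And>w xs. w \<in> words T ==> xs \<in> Obj (pw A w) ==>
    cmp (Rho h w) xs \<in> isos (Car B) (fo (Mf h) (fo (Phi A w) xs)) (fo (Phi B w) (map (fo (Mf h)) xs))"
  and "\<And>w fs xs ys. w \<in> words T ==> fs \<in> hom (pw A w) xs ys ==>
    cmp (Rho h w) ys \<cdot>[Car B] fa (Mf h) (fa (Phi A w) fs) = fa (Phi B w) (map (fa (Mf h)) fs) \<cdot>[Car B] cmp (Rho h w) xs"
 shows "mor_data A B h"
 unfolding mor_data_def
proof (intro conjI ballI isos_fun_catI nt_homI)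
 fix w assume w: "w \<in> words T"
 show "compF (pw A w) (Mf h) (Phi A w) \<in> functors (pw A w) (Car B)"
  by (rule compF_functors[OF powA.category_axioms A.Phi_functor[OF w] assms(1)])
 show "compF (pw A w) (Phi B w) (powF (Car A) (arity T w) (Mf h)) \<in> functors (pw A w) (Car B)"
  by (rule compF_functors[OF powA.category_axioms powF_functors[OF catA.category_axioms assms(1)] B.Phi_functor[OF w]])
 fix xs assume xs: "xs \<in> Obj (pw A w)"
 let ?A = "fo (compF (pw A w) (Phi B w) (powF (Car A) (arity T w) (Mf h))) xs" and ?B = "fo (compF (pw A w) (Mf h) (Phi A w)) xs"
 show i: "cmp (Rho h w) xs \<in> isos (Car B) ?B
   ?A"
  using isos[OF w xs] xs by (simp del: pow_simps)
 show "cmp (Rho h w) xs \<in> hom (Car B) ?B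
   ?A"
  by (rule isos_hom[OF i])
next
 fix w fs xs ys assume "w \<in> words T" and fs: "fs \<in> hom (pw A w) xs ys"
 then show "cmp (Rho h w) ys \<cdot>[Car B] fa (compF (pw A w) (Mf h) (Phi A w)) fs =
    fa (compF (pw A w) (Phi B w) (powF (Car A) (arity T w) (Mf h))) fs \<cdot>[Car B] cmp (Rho h w) xs"
  using assms(7) homD(1)[OF fs] by (simp del: pow_simps)
qed (use assms in \<open>auto intro: category_pow catA.category_axioms catB.category_axioms\<close>)

context
 fixes h assumes h: "mor_data A B h"
begin

lemma mor_data_Mf: "Mf h \<in> functors (Car A) (Car B)"
 using h by (simp add: mor_data_def)

lemma Rho_hom: "w \<in> words T ==> Rho h w \<in> hom (fun_cat (pw A w) (Car B))
     (compF (pw A w) (Mf h) (Phi A w))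
     (compF (pw A w) (Phi B w) (powF (Car A) (arity T w) (Mf h)))"
 using h by (simp add: mor_data_def isos_hom)

lemma Rho_isos: "w \<in> words T ==> xs \<in> Obj (pw A w) ==>
  cmp (Rho h w) xs \<in> isos (Car B) (fo (Mf h) (fo (Phi A w) xs)) (fo (Phi B w) (map (fo (Mf h)) xs))"
 using h isos_fun_catD[of "Rho h w" "pw A w" "Car B" "compF (pw A w) (Mf h) (Phi A w)"
  "compF (pw A w) (Phi B w) (powF (Car A) (arity T w) (Mf h))" xs] by (simp add: mor_data_def del: pow_simps)

lemma Rho_nat: "w \<in> words T ==> fs \<in> hom (pw A w) xs ys ==>
  cmp (Rho h w) ys \<cdot>[Car B] fa (Mf h) (fa (Phi A w) fs) = fa (Phi B w) (map (fa (Mf h)) fs) \<cdot>[Car B] cmp (Rho h w) xs"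
 using nt_homD(7)[OF Rho_hom, of w fs xs ys] homD(1)[of fs "pw A w" xs ys] by (simp del: pow_simps)

lemma Mf_Obj: "xs \<in> Obj (pow (Car A) n) ==> map (fo (Mf h)) xs \<in> Obj (pow (Car B) n)"
 using fun_fo[OF powF_functors[OF catA.category_axioms mor_data_Mf], of xs n] by (simp del: pow_simps)

lemma Mf_hom: "fs \<in> hom (pow (Car A) n) xs ys ==> map (fa (Mf h)) fs \<in> hom (pow (Car B) n) (map (fo (Mf h)) xs) (map (fo (Mf h)) ys)"
 using fun_fa[OF powF_functors[OF catA.category_axioms mor_data_Mf], of fs n xs ys] homD(1)[of fs "pow (Car A) n" xs ys]
  powA.hom_Obj[of fs n xs ys] by (simp del: pow_simps)

lemma map2_Rho_isos:
 assumes "set ws \<subseteq> words T" "xs \<in> Obj (pow (Car A) (tot ws))"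
 shows "RhoB h ws xs \<in> isos (pow (Car B) (length ws))
   (map (fo (Mf h)) (PhiB A ws xs))
   (PhiB B ws (map (fo (Mf h)) xs))"
proof (rule isos_powI[OF catB.category_axioms])
 fix i assume i: "i < length ws"
 have "ws ! i \<in> words T" using assms(1) i by auto
 then show "RhoB h ws xs ! i
   \<in> isos (Car B) (map (fo (Mf h)) (PhiB A ws xs) ! i)
    (PhiB B ws (map (fo (Mf h)) xs) ! i)"
  using Rho_isos[of "ws ! i" "blocks (ars ws) xs ! i"] blocks_Obj[OF assms(2), of i] i by (simp add: blocks_map del: pow_simps)
qed auto

text \<open>Whiskering computes the components of both sides; what remains is that the targets
  agree, which is \<open>gammaF_powF\<close>.\<close>

lemma Cc_compat_iff:
 assumes c: "composable T w ws" and ns: "ns = ars ws" and N: "N = sum_list ns"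
 shows "hcomp (pow (Car A) N) (Car B) (Cc B w ws)
      (idn (pow (Car A) N) (pow (Car B) N) (powF (Car A) N (Mf h)))
     \<cdot>[fun_cat (pow (Car A) N) (Car B)] Rho h (wgamma T w ws)
    = hcomp (pow (Car A) N) (Car B) (iPhi T B w) (prodN (Car A) ns (map (Rho h) ws))
     \<cdot>[fun_cat (pow (Car A) N) (Car B)]
     (hcomp (pow (Car A) N) (Car B) (Rho h w)
      (idn (pow (Car A) N) (pow (Car A) (length ws)) (prodF (Car A) ns (map (Phi A) ws)))
     \<cdot>[fun_cat (pow (Car A) N) (Car B)]
     hcomp (pow (Car A) N) (Car B) (idn (Car A) (Car B) (Mf h)) (Cc A w ws))
  \<longleftrightarrow> (\<forall>xs\<in>Obj (pow (Car A) N).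
   cmp (Cc B w ws) (map (fo (Mf h)) xs) \<cdot>[Car B] cmp (Rho h (wgamma T w ws)) xs
   = fa (Phi B w) (map2 (\<lambda>v. cmp (Rho h v)) ws (blocks ns xs)) \<cdot>[Car B]
    (cmp (Rho h w) (map2 (\<lambda>v. fo (Phi A v)) ws (blocks ns xs)) \<cdot>[Car B] fa (Mf h) (cmp (Cc A w ws) xs)))"
proof -
 note H = mor_data_Mf and wd = composableD(3)[OF c] and ws = composableD(4)[OF c] and lw = composableD(5)[OF c]
 note g = words_wgamma[OF c, folded ns, folded N]
 have wi: "ws ! i \<in> words T" if "i < length ws" for i using ws that by auto
 note CA = Cc_hom[OF A c, folded ns, folded N] and CB = Cc_hom[OF B c, folded ns, folded N]
 note Rg = Rho_hom[OF g(1), unfolded g(2)] and Rw = Rho_hom[OF wd]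
 have pF: "prodF (Car A) ns (map (Phi A) ws) \<in> functors (pow (Car A) N) (pw A w)"
  using prodF_functors[OF catA.category_axioms, of "map (Phi A) ws" ns "Car A"] A.Phi_functor[OF wi] ns N lw by simp
 have pN: "prodN (Car A) ns (map (Rho h) ws) \<in> hom (fun_cat (pow (Car A) N) (pw B w))
   (prodF (Car A) ns (map2 (\<lambda>n G. compF (pow (Car A) n) (Mf h) G) ns (map (Phi A) ws)))
   (prodF (Car A) ns (map2 (\<lambda>n G. compF (pow (Car A) n) G (powF (Car A) n (Mf h))) ns (map (Phi B) ws)))"
  using prodN_hom[OF catA.category_axioms catB.category_axioms, of "map (Rho h) ws" ns
   "map2 (\<lambda>n G. compF (pow (Car A) n) (Mf h) G) ns (map (Phi A) ws)"
   "map2 (\<lambda>n G. compF (pow (Car A) n) G (powF (Car A) n (Mf h))) ns (map (Phi B) ws)"] Rho_hom[OF wi] ns lw N by simp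
 note [simp] = nt_homD(3,4)[OF CA] nt_homD(3,4)[OF CB] nt_homD(3,4)[OF Rg] nt_homD(3,4)[OF Rw] nt_homD(3,4)[OF pN, simplified src_tgt_simps]
 have t: "compF (pow (Car A) N) (gammaF (Car B) (Phi B w) ns (map (Phi B) ws)) (powF (Car A) N (Mf h))
  = compF (pow (Car A) N) (Phi B w) (prodF (Car A) ns (map2 (\<lambda>n G. compF (pow (Car A) n) G (powF (Car A) n (Mf h))) ns (map (Phi B) ws)))"
  using gammaF_powF[of "map (Phi B) ws" ns "Mf h"  "Car A" "Car B"] H ns N by simp
 have tg: "map (tgt \<circ> Rho h) ws = map2 (\<lambda>n G. compF (pow (Car A) n) G (powF (Car A) n (Mf h))) ns (map (Phi B) ws)"
  using nt_homD(4)[OF Rho_hom[OF wi]] ns by (auto intro!: nth_equalityI)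
 have m: "map2 cmp (map (Rho h) ws) ys = map2 (\<lambda>v. cmp (Rho h v)) ws ys" "map2 fo (map (Phi A) ws) ys = map2 (\<lambda>v. fo (Phi A v)) ws ys" for ys :: "'o list list"
  by (auto simp: zip_map1 case_prod_beta intro: nth_equalityI)
 have iP: "src (iPhi T B w) = Phi B w" "tgt (iPhi T B w) = Phi B w" by (auto simp: iPhi_def)
 show ?thesis
  by (subst cell_eq_iff[of _ "Obj (pow (Car A) N)"])
   (auto simp: t tg iP cmp_whisker_left[OF catB.category_axioms H CA] cmp_whisker_right[OF catB.category_axioms powF_functors[OF catA.category_axioms H] CB]
    cmp_whisker_right[OF catB.category_axioms pF Rw, folded lw] N[symmetric]
    cmp_whisker_left[OF catB.category_axioms B.Phi_functor[OF wd] pN, folded iPhi_def] cmp_prodN[of _ "Car A" ns, folded N]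
    fo_prodF[of _ "Car A" ns, folded N] m
    simp del: hcomp_simps(4) pow_simps)
qed

lemma Ii_compat_iff:
 "hcomp (pow (Car A) 1) (Car B) (Ii B) (idn (pow (Car A) 1) (pow (Car B) 1) (powF (Car A) 1 (Mf h)))
     \<cdot>[fun_cat (pow (Car A) 1) (Car B)] Rho h (wunit T)
    = hcomp (pow (Car A) 1) (Car B) (idn (Car A) (Car B) (Mf h)) (Ii A)
  \<longleftrightarrow> (\<forall>x\<in>Obj (Car A). Ii_law A B h x)"
proof -
 note H = mor_data_Mf and IA = Ii_hom[OF A] and IB = Ii_hom[OF B]
 note R = Rho_hom[OF words_wunit(1), unfolded words_wunit(2)]
 note [simp] = nt_homD(3,4)[OF IA] nt_homD(3,4)[OF IB] nt_homD(3,4)[OF R]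
 have o: "(\<forall>xs\<in>Obj (pow (Car A) 1). P xs) \<longleftrightarrow> (\<forall>x\<in>Obj (Car A). P [x])" for P by (auto simp: length_Suc_conv)
 have "[x] \<in> Obj (pow (Car A) 1)" if "x \<in> Obj (Car A)" for x using that by simp
 note [simp] = cmp_whisker_left[OF catB.category_axioms H IA this] fo_powF[OF this]
  cmp_whisker_right[OF catB.category_axioms powF_functors[OF catA.category_axioms H] IB this] cmp_Cmp[OF this]
 show ?thesis
  by (subst cell_eq_iff[of _ "Obj (pow (Car A) 1)"])
   (simp_all add: unitF_powF[OF H] o del: hcomp_simps(4) pow_simps One_nat_def)
qed

lemma Ss_compat_iff:
 assumes w: "w \<in> words T" and fs: "length fs = arity T w" "set fs \<subseteq> {..<l}"
 shows "hcomp (pow (Car A) l) (Car B) (Ss B w l fs)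
      (idn (pow (Car A) l) (pow (Car B) l) (powF (Car A) l (Mf h)))
     \<cdot>[fun_cat (pow (Car A) l) (Car B)] Rho h (wsub T l fs w)
    = subN (Car A) l fs (Rho h w)
     \<cdot>[fun_cat (pow (Car A) l) (Car B)]
     hcomp (pow (Car A) l) (Car B) (idn (Car A) (Car B) (Mf h)) (Ss A w l fs)
  \<longleftrightarrow> (\<forall>xs\<in>Obj (pow (Car A) l). Ss_law A B h w l fs xs)"
proof -
 note H = mor_data_Mf and SA = Ss_hom[OF A w fs] and SB = Ss_hom[OF B w fs]
 note s = words_wsub[OF w fs]
 note R = Rho_hom[OF w] and Rs = Rho_hom[OF s(1), unfolded s(2)]
 note [simp] = nt_homD(3,4)[OF SA] nt_homD(3,4)[OF SB] nt_homD(3,4)[OF R] nt_homD(3,4)[OF Rs]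
 show ?thesis
  by (subst cell_eq_iff[of _ "Obj (pow (Car A) l)"])
   (auto simp: subF_powF[OF H fs(2), unfolded fs(1)] ext_simps cmp_whisker_left[OF catB.category_axioms H SA]
    cmp_whisker_right[OF catB.category_axioms powF_functors[OF catA.category_axioms H] SB]
    simp del: hcomp_simps(4) pow_simps)
qed

end

text \<open>From here on the coherence laws of morphisms are used in this form only, as equations
  between arrows of the carrier of \<open>B\<close>.\<close>

lemma alg_mors_iff:
 "h \<in> alg_mors T A B \<longleftrightarrow> mor_data A B h \<and>
  (\<forall>w ws. composable T w ws --> (\<forall>xs\<in>Obj (pow (Car A) (tot ws)).
   Cc_law A B h w ws xs)) \<and>
  (\<forall>x\<in>Obj (Car A). Ii_law A B h x) \<and>
  (\<forall>w\<in>words T. \<forall>l fs. length fs = arity T w --> set fs \<subseteq> {..<l} -->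
   (\<forall>xs\<in>Obj (pow (Car A) l). Ss_law A B h w l fs xs))"
proof (cases "mor_data A B h")
 case True
 show ?thesis
  using True Ii_compat_iff[OF True] unfolding alg_mors_def mor_data_def
  by (simp add: Cc_compat_iff[OF True] Ss_compat_iff[OF True] cong: conj_cong imp_cong del: pow_simps)
next
 case False
 then show ?thesis by (auto simp: alg_mors_def mor_data_def)
qed

lemma alg_morsI:
 assumes "mor_data A B h"
  and "\<And>w ws xs. composable T w ws ==> xs \<in> Obj (pow (Car A) (tot ws)) ==>
   Cc_law A B h w ws xs"
  and "\<And>x. x \<in> Obj (Car A) ==> Ii_law A B h x"
  and "\<And>w l fs xs. [|w \<in> words T; length fs = arity T w; set fs \<subseteq> {..<l}; xs \<in> Obj (pow (Car A) l)|] ==>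
   Ss_law A B h w l fs xs"
 shows "h \<in> alg_mors T A B"
 using assms unfolding alg_mors_iff by blast

lemma alg_morsD:
 assumes "h \<in> alg_mors T A B"
 shows mors_data: "mor_data A B h"
  and alg_mors_Cc: "composable T w ws ==> xs \<in> Obj (pow (Car A) (tot ws)) ==>
   Cc_law A B h w ws xs"
  and alg_mors_Ii: "x \<in> Obj (Car A) ==> Ii_law A B h x"
  and alg_mors_Ss: "[|w \<in> words T; length fs = arity T w; set fs \<subseteq> {..<l}; xs \<in> Obj (pow (Car A) l)|] ==>
   Ss_law A B h w l fs xs"
 using assms unfolding alg_mors_iff by blast+

lemma amor_eqI:
 assumes "mor_data A B h" "mor_data A B k" "Mf h = Mf k"
  and "\<And>w xs. w \<in> words T ==> xs \<in> Obj (pw A w) ==> cmp (Rho h w) xs = cmp (Rho k w) xs"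
 shows "h = k"
proof -
 have "Rho h w = Rho k w" if w: "w \<in> words T" for w
  by (rule nt_eqI[OF Rho_hom[OF assms(1) w] Rho_hom[OF assms(2) w, folded assms(3)] assms(4)[OF w]])
 then have "Rho h = Rho k" using assms(1,2) by (auto simp: mor_data_def intro: extensionalityI)
 then show ?thesis using assms(3) by (cases h; cases k) simp
qed

lemma acell_hom_iff:
 "\<alpha> \<in> hom (acat A B) h k \<longleftrightarrow> h \<in> alg_mors T A B \<and> k \<in> alg_mors T A B \<and> src \<alpha> = h \<and> tgt \<alpha> = k \<and>
   cmp \<alpha> \<in> extensional (Obj (Car A)) \<and>
   (\<forall>a\<in>Obj (Car A). cmp \<alpha> a \<in> hom (Car B) (fo (Mf h) a) (fo (Mf k) a)) \<and>
   (\<forall>f a b. f \<in> hom (Car A) a b --> cmp \<alpha> b \<cdot>[Car B] fa (Mf h) f = fa (Mf k) f \<cdot>[Car B] cmp \<alpha> a) \<and>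
   (\<forall>w\<in>words T. \<forall>xs\<in>Obj (pw A w).
    Rho_law A B \<alpha> h k w xs)"
proof (cases "h \<in> alg_mors T A B \<and> k \<in> alg_mors T A B \<and> src \<alpha> = h \<and> tgt \<alpha> = k \<and> cell_nt \<alpha> \<in> nat_trans (Car A) (Car B)")
 case True
 then have h: "mor_data A B h" and k: "mor_data A B k" using mors_data by auto
 have a: "cell_nt \<alpha> \<in> hom (fun_cat (Car A) (Car B)) (Mf h) (Mf k)" using True by (auto simp: hom_def)
 have "Rho k w \<cdot>[fun_cat (pow (Car A) n) (Car B)] hcomp (pow (Car A) n) (Car B) (cell_nt \<alpha>) (iPhi T A w)
    = hcomp (pow (Car A) n) (Car B) (iPhi T B w) (powN (Car A) n (cell_nt \<alpha>))
     \<cdot>[fun_cat (pow (Car A) n) (Car B)] Rho h w \<longleftrightarrow> (\<forall>xs\<in>Obj (pow (Car A) n).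
    Rho_law A B \<alpha> h k w xs)"
  if w: "w \<in> words T" and n: "n = arity T w" for w n
 proof -
  note [simp] = nt_homD(3,4)[OF Rho_hom[OF h w], folded n] nt_homD(3,4)[OF Rho_hom[OF k w], folded n]
  have [simp]: "src (iPhi T A w) = Phi A w" "tgt (iPhi T A w) = Phi A w" "src (iPhi T B w) = Phi B w" "tgt (iPhi T B w) = Phi B w" by (auto simp: iPhi_def)
  show ?thesis
   by (subst cell_eq_iff[of _ "Obj (pow (Car A) n)"])
    (use True in \<open>auto simp: cmp_whisker_right[OF catB.category_axioms A.Phi_functor[OF w] a, folded iPhi_def, folded n]
     cmp_whisker_left[OF catB.category_axioms B.Phi_functor[OF w] powN_hom[OF catA.category_axioms catB.category_axioms a], folded iPhi_def, folded n]
     simp del: hcomp_simps(4) pow_simps\<close>)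
 qed
 then show ?thesis using True nt_homD[OF a] by (auto simp: hom_def alg_cells_def simp del: pow_simps)
next
 case False
 have "False" if "h \<in> alg_mors T A B" "k \<in> alg_mors T A B" "src \<alpha> = h" "tgt \<alpha> = k" "cmp \<alpha> \<in> extensional (Obj (Car A))"
   "\<forall>a\<in>Obj (Car A). cmp \<alpha> a \<in> hom (Car B) (fo (Mf h) a) (fo (Mf k) a)"
   "\<forall>f a b. f \<in> hom (Car A) a b --> cmp \<alpha> b \<cdot>[Car B] fa (Mf h) f = fa (Mf k) f \<cdot>[Car B] cmp \<alpha> a"
 proof -
  have "cell_nt \<alpha> \<in> hom (fun_cat (Car A) (Car B)) (Mf h) (Mf k)"
   by (rule nt_homI) (use that mor_data_Mf[OF mors_data] in auto)
  then show False using False that by (auto simp: hom_def)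
 qed
 then show ?thesis using False by (auto simp: hom_def alg_cells_def)
qed

lemma acell_homI:
 assumes "h \<in> alg_mors T A B" "k \<in> alg_mors T A B" "src \<alpha> = h" "tgt \<alpha> = k" "cmp \<alpha> \<in> extensional (Obj (Car A))"
  "\<And>a. a \<in> Obj (Car A) ==> cmp \<alpha> a \<in> hom (Car B) (fo (Mf h) a) (fo (Mf k) a)"
  "\<And>f a b. f \<in> hom (Car A) a b ==> cmp \<alpha> b \<cdot>[Car B] fa (Mf h) f = fa (Mf k) f \<cdot>[Car B] cmp \<alpha> a"
  "\<And>w xs. w \<in> words T ==> xs \<in> Obj (pw A w) ==>
    Rho_law A B \<alpha> h k w xs"
 shows "\<alpha> \<in> hom (acat A B) h k"
 unfolding acell_hom_iff using assms by blast

lemma acell_homD: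
 assumes "\<alpha> \<in> hom (acat A B) h k"
 shows "h \<in> alg_mors T A B" "k \<in> alg_mors T A B" "src \<alpha> = h" "tgt \<alpha> = k" "cmp \<alpha> \<in> extensional (Obj (Car A))"
  "\<And>a. a \<in> Obj (Car A) ==> cmp \<alpha> a \<in> hom (Car B) (fo (Mf h) a) (fo (Mf k) a)"
  "\<And>f a b. f \<in> hom (Car A) a b ==> cmp \<alpha> b \<cdot>[Car B] fa (Mf h) f = fa (Mf k) f \<cdot>[Car B] cmp \<alpha> a"
  "\<And>w xs. w \<in> words T ==> xs \<in> Obj (pw A w) ==>
    Rho_law A B \<alpha> h k w xs"
 using assms unfolding acell_hom_iff by blast+

lemma acell_eqI:
 assumes "\<alpha> \<in> hom (acat A B) h k" "\<beta> \<in> hom (acat A B) h k"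
  "\<And>a. a \<in> Obj (Car A) ==> cmp \<alpha> a = cmp \<beta> a"
 shows "\<alpha> = \<beta>"
 by (rule cell_eqI[of _ _ "Obj (Car A)"]) (use assms acell_homD in auto)

lemma category_acat: "category (acat A B)"
proof
 show ide: "Ide (acat A B) h \<in> hom (acat A B) h h" if "h \<in> Obj (acat A B)" for h
 proof (rule acell_homI)
  have h: "mor_data A B h" using that mors_data by simp
  note H = mor_data_Mf[OF h]
  let ?B = "Ide (acat A B) h"
  show "cmp ?B a \<in> hom (Car B) (fo (Mf h) a) (fo (Mf h) a)" if "a \<in> Obj (Car A)" for a
   using that catB.Ide_hom fun_fo[OF H] by simp
  show "cmp ?B b \<cdot>[Car B] fa (Mf h) f = fa (Mf h) f \<cdot>[Car B] cmp ?B a"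
   if "f \<in> hom (Car A) a b" for f a b
   using catA.hom_Obj[OF that] catB.Cmp_Ide_left[OF fun_fa[OF H that]] catB.Cmp_Ide_right[OF fun_fa[OF H that]] by simp
  fix w xs assume w: "w \<in> words T" and xs: "xs \<in> Obj (pw A w)"
  have "map (cmp ?B) xs = map (Ide (Car B)) (map (fo (Mf h)) xs)" using xs by auto
  then show "cmp (Rho h w) xs \<cdot>[Car B] cmp ?B (fo (Phi A w) xs)
    = fa (Phi B w) (map (cmp ?B) xs) \<cdot>[Car B] cmp (Rho h w) xs"
   using fun_Ide[OF B.Phi_functor[OF w] Mf_Obj[OF h xs]] fun_fo[OF A.Phi_functor[OF w] xs]
    catB.Cmp_Ide_left[OF isos_hom[OF Rho_isos[OF h w xs]]] catB.Cmp_Ide_right[OF isos_hom[OF Rho_isos[OF h w xs]]]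
   by (simp del: map_map)
 qed (use that in auto)
 show comp: "\<beta> \<cdot>[acat A B] \<alpha> \<in> hom (acat A B) h l"
  if \<alpha>: "\<alpha> \<in> hom (acat A B) h k" and \<beta>: "\<beta> \<in> hom (acat A B) k l" for \<alpha> \<beta> h k l
 proof (rule acell_homI[OF acell_homD(1)[OF \<alpha>] acell_homD(2)[OF \<beta>]])
  have h: "mor_data A B h" and k: "mor_data A B k" and l: "mor_data A B l"
   using acell_homD(1,2)[OF \<alpha>] acell_homD(2)[OF \<beta>] mors_data by auto
  note cs = acell_homD(6)[OF \<alpha>] acell_homD(6)[OF \<beta>]
  let ?A = "\<beta> \<cdot>[acat A B] \<alpha>"
  show "cmp ?A a \<in> hom (Car B) (fo (Mf h) a) (fo (Mf l) a)" if "a \<in> Obj (Car A)" for a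
   using catB.Cmp_hom[OF cs(1)[OF that] cs(2)[OF that]] that by simp
  show "cmp ?A b \<cdot>[Car B] fa (Mf h) f = fa (Mf l) f \<cdot>[Car B] cmp ?A a"
   if f: "f \<in> hom (Car A) a b" for f a b
   using catA.hom_Obj[OF f] catB.paste[OF fun_fa[OF mor_data_Mf[OF h] f] cs(1) cs(1) fun_fa[OF mor_data_Mf[OF k] f] cs(2) cs(2)
     fun_fa[OF mor_data_Mf[OF l] f] acell_homD(7)[OF \<alpha> f] acell_homD(7)[OF \<beta> f]] by simp
  fix w xs assume w: "w \<in> words T" and xs: "xs \<in> Obj (pw A w)"
  note px = fun_fo[OF A.Phi_functor[OF w] xs]
  note ma = map_cmp_hom[OF cs(1) xs] and mb = map_cmp_hom[OF cs(2) xs]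
  have m: "map (cmp ?A) xs = map (cmp \<beta>) xs \<cdot>[pw B w] map (cmp \<alpha>) xs"
   using xs by (auto intro!: nth_equalityI simp: subset_iff)
  have "fa (Phi B w) (map (cmp ?A) xs) = fa (Phi B w) (map (cmp \<beta>) xs) \<cdot>[Car B] fa (Phi B w) (map (cmp \<alpha>) xs)"
   unfolding m by (rule fun_Cmp[OF B.Phi_functor[OF w] ma mb])
  then show "cmp (Rho l w) xs \<cdot>[Car B] cmp ?A (fo (Phi A w) xs)
    = fa (Phi B w) (map (cmp ?A) xs) \<cdot>[Car B] cmp (Rho h w) xs"
   using catB.paste[OF isos_hom[OF Rho_isos[OF h w xs]] cs(1)[OF px] fun_fa[OF B.Phi_functor[OF w] ma] isos_hom[OF Rho_isos[OF k w xs]]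
     cs(2)[OF px] fun_fa[OF B.Phi_functor[OF w] mb] isos_hom[OF Rho_isos[OF l w xs]]
     acell_homD(8)[OF \<alpha> w xs, symmetric] acell_homD(8)[OF \<beta> w xs, symmetric]] px by (simp del: pow_simps)
 qed (use acell_homD(3,4)[OF \<alpha>] acell_homD(3,4)[OF \<beta>] in auto)
 fix \<alpha> h k assume \<alpha>: "\<alpha> \<in> hom (acat A B) h k"
 have o: "h \<in> Obj (acat A B)" "k \<in> Obj (acat A B)" using acell_homD(1,2)[OF \<alpha>] by auto
 show "Ide (acat A B) k \<cdot>[acat A B] \<alpha> = \<alpha>"
  by (rule acell_eqI[OF comp[OF \<alpha> ide[OF o(2)]] \<alpha>]) (simp add: catB.Cmp_Ide_left[OF acell_homD(6)[OF \<alpha>]])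
 show "\<alpha> \<cdot>[acat A B] Ide (acat A B) h = \<alpha>"
  by (rule acell_eqI[OF comp[OF ide[OF o(1)] \<alpha>] \<alpha>]) (simp add: catB.Cmp_Ide_right[OF acell_homD(6)[OF \<alpha>]])
 fix \<beta> \<gamma> l m assume \<beta>: "\<beta> \<in> hom (acat A B) k l" and \<gamma>: "\<gamma> \<in> hom (acat A B) l m"
 show "\<gamma> \<cdot>[acat A B] (\<beta> \<cdot>[acat A B] \<alpha>) = (\<gamma> \<cdot>[acat A B] \<beta>) \<cdot>[acat A B] \<alpha>"
  by (rule acell_eqI[OF comp[OF comp[OF \<alpha> \<beta>] \<gamma>] comp[OF \<alpha> comp[OF \<beta> \<gamma>]]])
   (simp add: catB.Cmp_assoc[OF acell_homD(6)[OF \<alpha>] acell_homD(6)[OF \<beta>] acell_homD(6)[OF \<gamma>]])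
qed (auto simp: alg_cells_def)

end

end

section \<open>The 2-category of algebras\<close>

lemma (in category) paste':
 assumes "f \<in> hom C a b" "x \<in> hom C a c" "y \<in> hom C b d" "g \<in> hom C c d" "x' \<in> hom C c e" "y' \<in> hom C d k" "h \<in> hom C e k"
  and "g \<cdot>[C] x = y \<cdot>[C] f" "h \<cdot>[C] x' = y' \<cdot>[C] g"
 shows "h \<cdot>[C] (x' \<cdot>[C] x) = (y' \<cdot>[C] y) \<cdot>[C] f"
 using paste[OF assms(1-7)] assms(8,9) by simp

text \<open>Diagram behind the compatibility of a composite morphism with \<open>Cc\<close>. The
  three equations are the law for the outer morphism, the image under it of the law for the inner
  one, and naturality of the outer \<open>Rho\<close>.\<close>

lemma (in category) comp_chain:
 assumes h: "rg \<in> hom C a b" "r \<in> hom C b c" "k \<in> hom C c d" "kb \<in> hom C b b'" "q \<in> hom C b' c'" "p \<in> hom C c' d"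
  "ka \<in> hom C a a'" "qg \<in> hom C a' b''" "pg \<in> hom C b'' b'" "q' \<in> hom C b'' e" "p' \<in> hom C e c'"
  and e: "k \<cdot>[C] r = p \<cdot>[C] (q \<cdot>[C] kb)" "kb \<cdot>[C] rg = pg \<cdot>[C] (qg \<cdot>[C] ka)" "q \<cdot>[C] pg = p' \<cdot>[C] q'"
 shows "k \<cdot>[C] (r \<cdot>[C] rg) = (p \<cdot>[C] p') \<cdot>[C] ((q' \<cdot>[C] qg) \<cdot>[C] ka)"
proof -
 note qk = Cmp_hom[OF h(7,8)] and q'q = Cmp_hom[OF h(8,10)]
 have "k \<cdot>[C] (r \<cdot>[C] rg) = (p \<cdot>[C] (q \<cdot>[C] kb)) \<cdot>[C] rg" using Cmp_assoc[OF h(1-3)] e(1) by simp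
 also have "\<dots> = p \<cdot>[C] (q \<cdot>[C] (kb \<cdot>[C] rg))"
  using Cmp_assoc[OF h(1) Cmp_hom[OF h(4,5)] h(6)] Cmp_assoc[OF h(1,4,5)] by simp
 also have "\<dots> = p \<cdot>[C] ((q \<cdot>[C] pg) \<cdot>[C] (qg \<cdot>[C] ka))" using Cmp_assoc[OF qk h(9,5)] e(2) by simp
 also have "\<dots> = p \<cdot>[C] (p' \<cdot>[C] (q' \<cdot>[C] (qg \<cdot>[C] ka)))" using Cmp_assoc[OF qk h(10,11)] e(3) by simp
 also have "\<dots> = p \<cdot>[C] (p' \<cdot>[C] ((q' \<cdot>[C] qg) \<cdot>[C] ka))" using Cmp_assoc[OF h(7,8,10)] by simp
 also have "\<dots> = (p \<cdot>[C] p') \<cdot>[C] ((q' \<cdot>[C] qg) \<cdot>[C] ka)" by (rule Cmp_assoc[OF Cmp_hom[OF h(7) q'q] h(11,6)])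
 finally show ?thesis .
qed

context lawvere_theory
begin

definition acell_comp :: "('t, 'o, 'a) alg => ('t, 'p, 'b) alg => ('t, 'q, 'c) alg => ('t, 'p, 'b, 'q, 'c) acell => ('t, 'o, 'a, 'p, 'b) acell => ('t, 'o, 'a, 'q, 'c) acell" where
 "acell_comp A B C \<beta> \<alpha> = \<lparr>src = acomp A B C (src \<beta>) (src \<alpha>), tgt = acomp A B C (tgt \<beta>) (tgt \<alpha>),
    cmp = cmp (hcomp (Car A) (Car C) (cell_nt \<beta>) (cell_nt \<alpha>))\<rparr>"

lemma cmp_acell_comp: "a \<in> Obj (Car A) ==> cmp (acell_comp A B C \<beta> \<alpha>) a
  = fa (Mf (tgt \<beta>)) (cmp \<alpha> a) \<cdot>[Car C] cmp \<beta> (fo (Mf (src \<alpha>)) a)"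
 by (simp add: acell_comp_def cell_nt_def)

lemma Mf_alg_comp [simp]: "Mf (acomp A B C h g) = compF (Car A) (Mf h) (Mf g)"
 by (simp add: alg_comp_def)

context
 fixes A :: "('t, 'o, 'a) alg" and B :: "('t, 'p, 'b) alg" and C :: "('t, 'q, 'c) alg"
 assumes A: "pseudo_algebra T A" and B: "pseudo_algebra T B" and C: "pseudo_algebra T C"
begin

interpretation A: pseudo_algebra T A by (rule A)
interpretation B: pseudo_algebra T B by (rule B)
interpretation C: pseudo_algebra T C by (rule C)
interpretation OA: operations "Car A" "arity T" "Phi A" "words T" by (rule alg_operations[OF A])
interpretation OB: operations "Car B" "arity T" "Phi B" "words T" by (rule alg_operations[OF B])
interpretation OC: operations "Car C" "arity T" "Phi C" "words T" by (rule alg_operations[OF C])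
interpretation catA: category "Car A" by (rule A.category_Car)
interpretation catB: category "Car B" by (rule B.category_Car)
interpretation catC: category "Car C" by (rule C.category_Car)
interpretation powA: category "pow (Car A) n" for n by (rule category_pow) unfold_locales
interpretation powB: category "pow (Car B) n" for n by (rule category_pow) unfold_locales
interpretation powC: category "pow (Car C) n" for n by (rule category_pow) unfold_locales

lemma map_fo_compF: "set xs \<subseteq> Obj (Car A) ==> map (fo (compF (Car A) H G)) xs = map (fo H) (map (fo G) xs)"
 by (auto simp: subset_iff)

lemma Rho_comp:
 assumes g: "mor_data A B g" and h: "mor_data B C h" and w: "w \<in> words T" and xs: "xs \<in> Obj (pw A w)"
 shows "cmp (Rho (acomp A B C h g) w) xs = cmp (Rho h w) (map (fo (Mf g)) xs) \<cdot>[Car C] fa (Mf h) (cmp (Rho g w) xs)"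
 using w xs cmp_whisker_right[OF catC.category_axioms powF_functors[OF catA.category_axioms mor_data_Mf[OF A B g]] Rho_hom[OF B C h w] xs]
  cmp_whisker_left[OF catC.category_axioms mor_data_Mf[OF B C h] Rho_hom[OF A B g w] xs]
 by (simp add: alg_comp_def del: hcomp_simps(4) pow_simps)

lemma alg_comp_data:
 assumes g: "mor_data A B g" and h: "mor_data B C h"
 shows "mor_data A C (acomp A B C h g)"
proof (rule mor_dataI[OF A C])
 note G = mor_data_Mf[OF A B g] and H = mor_data_Mf[OF B C h]
 show "Mf (acomp A B C h g) \<in> functors (Car A) (Car C)"
  using compF_functors[OF catA.category_axioms G H] by simp
 show "Rho (acomp A B C h g) \<in> extensional (words T)" by (simp add: alg_comp_def)
 fix w assume w: "w \<in> words T"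
 note pw = A.Phi_functor[OF w] and Rg = nt_homD(3,4)[OF Rho_hom[OF A B g w]] and Rh = nt_homD(3,4)[OF Rho_hom[OF B C h w]]
 let ?B = "Rho (acomp A B C h g) w" and ?C = "Mf (acomp A B C h g)"
 show "src ?B = compF (pw A w) ?C (Phi A w)"
  using w by (simp add: alg_comp_def Rg compF_assoc[OF pw])
 let ?A = "compF (Car A) (Mf h) (Mf g)"
 have "powF (Car A) (arity T w) ?A = compF (pw A w) (powF (Car B) (arity T w) (Mf h)) (powF (Car A) (arity T w) (Mf g))"
 proof (rule func_eqI'[OF ext_simps(1) compF_ext(1) ext_simps(2) compF_ext(2)])
  let ?D = "compF (pw A w) (powF (Car B) (arity T w) (Mf h)) (powF (Car A) (arity T w) (Mf g))"
  show "fo (powF (Car A) (arity T w) ?A) xs = fo ?D xs"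
   if xs: "xs \<in> Obj (pw A w)" for xs
  proof -
   have "map (fo ?A) xs = map (fo (Mf h)) (map (fo (Mf g)) xs)" using xs by (intro map_fo_compF) simp
   then show ?thesis using xs Mf_Obj[OF A B g xs] by (simp del: pow_simps map_map)
  qed
  show "fa (powF (Car A) (arity T w) ?A) fs = fa ?D fs"
   if fs: "fs \<in> Arr (pw A w)" for fs
  proof -
   have "map (fa ?A) fs = map (fa (Mf h)) (map (fa (Mf g)) fs)" using fs by (auto simp: subset_iff)
   then show ?thesis using fs homD(1)[OF Mf_hom[OF A B g Arr_hom[OF fs]]] by (simp del: pow_simps map_map)
  qed
 qed
 then show "tgt ?B = compF (pw A w) (Phi C w) (powF (Car A) (arity T w) ?C)"
  using w by (simp add: alg_comp_def Rh compF_assoc[OF powF_functors[OF catA.category_axioms G]])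
 show "cmp ?B \<in> extensional (Obj (pw A w))"
  using w by (simp add: alg_comp_def)
 show "cmp ?B xs \<in> isos (Car C) (fo ?C (fo (Phi A w) xs))
   (fo (Phi C w) (map (fo ?C) xs))" if xs: "xs \<in> Obj (pw A w)" for xs
  using catC.isos_Cmp[OF fun_isos[OF H catB.category_axioms Rho_isos[OF A B g w xs]] Rho_isos[OF B C h w Mf_Obj[OF A B g xs]]]
   fun_fo[OF pw xs] xs map_fo_compF[of xs "Mf h" "Mf g"] by (simp add: Rho_comp[OF g h w xs] del: map_map)
 fix fs xs ys assume fs: "fs \<in> hom (pw A w) xs ys"
 note o = powA.hom_Obj[OF fs] and pf = fun_fa[OF pw fs] and gf = Mf_hom[OF A B g fs]
 note Gp = fun_fa[OF G pf] and Hp = fun_fa[OF H fun_fa[OF G pf]]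
 have e: "fa (Mf h) (cmp (Rho g w) ys) \<cdot>[Car C] fa (Mf h) (fa (Mf g) (fa (Phi A w) fs)) =
   fa (Mf h) (fa (Phi B w) (map (fa (Mf g)) fs)) \<cdot>[Car C] fa (Mf h) (cmp (Rho g w) xs)"
  using fun_Cmp[OF H Gp isos_hom[OF Rho_isos[OF A B g w o(2)]]] Rho_nat[OF A B g w fs]
   fun_Cmp[OF H isos_hom[OF Rho_isos[OF A B g w o(1)]] fun_fa[OF B.Phi_functor[OF w] gf]] by simp
 have m: "map (fa ?A) fs = map (fa (Mf h)) (map (fa (Mf g)) fs)" using hom_powD[OF fs] by auto
 note paste = catC.paste[OF Hp fun_fa[OF H isos_hom[OF Rho_isos[OF A B g w o(1)]]] fun_fa[OF H isos_hom[OF Rho_isos[OF A B g w o(2)]]]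
   fun_fa[OF H fun_fa[OF B.Phi_functor[OF w] gf]] isos_hom[OF Rho_isos[OF B C h w Mf_Obj[OF A B g o(1)]]]
   isos_hom[OF Rho_isos[OF B C h w Mf_Obj[OF A B g o(2)]]] fun_fa[OF C.Phi_functor[OF w] Mf_hom[OF B C h gf]]
   e Rho_nat[OF B C h w gf]]
 show "cmp ?B ys \<cdot>[Car C] fa ?C (fa (Phi A w) fs) =
   fa (Phi C w) (map (fa ?C) fs) \<cdot>[Car C] cmp ?B xs"
  using paste homD(1)[OF pf] m by (simp add: Rho_comp[OF g h w o(1)] Rho_comp[OF g h w o(2)] del: map_map)
qed

lemma alg_comp_mors:
 assumes gm: "g \<in> alg_mors T A B" and hm: "h \<in> alg_mors T B C"
 shows "acomp A B C h g \<in> alg_mors T A C"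
proof (rule alg_morsI[OF A C])
 note g = mors_data[OF A B gm] and h = mors_data[OF B C hm]
 note G = mor_data_Mf[OF A B g] and H = mor_data_Mf[OF B C h]
 show "mor_data A C (acomp A B C h g)" by (rule alg_comp_data[OF g h])
 {
  fix w ws xs assume c: "composable T w ws" and xs: "xs \<in> Obj (pow (Car A) (tot ws))"
  note w = composableD(3)[OF c] and ws = composableD(4)[OF c] and lw = composableD(5)[OF c]
  note wg = words_wgamma[OF c] and Gx = Mf_Obj[OF A B g xs]
  have xg: "xs \<in> Obj (pow (Car A) (arity T (wgamma T w ws)))" using xs wg by simp
  have Gg: "map (fo (Mf g)) xs \<in> Obj (pow (Car B) (arity T (wgamma T w ws)))" using Gx wg by simp
  note Ax = OA.map2_ph_Obj[OF ws xs, unfolded lw] and Bx = OB.map2_ph_Obj[OF ws Gx, unfolded lw]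
  note Rg = map2_Rho_isos[OF A B g ws xs, unfolded lw] and Rh = map2_Rho_isos[OF B C h ws Gx, unfolded lw]
  note HRg = Mf_hom[OF B C h isos_hom[OF Rg]]
  let ?A = "map (fo (Mf g)) xs"
  have m: "RhoB (acomp A B C h g) ws xs
   = RhoB h ws ?A \<cdot>[pw C w] map (fa (Mf h)) (RhoB g ws xs)"
   (is "?L = ?R")
  proof (rule nth_equalityI)
   fix i assume "i < length ?L"
   then have i: "i < length ws" by simp
   then have "ws ! i \<in> words T" using ws by auto
   then show "?L ! i = ?R ! i"
    using i blocks_Obj[OF xs, of i] by (simp add: Rho_comp[OF g h] blocks_map del: pow_simps(1,2))
  qed simp
  have r: "cmp (Rho (acomp A B C h g) (wgamma T w ws)) xs = cmp (Rho h (wgamma T w ws)) ?A \<cdot>[Car C] fa (Mf h) (cmp (Rho g (wgamma T w ws)) xs)"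
   by (rule Rho_comp[OF g h wg(1) xg])
  have rw: "cmp (Rho (acomp A B C h g) w) (PhiB A ws xs)
   = cmp (Rho h w) (map (fo (Mf g)) (PhiB A ws xs)) \<cdot>[Car C] fa (Mf h) (cmp (Rho g w) (PhiB A ws xs))"
   by (rule Rho_comp[OF g h w Ax])
  have pm: "fa (Phi C w) (RhoB (acomp A B C h g) ws xs)
   = fa (Phi C w) (RhoB h ws ?A)
    \<cdot>[Car C] fa (Phi C w) (map (fa (Mf h)) (RhoB g ws xs))"
   unfolding m by (rule fun_Cmp[OF C.Phi_functor[OF w] HRg isos_hom[OF Rh]])
  note t = isos_hom[OF Rho_isos[OF A B g wg(1) xg]] isos_hom[OF cmp_Cc[OF B c Gx]] fun_fa[OF B.Phi_functor[OF w] isos_hom[OF Rg]]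
   isos_hom[OF Rho_isos[OF A B g w Ax]] fun_fa[OF G isos_hom[OF cmp_Cc[OF A c xs]]]
  have e2: "fa (Mf h) (cmp (Cc B w ws) ?A) \<cdot>[Car C] fa (Mf h) (cmp (Rho g (wgamma T w ws)) xs)
   = fa (Mf h) (fa (Phi B w) (RhoB g ws xs)) \<cdot>[Car C]
    (fa (Mf h) (cmp (Rho g w) (PhiB A ws xs)) \<cdot>[Car C] fa (Mf h) (fa (Mf g) (cmp (Cc A w ws) xs)))"
   using alg_mors_Cc[OF A B gm c xs, THEN arg_cong, of "fa (Mf h)"] fun_Cmp[OF H t(1,2)]
    fun_Cmp[OF H catB.Cmp_hom[OF t(5,4)] t(3)] fun_Cmp[OF H t(5,4)] by simp
  have mm: "map (fo (compF (Car A) (Mf h) (Mf g))) xs = map (fo (Mf h)) ?A" using map_fo_compF[of xs] xs by simp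
  show "Cc_law A C (acomp A B C h g) w ws xs"
   unfolding r rw pm Mf_alg_comp mm fa_compF_hom[OF isos_hom[OF cmp_Cc[OF A c xs]]]
   by (rule catC.comp_chain[OF fun_fa[OF H t(1)] isos_hom[OF Rho_isos[OF B C h wg(1) Gg]] isos_hom[OF cmp_Cc[OF C c Mf_Obj[OF B C h Gx]]]
     fun_fa[OF H t(2)] isos_hom[OF Rho_isos[OF B C h w Bx]] fun_fa[OF C.Phi_functor[OF w] isos_hom[OF Rh]]
     fun_fa[OF H t(5)] fun_fa[OF H t(4)] fun_fa[OF H t(3)]
     isos_hom[OF Rho_isos[OF B C h w Mf_Obj[OF A B g Ax]]] fun_fa[OF C.Phi_functor[OF w] HRg]
     alg_mors_Cc[OF B C hm c Gx] e2 Rho_nat[OF B C h w isos_hom[OF Rg]]])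
 }
 {
  fix x assume x: "x \<in> Obj (Car A)"
  have x1: "[x] \<in> Obj (pow (Car A) (arity T (wunit T)))" using x words_wunit by simp
  have gx: "fo (Mf g) x \<in> Obj (Car B)" by (rule fun_fo[OF G x])
  note gx1 = Mf_Obj[OF A B g x1]
  note Rg = isos_hom[OF Rho_isos[OF A B g words_wunit(1) x1]] and Rh = isos_hom[OF Rho_isos[OF B C h words_wunit(1) gx1]]
  note I = isos_hom[OF cmp_Ii[OF A x]] isos_hom[OF cmp_Ii[OF B gx]] isos_hom[OF cmp_Ii[OF C fun_fo[OF H gx]]]
  have "cmp (Ii C) [fo (Mf h) (fo (Mf g) x)] \<cdot>[Car C] (cmp (Rho h (wunit T)) [fo (Mf g) x] \<cdot>[Car C] fa (Mf h) (cmp (Rho g (wunit T)) [x]))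
   = fa (Mf h) (cmp (Ii B) [fo (Mf g) x] \<cdot>[Car B] cmp (Rho g (wunit T)) [x])"
   using catC.Cmp_assoc[OF fun_fa[OF H Rg] Rh] I(2,3) alg_mors_Ii[OF B C hm gx] fun_Cmp[OF H Rg] by simp
  also have "\<dots> = fa (Mf h) (fa (Mf g) (cmp (Ii A) [x]))" using alg_mors_Ii[OF A B gm x] by simp
  finally show "Ii_law A C (acomp A B C h g) x"
   using x homD(1)[OF I(1)] by (simp add: Rho_comp[OF g h words_wunit(1) x1])
 }
 {
  fix w l fs xs assume w: "w \<in> words T" and fs: "length fs = arity T w" "set fs \<subseteq> {..<l}" and xs: "xs \<in> Obj (pow (Car A) l)"
  note s = words_wsub[OF w fs] and Gx = Mf_Obj[OF A B g xs]
  have xg: "xs \<in> Obj (pow (Car A) (arity T (wsub T l fs w)))" using xs s by simp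
  have Gg: "map (fo (Mf g)) xs \<in> Obj (pow (Car B) (arity T (wsub T l fs w)))" using Gx s by simp
  note xf = map_nth_Obj[OF xs fs(2), unfolded fs(1)]
  let ?B = "map (fo (Mf g)) xs"
  have mg: "map ((!) ?B) fs = map (fo (Mf g)) (map ((!) xs) fs)" using fs xs by (auto simp: subset_iff)
  have mh: "map ((!) (map (fo (Mf h)) ys)) fs = map (fo (Mf h)) (map ((!) ys) fs)" if "length ys = l" for ys using fs that by (auto simp: subset_iff)
  note t = isos_hom[OF Rho_isos[OF A B g s(1) xg]] isos_hom[OF cmp_Ss[OF B w fs Gx]]
    isos_hom[OF Rho_isos[OF A B g w xf]] fun_fa[OF G isos_hom[OF cmp_Ss[OF A w fs xs]]]
  note SC = isos_hom[OF cmp_Ss[OF C w fs Mf_Obj[OF B C h Gx]]]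
  have lG: "length ?B = l" using xs by simp
  have e1: "fa (Mf h) (cmp (Ss B w l fs) ?B) \<cdot>[Car C] fa (Mf h) (cmp (Rho g (wsub T l fs w)) xs)
   = fa (Mf h) (cmp (Rho g w) (map ((!) xs) fs)) \<cdot>[Car C] fa (Mf h) (fa (Mf g) (cmp (Ss A w l fs) xs))"
   using alg_mors_Ss[OF A B gm w fs xs, THEN arg_cong, of "fa (Mf h)"] fun_Cmp[OF H t(1,2)] fun_Cmp[OF H t(4) t(3)[folded mg]]
   by (simp add: mg del: map_map)
  have mm: "map (fo (compF (Car A) (Mf h) (Mf g))) xs = map (fo (Mf h)) ?B" using map_fo_compF[of xs] xs by simp
  have r: "cmp (Rho (acomp A B C h g) (wsub T l fs w)) xs = cmp (Rho h (wsub T l fs w)) ?B \<cdot>[Car C] fa (Mf h) (cmp (Rho g (wsub T l fs w)) xs)"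
   by (rule Rho_comp[OF g h s(1) xg])
  have rw: "cmp (Rho (acomp A B C h g) w) (map ((!) xs) fs)
   = cmp (Rho h w) (map (fo (Mf g)) (map ((!) xs) fs)) \<cdot>[Car C] fa (Mf h) (cmp (Rho g w) (map ((!) xs) fs))"
   by (rule Rho_comp[OF g h w xf])
  show "Ss_law A C (acomp A B C h g) w l fs xs"
   unfolding r rw Mf_alg_comp mm fa_compF_hom[OF isos_hom[OF cmp_Ss[OF A w fs xs]]]
   by (rule catC.paste'[OF fun_fa[OF H t(4)] fun_fa[OF H t(1)] fun_fa[OF H t(3)] fun_fa[OF H t(2)[unfolded mg]]
      isos_hom[OF Rho_isos[OF B C h s(1) Gg]] isos_hom[OF Rho_isos[OF B C h w Mf_Obj[OF A B g xf]]] SC[unfolded mh[OF lG] mg]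
      e1 alg_mors_Ss[OF B C hm w fs Gx, unfolded mg]])
 }
qed

lemma acell_comp_hom:
 assumes \<alpha>: "\<alpha> \<in> hom (acat A B) g g'" and \<beta>: "\<beta> \<in> hom (acat B C) h h'"
 shows "acell_comp A B C \<beta> \<alpha> \<in> hom (acat A C) (acomp A B C h g) (acomp A B C h' g')"
proof -
 note \<alpha>d = acell_homD[OF A B \<alpha>] and \<beta>d = acell_homD[OF B C \<beta>]
 note g = mors_data[OF A B \<alpha>d(1)] and g' = mors_data[OF A B \<alpha>d(2)] and h = mors_data[OF B C \<beta>d(1)] and h' = mors_data[OF B C \<beta>d(2)]
 note G = mor_data_Mf[OF A B g] and G' = mor_data_Mf[OF A B g'] and H = mor_data_Mf[OF B C h] and H' = mor_data_Mf[OF B C h']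
 have a: "cell_nt \<alpha> \<in> hom (fun_cat (Car A) (Car B)) (Mf g) (Mf g')"
  by (rule nt_homI) (use \<alpha>d G G' in \<open>auto simp: cell_nt_def\<close>)
 have b: "cell_nt \<beta> \<in> hom (fun_cat (Car B) (Car C)) (Mf h) (Mf h')"
  by (rule nt_homI) (use \<beta>d H H' in \<open>auto simp: cell_nt_def\<close>)
 note ab = nt_homD[OF hcomp_hom[OF catA.category_axioms catC.category_axioms a b]]
 let ?A = "hcomp (Car A) (Car C) (cell_nt \<beta>) (cell_nt \<alpha>)" and ?C = "acell_comp A B C \<beta> \<alpha>"
 have cc: "cmp ?C = cmp ?A" by (simp add: acell_comp_def)
 show ?thesis
 proof (rule acell_homI[OF A C alg_comp_mors[OF \<alpha>d(1) \<beta>d(1)] alg_comp_mors[OF \<alpha>d(2) \<beta>d(2)]]; (simp only: cc Mf_alg_comp)?)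
  show "src ?C = acomp A B C h g" "tgt ?C = acomp A B C h' g'"
   using \<alpha>d(3,4) \<beta>d(3,4) by (auto simp: acell_comp_def)
  fix w xs assume w: "w \<in> words T" and xs: "xs \<in> Obj (pw A w)"
  note px = fun_fo[OF A.Phi_functor[OF w] xs] and gx = Mf_Obj[OF A B g xs] and gx' = Mf_Obj[OF A B g' xs]
  note Rg = isos_hom[OF Rho_isos[OF A B g w xs]] and Rg' = isos_hom[OF Rho_isos[OF A B g' w xs]]
  let ?B = "map (fo (Mf g)) xs"
  have ma: "map (cmp \<alpha>) xs \<in> hom (pw B w) ?B (map (fo (Mf g')) xs)"
   by (rule map_cmp_hom[OF \<alpha>d(6) xs])
  note Pa = fun_fa[OF B.Phi_functor[OF w] ma]
  let ?D = "map (cmp \<alpha>) xs"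
  have e1: "fa (Mf h') (cmp (Rho g' w) xs) \<cdot>[Car C] fa (Mf h') (cmp \<alpha> (fo (Phi A w) xs))
    = fa (Mf h') (fa (Phi B w) ?D) \<cdot>[Car C] fa (Mf h') (cmp (Rho g w) xs)"
   using \<alpha>d(8)[OF w xs, THEN arg_cong, of "fa (Mf h')"] fun_Cmp[OF H' \<alpha>d(6)[OF px] Rg'] fun_Cmp[OF H' Rg Pa] by simp
  \<comment> \<open>Here naturality of \<open>\<beta>\<close> at the cell of \<open>g\<close> is
    pasted with the image under \<open>h'\<close> of the law for \<open>\<alpha>\<close>. Below,
    \<open>p2\<close> pastes the law for \<open>\<beta>\<close> with naturality of the cell of
    \<open>h'\<close>; together they give the law for the composite.\<close>
  note p1 = catC.paste'[OF fun_fa[OF H Rg] \<beta>d(6)[OF fun_fo[OF G px]] \<beta>d(6)[OF fun_fo[OF B.Phi_functor[OF w] gx]]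
    fun_fa[OF H' Rg] fun_fa[OF H' \<alpha>d(6)[OF px]] fun_fa[OF H' Pa] fun_fa[OF H' Rg'] \<beta>d(7)[OF Rg, symmetric] e1]
  note Ph = isos_hom[OF Rho_isos[OF B C h' w gx']] isos_hom[OF Rho_isos[OF B C h' w gx]] isos_hom[OF Rho_isos[OF B C h w gx]]
  have mb: "map (cmp \<beta>) ?B \<in> hom (pw C w) (map (fo (Mf h)) ?B) (map (fo (Mf h')) ?B)"
   by (rule map_cmp_hom[OF \<beta>d(6) gx])
  note mha = Mf_hom[OF B C h' ma]
  note Pb = fun_fa[OF C.Phi_functor[OF w] mb] and Pha = fun_fa[OF C.Phi_functor[OF w] mha]
  note p2 = catC.paste'[OF Ph(3) \<beta>d(6)[OF fun_fo[OF B.Phi_functor[OF w] gx]] Pb Ph(2) fun_fa[OF H' Pa] Pha Ph(1) \<beta>d(8)[OF w gx] Rho_nat[OF B C h' w ma]]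
  note x1 = catC.Cmp_hom[OF \<beta>d(6)[OF fun_fo[OF G px]] fun_fa[OF H' \<alpha>d(6)[OF px]]]
  note x2 = catC.Cmp_hom[OF \<beta>d(6)[OF fun_fo[OF B.Phi_functor[OF w] gx]] fun_fa[OF H' Pa]]
  have m: "map (cmp ?A) xs = map (fa (Mf h')) ?D \<cdot>[pw C w] map (cmp \<beta>) ?B"
   using xs \<alpha>d(3,4) \<beta>d(3,4) by (auto intro!: nth_equalityI simp: cell_nt_def subset_iff)
  have "cmp (Rho (acomp A B C h' g') w) xs \<cdot>[Car C] cmp ?A (fo (Phi A w) xs)
   = (cmp (Rho h' w) (map (fo (Mf g')) xs) \<cdot>[Car C] fa (Mf h') (cmp (Rho g' w) xs)) \<cdot>[Car C]
    (fa (Mf h') (cmp \<alpha> (fo (Phi A w) xs)) \<cdot>[Car C] cmp \<beta> (fo (Mf g) (fo (Phi A w) xs)))"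
   using px \<alpha>d(3,4) \<beta>d(3,4) by (simp add: Rho_comp[OF g' h' w xs] cell_nt_def)
  also have "\<dots> = (fa (Phi C w) (map (fa (Mf h')) ?D) \<cdot>[Car C] fa (Phi C w) (map (cmp \<beta>) ?B))
   \<cdot>[Car C] (cmp (Rho h w) ?B \<cdot>[Car C] fa (Mf h) (cmp (Rho g w) xs))"
   by (rule catC.paste[OF x1 fun_fa[OF H Rg] fun_fa[OF H' Rg'] x2 Ph(3) Ph(1) catC.Cmp_hom[OF Pb Pha] p1 p2])
  also have "\<dots> = fa (Phi C w) (map (cmp ?A) xs) \<cdot>[Car C] cmp (Rho (acomp A B C h g) w) xs"
   unfolding m fun_Cmp[OF C.Phi_functor[OF w] mb mha] Rho_comp[OF g h w xs] ..
  finally show "cmp (Rho (acomp A B C h' g') w) xs \<cdot>[Car C] cmp ?A (fo (Phi A w) xs) = \<dots>" .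
 qed (use ab in auto)
qed

end

lemma cmp_post_cell:
 assumes A: "pseudo_algebra T A" and B: "pseudo_algebra T B" and C: "pseudo_algebra T C" and h: "h \<in> alg_mors T B C"
  and \<alpha>: "\<alpha> \<in> hom (acat A B) g g'" and a: "a \<in> Obj (Car A)"
 shows "cmp (acell_comp A B C (Ide (acat B C) h) \<alpha>) a = fa (Mf h) (cmp \<alpha> a)"
proof -
 note ad = acell_homD[OF A B \<alpha>] and H = mor_data_Mf[OF B C mors_data[OF B C h]]
 have "fo (Mf g) a \<in> Obj (Car B)" by (rule fun_fo[OF mor_data_Mf[OF A B mors_data[OF A B ad(1)]] a])
 then show ?thesis
  using category.Cmp_Ide_right[OF cat_Car[OF C] fun_fa[OF H ad(6)[OF a]]]
  by (simp add: cmp_acell_comp[OF a] ad(3))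
qed

lemma cmp_pre_cell:
 assumes A: "pseudo_algebra T A" and B: "pseudo_algebra T B" and C: "pseudo_algebra T C" and g: "g \<in> alg_mors T A B"
  and \<beta>: "\<beta> \<in> hom (acat B C) h h'" and a: "a \<in> Obj (Car A)"
 shows "cmp (acell_comp A B C \<beta> (Ide (acat A B) g)) a = cmp \<beta> (fo (Mf g) a)"
proof -
 note bd = acell_homD[OF B C \<beta>] and H' = mor_data_Mf[OF B C mors_data[OF B C acell_homD(2)[OF B C \<beta>]]]
 have o: "fo (Mf g) a \<in> Obj (Car B)" by (rule fun_fo[OF mor_data_Mf[OF A B mors_data[OF A B g]] a])
 show ?thesis
  using category.Cmp_Ide_left[OF cat_Car[OF C] bd(6)[OF o]] fun_Ide[OF H' o] a
  by (simp add: cmp_acell_comp[OF a] bd(4))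
qed

lemma alg_id_mors: assumes A: "pseudo_algebra T A" shows "alg_id T A \<in> alg_mors T A A"
proof -
 interpret A: pseudo_algebra T A by (rule A)
 interpret OA: operations "Car A" "arity T" "Phi A" "words T" by (rule alg_operations[OF A])
 interpret catA: category "Car A" by (rule A.category_Car)
 have id: "Mf (alg_id T A) = id_func (Car A)" "w \<in> words T ==> Rho (alg_id T A) w = iPhi T A w" for w by (auto simp: alg_id_def)
 have cI: "cmp (iPhi T A w) xs = Ide (Car A) (fo (Phi A w) xs)" if "xs \<in> Obj (pw A w)" for w xs
  using that by (simp add: iPhi_def)
 have mi: "map (fo (id_func (Car A))) xs = xs" if "xs \<in> Obj (pow (Car A) n)" for xs n
  using that by (auto intro: nth_equalityI simp: subset_iff)
 have d: "mor_data A A (alg_id T A)"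
 proof (rule mor_dataI[OF A A])
  fix w assume w: "w \<in> words T"
  let ?A = "Rho (alg_id T A) w"
  show "src ?A = compF (pw A w) (Mf (alg_id T A)) (Phi A w)"
   using w by (simp add: id iPhi_def compF_id_left[OF A.Phi_functor])
  have "powF (Car A) n (id_func (Car A)) = id_func (pow (Car A) n)" for n
   by (rule func_eqI'[OF ext_simps(1) _ ext_simps(2)]) (auto simp: id_func_def powF_def subset_iff intro!: nth_equalityI)
  then show "tgt ?A = compF (pw A w) (Phi A w) (powF (Car A) (arity T w) (Mf (alg_id T A)))"
   using w by (simp add: id iPhi_def compF_id_right[OF A.Phi_functor])
  show "cmp ?A xs \<in> isos (Car A) (fo (Mf (alg_id T A)) (fo (Phi A w) xs)) (fo (Phi A w) (map (fo (Mf (alg_id T A))) xs))"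
   if "xs \<in> Obj (pw A w)" for xs
   using that w fun_fo[OF A.Phi_functor[OF w] that] by (simp add: id cI mi[OF that] catA.Ide_isos del: pow_simps)
  show "cmp ?A ys \<cdot>[Car A] fa (Mf (alg_id T A)) (fa (Phi A w) fs) = fa (Phi A w) (map (fa (Mf (alg_id T A))) fs) \<cdot>[Car A] cmp ?A xs"
   if fs: "fs \<in> hom (pw A w) xs ys" for fs xs ys
  proof -
   have "map (fa (id_func (Car A))) fs = fs" using hom_powD[OF fs] by (auto intro: nth_equalityI simp: subset_iff)
   then show ?thesis
    using w category.hom_Obj[OF category_pow[OF catA.category_axioms] fs] fun_fa[OF A.Phi_functor[OF w] fs]
    by (simp add: id cI homD(1) catA.Cmp_Ide_left catA.Cmp_Ide_right del: pow_simps)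
  qed
 qed (auto simp: alg_id_def iPhi_def id_func_functors[OF catA.category_axioms])
 show ?thesis
 proof (rule alg_morsI[OF A A d])
  fix w ws xs assume c: "composable T w ws" and xs: "xs \<in> Obj (pow (Car A) (tot ws))"
  note w = composableD(3)[OF c] and ws = composableD(4)[OF c] and lw = composableD(5)[OF c] and wg = words_wgamma[OF c]
  have xg: "xs \<in> Obj (pow (Car A) (arity T (wgamma T w ws)))" using xs wg by simp
  note Ax = OA.map2_ph_Obj[OF ws xs, unfolded lw]
  have "RhoB (alg_id T A) ws xs = map (Ide (Car A)) (PhiB A ws xs)"
  proof (rule nth_equalityI)
   fix i assume "i < length (RhoB (alg_id T A) ws xs)"
   then have i: "i < length ws" by simp
   then have "ws ! i \<in> words T" using ws by auto
   then show "RhoB (alg_id T A) ws xs ! i = map (Ide (Car A)) (PhiB A ws xs) ! i"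
    using i blocks_Obj[OF xs, of i] cI by (simp add: id del: pow_simps)
  qed simp
  then have "fa (Phi A w) (RhoB (alg_id T A) ws xs) = Ide (Car A) (fo (Phi A w) (PhiB A ws xs))"
   using fun_Ide[OF A.Phi_functor[OF w] Ax] by (simp del: map_map)
  moreover note C = isos_hom[OF cmp_Cc[OF A c xs]]
  ultimately show "Cc_law A A (alg_id T A) w ws xs"
   using mi[OF xs] xg Ax
   by (simp add: id w wg(1) cI homD(1)[OF C] catA.Cmp_Ide_left[OF C] catA.Cmp_Ide_right[OF C] del: pow_simps)
 next
  fix x assume x: "x \<in> Obj (Car A)"
  note C = isos_hom[OF cmp_Ii[OF A x]]
  have "[x] \<in> Obj (pow (Car A) (arity T (wunit T)))" using x words_wunit by simp
  then show "Ii_law A A (alg_id T A) x"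
   using x by (simp add: id words_wunit(1) cI homD(1)[OF C] catA.Cmp_Ide_right[OF C] del: pow_simps)
 next
  fix w l fs xs assume w: "w \<in> words T" and fs: "length fs = arity T w" "set fs \<subseteq> {..<l}" and xs: "xs \<in> Obj (pow (Car A) l)"
  note C = isos_hom[OF cmp_Ss[OF A w fs xs]] and s = words_wsub[OF w fs]
  have xg: "xs \<in> Obj (pow (Car A) (arity T (wsub T l fs w)))" using xs s by simp
  show "Ss_law A A (alg_id T A) w l fs xs"
   using mi[OF xs] xg map_nth_Obj[OF xs fs(2), unfolded fs(1)]
   by (simp add: id w s(1) cI homD(1)[OF C] catA.Cmp_Ide_left[OF C] catA.Cmp_Ide_right[OF C] del: pow_simps)
 qed
qed

abbreviation "smallA U A == pseudo_algebra T A \<and> Obj (Car A) \<in> U \<and> Arr (Car A) \<in> U"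

lemma Alg_simps [simp]:
 "A \<in> Ob (Alg U T) \<longleftrightarrow> smallA U A" "Hom (Alg U T) = acat"
 "One (Alg U T) = alg_id T" "Hc1 (Alg U T) = acomp" "Hc2 (Alg U T) A B C = acell_comp A B C"
 by (auto simp: Alg_def acell_comp_def fun_eq_iff)

text \<open>Morphisms are equal when their functors and the components of \<open>Rho\<close> are,
  2-cells when their components are. So every law becomes an equation between arrows of a
  carrier.\<close>

lemma two_category_Alg: "two_category (Alg U T)"
proof (rule two_category.intro; (simp only: Alg_simps)?)
 fix A B assume "smallA U A" "smallA U B"
 then have A: "pseudo_algebra T A" and B: "pseudo_algebra T B" by auto
 interpret A: pseudo_algebra T A by (rule A)
 interpret B: pseudo_algebra T B by (rule B)
 interpret catA: category "Car A" by (rule A.category_Car)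
 interpret catB: category "Car B" by (rule B.category_Car)
 interpret AB: category "acat A B" by (rule category_acat[OF A B])
 show "category (acat A B)" by (rule category_acat[OF A B])
 show "alg_id T A \<in> Obj (acat A A)" using alg_id_mors[OF A] by simp
 note iA = alg_id_mors[OF A] and iB = alg_id_mors[OF B]
 have idMf: "Mf (alg_id T A) = id_func (Car A)" "Mf (alg_id T B) = id_func (Car B)" by (auto simp: alg_id_def)
 have idR: "cmp (Rho (alg_id T Y) w) xs = Ide (Car Y) (fo (Phi Y w) xs)" if "w \<in> words T" "xs \<in> Obj (pw Y w)" for Y w xs
  using that by (simp add: alg_id_def iPhi_def)
 have left: "acomp A B B (alg_id T B) h = h" if hm: "h \<in> alg_mors T A B" for h
 proof -
  note h = mors_data[OF A B hm] and i = mors_data[OF B B iB]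
  note H = mor_data_Mf[OF A B h]
  show ?thesis
  proof (rule amor_eqI[OF A B alg_comp_data[OF A B B h i] h])
   show "Mf (acomp A B B (alg_id T B) h) = Mf h" by (simp add: idMf compF_id_left[OF H])
   fix w xs assume w: "w \<in> words T" and xs: "xs \<in> Obj (pw A w)"
   note R = isos_hom[OF Rho_isos[OF A B h w xs]]
   show "cmp (Rho (acomp A B B (alg_id T B) h) w) xs = cmp (Rho h w) xs"
    by (simp only: Rho_comp[OF A B B h i w xs] idR[OF w Mf_Obj[OF A B h xs]] idMf fa_id_func[OF homD(1)[OF R]] catB.Cmp_Ide_left[OF R])
  qed
 qed
 have right: "acomp A A B h (alg_id T A) = h" if hm: "h \<in> alg_mors T A B" for h
 proof -
  note h = mors_data[OF A B hm] and i = mors_data[OF A A iA]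
  note H = mor_data_Mf[OF A B h]
  show ?thesis
  proof (rule amor_eqI[OF A B alg_comp_data[OF A A B i h] h])
   show "Mf (acomp A A B h (alg_id T A)) = Mf h" by (simp add: idMf compF_id_right[OF H])
   fix w xs assume w: "w \<in> words T" and xs: "xs \<in> Obj (pw A w)"
   note R = isos_hom[OF Rho_isos[OF A B h w xs]]
   have "map (fo (id_func (Car A))) xs = xs" using xs by (auto intro: nth_equalityI simp: subset_iff)
   then show "cmp (Rho (acomp A A B h (alg_id T A)) w) xs = cmp (Rho h w) xs"
    by (simp only: Rho_comp[OF A A B i h w xs] idR[OF w xs] idMf fun_Ide[OF H fun_fo[OF A.Phi_functor[OF w] xs]] catB.Cmp_Ide_right[OF R])
  qed
 qed
 show "acomp A B B (alg_id T B) h = h" "acomp A A B h (alg_id T A) = h" if "h \<in> Obj (acat A B)" for h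
  using left right that by auto
 fix \<alpha> assume "\<alpha> \<in> Arr (acat A B)"
 then obtain h k where \<alpha>: "\<alpha> \<in> hom (acat A B) h k" by (auto simp: hom_def)
 note \<alpha>d = acell_homD[OF A B \<alpha>]
 note H = mor_data_Mf[OF A B mors_data[OF A B \<alpha>d(1)]] and K = mor_data_Mf[OF A B mors_data[OF A B \<alpha>d(2)]]
 have i: "Ide (acat A A) (alg_id T A) \<in> hom (acat A A) (alg_id T A) (alg_id T A)"
  "Ide (acat B B) (alg_id T B) \<in> hom (acat B B) (alg_id T B) (alg_id T B)"
  using category.Ide_hom[OF category_acat[OF A A], of "alg_id T A"] category.Ide_hom[OF category_acat[OF B B], of "alg_id T B"] iA iB by auto
 show "acell_comp A B B (Ide (acat B B) (alg_id T B)) \<alpha> = \<alpha>"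
 proof (rule acell_eqI[OF A B acell_comp_hom[OF A B B \<alpha> i(2)]])
  show "\<alpha> \<in> hom (acat A B) (acomp A B B (alg_id T B) h) (acomp A B B (alg_id T B) k)"
   using \<alpha> left \<alpha>d(1,2) by simp
  fix a assume a: "a \<in> Obj (Car A)"
  show "cmp (acell_comp A B B (Ide (acat B B) (alg_id T B)) \<alpha>) a = cmp \<alpha> a"
   using a fun_fo[OF H a] homD(1)[OF \<alpha>d(6)[OF a]] catB.Cmp_Ide_right[OF \<alpha>d(6)[OF a]]
   by (simp add: cmp_acell_comp[OF a] idMf \<alpha>d(3))
 qed
 show "acell_comp A A B \<alpha> (Ide (acat A A) (alg_id T A)) = \<alpha>"
 proof (rule acell_eqI[OF A B acell_comp_hom[OF A A B i(1) \<alpha>]])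
  show "\<alpha> \<in> hom (acat A B) (acomp A A B h (alg_id T A)) (acomp A A B k (alg_id T A))"
   using \<alpha> right \<alpha>d(1,2) by simp
  fix a assume a: "a \<in> Obj (Car A)"
  show "cmp (acell_comp A A B \<alpha> (Ide (acat A A) (alg_id T A))) a = cmp \<alpha> a"
   using a fun_Ide[OF K a] catB.Cmp_Ide_left[OF \<alpha>d(6)[OF a]]
   by (simp add: cmp_acell_comp[OF a] idMf \<alpha>d(4))
 qed
next
 fix A B C assume "smallA U A" "smallA U B"
  "smallA U C"
 then have A: "pseudo_algebra T A" and B: "pseudo_algebra T B" and C: "pseudo_algebra T C" by auto
 interpret catA: category "Car A" by (rule cat_Car[OF A])
 interpret catB: category "Car B" by (rule cat_Car[OF B])
 interpret catC: category "Car C" by (rule cat_Car[OF C])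
 interpret AB: category "acat A B" by (rule category_acat[OF A B])
 interpret BC: category "acat B C" by (rule category_acat[OF B C])
 interpret AC: category "acat A C" by (rule category_acat[OF A C])
 show comp: "acomp A B C h g \<in> Obj (acat A C)" if "g \<in> Obj (acat A B)" "h \<in> Obj (acat B C)" for g h
  using that alg_comp_mors[OF A B C] by simp
 show "acell_comp A B C \<beta> \<alpha> \<in> hom (acat A C) (acomp A B C g f) (acomp A B C g' f')"
  if "\<alpha> \<in> hom (acat A B) f f'" "\<beta> \<in> hom (acat B C) g g'" for \<alpha> \<beta> f f' g g'
  by (rule acell_comp_hom[OF A B C that])
 show "acell_comp A B C (Ide (acat B C) g) (Ide (acat A B) f) = Ide (acat A C) (acomp A B C g f)"
  if f: "f \<in> Obj (acat A B)" and g: "g \<in> Obj (acat B C)" for f g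
 proof (rule acell_eqI[OF A C acell_comp_hom[OF A B C AB.Ide_hom[OF f] BC.Ide_hom[OF g]] AC.Ide_hom[OF comp[OF f g]]])
  fix a assume a: "a \<in> Obj (Car A)"
  have f': "f \<in> alg_mors T A B" and g': "g \<in> alg_mors T B C" using f g by auto
  note F = mor_data_Mf[OF A B mors_data[OF A B f']] and G = mor_data_Mf[OF B C mors_data[OF B C g']]
  show "cmp (acell_comp A B C (Ide (acat B C) g) (Ide (acat A B) f)) a = cmp (Ide (acat A C) (acomp A B C g f)) a"
   using a fun_fo[OF F a] fun_Ide[OF G fun_fo[OF F a]] fun_fo[OF G fun_fo[OF F a]]
   by (simp add: cmp_acell_comp[OF a] catC.Cmp_Ide_left[OF catC.Ide_hom])
 qed
 show "acell_comp A B C (\<beta>' \<cdot>[acat B C] \<beta>) (\<alpha>' \<cdot>[acat A B] \<alpha>) = acell_comp A B C \<beta>' \<alpha>' \<cdot>[acat A C] acell_comp A B C \<beta> \<alpha>"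
  if \<alpha>: "\<alpha> \<in> hom (acat A B) f f'" and \<alpha>': "\<alpha>' \<in> hom (acat A B) f' f''" and \<beta>: "\<beta> \<in> hom (acat B C) g g'"
   and \<beta>': "\<beta>' \<in> hom (acat B C) g' g''" for \<alpha> \<alpha>' \<beta> \<beta>' f f' f'' g g' g''
 proof (rule acell_eqI[OF A C acell_comp_hom[OF A B C AB.Cmp_hom[OF \<alpha> \<alpha>'] BC.Cmp_hom[OF \<beta> \<beta>']]
   AC.Cmp_hom[OF acell_comp_hom[OF A B C \<alpha> \<beta>] acell_comp_hom[OF A B C \<alpha>' \<beta>']]])
  fix a assume a: "a \<in> Obj (Car A)"
  note \<alpha>d = acell_homD[OF A B \<alpha>] and \<alpha>d' = acell_homD[OF A B \<alpha>'] and \<beta>d = acell_homD[OF B C \<beta>] and \<beta>d' = acell_homD[OF B C \<beta>']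
  note F = mor_data_Mf[OF A B mors_data[OF A B \<alpha>d(1)]] and F' = mor_data_Mf[OF A B mors_data[OF A B \<alpha>d'(1)]]
   and G' = mor_data_Mf[OF B C mors_data[OF B C \<beta>d(2)]] and G'' = mor_data_Mf[OF B C mors_data[OF B C \<beta>d'(2)]]
  note t = \<beta>d(6)[OF fun_fo[OF F a]] \<beta>d'(6)[OF fun_fo[OF F a]] \<beta>d'(6)[OF fun_fo[OF F' a]]
   fun_fa[OF G' \<alpha>d(6)[OF a]] fun_fa[OF G'' \<alpha>d(6)[OF a]] fun_fa[OF G'' \<alpha>d'(6)[OF a]]
  \<comment> \<open>Middle four interchange: naturality of \<open>\<beta>'\<close> at the component
    of \<open>\<alpha>\<close> exchanges the two inner factors.\<close>
  have "(fa (Mf g'') (cmp \<alpha>' a) \<cdot>[Car C] fa (Mf g'') (cmp \<alpha> a)) \<cdot>[Car C] (cmp \<beta>' (fo (Mf f) a) \<cdot>[Car C] cmp \<beta> (fo (Mf f) a))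
   = fa (Mf g'') (cmp \<alpha>' a) \<cdot>[Car C] ((fa (Mf g'') (cmp \<alpha> a) \<cdot>[Car C] cmp \<beta>' (fo (Mf f) a)) \<cdot>[Car C] cmp \<beta> (fo (Mf f) a))"
   using catC.Cmp_assoc[OF catC.Cmp_hom[OF t(1,2)] t(5,6)] catC.Cmp_assoc[OF t(1,2,5)] by simp
  also have "\<dots> = fa (Mf g'') (cmp \<alpha>' a) \<cdot>[Car C] (cmp \<beta>' (fo (Mf f') a) \<cdot>[Car C] (fa (Mf g') (cmp \<alpha> a) \<cdot>[Car C] cmp \<beta> (fo (Mf f) a)))"
   using \<beta>d'(7)[OF \<alpha>d(6)[OF a]] catC.Cmp_assoc[OF t(1,4,3)] by simp
  also have "\<dots> = (fa (Mf g'') (cmp \<alpha>' a) \<cdot>[Car C] cmp \<beta>' (fo (Mf f') a)) \<cdot>[Car C] (fa (Mf g') (cmp \<alpha> a) \<cdot>[Car C] cmp \<beta> (fo (Mf f) a))"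
   by (rule catC.Cmp_assoc[OF catC.Cmp_hom[OF t(1,4)] t(3,6)])
  finally show "cmp (acell_comp A B C (\<beta>' \<cdot>[acat B C] \<beta>) (\<alpha>' \<cdot>[acat A B] \<alpha>)) a
   = cmp (acell_comp A B C \<beta>' \<alpha>' \<cdot>[acat A C] acell_comp A B C \<beta> \<alpha>) a"
   using a fun_fo[OF F a] fun_Cmp[OF G'' \<alpha>d(6)[OF a] \<alpha>d'(6)[OF a]]
   by (simp add: cmp_acell_comp[OF a] \<alpha>d(3) \<alpha>d'(3) \<beta>d(4) \<beta>d'(4))
 qed
next
 fix A B C D assume "smallA U A" "smallA U B"
  "smallA U C" "smallA U D"
 then have A: "pseudo_algebra T A" and B: "pseudo_algebra T B" and C: "pseudo_algebra T C" and D: "pseudo_algebra T D" by auto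
 interpret catD: category "Car D" by (rule cat_Car[OF D])
 have assoc: "acomp A B D (acomp B C D h g) f = acomp A C D h (acomp A B C g f)"
  if fm: "f \<in> alg_mors T A B" and gm: "g \<in> alg_mors T B C" and hm: "h \<in> alg_mors T C D" for f g h
 proof -
  note f = mors_data[OF A B fm] and g = mors_data[OF B C gm] and h = mors_data[OF C D hm]
  note F = mor_data_Mf[OF A B f] and H = mor_data_Mf[OF C D h] and G = mor_data_Mf[OF B C g]
  note hg = alg_comp_data[OF B C D g h] and gf = alg_comp_data[OF A B C f g]
  show ?thesis
  proof (rule amor_eqI[OF A D alg_comp_data[OF A B D f hg] alg_comp_data[OF A C D gf h]])
   show "Mf (acomp A B D (acomp B C D h g) f) = Mf (acomp A C D h (acomp A B C g f))"
    by (simp add: compF_assoc[OF F])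
   fix w xs assume w: "w \<in> words T" and xs: "xs \<in> Obj (pw A w)"
   note fx = Mf_Obj[OF A B f xs]
   note Rf = isos_hom[OF Rho_isos[OF A B f w xs]] and Rg = isos_hom[OF Rho_isos[OF B C g w fx]]
    and Rh = isos_hom[OF Rho_isos[OF C D h w Mf_Obj[OF B C g fx]]]
   have m: "map (fo (compF (Car A) (Mf g) (Mf f))) xs = map (fo (Mf g)) (map (fo (Mf f)) xs)" using xs by (auto simp: subset_iff)
   show "cmp (Rho (acomp A B D (acomp B C D h g) f) w) xs = cmp (Rho (acomp A C D h (acomp A B C g f)) w) xs"
    unfolding Rho_comp[OF A B D f hg w xs] Rho_comp[OF B C D g h w fx] Rho_comp[OF A C D gf h w xs]
     Rho_comp[OF A B C f g w xs] Mf_alg_comp m fa_compF_hom[OF Rf] fun_Cmp[OF H fun_fa[OF G Rf] Rg]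
    by (rule catD.Cmp_assoc[OF fun_fa[OF H fun_fa[OF G Rf]] fun_fa[OF H Rg] Rh, symmetric])
  qed
 qed
 show "acomp A C D h (acomp A B C g f) = acomp A B D (acomp B C D h g) f"
  if "f \<in> Obj (acat A B)" "g \<in> Obj (acat B C)" "h \<in> Obj (acat C D)" for f g h
  using that assoc by simp
 fix \<alpha> \<beta> \<gamma> assume "\<alpha> \<in> Arr (acat A B)" "\<beta> \<in> Arr (acat B C)" "\<gamma> \<in> Arr (acat C D)"
 then obtain f f' g g' h h' where \<alpha>: "\<alpha> \<in> hom (acat A B) f f'" and \<beta>: "\<beta> \<in> hom (acat B C) g g'"
  and \<gamma>: "\<gamma> \<in> hom (acat C D) h h'" by (auto simp: hom_def)
 note \<alpha>d = acell_homD[OF A B \<alpha>] and \<beta>d = acell_homD[OF B C \<beta>] and \<gamma>d = acell_homD[OF C D \<gamma>]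
 note \<beta>\<alpha> = acell_comp_hom[OF A B C \<alpha> \<beta>] and \<gamma>\<beta> = acell_comp_hom[OF B C D \<beta> \<gamma>]
 note F = mor_data_Mf[OF A B mors_data[OF A B \<alpha>d(1)]] and G = mor_data_Mf[OF B C mors_data[OF B C \<beta>d(1)]]
  and G' = mor_data_Mf[OF B C mors_data[OF B C \<beta>d(2)]] and H' = mor_data_Mf[OF C D mors_data[OF C D \<gamma>d(2)]]
 let ?A = "acell_comp B C D \<gamma> \<beta>"
 show "acell_comp A C D \<gamma> (acell_comp A B C \<beta> \<alpha>) = acell_comp A B D ?A \<alpha>"
 proof (rule acell_eqI[OF A D acell_comp_hom[OF A C D \<beta>\<alpha> \<gamma>]])
  show "acell_comp A B D ?A \<alpha> \<in> hom (acat A D) (acomp A C D h (acomp A B C g f)) (acomp A C D h' (acomp A B C g' f'))"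
   using acell_comp_hom[OF A B D \<alpha> \<gamma>\<beta>] assoc \<alpha>d(1,2) \<beta>d(1,2) \<gamma>d(1,2) by simp
  fix a assume a: "a \<in> Obj (Car A)"
  note fa' = fun_fo[OF F a]
  show "cmp (acell_comp A C D \<gamma> (acell_comp A B C \<beta> \<alpha>)) a = cmp (acell_comp A B D ?A \<alpha>) a"
   using a fa' homD(1)[OF \<alpha>d(6)[OF a]] fun_Cmp[OF H' \<beta>d(6)[OF fa'] fun_fa[OF G' \<alpha>d(6)[OF a]]]
    catD.Cmp_assoc[OF \<gamma>d(6)[OF fun_fo[OF G fa']] fun_fa[OF H' \<beta>d(6)[OF fa']] fun_fa[OF H' fun_fa[OF G' \<alpha>d(6)[OF a]]]]
   by (simp add: cmp_acell_comp[OF a] cmp_acell_comp[OF a] cmp_acell_comp[OF a] cmp_acell_comp[OF fa']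
     acell_homD(3,4)[OF A C \<beta>\<alpha>] acell_homD(3,4)[OF B D \<gamma>\<beta>] \<alpha>d(3,4) \<beta>d(3,4) \<gamma>d(3,4))
 qed
qed

end

section \<open>Lifting cocones along a jointly faithful family\<close>

text \<open>The 1-cells \<open>P i\<close> out of \<open>W\<close> are jointly faithful on 2-cells
  into \<open>W\<close>. Data in \<open>W\<close> that every \<open>P i\<close> sends to the cocone
  \<open>\<tau> i\<close> then form a cocone, because each \<open>\<tau> i\<close> is one. This
  isolates the verification of the universal cocone from the syntax.\<close>

locale cone_lifting = bicolimit_data C D F J
 for C :: "('o, 'f, 'a) twocat" and D :: "('d, 'g, 'b) twocat"
  and F :: "('d, 'g, 'b, 'o, 'f, 'a) pfun" and J :: "('d, 'g, 'b, 'p, 'e) catfun" +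
 fixes W :: 'o and I :: "'i set" and X :: "'i => 'o" and P :: "'i => 'f" and \<tau> :: "'i => ('d, 'g, 'p, 'e, 'f, 'a) pnat"
  and k0 :: "'d => 'p => 'f" and k1 :: "'d => 'e => 'a" and k2 :: "'d => 'd => 'g => 'p => 'a"
 assumes W: "W \<in> Ob C" and X: "i \<in> I ==> X i \<in> Ob C" and P: "i \<in> I ==> P i \<in> Obj (Hom C W (X i))"
  and \<tau>: "i \<in> I ==> \<tau> i \<in> cones (X i)"
  and faithful: "[|d \<in> Ob D; \<alpha> \<in> hom (Hom C (P0 F d) W) h k; \<beta> \<in> hom (Hom C (P0 F d) W) h k;
    \<And>i. i \<in> I ==> Hc2 C (P0 F d) W (X i) (Ide (Hom C W (X i)) (P i)) \<alpha>
     = Hc2 C (P0 F d) W (X i) (Ide (Hom C W (X i)) (P i)) \<beta>|] ==> \<alpha> = \<beta>"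
  and k0: "d \<in> Ob D ==> j \<in> Obj (P0 J d) ==> k0 d j \<in> Obj (Hom C (P0 F d) W)"
  and P_k0: "i \<in> I ==> d \<in> Ob D ==> j \<in> Obj (P0 J d) ==> Hc1 C (P0 F d) W (X i) (P i) (k0 d j) = fo (t1 (\<tau> i) d) j"
  and k1: "d \<in> Ob D ==> u \<in> hom (P0 J d) j j' ==> k1 d u \<in> hom (Hom C (P0 F d) W) (k0 d j) (k0 d j')"
  and P_k1: "i \<in> I ==> d \<in> Ob D ==> u \<in> hom (P0 J d) j j' ==>
    Hc2 C (P0 F d) W (X i) (Ide (Hom C W (X i)) (P i)) (k1 d u) = fa (t1 (\<tau> i) d) u"
  and k2: "one_cell D e d f ==> j \<in> Obj (P0 J d) ==> k2 d e f j \<in> isos (Hom C (P0 F e) W)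
    (Hc1 C (P0 F e) (P0 F d) W (k0 d j) (P1 F e d f)) (k0 e (fo (P1 J d e f) j))"
  and P_k2: "i \<in> I ==> one_cell D e d f ==> j \<in> Obj (P0 J d) ==>
    Hc2 C (P0 F e) W (X i) (Ide (Hom C W (X i)) (P i)) (k2 d e f j) = cmp (t2 (\<tau> i) d e f) j"
begin

definition \<kappa>t where
 "\<kappa>t d = \<lparr>fo = (\<lambda>j\<in>Obj (P0 J d). k0 d j), fa = (\<lambda>u\<in>Arr (P0 J d). k1 d u)\<rparr>"

definition \<kappa> where
 "\<kappa> = \<lparr>t1 = (\<lambda>d\<in>Ob D. \<kappa>t d),
   t2 = (\<lambda>d e f. if one_cell D e d f then
    \<lparr>src = compF (P0 J d) (pre e d W f) (\<kappa>t d), tgt = compF (P0 J d) (\<kappa>t e) (P1 J d e f),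
    cmp = (\<lambda>j\<in>Obj (P0 J d). k2 d e f j)\<rparr> else undefined)\<rparr>"

lemma t1_\<kappa> [simp]: "d \<in> Ob D ==> t1 \<kappa> d = \<kappa>t d"
 and fo_\<kappa>t [simp]: "j \<in> Obj (P0 J d) ==> fo (\<kappa>t d) j = k0 d j"
 and fa_\<kappa>t [simp]: "u \<in> Arr (P0 J d) ==> fa (\<kappa>t d) u = k1 d u"
 and cmp_t2_\<kappa> [simp]: "one_cell D e d f ==> j \<in> Obj (P0 J d) ==> cmp (t2 \<kappa> d e f) j = k2 d e f j"
 by (auto simp: \<kappa>_def \<kappa>t_def)

abbreviation q where "q i d == Hc2F d W (X i) (Ide (Hom C W (X i)) (P i))"

lemma q_Cmp: "[|i \<in> I; d \<in> Ob D; \<alpha> \<in> hom (HF d W) h k; \<beta> \<in> hom (HF d W) k l|] ==>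
  q i d (\<beta> \<cdot>[HF d W] \<alpha>) = q i d \<beta> \<cdot>[HF d (X i)] q i d \<alpha>"
 by (rule C.Hc2_Cmp_right[OF F.P0_Ob W X P])

lemma q_Ide: "[|i \<in> I; d \<in> Ob D; j \<in> Obj (P0 J d)|] ==>
  q i d (Ide (HF d W) (k0 d j)) = Ide (HF d (X i)) (fo (t1 (\<tau> i) d) j)"
 by (simp add: C.Hc2_Ide F.P0_Ob W X P k0 P_k0)

lemma q_pre: "[|i \<in> I; one_cell D e d f; \<alpha> \<in> Arr (HF d W)|] ==>
  q i e (Hc2F e (P0 F d) W \<alpha> (ideF e d f))
   = Hc2F e (P0 F d) (X i) (q i d \<alpha>) (ideF e d f)"
 by (rule C.Hc2_assoc) (auto simp: F.P0_Ob W X P one_cellD F1_Obj C.Ide_Arr)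

lemma q_pre2: "[|i \<in> I; e \<in> Ob D; d \<in> Ob D; j \<in> Obj (P0 J d); \<theta> \<in> Arr (HF e (P0 F d))|] ==>
  q i e (Hc2F e (P0 F d) W (Ide (HF d W) (k0 d j)) \<theta>)
   = Hc2F e (P0 F d) (X i) (Ide (HF d (X i)) (fo (t1 (\<tau> i) d) j)) \<theta>"
 by (simp add: C.Hc2_assoc F.P0_Ob W X P C.Ide_Arr k0 q_Ide)

lemma \<kappa>t_functors: assumes d: "d \<in> Ob D" shows "\<kappa>t d \<in> functors (P0 J d) (HF d W)"
proof (rule functorsI)
 interpret Jd: category "P0 J d" using J.category_P0 d by simp
 interpret H: category "HF d W" by (rule C.category_Hom[OF F.P0_Ob[OF d] W])
 show "fa (\<kappa>t d) u \<in> hom (HF d W) (fo (\<kappa>t d) j) (fo (\<kappa>t d) j')" if "u \<in> hom (P0 J d) j j'" for u j j'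
  using k1[OF d that] Jd.hom_Obj[OF that] homD(1)[OF that] by simp
 show "fa (\<kappa>t d) (Ide (P0 J d) j) = Ide (HF d W) (fo (\<kappa>t d) j)" if j: "j \<in> Obj (P0 J d)" for j
 proof -
  have "k1 d (Ide (P0 J d) j) = Ide (HF d W) (k0 d j)"
   using fun_Ide[OF pnat_dataD(1)[OF X \<tau> d] j]
   by (intro faithful[OF d k1[OF d Jd.Ide_hom[OF j]] H.Ide_hom[OF k0[OF d j]]])
    (simp add: P_k1[OF _ d Jd.Ide_hom[OF j]] q_Ide d j)
  then show ?thesis using j homD(1)[OF Jd.Ide_hom[OF j]] by simp
 qed
 show "fa (\<kappa>t d) (v \<cdot>[P0 J d] u) = fa (\<kappa>t d) v \<cdot>[HF d W] fa (\<kappa>t d) u"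
  if u: "u \<in> hom (P0 J d) j j'" and v: "v \<in> hom (P0 J d) j' j''" for u v j j' j''
 proof -
  note vu = Jd.Cmp_hom[OF u v]
  have "k1 d (v \<cdot>[P0 J d] u) = k1 d v \<cdot>[HF d W] k1 d u"
   using fun_Cmp[OF pnat_dataD(1)[OF X \<tau> d] u v]
   by (intro faithful[OF d k1[OF d vu] H.Cmp_hom[OF k1[OF d u] k1[OF d v]]])
    (simp add: P_k1[OF _ d vu] P_k1[OF _ d u] P_k1[OF _ d v] q_Cmp[OF _ d k1[OF d u] k1[OF d v]])
  then show ?thesis using homD(1)[OF u] homD(1)[OF v] homD(1)[OF vu] by simp
 qed
qed (auto simp: \<kappa>t_def k0 d)

text \<open>Each condition is an equality of 2-cells into \<open>W\<close>. Applying
  \<open>q i\<close> gives the corresponding condition for \<open>\<tau> i\<close>, and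
  \<open>faithful\<close> brings it back.\<close>

lemma \<kappa>_cones: "\<kappa> \<in> cones W"
proof (rule cat_valued_pair.pseudo_natsI[OF cat_valued_pair[OF W]], unfold op2_simps hom_into_simps, goal_cases)
 case 1
 show ?case
  unfolding cat_valued_pair.pnat_data_def[OF cat_valued_pair[OF W]]
 proof (intro conjI allI impI; (simp only: op2_simps hom_into_simps)?)
  show "t1 \<kappa> \<in> (\<Pi>\<^sub>E d\<in>Ob D. functors (P0 J d) (HF d W))"
   using \<kappa>t_functors by (auto simp: \<kappa>_def)
  show "t2 \<kappa> d e f = undefined" if "\<not> one_cell D e d f" for d e f using that by (simp add: \<kappa>_def)
  fix d e f assume f: "one_cell D e d f"
  note ob = one_cellD[OF f] and Fo = F.P0_Ob[OF one_cellD(1)[OF f]] F.P0_Ob[OF one_cellD(2)[OF f]]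
  have Jf: "P1 J d e f \<in> functors (P0 J d) (P0 J e)" using J.P1_functors[of d e f] f by simp
  have cJ: "category (P0 J d)" using J.category_P0 ob by simp
  note H = C.category_Hom[OF Fo(1) W]
  note pf = C.prefun_functors[OF Fo W F1_Obj[OF f]]
  let ?A = "compF (P0 J d) (pre e d W f) (t1 \<kappa> d)" and ?B = "compF (P0 J d) (t1 \<kappa> e) (P1 J d e f)"
  show "t2 \<kappa> d e f \<in> isos (fun_cat (P0 J d) (HF e W))
    ?A ?B"
  proof (rule isos_fun_catI[OF cJ H nt_homI])
   show "compF (P0 J d) (pre e d W f) (t1 \<kappa> d) \<in> functors (P0 J d) (HF e W)"
    "compF (P0 J d) (t1 \<kappa> e) (P1 J d e f) \<in> functors (P0 J d) (HF e W)"
    using compF_functors[OF cJ \<kappa>t_functors[OF ob(2)] pf] compF_functors[OF cJ Jf \<kappa>t_functors[OF ob(1)]] ob by auto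
   let ?C = "t2 \<kappa> d e f"
   show "src ?C = compF (P0 J d) (pre e d W f) (t1 \<kappa> d)"
    "tgt ?C = compF (P0 J d) (t1 \<kappa> e) (P1 J d e f)" "cmp ?C \<in> extensional (Obj (P0 J d))"
    using f ob by (auto simp: \<kappa>_def)
   show i: "cmp ?C j \<in> isos (HF e W) (fo ?A j)
     (fo ?B j)" if "j \<in> Obj (P0 J d)" for j
    using k2[OF f that] that f ob J1[OF f that] k0[OF ob(2) that] by simp
   show "cmp ?C j \<in> hom (HF e W) (fo ?A j)
     (fo ?B j)" if "j \<in> Obj (P0 J d)" for j
    by (rule isos_hom[OF i[OF that]])
   fix u j j' assume u: "u \<in> hom (P0 J d) j j'"
   note jj = category.hom_Obj[OF cJ u] and Ju = fun_fa[OF Jf u]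
   note a = k1[OF ob(2) u] and b = k1[OF ob(1) Ju]
   note k2 = isos_hom[OF k2[OF f jj(1)]] isos_hom[OF k2[OF f jj(2)]]
   have pa: "Hc2F e (P0 F d) W (k1 d u) (ideF e d f) \<in> hom (HF e W)
     (Hc1 C (P0 F e) (P0 F d) W (k0 d j) (P1 F e d f)) (Hc1 C (P0 F e) (P0 F d) W (k0 d j') (P1 F e d f))"
    by (rule C.Hc2_hom[OF Fo W C.Ide_Hom[OF Fo F1_Obj[OF f]] a])
   have "k2 d e f j' \<cdot>[HF e W] Hc2F e (P0 F d) W (k1 d u) (ideF e d f)
    = k1 e (fa (P1 J d e f) u) \<cdot>[HF e W] k2 d e f j" (is "?l = ?r")
   proof (rule faithful[OF ob(1) category.Cmp_hom[OF H pa k2(2)] category.Cmp_hom[OF H k2(1) b]])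
    fix i assume i: "i \<in> I"
    have t2: "t2 (\<tau> i) d e f \<in> hom (fun_cat (P0 J d) (HF e (X i)))
     (compF (P0 J d) (prefun C (P0 F e) (P0 F d) (X i) (P1 F e d f)) (t1 (\<tau> i) d)) (compF (P0 J d) (t1 (\<tau> i) e) (P1 J d e f))"
     using pnat_dataD(2)[OF X[OF i] \<tau>[OF i] f] by simp
    show "q i e ?l = q i e ?r"
     using nt_homD(7)[OF t2 u] homD(1)[OF u] homD(1)[OF cone_fa[OF X[OF i] \<tau>[OF i] ob(2) u]]
     by (simp add: q_Cmp[OF i ob(1) pa k2(2)] q_Cmp[OF i ob(1) k2(1) b] P_k2[OF i f jj(1)] P_k2[OF i f jj(2)]
      q_pre[OF i f homD(1)[OF a]] P_k1[OF i ob(2) u] P_k1[OF i ob(1) Ju])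
   qed
   then show "cmp ?C j' \<cdot>[HF e W] fa ?A u
    = fa ?B u \<cdot>[HF e W] cmp ?C j"
    using f ob jj homD(1)[OF u] homD(1)[OF Ju] homD(1)[OF a] by simp
  qed
 qed
next
 case hyp: (2 d e \<theta> f g j)
 note de = hyp(1,2) and \<theta> = hyp(3) and f = hyp(4) and g = hyp(5) and j = hyp(6)
 note Fo = F.P0_Ob[OF de(2)] F.P0_Ob[OF de(1)]
 note H = C.category_Hom[OF Fo(1) W]
 have J2: "cmp (P2 J d e \<theta>) j \<in> hom (P0 J e) (fo (P1 J d e f) j) (fo (P1 J d e g) j)"
  using nt_homD(6)[OF J.P2_nt j] de \<theta> by simp
 note k2 = isos_hom[OF k2[OF f j]] isos_hom[OF k2[OF g j]] and k1 = k1[OF de(2) J2]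
 note F2 = F.P2_hom[OF de(2,1) \<theta>]
 note p = C.Hc2_hom[OF Fo W F2 C.Ide_Hom[OF Fo(2) W k0[OF de(1) j]]]
 have "k1 e (cmp (P2 J d e \<theta>) j) \<cdot>[HF e W] k2 d e f j
  = k2 d e g j \<cdot>[HF e W] Hc2F e (P0 F d) W (Ide (HF d W) (k0 d j)) (P2 F e d \<theta>)" (is "?l = ?r")
 proof (rule faithful[OF de(2) category.Cmp_hom[OF H k2(1) k1] category.Cmp_hom[OF H p k2(2)]])
  fix i assume i: "i \<in> I"
  show "q i e ?l = q i e ?r"
   using pseudo_natsD(2)[OF X[OF i] \<tau>[OF i] de \<theta> j] cone_fo[OF X[OF i] \<tau>[OF i] de(1) j]
   by (simp add: q_Cmp[OF i de(2) k2(1) k1] q_Cmp[OF i de(2) p k2(2)] P_k1[OF i de(2) J2] P_k2[OF i f j] P_k2[OF i g j]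
    q_pre2[OF i de(2,1) j homD(1)[OF F2]])
 qed
 then show ?case
  using de f g j homD(1)[OF J2] k0[OF de(1) j] by simp
next
 case hyp: (3 c d e f g j)
 note f = hyp(1) and g = hyp(2) and j = hyp(3)
 note ob = one_cellD[OF f] one_cellD[OF g]
 note Fo = F.P0_Ob[OF ob(2)] F.P0_Ob[OF ob(1)] F.P0_Ob[OF ob(4)]
 note H = C.category_Hom[OF Fo(3) W]
 have gf: "one_cell D e c (Hc1 D e d c f g)" using f g by (simp add: D.one_cell_Hc1)
 note jf = J1[OF f j]
 let ?E = "fo (P1 J c d f) j"
 have Jc: "cmp (Pc J c d e g f) j \<in> hom (P0 J e) (fo (P1 J d e g) ?E) (fo (P1 J c e (Hc1 D e d c f g)) j)"
  using nt_homD(6)[OF J.Pc_nt j, of d f e g] f g j by simp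
 note kf = isos_hom[OF k2[OF f j]] and kg = isos_hom[OF k2[OF g jf]] and kgf = isos_hom[OF k2[OF gf j]] and k1 = k1[OF ob(4) Jc]
 let ?D = "Hc1 C (P0 F e) (P0 F d) (P0 F c) (P1 F d c f) (P1 F e d g)"
 have Fc: "Pc F e d c f g \<in> hom (HF e (P0 F c)) ?D
   (P1 F e c (Hc1 D e d c f g))"
  using isos_hom[OF F.Pc_iso] ob by blast
 note p = C.Hc2_hom[OF Fo(3,1) W Fc C.Ide_Hom[OF Fo(1) W k0[OF ob(2) j]]]
 have kfg: "Hc2F e (P0 F d) W (k2 c d f j) (ideF e d g) \<in>
  hom (HF e W) (Hc1 C (P0 F e) (P0 F c) W (k0 c j) ?D)
   (Hc1 C (P0 F e) (P0 F d) W (k0 d ?E) (P1 F e d g))"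
  using C.Hc2_hom[OF Fo(3,2) W C.Ide_Hom[OF Fo(3,2) F1_Obj[OF g]] kf] C.Hc1_assoc[OF Fo(3,2,1) W F1_Obj[OF g] F1_Obj[OF f] k0[OF ob(2) j]]
  by simp
 note kgg = category.Cmp_hom[OF H kfg kg]
 have "k1 e (cmp (Pc J c d e g f) j) \<cdot>[HF e W] (k2 d e g ?E \<cdot>[HF e W]
    Hc2F e (P0 F d) W (k2 c d f j) (ideF e d g))
  = k2 c e (Hc1 D e d c f g) j \<cdot>[HF e W] Hc2F e (P0 F c) W (Ide (HF c W) (k0 c j)) (Pc F e d c f g)" (is "?l = ?r")
 proof (rule faithful[OF ob(4) category.Cmp_hom[OF H kgg k1] category.Cmp_hom[OF H p kgf]])
  fix i assume i: "i \<in> I"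
  show "q i e ?l = q i e ?r"
   using pseudo_natsD(3)[OF X[OF i] \<tau>[OF i] f g j] cone_fo[OF X[OF i] \<tau>[OF i] ob(2) j]
    homD(1)[OF isos_hom[OF cone_t2[OF X[OF i] \<tau>[OF i] f j]]]
   by (simp add: q_Cmp[OF i ob(4) kgg k1] q_Cmp[OF i ob(4) kfg kg] q_Cmp[OF i ob(4) p kgf] P_k1[OF i ob(4) Jc] P_k2[OF i f j]
     P_k2[OF i g jf] P_k2[OF i gf j] q_pre2[OF i ob(4,2) j homD(1)[OF Fc]] q_pre[OF i g homD(1)[OF kf]])
 qed
 then show ?case
  using ob f g gf j jf homD(1)[OF Jc] homD(1)[OF kf] k0[OF ob(2) j] by simp
next
 case hyp: (4 d j)
 note d = hyp(1) and j = hyp(2)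
 note Fo = F.P0_Ob[OF d] and o1 = D.one_cell_One[OF d]
 note H = C.category_Hom[OF Fo W]
 have Jj: "cmp (Pu J d) j \<in> hom (P0 J d) j (fo (P1 J d d (One D d)) j)"
  using nt_homD(6)[OF J.Pu_nt j] d j by simp
 note Fu = isos_hom[OF F.Pu_iso[OF d]]
 have p: "Hc2F d (P0 F d) W (Ide (HF d W) (k0 d j)) (Pu F d) \<in> hom (HF d W) (k0 d j)
   (Hc1 C (P0 F d) (P0 F d) W (k0 d j) (P1 F d d (One D d)))"
  using C.Hc2_hom[OF Fo Fo W Fu C.Ide_Hom[OF Fo W k0[OF d j]]] C.Hc1_One_right[OF Fo W k0[OF d j]] by simp
 note k2 = isos_hom[OF k2[OF o1 j]]
 have "k2 d d (One D d) j \<cdot>[HF d W] Hc2F d (P0 F d) W (Ide (HF d W) (k0 d j)) (Pu F d) = k1 d (cmp (Pu J d) j)" (is "?l = ?r")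
 proof (rule faithful[OF d category.Cmp_hom[OF H p k2] k1[OF d Jj]])
  fix i assume i: "i \<in> I"
  show "q i d ?l = q i d ?r"
   using pseudo_natsD(4)[OF X[OF i] \<tau>[OF i] d j] cone_fo[OF X[OF i] \<tau>[OF i] d j]
   by (simp add: q_Cmp[OF i d p k2] P_k1[OF i d Jj] P_k2[OF i o1 j] q_pre2[OF i d d j homD(1)[OF Fu]])
 qed
 then show ?case
  using d o1 j homD(1)[OF Jj] k0[OF d j] by simp
qed

text \<open>By assumption composition with \<open>P i\<close> sends \<open>k0\<close>,
  \<open>k1\<close> and \<open>k2\<close> to the parts of \<open>\<tau> i\<close>, and a cocone is
  determined by these parts. Equality, and not just isomorphism, is what yields strict surjectivity
  on cocones later.\<close>

lemma push_\<kappa>: assumes i: "i \<in> I" shows "push W (X i) (P i) \<kappa> = \<tau> i"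
proof (rule pnat_eqI[OF X[OF i] push_cones[OF W X[OF i] P[OF i] \<kappa>_cones] \<tau>[OF i]])
 fix d assume d: "d \<in> Ob D"
 have cJ: "category (P0 J d)" using J.category_P0 d by simp
 let ?A = "postfun C (P0 F d) W (X i) (P i)"
 have "compF (P0 J d) ?A (\<kappa>t d) = t1 (\<tau> i) d"
 proof (rule func_eqI[OF compF_functors[OF cJ \<kappa>t_functors[OF d] C.postfun_functors[OF F.P0_Ob[OF d] W X[OF i] P[OF i]]]
   pnat_dataD(1)[OF X[OF i] \<tau>[OF i] d]])
  show "fo (compF (P0 J d) ?A (\<kappa>t d)) j = fo (t1 (\<tau> i) d) j" if "j \<in> Obj (P0 J d)" for j
   using that by (simp add: k0[OF d] P_k0[OF i d])
  show "fa (compF (P0 J d) ?A (\<kappa>t d)) u = fa (t1 (\<tau> i) d) u" if "u \<in> Arr (P0 J d)" for u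
   using that homD(1)[OF k1[OF d Arr_hom[OF that]]] by (simp add: P_k1[OF i d Arr_hom[OF that]])
 qed
 then show "t1 (push W (X i) (P i) \<kappa>) d = t1 (\<tau> i) d" using d by simp
next
 fix d e f j assume f: "one_cell D e d f" and j: "j \<in> Obj (P0 J d)"
 show "cmp (t2 (push W (X i) (P i) \<kappa>) d e f) j = cmp (t2 (\<tau> i) d e f) j"
  using f j by (simp add: cmp_push_t2[OF W X[OF i] P[OF i] \<kappa>_cones f j] P_k2[OF i f j])
qed

end

section \<open>Strict preservation of operations\<close>

locale strict_functor = V: category V + X: category X
 for V :: "('o, 'a) cat" and X :: "('p, 'b) cat" +
 fixes P :: "('o, 'a, 'p, 'b) func"
 assumes P: "P \<in> functors V X"
begin

text \<open>The functor \<open>P\<close> carries \<open>F\<close> to \<open>F'\<close> on the nose.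
  Typing is built into \<open>relF\<close> and \<open>relH\<close>, so their closure properties also
  show that the composites formed are well typed.\<close>

definition relF :: "nat => ('o list, 'a list, 'o, 'a) func => ('p list, 'b list, 'p, 'b) func => bool" where
 "relF n F F' \<longleftrightarrow> F \<in> functors (pow V n) V \<and> F' \<in> functors (pow X n) X \<and>
   (\<forall>xs\<in>Obj (pow V n). fo P (fo F xs) = fo F' (map (fo P) xs)) \<and>
   (\<forall>fs\<in>Arr (pow V n). fa P (fa F fs) = fa F' (map (fa P) fs))"

definition relH :: "nat => ('o list, 'a list, 'o, 'a) nt => ('p list, 'b list, 'p, 'b) nt => bool" where
 "relH n \<alpha> \<alpha>' \<longleftrightarrow> \<alpha> \<in> hom (opcat V n) (src \<alpha>) (tgt \<alpha>) \<and> \<alpha>' \<in> hom (opcat X n) (src \<alpha>') (tgt \<alpha>') \<and>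
   relF n (src \<alpha>) (src \<alpha>') \<and> relF n (tgt \<alpha>) (tgt \<alpha>') \<and>
   (\<forall>xs\<in>Obj (pow V n). fa P (cmp \<alpha> xs) = cmp \<alpha>' (map (fo P) xs))"

lemma P_Obj: "xs \<in> Obj (pow V n) ==> map (fo P) xs \<in> Obj (pow X n)"
 using fun_fo[OF P] by auto

lemma P_hom: "fs \<in> hom (pow V n) xs ys ==> map (fa P) fs \<in> hom (pow X n) (map (fo P) xs) (map (fo P) ys)"
 unfolding hom_pow_iff using fun_fa[OF P] by auto

lemma relH_idn: "relF n F F' ==> relH n (idn (pow V n) V F) (idn (pow X n) X F')"
 unfolding relH_def using P_Obj fun_fo[of F "pow V n" V]
 by (auto simp: relF_def fun_Ide[OF P] simp del: pow_simps intro: idn_hom category_pow V.category_axioms X.category_axioms)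

lemma relH_Cmp:
 assumes "relH n \<alpha> \<alpha>'" "relH n \<beta> \<beta>'" "src \<beta> = tgt \<alpha>" "src \<beta>' = tgt \<alpha>'"
 shows "relH n (\<beta> \<cdot>[opcat V n] \<alpha>) (\<beta>' \<cdot>[opcat X n] \<alpha>')"
proof -
 have a: "\<alpha> \<in> hom (opcat V n) (src \<alpha>) (tgt \<alpha>)" "\<beta> \<in> hom (opcat V n) (tgt \<alpha>) (tgt \<beta>)"
  "\<alpha>' \<in> hom (opcat X n) (src \<alpha>') (tgt \<alpha>')" "\<beta>' \<in> hom (opcat X n) (tgt \<alpha>') (tgt \<beta>')" using assms by (auto simp: relH_def)
 have "\<beta> \<cdot>[opcat V n] \<alpha> \<in> hom (opcat V n) (src \<alpha>) (tgt \<beta>)" "\<beta>' \<cdot>[opcat X n] \<alpha>' \<in> hom (opcat X n) (src \<alpha>') (tgt \<beta>')"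
  using category.Cmp_hom[OF category_fun_cat[OF category_pow[OF V.category_axioms] V.category_axioms] a(1,2)]
   category.Cmp_hom[OF category_fun_cat[OF category_pow[OF X.category_axioms] X.category_axioms] a(3,4)] by auto
 then show ?thesis
  using assms(1,2) P_Obj fun_Cmp[OF P nt_homD(6)[OF a(1)] nt_homD(6)[OF a(2)]] by (auto simp: relH_def simp del: pow_simps)
qed

lemma relF_gammaF:
 assumes l: "length Fs = length ns" "length Fs' = length ns" and r: "\<forall>i<length ns. relF (ns ! i) (Fs ! i) (Fs' ! i)"
  and F: "relF (length ns) F F'"
 shows "relF (sum_list ns) (gammaF V F ns Fs) (gammaF X F' ns Fs')"
proof -
 have f: "\<forall>i<length ns. Fs ! i \<in> functors (pow V (ns ! i)) V" "\<forall>i<length ns. Fs' ! i \<in> functors (pow X (ns ! i)) X"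
  using r by (auto simp: relF_def)
 note pF = prodF_functors[OF V.category_axioms l(1) f(1)]
 have o: "fo P (fo (gammaF V F ns Fs) xs) = fo (gammaF X F' ns Fs') (map (fo P) xs)" if xs: "xs \<in> Obj (pow V (sum_list ns))" for xs
 proof -
  have "map (fo P) (map2 fo Fs (blocks ns xs)) = map2 fo Fs' (blocks ns (map (fo P) xs))"
   using l r blocks_Obj[OF xs] by (auto simp: blocks_map relF_def simp del: pow_simps intro!: nth_equalityI)
  then show ?thesis
   using xs F fun_fo[OF pF xs] P_Obj[OF xs] by (simp add: gammaF_def relF_def del: pow_simps)
 qed
 have a: "fa P (fa (gammaF V F ns Fs) fs) = fa (gammaF X F' ns Fs') (map (fa P) fs)" if fs: "fs \<in> Arr (pow V (sum_list ns))" for fs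
 proof -
  have "map (fa P) (map2 fa Fs (blocks ns fs)) = map2 fa Fs' (blocks ns (map (fa P) fs))"
   using l r homD(1)[OF blocks_hom[OF Arr_hom[OF fs]]] by (auto simp: blocks_map relF_def simp del: pow_simps intro!: nth_equalityI)
  then show ?thesis
   using fs F fun_Arr[OF pF fs] homD(1)[OF P_hom[OF Arr_hom[OF fs]]] by (simp add: gammaF_def relF_def del: pow_simps)
 qed
 show ?thesis
  unfolding relF_def using o a F gammaF_functors[OF V.category_axioms l(1) f(1)] gammaF_functors[OF X.category_axioms l(2) f(2)]
  by (simp add: relF_def del: pow_simps)
qed

text \<open>A component of \<open>gammaN\<close> is a composite of two arrows; \<open>P\<close>
  preserves the composite, and each factor is covered by a hypothesis.\<close>

lemma relH_gammaN:
 assumes l: "length \<alpha>s = length ns" "length \<alpha>s' = length ns" and r: "\<forall>i<length ns. relH (ns ! i) (\<alpha>s ! i) (\<alpha>s' ! i)"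
  and \<beta>: "relH (length ns) \<beta> \<beta>'"
 shows "relH (sum_list ns) (gammaN V \<beta> ns \<alpha>s) (gammaN X \<beta>' ns \<alpha>s')"
proof -
 have f: "\<forall>i<length ns. \<alpha>s ! i \<in> hom (opcat V (ns ! i)) (map src \<alpha>s ! i) (map tgt \<alpha>s ! i)"
  "\<forall>i<length ns. \<alpha>s' ! i \<in> hom (opcat X (ns ! i)) (map src \<alpha>s' ! i) (map tgt \<alpha>s' ! i)"
  using r l by (auto simp: relH_def)
 have b: "\<beta> \<in> hom (opcat V (length ns)) (src \<beta>) (tgt \<beta>)" "\<beta>' \<in> hom (opcat X (length ns)) (src \<beta>') (tgt \<beta>')"
  using \<beta> by (auto simp: relH_def)
 let ?A = "map src \<alpha>s" and ?C = "map src \<alpha>s'" and ?D = "gammaF X (tgt \<beta>') ns (map tgt \<alpha>s')" and ?E = "gammaF V (tgt \<beta>) ns (map tgt \<alpha>s)"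
 have g: "gammaN V \<beta> ns \<alpha>s \<in> hom (opcat V (sum_list ns)) (gammaF V (src \<beta>) ns ?A) ?E"
  "gammaN X \<beta>' ns \<alpha>s' \<in> hom (opcat X (sum_list ns)) (gammaF X (src \<beta>') ns ?C) ?D"
  using gammaN_hom[OF V.category_axioms l(1) _ _ f(1) b(1)] gammaN_hom[OF X.category_axioms l(2) _ _ f(2) b(2)] l by auto
 have s: "relF (sum_list ns) (gammaF V (src \<beta>) ns ?A) (gammaF X (src \<beta>') ns ?C)"
  "relF (sum_list ns) ?E ?D"
  using l r \<beta> by (auto simp: relH_def intro!: relF_gammaF)
 have pN: "prodN V ns \<alpha>s \<in> hom (fun_cat (pow V (sum_list ns)) (pow V (length ns))) (prodF V ns ?A) (prodF V ns (map tgt \<alpha>s))"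
  by (rule prodN_hom[OF V.category_axioms V.category_axioms l(1) _ _ f(1)]) (simp_all add: l)
 have "fa P (cmp (gammaN V \<beta> ns \<alpha>s) xs) = cmp (gammaN X \<beta>' ns \<alpha>s') (map (fo P) xs)" if xs: "xs \<in> Obj (pow V (sum_list ns))" for xs
 proof -
  have m: "map (fa P) (map2 cmp \<alpha>s (blocks ns xs)) = map2 cmp \<alpha>s' (blocks ns (map (fo P) xs))"
   using l r blocks_Obj[OF xs] by (auto simp: blocks_map relH_def simp del: pow_simps intro!: nth_equalityI)
  have m2: "map (fo P) (map2 fo ?A (blocks ns xs)) = map2 fo ?C (blocks ns (map (fo P) xs))"
   using l r blocks_Obj[OF xs] by (auto simp: blocks_map relH_def relF_def simp del: pow_simps intro!: nth_equalityI)
  note c = nt_homD(6)[OF pN xs] and o = fun_fo[OF nt_homD(1)[OF pN] xs]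
  have t: "relF (length ns) (tgt \<beta>) (tgt \<beta>')" using \<beta> by (simp add: relH_def)
  let ?B = "cmp (prodN V ns \<alpha>s) xs"
  have "fa P (fa (tgt \<beta>) ?B \<cdot>[V] cmp \<beta> (fo (prodF V ns ?A) xs))
    = fa P (fa (tgt \<beta>) ?B) \<cdot>[X] fa P (cmp \<beta> (fo (prodF V ns ?A) xs))"
   by (rule fun_Cmp[OF P nt_homD(6)[OF b(1) o] fun_fa[OF nt_homD(2)[OF b(1)] c]])
  also have "fa P (cmp \<beta> (fo (prodF V ns ?A) xs)) = cmp \<beta>' (fo (prodF X ns ?C) (map (fo P) xs))"
   using \<beta> o xs P_Obj[OF xs] m2 by (simp add: relH_def del: pow_simps)
  also have "fa P (fa (tgt \<beta>) ?B) = fa (tgt \<beta>') (cmp (prodN X ns \<alpha>s') (map (fo P) xs))"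
   using t homD(1)[OF c] xs P_Obj[OF xs] m by (simp add: relF_def del: pow_simps)
  finally show ?thesis using xs P_Obj[OF xs] by (simp add: gammaN_def del: pow_simps)
 qed
 then show ?thesis unfolding relH_def using g s nt_homD(3,4)[OF g(1)] nt_homD(3,4)[OF g(2)] by (simp del: pow_simps)
qed

lemma relF_subF:
 assumes ks: "set ks \<subseteq> {..<l}" and F: "relF (length ks) F F'"
 shows "relF l (subF V l ks F) (subF X l ks F')"
proof -
 have f: "F \<in> functors (pow V (length ks)) V" "F' \<in> functors (pow X (length ks)) X" using F by (auto simp: relF_def)
 have m: "map ((!) (map g xs)) ks = map g (map ((!) xs) ks)" if "length xs = l" for g xs
  using ks that by (auto simp: subset_iff)
 have "fo P (fo (subF V l ks F) xs) = fo (subF X l ks F') (map (fo P) xs)" if xs: "xs \<in> Obj (pow V l)" for xs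
 proof -
  have "map ((!) (map (fo P) xs)) ks = map (fo P) (map ((!) xs) ks)" using ks xs by (auto simp: subset_iff)
  then show ?thesis using xs F P_Obj[OF xs] map_nth_Obj[OF xs ks] by (simp add: relF_def del: pow_simps map_map)
 qed
 moreover have "fa P (fa (subF V l ks F) fs) = fa (subF X l ks F') (map (fa P) fs)" if fs: "fs \<in> Arr (pow V l)" for fs
 proof -
  have "map ((!) (map (fa P) fs)) ks = map (fa P) (map ((!) fs) ks)" using ks fs by (auto simp: subset_iff)
  then show ?thesis using fs F homD(1)[OF P_hom[OF Arr_hom[OF fs]]] homD(1)[OF map_nth_hom[OF Arr_hom[OF fs] ks]]
   by (simp add: relF_def del: pow_simps map_map)
 qed
 ultimately show ?thesis
  unfolding relF_def using subF_functors[OF V.category_axioms f(1) ks] subF_functors[OF X.category_axioms f(2) ks] by blast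
qed

lemma relH_subN:
 assumes ks: "set ks \<subseteq> {..<l}" and \<alpha>: "relH (length ks) \<alpha> \<alpha>'"
 shows "relH l (subN V l ks \<alpha>) (subN X l ks \<alpha>')"
proof -
 have f: "\<alpha> \<in> hom (opcat V (length ks)) (src \<alpha>) (tgt \<alpha>)" "\<alpha>' \<in> hom (opcat X (length ks)) (src \<alpha>') (tgt \<alpha>')"
  "relF (length ks) (src \<alpha>) (src \<alpha>')" "relF (length ks) (tgt \<alpha>) (tgt \<alpha>')"
  using \<alpha> by (auto simp: relH_def)
 have "fa P (cmp (subN V l ks \<alpha>) xs) = cmp (subN X l ks \<alpha>') (map (fo P) xs)" if xs: "xs \<in> Obj (pow V l)" for xs
 proof -
  have "map ((!) (map (fo P) xs)) ks = map (fo P) (map ((!) xs) ks)" using ks xs by (auto simp: subset_iff)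
  then show ?thesis using xs \<alpha> P_Obj[OF xs] map_nth_Obj[OF xs ks] by (simp add: relH_def del: pow_simps map_map)
 qed
 then show ?thesis
  unfolding relH_def using subN_hom[OF V.category_axioms ks f(1)] subN_hom[OF X.category_axioms ks f(2)]
   relF_subF[OF ks f(3)] relF_subF[OF ks f(4)] by (simp del: pow_simps)
qed

lemma relF_unitF: "relF 1 (unitF V) (unitF X)"
 unfolding relF_def
proof (intro conjI ballI unitF_functors V.category_axioms X.category_axioms)
 show "fo P (fo (unitF V) xs) = fo (unitF X) (map (fo P) xs)" if "xs \<in> Obj (pow V 1)" for xs
  using that fun_fo[OF P] by (cases xs) auto
 show "fa P (fa (unitF V) xs) = fa (unitF X) (map (fa P) xs)" if "xs \<in> Arr (pow V 1)" for xs
  using that fun_Arr[OF P] by (cases xs) auto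
qed

end

section \<open>Isomorphisms of algebra morphisms\<close>

context lawvere_theory
begin

lemma isos_alg_hom_catD:
 assumes "\<alpha> \<in> isos (acat A B) h k" "pseudo_algebra T A" "pseudo_algebra T B" "a \<in> Obj (Car A)"
 shows "cmp \<alpha> a \<in> isos (Car B) (fo (Mf h) a) (fo (Mf k) a)"
proof -
 obtain \<beta> where b: "\<beta> \<in> hom (acat A B) k h" "\<beta> \<cdot>[acat A B] \<alpha> = Ide (acat A B) h"
  "\<alpha> \<cdot>[acat A B] \<beta> = Ide (acat A B) k" and a: "\<alpha> \<in> hom (acat A B) h k"
  using assms(1) by (auto simp: isos_def)
 show ?thesis
  using b(2,3)[THEN arg_cong, of "\<lambda>x. cmp x a"] assms(4)
  by (intro isosI[OF acell_homD(6)[OF assms(2,3) a assms(4)] acell_homD(6)[OF assms(2,3) b(1) assms(4)]]) simp_all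
qed

text \<open>The pointwise inverses form a 2-cell: the functor \<open>Phi B w\<close> preserves
  inverses, and \<open>inv_square\<close> inverts the square that relates \<alpha> to
  \<open>Rho\<close>.\<close>

lemma isos_alg_hom_catI:
 assumes A: "pseudo_algebra T A" and B: "pseudo_algebra T B" and \<alpha>: "\<alpha> \<in> hom (acat A B) h k"
  and i: "\<And>a. a \<in> Obj (Car A) ==> cmp \<alpha> a \<in> isos (Car B) (fo (Mf h) a) (fo (Mf k) a)"
 shows "\<alpha> \<in> isos (acat A B) h k"
proof -
 interpret A: pseudo_algebra T A by (rule A)
 interpret B: pseudo_algebra T B by (rule B)
 interpret catA: category "Car A" by (rule A.category_Car)
 interpret catB: category "Car B" by (rule B.category_Car)
 interpret AB: category "acat A B" by (rule category_acat[OF A B])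
 note \<alpha>d = acell_homD[OF A B \<alpha>]
 note h = mors_data[OF A B \<alpha>d(1)] and k = mors_data[OF A B \<alpha>d(2)]
 note H = mor_data_Mf[OF A B h] and K = mor_data_Mf[OF A B k]
 let ?\<beta> = "\<lparr>src = k, tgt = h, cmp = (\<lambda>a\<in>Obj (Car A). inv_arr (Car B) (cmp \<alpha> a))\<rparr>"
 have \<beta>: "?\<beta> \<in> hom (acat A B) k h"
 proof (rule acell_homI[OF A B \<alpha>d(2,1)])
  show "cmp ?\<beta> a \<in> hom (Car B) (fo (Mf k) a) (fo (Mf h) a)" if "a \<in> Obj (Car A)" for a
   using inv_arr_hom[OF i[OF that]] that by simp
  show "cmp ?\<beta> b \<cdot>[Car B] fa (Mf k) f = fa (Mf h) f \<cdot>[Car B] cmp ?\<beta> a" if f: "f \<in> hom (Car A) a b" for f a b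
   using catA.hom_Obj[OF f] catB.inv_square[OF i i fun_fa[OF H f] fun_fa[OF K f] \<alpha>d(7)[OF f, symmetric]] by simp
  fix w xs assume w: "w \<in> words T" and xs: "xs \<in> Obj (pw A w)"
  note px = fun_fo[OF A.Phi_functor[OF w] xs]
  let ?A = "map (fo (Mf h)) xs"
  have ai: "map (cmp \<alpha>) xs \<in> isos (pw B w) ?A (map (fo (Mf k)) xs)"
   using xs by (intro isos_powI[OF catB.category_axioms]) (auto intro!: i)
  have "map (cmp ?\<beta>) xs \<in> hom (pw B w) (map (fo (Mf k)) xs) ?A"
   using xs inv_arr_hom[OF i] by (auto simp: hom_pow_iff subset_iff)
  moreover have "map (cmp ?\<beta>) xs \<cdot>[pw B w] map (cmp \<alpha>) xs = Ide (pw B w) ?A"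
   using xs inv_arr_left[OF i] by (auto simp: subset_iff intro!: nth_equalityI)
  ultimately have "map (cmp ?\<beta>) xs = inv_arr (pw B w) (map (cmp \<alpha>) xs)"
   by (rule category.inv_arr_unique[OF category_pow[OF catB.category_axioms] ai])
  then have m: "fa (Phi B w) (map (cmp ?\<beta>) xs) = inv_arr (Car B) (fa (Phi B w) (map (cmp \<alpha>) xs))"
   using fun_inv_arr[OF B.Phi_functor[OF w] category_pow[OF catB.category_axioms] catB.category_axioms ai] by simp
  show "cmp (Rho h w) xs \<cdot>[Car B] cmp ?\<beta> (fo (Phi A w) xs) = fa (Phi B w) (map (cmp ?\<beta>) xs) \<cdot>[Car B] cmp (Rho k w) xs"
   unfolding m using px catB.inv_square[OF i[OF px] fun_isos[OF B.Phi_functor[OF w] category_pow[OF catB.category_axioms] ai]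
    isos_hom[OF Rho_isos[OF A B h w xs]] isos_hom[OF Rho_isos[OF A B k w xs]] \<alpha>d(8)[OF w xs]] by simp
 qed auto
 show ?thesis
  by (rule isosI[OF \<alpha> \<beta>]; rule acell_eqI[OF A B AB.Cmp_hom AB.Ide_hom])
    (use \<alpha> \<beta> \<alpha>d(1,2) in \<open>auto simp: inv_arr_left[OF i] inv_arr_right[OF i]\<close>)
qed

end

section \<open>The syntactic algebra\<close>

text \<open>Raw terms; arities and the ranges of \<open>d\<close>, \<open>j\<close> and
  \<open>x\<close> are imposed by \<open>OT\<close>. One type parameter suffices because words,
  objects and arrows all have the type of the universe.\<close>

datatype 'v oterm = Gen 'v 'v 'v | Op 'v "'v oterm list"

text \<open>A raw pair of vertex and legs, turned into a type so that arrows can be families indexed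
  by it. The pairs that are cocones with small vertex form \<open>Idx\<close>.\<close>

datatype 'u cocone = Cocone (vertex: "('u, 'u, 'u) alg")
 (legs: "('u, 'u, 'u, 'u, ('u, 'u, 'u, 'u, 'u) amor, ('u, 'u, 'u, 'u, 'u) acell) pnat")

text \<open>An arrow is given by its domain, its codomain and its interpretations in all cocones.\<close>

datatype 'u arrow = Arrow (dm: "'u oterm") (cd: "'u oterm") (vl: "'u cocone => 'u")

text \<open>Strict by definition: \<open>Op\<close> is interpreted by the operation of the vertex
  itself. Therefore formal operations on terms commute with interpretation on the nose.\<close>

primrec ev :: "'u cocone => 'u oterm => 'u" where
 "ev i (Gen d j x) = fo (Mf (fo (t1 (legs i) d) j)) x"
| "ev i (Op w ts) = fo (Phi (vertex i) w) (map (ev i) ts)"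

lemma map_ev_map2_Op: "map (ev i) (map2 Op ws (blocks ns ts)) = map2 (\<lambda>v. fo (Phi (vertex i) v)) ws (blocks ns (map (ev i) ts))"
 by (auto simp: blocks_map intro!: nth_equalityI)

text \<open>The weight \<open>J\<close> occurs twice: as \<open>cat_valued\<close> data for the
  cocone calculus, and as a pseudo functor into \<open>Cat U\<close> for the smallness of its
  values. \<open>words_U\<close> bounds the number of words that may head a term.\<close>

locale free_bicolimit = universe U + lawvere_theory T + bicolimit_data "Alg U T" D F J + JU: pseudo_functor "op2 D" "Cat U" J
 for U :: "'u set set" and T :: "'u lawvere" and D :: "('u, 'u, 'u) twocat"
  and F :: "('u, 'u, 'u, ('u, 'u, 'u) alg, ('u, 'u, 'u, 'u, 'u) amor, ('u, 'u, 'u, 'u, 'u) acell) pfun"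
  and J :: "('u, 'u, 'u, 'u, 'u) catfun" +
 assumes words_U: "Arr (Tcat T) \<in> U" and small_D: "small_twocat U D"
begin

abbreviation "VC i == Car (vertex i)"
abbreviation FC where "FC d == Car (P0 F d)"

lemma algF: "d \<in> Ob D ==> pseudo_algebra T (P0 F d)"
 using F.P0_Ob by simp

lemma catF: "d \<in> Ob D ==> category (FC d)"
 by (rule cat_Car[OF algF])

lemma catJ: "d \<in> Ob D ==> category (P0 J d)"
 using J.category_P0 by simp

lemma morF: "one_cell D e d f ==> P1 F e d f \<in> alg_mors T (P0 F e) (P0 F d)"
 using F1_Obj by simp

lemma MfF: "one_cell D e d f ==> Mf (P1 F e d f) \<in> functors (FC e) (FC d)"
 by (rule mor_data_Mf[OF algF algF mors_data[OF algF algF morF]]) (auto dest: one_cellD)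

text \<open>A large collection, but still a set over one HOL type. Once \<open>WA\<close> is known
  to be a small algebra, cocones with vertex \<open>WA\<close> belong to it as well.\<close>

definition Idx :: "'u cocone set" where
 "Idx = {i. vertex i \<in> Ob (Alg U T) \<and> legs i \<in> cones (vertex i)}"

context
 fixes i assumes i: "i \<in> Idx"
begin

lemma Idx_Ob: "vertex i \<in> Ob (Alg U T)" and Idx_cones: "legs i \<in> cones (vertex i)"
 using i by (auto simp: Idx_def)

lemma algX: "pseudo_algebra T (vertex i)"
 using Idx_Ob by simp

lemma catX: "category (VC i)"
 by (rule cat_Car[OF algX])

lemma p_mor: "d \<in> Ob D ==> j \<in> Obj (P0 J d) ==> fo (t1 (legs i) d) j \<in> alg_mors T (P0 F d) (vertex i)"
 using cone_fo[OF Idx_Ob Idx_cones] by simp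

lemma p_data: "d \<in> Ob D ==> j \<in> Obj (P0 J d) ==> mor_data (P0 F d) (vertex i) (fo (t1 (legs i) d) j)"
 by (rule mors_data[OF algF algX p_mor])

lemma p_Mf: "d \<in> Ob D ==> j \<in> Obj (P0 J d) ==> Mf (fo (t1 (legs i) d) j) \<in> functors (FC d) (VC i)"
 by (rule mor_data_Mf[OF algF algX p_data])

lemma p_wt: "d \<in> Ob D ==> u \<in> hom (P0 J d) j j' ==>
  fa (t1 (legs i) d) u \<in> hom (acat (P0 F d) (vertex i)) (fo (t1 (legs i) d) j) (fo (t1 (legs i) d) j')"
 using cone_fa[OF Idx_Ob Idx_cones] by simp

lemma p_sig: "one_cell D e d f ==> j \<in> Obj (P0 J d) ==>
  cmp (t2 (legs i) d e f) j \<in> isos (acat (P0 F e) (vertex i))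
   (acomp (P0 F e) (P0 F d) (vertex i) (fo (t1 (legs i) d) j) (P1 F e d f)) (fo (t1 (legs i) e) (fo (P1 J d e f) j))"
 using cone_t2[OF Idx_Ob Idx_cones] by simp

end

section \<open>Terms, generating arrows and their interpretations\<close>

inductive_set OT :: "'u oterm set" where
 Gen: "d \<in> Ob D ==> j \<in> Obj (P0 J d) ==> x \<in> Obj (FC d) ==> Gen d j x \<in> OT"
| Op: "w \<in> words T ==> length ts = arity T w ==> \<forall>t\<in>set ts. t \<in> OT ==> Op w ts \<in> OT"

lemma OT_Op: "w \<in> words T ==> length ts = arity T w ==> set ts \<subseteq> OT ==> Op w ts \<in> OT"
 by (rule OT.Op) auto

lemma ev_Obj: assumes "i \<in> Idx" "t \<in> OT" shows "ev i t \<in> Obj (VC i)"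
 using assms(2)
proof induction
 case (Gen d j x) then show ?case using fun_fo[OF p_Mf[OF assms(1)]] by simp
next
 case (Op w ts)
 then have "map (ev i) ts \<in> Obj (pow (VC i) (arity T w))" by auto
 then show ?case using fun_fo[OF Phi_fun[OF algX[OF assms(1)] Op(1)]] by simp
qed

lemma ev_pow: "i \<in> Idx ==> set ts \<subseteq> OT ==> length ts = n ==> map (ev i) ts \<in> Obj (pow (VC i) n)"
 using ev_Obj by auto

lemma map2_Op_OT:
 assumes "set ws \<subseteq> words T" "set ts \<subseteq> OT" "length ts = tot ws"
 shows "set (map2 Op ws (blocks (ars ws) ts)) \<subseteq> OT"
proof -
 have "Op (ws ! k) (blocks (ars ws) ts ! k) \<in> OT" if "k < length ws" for k
  using assms that set_blocks_nth[of k "ars ws" ts] subsetD[OF assms(1) nth_mem[OF that]] by (intro OT_Op) auto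
 then show ?thesis by (auto simp: set_conv_nth)
qed

text \<open>Restriction to \<open>Idx\<close> makes equality of arrows with the same ends the same
  as equality of their values in all cocones.\<close>

definition mk :: "'u oterm => 'u oterm => ('u cocone => 'u) => 'u arrow" where
 "mk s t \<phi> = Arrow s t (restrict \<phi> Idx)"

lemma mk_simps [simp]: "dm (mk s t \<phi>) = s" "cd (mk s t \<phi>) = t" "i \<in> Idx ==> vl (mk s t \<phi>) i = \<phi> i"
 "vl (mk s t \<phi>) \<in> extensional Idx"
 by (auto simp: mk_def)

definition "ideA s = mk s s (\<lambda>i. Ide (VC i) (ev i s))"
text \<open>Each family provides one piece of structure: \<open>arrA\<close> and \<open>rhoA\<close>
  make a leg a morphism of algebras, \<open>wtA\<close> and \<open>sigA\<close> make the legs a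
  cocone, and \<open>ccA\<close>, \<open>iiA\<close>, \<open>ssA\<close> become the coherence cells
  of the algebra.\<close>

definition "arrA d j f = mk (Gen d j (Dom (FC d) f)) (Gen d j (Cod (FC d) f)) (\<lambda>i. fa (Mf (fo (t1 (legs i) d) j)) f)"
definition "wtA d u x = mk (Gen d (Dom (P0 J d) u) x) (Gen d (Cod (P0 J d) u) x) (\<lambda>i. cmp (fa (t1 (legs i) d) u) x)"
definition "rhoA d j w xs = mk (Gen d j (fo (Phi (P0 F d) w) xs)) (Op w (map (Gen d j) xs)) (\<lambda>i. cmp (Rho (fo (t1 (legs i) d) j) w) xs)"
definition "sigA d e f j x = mk (Gen d j (fo (Mf (P1 F e d f)) x)) (Gen e (fo (P1 J d e f) j) x) (\<lambda>i. cmp (cmp (t2 (legs i) d e f) j) x)"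
definition "ccA w ws ts = mk (Op (wgamma T w ws) ts) (Op w (map2 Op ws (blocks (ars ws) ts))) (\<lambda>i. cmp (Cc (vertex i) w ws) (map (ev i) ts))"
definition "iiA t = mk (Op (wunit T) [t]) t (\<lambda>i. cmp (Ii (vertex i)) [ev i t])"
definition "ssA w l fs ts = mk (Op (wsub T l fs w) ts) (Op w (map ((!) ts) fs)) (\<lambda>i. cmp (Ss (vertex i) w l fs) (map (ev i) ts))"
definition "compA b a = mk (dm a) (cd b) (\<lambda>i. vl b i \<cdot>[VC i] vl a i)"
definition "opA w as = mk (Op w (map dm as)) (Op w (map cd as)) (\<lambda>i. fa (Phi (vertex i) w) (map (\<lambda>a. vl a i) as))"
definition "invA a = mk (cd a) (dm a) (\<lambda>i. inv_arr (VC i) (vl a i))"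

lemma arrow_simps [simp]:
 "dm (compA b a) = dm a" "cd (compA b a) = cd b" "i \<in> Idx ==> vl (compA b a) i = vl b i \<cdot>[VC i] vl a i"
 "dm (ideA s) = s" "cd (ideA s) = s" "i \<in> Idx ==> vl (ideA s) i = Ide (VC i) (ev i s)"
 "dm (invA a) = cd a" "cd (invA a) = dm a" "i \<in> Idx ==> vl (invA a) i = inv_arr (VC i) (vl a i)"
 "dm (opA w as) = Op w (map dm as)" "cd (opA w as) = Op w (map cd as)"
 "i \<in> Idx ==> vl (opA w as) i = fa (Phi (vertex i) w) (map (\<lambda>a. vl a i) as)"
 by (auto simp: compA_def ideA_def invA_def opA_def)

inductive_set BA :: "'u arrow set" where
 ide: "s \<in> OT ==> ideA s \<in> BA"
| arr: "d \<in> Ob D ==> j \<in> Obj (P0 J d) ==> f \<in> Arr (FC d) ==> arrA d j f \<in> BA"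
| wt: "d \<in> Ob D ==> u \<in> Arr (P0 J d) ==> x \<in> Obj (FC d) ==> wtA d u x \<in> BA"
| rho: "d \<in> Ob D ==> j \<in> Obj (P0 J d) ==> w \<in> words T ==> xs \<in> Obj (pw (P0 F d) w) ==> rhoA d j w xs \<in> BA"
| sig: "one_cell D e d f ==> j \<in> Obj (P0 J d) ==> x \<in> Obj (FC e) ==> sigA d e f j x \<in> BA"
| cc: "composable T w ws ==> set ts \<subseteq> OT ==> length ts = tot ws ==> ccA w ws ts \<in> BA"
| ii: "t \<in> OT ==> iiA t \<in> BA"
| ss: "w \<in> words T ==> length fs = arity T w ==> set fs \<subseteq> {..<l} ==> set ts \<subseteq> OT ==> length ts = l ==> ssA w l fs ts \<in> BA"

text \<open>The condition of \<open>inv\<close> is semantic: not only formal inverses of generators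
  are added, but an inverse of every arrow whose values are all invertible. The condition also
  guarantees that the new values are typed correctly.\<close>

inductive_set AT :: "'u arrow set" where
 basic: "a \<in> BA ==> a \<in> AT"
| comp: "a \<in> AT ==> b \<in> AT ==> cd a = dm b ==> compA b a \<in> AT"
| op: "w \<in> words T ==> length as = arity T w ==> \<forall>a\<in>set as. a \<in> AT ==> opA w as \<in> AT"
| inv: "a \<in> AT ==> \<forall>i\<in>Idx. vl a i \<in> isos (VC i) (ev i (dm a)) (ev i (cd a)) ==> invA a \<in> AT"

definition typed :: "'u arrow => bool" where
 "typed a \<longleftrightarrow> dm a \<in> OT \<and> cd a \<in> OT \<and> vl a \<in> extensional Idx \<and>
   (\<forall>i\<in>Idx. vl a i \<in> hom (VC i) (ev i (dm a)) (ev i (cd a)))"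

abbreviation iso_arrow :: "'u arrow => bool" where
 "iso_arrow a == \<forall>i\<in>Idx. vl a i \<in> isos (VC i) (ev i (dm a)) (ev i (cd a))"

lemma iso_rhoA:
 assumes "d \<in> Ob D" "j \<in> Obj (P0 J d)" "w \<in> words T" "xs \<in> Obj (pw (P0 F d) w)"
 shows "iso_arrow (rhoA d j w xs)"
 using Rho_isos[OF algF[OF assms(1)] algX p_data[OF _ assms(1,2)] assms(3,4)]
 by (simp add: rhoA_def comp_def)

lemma iso_sigA:
 assumes "one_cell D e d f" "j \<in> Obj (P0 J d)" "x \<in> Obj (FC e)"
 shows "iso_arrow (sigA d e f j x)"
 using isos_alg_hom_catD[OF p_sig[OF _ assms(1,2)] algF[OF one_cellD(1)[OF assms(1)]] algX assms(3)] assms(3)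
 by (simp add: sigA_def)

lemma iso_ccA:
 assumes "composable T w ws" "set ts \<subseteq> OT" "length ts = tot ws"
 shows "iso_arrow (ccA w ws ts)"
proof
 fix i assume i: "i \<in> Idx"
 show "vl (ccA w ws ts) i \<in> isos (VC i) (ev i (dm (ccA w ws ts))) (ev i (cd (ccA w ws ts)))"
  using cmp_Cc[OF algX[OF i] assms(1) ev_pow[OF i assms(2,3)]] i by (simp add: ccA_def map_ev_map2_Op del: map_map)
qed

lemma iso_iiA: assumes "t \<in> OT" shows "iso_arrow (iiA t)"
 using cmp_Ii[OF algX ev_Obj[OF _ assms]] by (simp add: iiA_def)

lemma iso_ssA:
 assumes "w \<in> words T" "length fs = arity T w" "set fs \<subseteq> {..<l}" "set ts \<subseteq> OT" "length ts = l"
 shows "iso_arrow (ssA w l fs ts)"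
proof
 fix i assume i: "i \<in> Idx"
 have "map ((!) (map (ev i) ts)) fs = map (ev i) (map ((!) ts) fs)" using assms by (auto simp: subset_iff)
 then show "vl (ssA w l fs ts) i \<in> isos (VC i) (ev i (dm (ssA w l fs ts))) (ev i (cd (ssA w l fs ts)))"
  using cmp_Ss[OF algX[OF i] assms(1-3) ev_pow[OF i assms(4,5)]] i by (simp add: ssA_def del: map_map)
qed

lemma map_nth_OT: "set ts \<subseteq> OT ==> set fs \<subseteq> {..<length ts} ==> set (map ((!) ts) fs) \<subseteq> OT"
 by (auto simp: subset_iff)

lemma BA_typed: "a \<in> BA ==> typed a"
proof (induction rule: BA.induct)
 case (ide s)
 then show ?case using category.Ide_hom[OF catX ev_Obj] by (simp add: typed_def ideA_def)
next
 case (arr d j f)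
 then show ?case
  using fun_fa[OF p_Mf Arr_hom] category.hom_Obj[OF catF Arr_hom] by (auto simp: typed_def arrA_def intro: OT.Gen)
next
 case (wt d u x)
 have "cmp (fa (t1 (legs i) d) u) x \<in> hom (VC i) (fo (Mf (fo (t1 (legs i) d) (Dom (P0 J d) u))) x) (fo (Mf (fo (t1 (legs i) d) (Cod (P0 J d) u))) x)"
  if "i \<in> Idx" for i
  by (rule acell_homD(6)[OF algF[OF wt(1)] algX[OF that] p_wt[OF that wt(1) Arr_hom[OF wt(2)]] wt(3)])
 then show ?case
  using wt category.hom_Obj[OF catJ Arr_hom, of d u] by (auto simp: typed_def wtA_def intro: OT.Gen)
next
 case (rho d j w xs)
 have "Gen d j (fo (Phi (P0 F d) w) xs) \<in> OT"
  using rho fun_fo[OF Phi_fun[OF algF[OF rho(1)] rho(3)] rho(4)] by (auto intro: OT.Gen)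
 moreover have "Op w (map (Gen d j) xs) \<in> OT" using rho by (intro OT_Op) (auto intro: OT.Gen)
 ultimately show ?case using isos_hom[OF iso_rhoA[OF rho, rule_format]] by (simp add: typed_def) (simp add: rhoA_def)
next
 case (sig e d f j x)
 note ob = one_cellD[OF sig(1)]
 have "Gen d j (fo (Mf (P1 F e d f)) x) \<in> OT" "Gen e (fo (P1 J d e f) j) x \<in> OT"
  using fun_fo[OF MfF[OF sig(1)] sig(3)] J1[OF sig(1,2)] sig ob by (auto intro: OT.Gen)
 then show ?case using isos_hom[OF iso_sigA[OF sig, rule_format]] by (simp add: typed_def) (simp add: sigA_def)
next
 case (cc w ws ts)
 note c = composableD[OF cc(1)]
 have "Op (wgamma T w ws) ts \<in> OT" using words_wgamma[OF cc(1)] cc by (intro OT_Op) auto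
 moreover have "Op w (map2 Op ws (blocks (ars ws) ts)) \<in> OT"
  using map2_Op_OT[OF c(4) cc(2,3)] c by (intro OT_Op) auto
 ultimately show ?case using isos_hom[OF iso_ccA[OF cc, rule_format]] by (simp add: typed_def) (simp add: ccA_def)
next
 case (ii t)
 have "Op (wunit T) [t] \<in> OT" using words_wunit ii by (intro OT_Op) auto
 then show ?case using ii isos_hom[OF iso_iiA[OF ii, rule_format]] by (simp add: typed_def) (simp add: iiA_def)
next
 case (ss w fs l ts)
 have "Op (wsub T l fs w) ts \<in> OT" using words_wsub[OF ss(1-3)] ss by (intro OT_Op) auto
 moreover have "Op w (map ((!) ts) fs) \<in> OT" using map_nth_OT[OF ss(4)] ss by (intro OT_Op) auto
 ultimately show ?case using isos_hom[OF iso_ssA[OF ss, rule_format]] by (simp add: typed_def) (simp add: ssA_def)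
qed

lemma AT_typed: "a \<in> AT ==> typed a"
proof (induction rule: AT.induct)
 case (basic a) then show ?case by (rule BA_typed)
next
 case (comp a b)
 then show ?case using category.Cmp_hom[OF catX] by (fastforce simp: typed_def compA_def)
next
 case (op w as)
 have a: "typed a" if "a \<in> set as" for a using op that by blast
 have "fa (Phi (vertex i) w) (map (\<lambda>a. vl a i) as) \<in> hom (VC i) (fo (Phi (vertex i) w) (map (ev i) (map dm as))) (fo (Phi (vertex i) w) (map (ev i) (map cd as)))"
  if i: "i \<in> Idx" for i
  using a i op(2) by (intro fun_fa[OF Phi_fun[OF algX[OF i] op(1)]]) (auto simp: typed_def hom_pow_iff)
 then show ?case using a op by (auto simp: typed_def opA_def intro!: OT_Op)
next
 case (inv a)
 then show ?case using inv_arr_hom[OF inv(2)[rule_format]] by (simp add: typed_def) (simp add: invA_def)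
qed

lemma AT_OT: "a \<in> AT ==> dm a \<in> OT" "a \<in> AT ==> cd a \<in> OT"
 using AT_typed by (auto simp: typed_def)

lemma AT_hom: "a \<in> AT ==> i \<in> Idx ==> vl a i \<in> hom (VC i) (ev i (dm a)) (ev i (cd a))"
 using AT_typed by (auto simp: typed_def)

text \<open>No quotient is involved: an arrow is nothing but its ends and its values.\<close>

lemma AT_eqI:
 assumes "a \<in> AT" "b \<in> AT" "dm a = dm b" "cd a = cd b" "\<And>i. i \<in> Idx ==> vl a i = vl b i"
 shows "a = b"
proof -
 have "vl a = vl b" using AT_typed[OF assms(1)] AT_typed[OF assms(2)] assms(5) by (auto simp: typed_def intro: extensionalityI)
 then show ?thesis using assms(3,4) by (intro arrow.expand) auto
qed

section \<open>Bounds for the numbers of terms and arrows, and their encoding in the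
  universe\<close>

definition params :: "'u set" where
 "params = Ob D \<union> (\<Union>d\<in>Ob D. \<Union>e\<in>Ob D. Obj (Hom D d e)) \<union>
   (\<Union>d\<in>Ob D. Obj (P0 J d) \<union> Arr (P0 J d) \<union> Obj (FC d) \<union> Arr (FC d)) \<union> Arr (Tcat T)"

lemma small_params: "small params"
proof -
 have "small (Ob D)" "\<And>d e. d \<in> Ob D ==> e \<in> Ob D ==> small (Obj (Hom D d e))"
  using small_D by (auto simp: small_twocat_def intro: U_small)
 moreover have "small (Obj (P0 J d))" "small (Arr (P0 J d))" if "d \<in> Ob D" for d
  using JU.P0_Ob[of d] that by (auto intro: U_small)
 moreover have "small (Obj (FC d))" "small (Arr (FC d))" if "d \<in> Ob D" for d
  using F.P0_Ob[of d] that by (auto intro: U_small)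
 ultimately show ?thesis unfolding params_def by (intro small_Un small_UN U_small[OF words_U]) auto
qed

lemma in_params:
 "d \<in> Ob D ==> d \<in> params" "one_cell D d e f ==> f \<in> params" "d \<in> Ob D ==> j \<in> Obj (P0 J d) ==> j \<in> params"
 "d \<in> Ob D ==> u \<in> Arr (P0 J d) ==> u \<in> params" "d \<in> Ob D ==> x \<in> Obj (FC d) ==> x \<in> params"
 "d \<in> Ob D ==> g \<in> Arr (FC d) ==> g \<in> params" "w \<in> words T ==> w \<in> params"
 by (auto simp: params_def words_def one_cell_def)

text \<open>The bound counts all terms over the small set \<open>params\<close>, well formed or
  not.\<close>

lemma small_OT: "small OT"
proof -
 let ?A = "params \<times> params \<times> params"
 have "t \<in> clos ((\<lambda>(d, j, x). Gen d j x) ` ?A) (Op ` params)" if "t \<in> OT" for t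
  using that
 proof induction
  case (Gen d j x)
  then show ?case by (intro clos.gen image_eqI[of _ _ "(d, j, x)"]) (auto intro: in_params)
 next
  case (Op w ts)
  then show ?case by (intro clos.op) (auto intro: in_params)
 qed
 then have "OT \<subseteq> clos ((\<lambda>(d, j, x). Gen d j x) ` ?A) (Op ` params)" by blast
 then show ?thesis
  by (rule small_subset[rotated]) (intro small_clos small_image small_Times small_params)
qed

text \<open>The values of an arrow form a large family, but a generator is determined by its
  finitely many parameters, so the generators are covered by eight images of small sets.\<close>

lemma small_BA: "small BA"
proof -
 let ?p = params and ?l = "lists params" and ?o = "lists OT" and ?n = "UNIV :: nat set" and ?m = "UNIV :: nat list set" and ?arr = "\<lambda>(d, j, f). arrA d j f" and ?wt = "\<lambda>(d, u, x). wtA d u x" and ?rho = "\<lambda>(d, j, w, xs). rhoA d j w xs"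
  and ?sig = "\<lambda>(d, e, f, j, x). sigA d e f j x" and ?cc = "\<lambda>(w, ws, ts). ccA w ws ts" and ?ss = "\<lambda>(w, l, fs, ts). ssA w l fs ts"
 let ?B = "ideA ` OT \<union> ?arr ` (?p \<times> ?p \<times> ?p) \<union> ?wt ` (?p \<times> ?p \<times> ?p) \<union> ?rho ` (?p \<times> ?p \<times> ?p \<times> ?l)
  \<union> ?sig ` (?p \<times> ?p \<times> ?p \<times> ?p \<times> ?p) \<union> ?cc ` (?p \<times> ?l \<times> ?o) \<union> iiA ` OT \<union> ?ss ` (?p \<times> ?n \<times> ?m \<times> ?o)"
 have "a \<in> ?B" if "a \<in> BA" for a
  using that
 proof induction
  case (ide s) then have "ideA s \<in> ideA ` OT" by (rule imageI)
  then show ?case by (simp only: Un_iff simp_thms)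
 next
  case (arr d j f) then have "?arr (d, j, f) \<in> ?arr ` (?p \<times> ?p \<times> ?p)" by (intro imageI) (auto intro: in_params)
  then show ?case by (simp only: Un_iff simp_thms split)
 next
  case (wt d u x) then have "?wt (d, u, x) \<in> ?wt ` (?p \<times> ?p \<times> ?p)" by (intro imageI) (auto intro: in_params)
  then show ?case by (simp only: Un_iff simp_thms split)
 next
  case (rho d j w xs) then have "?rho (d, j, w, xs) \<in> ?rho ` (?p \<times> ?p \<times> ?p \<times> ?l)" by (intro imageI) (auto intro: in_params)
  then show ?case by (simp only: Un_iff simp_thms split)
 next
  case (sig e d f j x) then have "?sig (d, e, f, j, x) \<in> ?sig ` (?p \<times> ?p \<times> ?p \<times> ?p \<times> ?p)" by (intro imageI) (auto intro: in_params dest: one_cellD)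
  then show ?case by (simp only: Un_iff simp_thms split)
 next
  case (cc w ws ts) then have "?cc (w, ws, ts) \<in> ?cc ` (?p \<times> ?l \<times> ?o)" using composableD(3,4)[OF cc(1)] by (intro imageI) (auto intro: in_params)
  then show ?case by (simp only: Un_iff simp_thms split)
 next
  case (ii t) then have "iiA t \<in> iiA ` OT" by (rule imageI)
  then show ?case by (simp only: Un_iff simp_thms)
 next
  case (ss w fs l ts) then have "?ss (w, l, fs, ts) \<in> ?ss ` (?p \<times> ?n \<times> ?m \<times> ?o)" by (intro imageI) (auto intro: in_params)
  then show ?case by (simp only: Un_iff simp_thms split)
 qed
 then have "BA \<subseteq> ?B" by (rule subsetI)
 then show ?thesis
  by (rule small_subset[rotated])
   (intro small_Un small_image small_Times small_params small_OT small_lists small_nat small_countable[of "UNIV :: nat list set"] countableI_type)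
qed

lemma small_AT: "small AT"
proof -
 \<comment> \<open>Composition and inversion are rewritten as operations on lists, as
   \<open>clos\<close> demands; in a list of two arrows the one applied last comes first.\<close>
 let ?Ops = "{\<lambda>as. compA (as ! 0) (as ! 1), \<lambda>as. invA (as ! 0)} \<union> opA ` params"
 have "a \<in> clos BA ?Ops" if "a \<in> AT" for a
  using that
 proof induction
  case (basic a) then show ?case by (rule clos.gen)
 next
  case (comp a b)
  have "(\<lambda>as. compA (as ! 0) (as ! 1)) [b, a] \<in> clos BA ?Ops" by (rule clos.op) (use comp in auto)
  then show ?case by simp
 next
  case (op w as)
  then show ?case by (intro clos.op[of "opA w"]) (auto intro: in_params)
 next
  case (inv a)
  have "(\<lambda>as. invA (as ! 0)) [a] \<in> clos BA ?Ops" by (rule clos.op) (use inv in auto)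
  then show ?case by simp
 qed
 moreover have "small ?Ops" by (intro small_Un small_image small_params small_countable) auto
 ultimately show ?thesis using small_subset[OF small_clos[OF small_BA, of ?Ops]] by blast
qed

text \<open>An object of \<open>Alg U T\<close> has its carrier over the type of the universe and in
  \<open>U\<close>, so terms and arrows have to be replaced by codes.\<close>

definition eo :: "'u oterm => 'u" where "eo = (SOME e. inj_on e OT \<and> e ` OT \<in> U)"
definition ea :: "'u arrow => 'u" where "ea = (SOME e. inj_on e AT \<and> e ` AT \<in> U)"

lemma eo: "inj_on eo OT" "eo ` OT \<in> U"
proof -
 have "\<exists>e :: 'u oterm => 'u. inj_on e OT \<and> e ` OT \<in> U" using small_code[OF small_OT] by blast
 from someI_ex[OF this, folded eo_def] show "inj_on eo OT" "eo ` OT \<in> U" by auto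
qed

lemma ea: "inj_on ea AT" "ea ` AT \<in> U"
proof -
 have "\<exists>e :: 'u arrow => 'u. inj_on e AT \<and> e ` AT \<in> U" using small_code[OF small_AT] by blast
 from someI_ex[OF this, folded ea_def] show "inj_on ea AT" "ea ` AT \<in> U" by auto
qed

definition "ot = inv_into OT eo"
definition "at = inv_into AT ea"

lemma ot_eo [simp]: "t \<in> OT ==> ot (eo t) = t"
 unfolding ot_def by (rule inv_into_f_f[OF eo(1)])

lemma at_ea [simp]: "a \<in> AT ==> at (ea a) = a"
 unfolding at_def by (rule inv_into_f_f[OF ea(1)])

section \<open>The category of encoded terms and its interpretation functors\<close>

definition Wc :: "('u, 'u) cat" where
 "Wc = \<lparr>Obj = eo ` OT, Arr = ea ` AT, Dom = (\<lambda>a. eo (dm (at a))), Cod = (\<lambda>a. eo (cd (at a))),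
   Ide = (\<lambda>x. ea (ideA (ot x))), Cmp = (\<lambda>g f. ea (compA (at g) (at f)))\<rparr>"

lemma Wc_simps: "Obj Wc = eo ` OT" "Arr Wc = ea ` AT"
 "a \<in> AT ==> Dom Wc (ea a) = eo (dm a)" "a \<in> AT ==> Cod Wc (ea a) = eo (cd a)"
 "t \<in> OT ==> Ide Wc (eo t) = ea (ideA t)" "a \<in> AT ==> b \<in> AT ==> ea b \<cdot>[Wc] ea a = ea (compA b a)"
 by (auto simp: Wc_def)

lemma eo_eq_iff: "s \<in> OT ==> t \<in> OT ==> eo s = eo t \<longleftrightarrow> s = t"
 using eo(1) by (auto dest: inj_onD)

lemma ea_hom: "a \<in> AT ==> ea a \<in> hom Wc (eo (dm a)) (eo (cd a))"
 by (simp add: hom_def Wc_simps)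

lemma Wc_homE:
 assumes "f \<in> hom Wc x y"
 obtains a where "a \<in> AT" "f = ea a" "x = eo (dm a)" "y = eo (cd a)"
 using assms by (auto simp: hom_def Wc_simps)

lemma ideA_AT: "t \<in> OT ==> ideA t \<in> AT"
 by (rule AT.basic[OF BA.ide])

lemma category_Wc: "category Wc"
proof
 show "Dom Wc f \<in> Obj Wc" "Cod Wc f \<in> Obj Wc" if "f \<in> Arr Wc" for f using that AT_OT by (auto simp: Wc_simps)
 show "Ide Wc x \<in> hom Wc x x" if "x \<in> Obj Wc" for x
  using that ea_hom[OF ideA_AT] by (auto simp: Wc_simps ideA_def)
 show "g \<cdot>[Wc] f \<in> hom Wc x z" if "f \<in> hom Wc x y" "g \<in> hom Wc y z" for f g x y z
 proof -
  from that obtain a b where ab: "a \<in> AT" "b \<in> AT" "f = ea a" "g = ea b" "x = eo (dm a)" "eo (cd a) = eo (dm b)" "z = eo (cd b)"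
   by (metis Wc_homE)
  then have "compA b a \<in> AT" by (intro AT.comp) (auto simp: eo_eq_iff AT_OT)
  then show ?thesis using ea_hom[of "compA b a"] ab by (simp add: Wc_simps compA_def)
 qed
 fix f x y assume f: "f \<in> hom Wc x y"
 then obtain a where a: "a \<in> AT" "f = ea a" "x = eo (dm a)" "y = eo (cd a)" by (rule Wc_homE)
 note oa = AT_OT[OF a(1)]
 have AT1: "compA (ideA (cd a)) a \<in> AT" "compA a (ideA (dm a)) \<in> AT"
  using a(1) oa ideA_AT by (auto intro!: AT.comp)
 have "compA (ideA (cd a)) a = a"
  by (rule AT_eqI[OF AT1(1) a(1)]) (auto simp: category.Cmp_Ide_left[OF catX AT_hom[OF a(1)]])
 moreover have "compA a (ideA (dm a)) = a"
  by (rule AT_eqI[OF AT1(2) a(1)]) (auto simp: category.Cmp_Ide_right[OF catX AT_hom[OF a(1)]])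
 ultimately show "Ide Wc y \<cdot>[Wc] f = f" "f \<cdot>[Wc] Ide Wc x = f" using a oa ideA_AT by (simp_all add: Wc_simps)
 fix g h z v assume "g \<in> hom Wc y z" "h \<in> hom Wc z v"
 then obtain b c where bc: "b \<in> AT" "c \<in> AT" "g = ea b" "h = ea c" "y = eo (dm b)" "z = eo (cd b)" "eo (cd b) = eo (dm c)"
  by (metis Wc_homE)
 have e: "cd a = dm b" "cd b = dm c" using a bc by (auto simp: eo_eq_iff AT_OT)
 have AT: "compA b a \<in> AT" "compA c b \<in> AT" "compA c (compA b a) \<in> AT" "compA (compA c b) a \<in> AT"
  using a bc e by (auto intro!: AT.comp)
 have "compA c (compA b a) = compA (compA c b) a"
  by (rule AT_eqI[OF AT(3,4)])
   (use category.Cmp_assoc[OF catX AT_hom[OF a(1)] AT_hom[OF bc(1), folded e] AT_hom[OF bc(2), folded e]] in auto)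
 then show "h \<cdot>[Wc] (g \<cdot>[Wc] f) = (h \<cdot>[Wc] g) \<cdot>[Wc] f" using a bc AT by (simp add: Wc_simps)
qed

sublocale W: category Wc by (rule category_Wc)

definition PF :: "'u cocone => ('u, 'u, 'u, 'u) func" where
 "PF i = \<lparr>fo = (\<lambda>x\<in>Obj Wc. ev i (ot x)), fa = (\<lambda>f\<in>Arr Wc. vl (at f) i)\<rparr>"

lemma fo_PF [simp]: "t \<in> OT ==> fo (PF i) (eo t) = ev i t"
 and fa_PF [simp]: "a \<in> AT ==> fa (PF i) (ea a) = vl a i"
 by (auto simp: PF_def Wc_simps)

lemma compA_AT: "a \<in> AT ==> b \<in> AT ==> eo (cd a) = eo (dm b) ==> compA b a \<in> AT"
 by (rule AT.comp) (auto simp: eo_eq_iff AT_OT)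

lemma PF_functors: assumes i: "i \<in> Idx" shows "PF i \<in> functors Wc (VC i)"
proof (rule functorsI)
 show "fo (PF i) x \<in> Obj (VC i)" if "x \<in> Obj Wc" for x using that ev_Obj[OF i] by (auto simp: Wc_simps)
 show "fa (PF i) f \<in> hom (VC i) (fo (PF i) x) (fo (PF i) y)" if "f \<in> hom Wc x y" for f x y
  using that by (rule Wc_homE) (use AT_hom[OF _ i] AT_OT in auto)
 show "fa (PF i) (Ide Wc x) = Ide (VC i) (fo (PF i) x)" if "x \<in> Obj Wc" for x
  using that i by (auto simp: Wc_simps ideA_AT)
 show "fa (PF i) (g \<cdot>[Wc] f) = fa (PF i) g \<cdot>[VC i] fa (PF i) f" if fg: "f \<in> hom Wc x y" "g \<in> hom Wc y z" for f g x y z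
 proof -
  from fg obtain a b where ab: "a \<in> AT" "b \<in> AT" "f = ea a" "g = ea b" "eo (cd a) = eo (dm b)" by (metis Wc_homE)
  then show ?thesis using compA_AT[OF ab(1,2,5)] i by (simp add: Wc_simps)
 qed
qed (auto simp: PF_def)

text \<open>Joint faithfulness of the interpretations. All equations in \<open>Wc\<close>, and so
  all laws of the algebra and of the universal cocone, are proved through this rule.\<close>

lemma W_eqI:
 assumes "f \<in> hom Wc x y" "g \<in> hom Wc x y" "\<And>i. i \<in> Idx ==> fa (PF i) f = fa (PF i) g"
 shows "f = g"
proof -
 obtain a where a: "a \<in> AT" "f = ea a" "x = eo (dm a)" "y = eo (cd a)" using assms(1) by (rule Wc_homE)
 obtain b where b: "b \<in> AT" "g = ea b" "x = eo (dm b)" "y = eo (cd b)" using assms(2) by (rule Wc_homE)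
 have "dm a = dm b" "cd a = cd b" using a b by (simp_all add: eo_eq_iff AT_OT)
 then have "a = b" using a b assms(3) by (intro AT_eqI) auto
 then show ?thesis using a b by simp
qed

text \<open>Joint reflection of isomorphisms. The inverse exists because of the rule
  \<open>inv\<close> of \<open>AT\<close>, whose condition is exactly the hypothesis on
  values.\<close>

lemma W_isosI:
 assumes f: "f \<in> hom Wc x y" and i: "\<And>i. i \<in> Idx ==> fa (PF i) f \<in> isos (VC i) (fo (PF i) x) (fo (PF i) y)"
 shows "f \<in> isos Wc x y"
proof -
 obtain a where a: "a \<in> AT" "f = ea a" "x = eo (dm a)" "y = eo (cd a)" using f by (rule Wc_homE)
 have "iso_arrow a" using i a AT_OT by simp
 then have inv: "invA a \<in> AT" by (rule AT.inv[OF a(1)])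
 have g: "ea (invA a) \<in> hom Wc y x" using ea_hom[OF inv] a by (simp add: invA_def)
 have v: "fa (PF k) (ea (invA a)) = inv_arr (Car (vertex k)) (fa (PF k) f)" if "k \<in> Idx" for k
  using inv a that by simp
 note o = W.hom_Obj[OF f]
 show ?thesis
 proof (rule isosI[OF f g])
  show "ea (invA a) \<cdot>[Wc] f = Ide Wc x"
   by (rule W_eqI[OF W.Cmp_hom[OF f g] W.Ide_hom[OF o(1)]])
    (simp add: fun_Cmp[OF PF_functors f g] fun_Ide[OF PF_functors o(1)] v inv_arr_left[OF i])
  show "f \<cdot>[Wc] ea (invA a) = Ide Wc y"
   by (rule W_eqI[OF W.Cmp_hom[OF g f] W.Ide_hom[OF o(2)]])
    (simp add: fun_Cmp[OF PF_functors g f] fun_Ide[OF PF_functors o(2)] v inv_arr_right[OF i])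
 qed
qed

lemma strict: "i \<in> Idx ==> strict_functor Wc (VC i) (PF i)"
 unfolding strict_functor_def strict_functor_axioms_def using category_Wc catX PF_functors by blast

end

section \<open>Algebra structure reflected along strict morphisms\<close>

text \<open>Formulated for structures and not for algebras, since it is applied to \<open>WA\<close>
  in order to prove the laws there. The equations for sources and targets allow the sides of the
  axioms to be composed on both ends of \<open>P\<close>.\<close>

locale strict_morphism = lawvere_theory T + strict_functor "Car A" "Car B" P
 for T :: "'t lawvere" and A :: "('t, 'o, 'a) alg" and B :: "('t, 'p, 'b) alg" and P +
 assumes Phi_rel: "w \<in> words T ==> relF (arity T w) (Phi A w) (Phi B w)"
  and Cc_rel: "composable T w ws ==> relH (tot ws) (Cc A w ws) (Cc B w ws)"
  and Cc_A: "composable T w ws ==> src (Cc A w ws) = Phi A (wgamma T w ws)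
    \<and> tgt (Cc A w ws) = gammaF (Car A) (Phi A w) (ars ws) (map (Phi A) ws)"
  and Cc_B: "composable T w ws ==> src (Cc B w ws) = Phi B (wgamma T w ws)
    \<and> tgt (Cc B w ws) = gammaF (Car B) (Phi B w) (ars ws) (map (Phi B) ws)"
  and Ii_rel: "relH 1 (Ii A) (Ii B)"
  and Ii_AB: "src (Ii A) = Phi A (wunit T)" "src (Ii B) = Phi B (wunit T)"
  and Ss_rel: "w \<in> words T ==> length fs = arity T w ==> set fs \<subseteq> {..<l} ==> relH l (Ss A w l fs) (Ss B w l fs)"
  and Ss_A: "w \<in> words T ==> length fs = arity T w ==> set fs \<subseteq> {..<l} ==>
    src (Ss A w l fs) = Phi A (wsub T l fs w) \<and> tgt (Ss A w l fs) = subF (Car A) l fs (Phi A w)"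
  and Ss_B: "w \<in> words T ==> length fs = arity T w ==> set fs \<subseteq> {..<l} ==>
    src (Ss B w l fs) = Phi B (wsub T l fs w) \<and> tgt (Ss B w l fs) = subF (Car B) l fs (Phi B w)"
begin

lemma iPhi_rel: "w \<in> words T ==> relH (arity T w) (iPhi T A w) (iPhi T B w)"
 unfolding iPhi_def by (rule relH_idn[OF Phi_rel])

lemma gammaN_simps: "src (gammaN X \<beta> ns \<alpha>s) = gammaF X (src \<beta>) ns (map src \<alpha>s)"
 "tgt (gammaN X \<beta> ns \<alpha>s) = gammaF X (tgt \<beta>) ns (map tgt \<alpha>s)" "src (iPhi T C w) = Phi C w" "tgt (iPhi T C w) = Phi C w"
 by (auto simp: gammaN_def gammaF_def iPhi_def)

lemma src_iPhi: "map (src \<circ> iPhi T C) ws = map (Phi C) ws"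
 by (auto simp: gammaN_simps)

text \<open>Each side of an axiom is built from structure cells by \<open>gammaN\<close>,
  \<open>subN\<close> and vertical composition, under which \<open>relH\<close> is closed. The
  following lemmas treat the other axioms in the same way.\<close>

lemma assoc_rel:
 assumes c: "composable T w ws" and l: "length wss = length ws" and cs: "\<forall>i<length ws. composable T (ws ! i) (wss ! i)"
 shows "relH (tot (concat wss)) (assoc_l A w ws wss) (assoc_l B w ws wss)" (is ?lhs)
  and "relH (tot (concat wss)) (assoc_r A w ws wss) (assoc_r B w ws wss)" (is ?rhs)
proof -
 note a = composable_assoc[OF c l cs] and cd = composableD[OF c]
 have N: "tot (concat wss) = sum_list (map (\<lambda>vs. tot vs) wss)" by (induction wss) auto
 have v: "concat wss ! i \<in> words T" if "i < length (concat wss)" for i using composableD(4)[OF a(1)] that by (meson nth_mem subsetD)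
 have g: "relH (tot (concat wss)) (gammaN (Car A) (Cc A w ws) (ars (concat wss)) (map (iPhi T A) (concat wss)))
   (gammaN (Car B) (Cc B w ws) (ars (concat wss)) (map (iPhi T B) (concat wss)))"
  by (rule relH_gammaN) (use Cc_rel[OF c] a(4) iPhi_rel[OF v] in \<open>auto simp: length_concat\<close>)
 show ?lhs
  by (rule relH_Cmp[OF Cc_rel[OF a(1)] g]) (auto simp: gammaN_simps Cc_A[OF c] Cc_A[OF a(1)] Cc_B[OF c] Cc_B[OF a(1)] src_iPhi)
 have g: "relH (sum_list (map (\<lambda>vs. tot vs) wss))
   (gammaN (Car A) (iPhi T A w) (map (\<lambda>vs. tot vs) wss) (map2 (Cc A) ws wss))
   (gammaN (Car B) (iPhi T B w) (map (\<lambda>vs. tot vs) wss) (map2 (Cc B) ws wss))"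
  by (rule relH_gammaN) (use Cc_rel[OF cs[rule_format]] iPhi_rel[OF cd(3)] l cd(5) in auto)
 let ?A = "map2 (wgamma T) ws wss"
 have s: "map src (map2 (Cc A) ws wss) = map (Phi A) ?A" "map src (map2 (Cc B) ws wss) = map (Phi B) ?A"
  by (rule nth_equalityI; use Cc_A[OF cs[rule_format]] Cc_B[OF cs[rule_format]] l in auto)+
 have r: "relH (sum_list (map (\<lambda>vs. tot vs) wss)) (Cc A w ?A) (Cc B w ?A)"
  using Cc_rel[OF a(2)] unfolding a(3) .
 show ?rhs unfolding N
  by (rule relH_Cmp[OF r g]) (simp_all only: gammaN_simps Cc_A[OF a(2)] Cc_B[OF a(2)] s a(3))
qed

lemma unit_right_rel:
 assumes w: "w \<in> words T"
 shows "relH (arity T w) (unit_r A w) (unit_r B w)"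
proof -
 note c = composable_unit(1)[OF w]
 have s: "sum_list (replicate (arity T w) (1::nat)) = arity T w" "ars (replicate (arity T w) (wunit T)) = replicate (arity T w) 1"
  using words_wunit by (auto simp: sum_list_replicate)
 let ?A = "replicate (arity T w) 1"
 have g: "relH (sum_list ?A) (gammaN (Car A) (iPhi T A w) ?A (replicate (arity T w) (Ii A)))
   (gammaN (Car B) (iPhi T B w) ?A (replicate (arity T w) (Ii B)))"
  by (rule relH_gammaN) (use Ii_rel iPhi_rel[OF w] in auto)
 show ?thesis
  by (rule relH_Cmp[OF Cc_rel[OF c, unfolded s(2), unfolded s(1)] g[unfolded s(1)]])
   (simp_all add: gammaN_simps Cc_A[OF c, unfolded s(2)] Cc_B[OF c, unfolded s(2)] Ii_AB)
qed

lemma unit_left_rel: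
 assumes w: "w \<in> words T"
 shows "relH (arity T w) (unit_l A w) (unit_l B w)"
proof -
 note c = composable_unit(2)[OF w]
 have g: "relH (sum_list [arity T w]) (gammaN (Car A) (Ii A) [arity T w] [iPhi T A w]) (gammaN (Car B) (Ii B) [arity T w] [iPhi T B w])"
  by (rule relH_gammaN) (use Ii_rel iPhi_rel[OF w] in auto)
 show ?thesis
  using relH_Cmp[OF Cc_rel[OF c, simplified] g[simplified]] by (simp add: gammaN_simps Cc_A[OF c] Cc_B[OF c] Ii_AB)
qed

lemma sub_left_rel:
 assumes w: "w \<in> words T" and fs: "length fs = arity T w" "set fs \<subseteq> {..<length ws}" and ws: "set ws \<subseteq> words T"
  and ns: "ns = ars ws"
 shows "relH (sum_list ns) (sub_left_l A w fs ws ns) (sub_left_l B w fs ws ns)" (is ?lhs)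
  and "relH (sum_list ns) (sub_left_r A w fs ws ns) (sub_left_r B w fs ws ns)" (is ?rhs)
proof -
 note q = wsub_wgamma_left[OF w fs ws ns]
 have fn: "set fs \<subseteq> {..<length ns}" using fs ns by simp
 note sb = set_block_map[OF fn]
 have lb: "length (block_map ns fs) = sum_list (ars (map ((!) ws) fs))" unfolding length_block_map[OF fn] q(4) ..
 have lb': "length (block_map ns fs) = arity T (wgamma T w (map ((!) ws) fs))" unfolding lb words_wgamma(2)[OF q(1)] ..
 note W = words_wgamma(1)[OF q(1)]
 show ?lhs
  by (rule relH_Cmp[OF Ss_rel[OF W lb' sb] relH_subN[OF sb Cc_rel[OF q(1), folded lb]]])
   (simp_all add: Ss_A[OF W lb' sb] Ss_B[OF W lb' sb] Cc_A[OF q(1)] Cc_B[OF q(1)])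
 have g: "relH (sum_list ns) (gammaN (Car A) (Ss A w (length ws) fs) ns (map (iPhi T A) ws)) (gammaN (Car B) (Ss B w (length ws) fs) ns (map (iPhi T B) ws))"
  by (rule relH_gammaN) (use Ss_rel[OF w fs] iPhi_rel subsetD[OF ws nth_mem] ns in auto)
 show ?rhs
  by (rule relH_Cmp[OF Cc_rel[OF q(2), folded ns] g])
   (simp_all add: gammaN_simps Cc_A[OF q(2)] Cc_B[OF q(2)] Ss_A[OF w fs] Ss_B[OF w fs] src_iPhi ns)
qed

lemma sub_right_rel:
 assumes c: "composable T w ws" and l: "length gss = length ws" "length ns = length ws"
  and g: "\<forall>i<length ws. length (gss ! i) = arity T (ws ! i) \<and> set (gss ! i) \<subseteq> {..<ns ! i}"
 shows "relH (sum_list ns) (sub_right_l A w ws gss ns) (sub_right_l B w ws gss ns)" (is ?lhs)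
  and "relH (sum_list ns) (sub_right_r A w ws gss ns) (sub_right_r B w ws gss ns)" (is ?rhs)
proof -
 note q = wsub_wgamma_right[OF c l g] and cd = composableD[OF c]
 have lg: "length gss = length ns" using l by simp
 have g': "\<forall>i<length ns. set (gss ! i) \<subseteq> {..<ns ! i}" using g l by auto
 note sb = set_block_sum[OF lg g']
 have lb: "length (block_sum ns gss) = tot ws" unfolding length_block_sum q(3) ..
 have lb': "length (block_sum ns gss) = arity T (wgamma T w ws)" unfolding lb words_wgamma(2)[OF c] ..
 note W = words_wgamma(1)[OF c]
 show ?lhs
  by (rule relH_Cmp[OF Ss_rel[OF W lb' sb] relH_subN[OF sb Cc_rel[OF c, folded lb]]])
   (simp_all add: Ss_A[OF W lb' sb] Ss_B[OF W lb' sb] Cc_A[OF c] Cc_B[OF c])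
 have wi: "ws ! i \<in> words T" if "i < length ws" for i using subsetD[OF cd(4) nth_mem[OF that]] .
 note gi = g[rule_format, THEN conjunct1] g[rule_format, THEN conjunct2]
 have gn: "relH (sum_list ns) (gammaN (Car A) (iPhi T A w) ns (map (\<lambda>i. Ss A (ws ! i) (ns ! i) (gss ! i)) [0..<length ws]))
   (gammaN (Car B) (iPhi T B w) ns (map (\<lambda>i. Ss B (ws ! i) (ns ! i) (gss ! i)) [0..<length ws]))"
  by (rule relH_gammaN) (use iPhi_rel[OF cd(3)] Ss_rel[OF wi gi] l cd(5) in auto)
 have s: "map src (map (\<lambda>i. Ss A (ws ! i) (ns ! i) (gss ! i)) [0..<length ws]) = map (Phi A) (map (\<lambda>i. wsub T (ns ! i) (gss ! i) (ws ! i)) [0..<length ws])"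
  "map src (map (\<lambda>i. Ss B (ws ! i) (ns ! i) (gss ! i)) [0..<length ws]) = map (Phi B) (map (\<lambda>i. wsub T (ns ! i) (gss ! i) (ws ! i)) [0..<length ws])"
  using Ss_A[OF wi gi] Ss_B[OF wi gi] by auto
 show ?rhs
  by (rule relH_Cmp[OF Cc_rel[OF q(1), unfolded q(2)] gn])
   (simp_all only: gammaN_simps Cc_A[OF q(1)] Cc_B[OF q(1)] s q(2))
qed

lemma sub_sub_rel:
 assumes w: "w \<in> words T" and fs: "length fs = arity T w" "set fs \<subseteq> {..<length gs}" and gs: "set gs \<subseteq> {..<m}"
 shows "relH m (sub_sub A w fs gs m) (sub_sub B w fs gs m)"
proof -
 note s = words_wsub[OF w fs]
 show ?thesis
  by (rule relH_Cmp[OF Ss_rel[OF s(1) s(2)[symmetric] gs] relH_subN[OF gs Ss_rel[OF w fs]]])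
   (simp_all add: Ss_A[OF w fs] Ss_B[OF w fs] Ss_A[OF s(1) s(2)[symmetric] gs] Ss_B[OF s(1) s(2)[symmetric] gs])
qed

end

section \<open>Operations and coherence cells on the category of terms\<close>

context free_bicolimit
begin

lemma Wc_pow_Obj: assumes "xs \<in> Obj (pow Wc n)" obtains ts where "set ts \<subseteq> OT" "length ts = n" "xs = map eo ts" "map ot xs = ts"
proof (rule that)
 show "set (map ot xs) \<subseteq> OT" "length (map ot xs) = n" using assms by (auto simp: Wc_simps subset_iff image_iff)
 show "xs = map eo (map ot xs)" using assms by (auto simp: Wc_simps subset_iff image_iff intro!: nth_equalityI) (metis nth_mem ot_eo)
qed simp

lemma Wc_pow_hom:
 assumes "fs \<in> hom (pow Wc n) xs ys"
 obtains as where "set as \<subseteq> AT" "length as = n" "fs = map ea as" "map at fs = as" "xs = map eo (map dm as)" "ys = map eo (map cd as)"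
proof (rule that)
 note f = hom_powD[OF assms]
 show a: "set (map at fs) \<subseteq> AT" "length (map at fs) = n" using f by (auto simp: Wc_simps)
 show e: "fs = map ea (map at fs)" using f by (auto simp: Wc_simps subset_iff image_iff intro!: nth_equalityI) (metis at_ea nth_mem)
 show "xs = map eo (map dm (map at fs))" "ys = map eo (map cd (map at fs))"
  using f by (auto simp: Wc_def)
qed simp

lemma eo_pow: "set ts \<subseteq> OT ==> length ts = n ==> map eo ts \<in> Obj (pow Wc n)"
 by (auto simp: Wc_simps)

lemma ea_pow: "set as \<subseteq> AT ==> length as = n ==> map ea as \<in> hom (pow Wc n) (map eo (map dm as)) (map eo (map cd as))"
 unfolding hom_pow_iff using ea_hom by (auto simp: subset_iff)

lemma map_ot_eo [simp]: "set ts \<subseteq> OT ==> map ot (map eo ts) = ts"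
 by (auto intro!: nth_equalityI simp: subset_iff)

lemma map_at_ea [simp]: "set as \<subseteq> AT ==> map at (map ea as) = as"
 by (auto intro!: nth_equalityI simp: subset_iff)

lemma map_PF [simp]: "set ts \<subseteq> OT ==> map (fo (PF i)) (map eo ts) = map (ev i) ts"
 "set as \<subseteq> AT ==> map (fa (PF i)) (map ea as) = map (\<lambda>a. vl a i) as"
 by (auto simp: subset_iff)

definition PhiW :: "'u => ('u list, 'u list, 'u, 'u) func" where
 "PhiW w = \<lparr>fo = (\<lambda>xs\<in>Obj (pow Wc (arity T w)). eo (Op w (map ot xs))),
   fa = (\<lambda>fs\<in>Arr (pow Wc (arity T w)). ea (opA w (map at fs)))\<rparr>"

lemma fo_PhiW: "set ts \<subseteq> OT ==> length ts = arity T w ==> fo (PhiW w) (map eo ts) = eo (Op w ts)"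
 unfolding PhiW_def using eo_pow[of ts "arity T w"] by (simp del: pow_simps map_map)

lemma fa_PhiW: "set as \<subseteq> AT ==> length as = arity T w ==> fa (PhiW w) (map ea as) = ea (opA w as)"
 unfolding PhiW_def using homD(1)[OF ea_pow[of as "arity T w"]] by (simp del: pow_simps map_map)

lemma opA_AT: "w \<in> words T ==> set as \<subseteq> AT ==> length as = arity T w ==> opA w as \<in> AT"
 by (rule AT.op) auto

lemma PF_PhiW:
 assumes i: "i \<in> Idx" and w: "w \<in> words T"
 shows "xs \<in> Obj (pow Wc (arity T w)) ==> fo (PF i) (fo (PhiW w) xs) = fo (Phi (vertex i) w) (map (fo (PF i)) xs)"
  and "fs \<in> hom (pow Wc (arity T w)) xs ys ==> fa (PF i) (fa (PhiW w) fs) = fa (Phi (vertex i) w) (map (fa (PF i)) fs)"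
proof -
 show "fo (PF i) (fo (PhiW w) xs) = fo (Phi (vertex i) w) (map (fo (PF i)) xs)" if "xs \<in> Obj (pow Wc (arity T w))"
  using that by (rule Wc_pow_Obj) (use OT_Op[OF w] in \<open>simp add: fo_PhiW del: map_map\<close>)
 show "fa (PF i) (fa (PhiW w) fs) = fa (Phi (vertex i) w) (map (fa (PF i)) fs)" if "fs \<in> hom (pow Wc (arity T w)) xs ys"
  using that by (rule Wc_pow_hom) (use opA_AT[OF w] i in \<open>simp add: fa_PhiW del: map_map\<close>)
qed

lemma PhiW_hom:
 assumes w: "w \<in> words T" and fs: "fs \<in> hom (pow Wc (arity T w)) xs ys"
 shows "fa (PhiW w) fs \<in> hom Wc (fo (PhiW w) xs) (fo (PhiW w) ys)"
proof -
 obtain as where a: "set as \<subseteq> AT" "length as = arity T w" "fs = map ea as" "map at fs = as" "xs = map eo (map dm as)" "ys = map eo (map cd as)"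
  using fs by (rule Wc_pow_hom)
 have "set (map dm as) \<subseteq> OT" "set (map cd as) \<subseteq> OT" using a AT_OT by auto
 then show ?thesis using ea_hom[OF opA_AT[OF w a(1,2)]] a by (simp add: fa_PhiW fo_PhiW del: map_map)
qed

text \<open>Functoriality is an equation between arrows of \<open>Wc\<close>; its value in a cocone
  is functoriality of the operation of the vertex.\<close>

lemma PhiW_functors: assumes w: "w \<in> words T" shows "PhiW w \<in> functors (pow Wc (arity T w)) Wc"
proof (rule functorsI)
 interpret P: category "pow Wc n" for n by (rule category_pow[OF category_Wc])
 let ?A = "pow Wc (arity T w)"
 show "fo (PhiW w) xs \<in> Obj Wc" if "xs \<in> Obj ?A" for xs
  using that by (rule Wc_pow_Obj) (use OT_Op[OF w] in \<open>auto simp: fo_PhiW Wc_simps simp del: map_map\<close>)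
 then have ob: "\<And>xs. xs \<in> Obj ?A ==> fo (PhiW w) xs \<in> Obj Wc" .
 show "fa (PhiW w) fs \<in> hom Wc (fo (PhiW w) xs) (fo (PhiW w) ys)" if "fs \<in> hom ?A xs ys" for fs xs ys
  by (rule PhiW_hom[OF w that])
 show "fa (PhiW w) (Ide ?A xs) = Ide Wc (fo (PhiW w) xs)" (is "?l = ?r") if xs: "xs \<in> Obj ?A" for xs
 proof (rule W_eqI[OF PhiW_hom[OF w P.Ide_hom[OF xs]] W.Ide_hom[OF ob[OF xs]]])
  fix i assume i: "i \<in> Idx"
  interpret S: strict_functor Wc "VC i" "PF i" by (rule strict[OF i])
  have "map (fa (PF i)) (Ide ?A xs) = Ide (pow (VC i) (arity T w)) (map (fo (PF i)) xs)"
   using xs fun_Ide[OF PF_functors[OF i]] by auto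
  then show "fa (PF i) ?l = fa (PF i) ?r"
   using fun_Ide[OF Phi_fun[OF algX[OF i] w] S.P_Obj[OF xs]]
   by (simp only: PF_PhiW[OF i w] PF_PhiW(2)[OF i w P.Ide_hom[OF xs]] xs fun_Ide[OF PF_functors[OF i] ob[OF xs]])
 qed
 show "fa (PhiW w) (gs \<cdot>[pow Wc (arity T w)] fs) = fa (PhiW w) gs \<cdot>[Wc] fa (PhiW w) fs" (is "?l = ?r")
  if fs: "fs \<in> hom ?A xs ys" and gs: "gs \<in> hom ?A ys zs" for fs gs xs ys zs
 proof (rule W_eqI[OF PhiW_hom[OF w P.Cmp_hom[OF fs gs]] W.Cmp_hom[OF PhiW_hom[OF w fs] PhiW_hom[OF w gs]]])
  fix i assume i: "i \<in> Idx"
  interpret S: strict_functor Wc "VC i" "PF i" by (rule strict[OF i])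
  have "map (fa (PF i)) (gs \<cdot>[pow Wc (arity T w)] fs) = map (fa (PF i)) gs \<cdot>[pow (VC i) (arity T w)] map (fa (PF i)) fs"
   using fs gs by (auto simp: hom_pow_iff intro!: nth_equalityI fun_Cmp[OF PF_functors[OF i]])
  then show "fa (PF i) ?l = fa (PF i) ?r"
   using fun_Cmp[OF Phi_fun[OF algX[OF i] w] S.P_hom[OF fs] S.P_hom[OF gs]]
   by (simp only: PF_PhiW(2)[OF i w P.Cmp_hom[OF fs gs]] PF_PhiW(2)[OF i w fs] PF_PhiW(2)[OF i w gs]
     fun_Cmp[OF PF_functors[OF i] PhiW_hom[OF w fs] PhiW_hom[OF w gs]])
 qed
qed (simp_all add: PhiW_def del: pow_simps)

sublocale OW: operations Wc "arity T" PhiW "words T"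
 by (rule operations.intro[OF category_Wc PhiW_functors])

abbreviation rF where "rF i == strict_functor.relF Wc (VC i) (PF i)"
abbreviation rH where "rH i == strict_functor.relH Wc (VC i) (PF i)"

lemma rF_PhiW: assumes i: "i \<in> Idx" and w: "w \<in> words T" shows "rF i (arity T w) (PhiW w) (Phi (vertex i) w)"
 unfolding strict_functor.relF_def[OF strict[OF i]]
 using PhiW_functors[OF w] Phi_fun[OF algX[OF i] w] PF_PhiW(1)[OF i w] PF_PhiW(2)[OF i w Arr_hom] by blast

text \<open>Natural isomorphisms on powers of \<open>Wc\<close> come from families of arrows whose
  values are the components of natural isomorphisms \<alpha>' in every cocone. All coherence cells
  of \<open>WA\<close> arise in this way.\<close>

lemma W_ntI:
 assumes F: "M \<in> functors (pow Wc n) Wc" and G: "N \<in> functors (pow Wc n) Wc" and "src \<alpha> = M" "tgt \<alpha> = N" "cmp \<alpha> \<in> extensional (Obj (pow Wc n))"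
  and h: "\<And>xs. xs \<in> Obj (pow Wc n) ==> cmp \<alpha> xs \<in> hom Wc (fo M xs) (fo N xs)"
  and r: "\<And>i. i \<in> Idx ==> rF i n M (M' i)" "\<And>i. i \<in> Idx ==> rF i n N (N' i)"
  and A: "\<And>i. i \<in> Idx ==> \<alpha>' i \<in> isos (opcat (VC i) n) (M' i) (N' i)"
  and e: "\<And>i xs. i \<in> Idx ==> xs \<in> Obj (pow Wc n) ==> fa (PF i) (cmp \<alpha> xs) = cmp (\<alpha>' i) (map (fo (PF i)) xs)"
 shows "\<alpha> \<in> isos (opcat Wc n) M N" "i \<in> Idx ==> rH i n \<alpha> (\<alpha>' i)"
proof -
 interpret P: category "pow Wc n" by (rule category_pow[OF category_Wc])
 have hom: "\<alpha> \<in> hom (opcat Wc n) M N"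
 proof (rule nt_homI[OF F G assms(3-5) h])
  fix fs xs ys assume fs: "fs \<in> hom (pow Wc n) xs ys"
  note o = P.hom_Obj[OF fs]
  \<comment> \<open>Naturality is tested in each cocone, where it is naturality of \<alpha>' at the
    interpreted arguments.\<close>
  show "cmp \<alpha> ys \<cdot>[Wc] fa M fs = fa N fs \<cdot>[Wc] cmp \<alpha> xs" (is "?l = ?r")
  proof (rule W_eqI[OF W.Cmp_hom[OF fun_fa[OF F fs] h[OF o(2)]] W.Cmp_hom[OF h[OF o(1)] fun_fa[OF G fs]]])
   fix i assume i: "i \<in> Idx"
   interpret S: strict_functor Wc "VC i" "PF i" by (rule strict[OF i])
   have a: "fa (PF i) (fa M fs) = fa (M' i) (map (fa (PF i)) fs)" "fa (PF i) (fa N fs) = fa (N' i) (map (fa (PF i)) fs)"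
    using r[OF i] homD(1)[OF fs] by (simp_all add: S.relF_def del: pow_simps)
   show "fa (PF i) ?l = fa (PF i) ?r"
    using nt_homD(7)[OF isos_hom[OF A[OF i]] S.P_hom[OF fs]]
    by (simp only: fun_Cmp[OF S.P fun_fa[OF F fs] h[OF o(2)]] fun_Cmp[OF S.P h[OF o(1)] fun_fa[OF G fs]] a e[OF i o(1)] e[OF i o(2)])
  qed
 qed
 show "\<alpha> \<in> isos (opcat Wc n) M N"
 proof (rule isos_fun_catI[OF P.category_axioms category_Wc hom W_isosI[OF h]])
  fix xs i assume xs: "xs \<in> Obj (pow Wc n)" and i: "i \<in> Idx"
  interpret S: strict_functor Wc "VC i" "PF i" by (rule strict[OF i])
  show "fa (PF i) (cmp \<alpha> xs) \<in> isos (VC i) (fo (PF i) (fo M xs)) (fo (PF i) (fo N xs))"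
   using isos_fun_catD[OF A[OF i] S.P_Obj[OF xs]] r[OF i] xs by (simp add: S.relF_def e[OF i xs] del: pow_simps)
 qed
 show "rH i n \<alpha> (\<alpha>' i)" if i: "i \<in> Idx"
  unfolding strict_functor.relH_def[OF strict[OF i]]
  using hom isos_hom[OF A[OF i]] nt_homD(3,4)[OF isos_hom[OF A[OF i]]] r[OF i] e[OF i] assms(3,4) by simp
qed

definition CcW where
 "CcW w ws = \<lparr>src = PhiW (wgamma T w ws), tgt = gammaF Wc (PhiW w) (ars ws) (map PhiW ws),
   cmp = (\<lambda>xs\<in>Obj (pow Wc (tot ws)). ea (ccA w ws (map ot xs)))\<rparr>"

definition IiW where
 "IiW = \<lparr>src = PhiW (wunit T), tgt = unitF Wc, cmp = (\<lambda>xs\<in>Obj (pow Wc 1). ea (iiA (ot (hd xs))))\<rparr>"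

definition SsW where
 "SsW w l fs = \<lparr>src = PhiW (wsub T l fs w), tgt = subF Wc l fs (PhiW w), cmp = (\<lambda>xs\<in>Obj (pow Wc l). ea (ssA w l fs (map ot xs)))\<rparr>"

definition WA :: "('u, 'u, 'u) alg" where
 "WA = \<lparr>Car = Wc, Phi = PhiW, Cc = CcW, Ii = IiW, Ss = SsW\<rparr>"

lemma WA_simps [simp]: "Car WA = Wc" "Phi WA = PhiW" "Cc WA = CcW" "Ii WA = IiW" "Ss WA = SsW"
 by (auto simp: WA_def)

lemma map2_PhiW_eo:
 assumes "set ws \<subseteq> words T" "set ts \<subseteq> OT" "length ts = tot ws"
 shows "map2 (\<lambda>v. fo (PhiW v)) ws (blocks (ars ws) (map eo ts)) = map eo (map2 Op ws (blocks (ars ws) ts))"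
proof (rule nth_equalityI)
 fix k assume "k < length (map2 (\<lambda>v. fo (PhiW v)) ws (blocks (ars ws) (map eo ts)))"
 then have k: "k < length ws" by simp
 then show "map2 (\<lambda>v. fo (PhiW v)) ws (blocks (ars ws) (map eo ts)) ! k = map eo (map2 Op ws (blocks (ars ws) ts)) ! k"
  using fo_PhiW[of "blocks (ars ws) ts ! k" "ws ! k"] set_blocks_nth[of k "ars ws" ts] assms by (simp add: blocks_map)
qed simp

lemma ccA_AT: "composable T w ws ==> set ts \<subseteq> OT ==> length ts = tot ws ==> ccA w ws ts \<in> AT"
 by (rule AT.basic[OF BA.cc])

lemma iiA_AT: "t \<in> OT ==> iiA t \<in> AT"
 by (rule AT.basic[OF BA.ii])

lemma ssA_AT: "w \<in> words T ==> length fs = arity T w ==> set fs \<subseteq> {..<l} ==> set ts \<subseteq> OT ==> length ts = l ==> ssA w l fs ts \<in> AT"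
 by (rule AT.basic[OF BA.ss])

lemma cmp_CcW: "set ts \<subseteq> OT ==> length ts = tot ws ==> cmp (CcW w ws) (map eo ts) = ea (ccA w ws ts)"
 unfolding CcW_def using eo_pow by (simp del: pow_simps map_map)

lemma cmp_IiW: "t \<in> OT ==> cmp IiW [eo t] = ea (iiA t)"
 unfolding IiW_def by (simp add: Wc_simps)

lemma cmp_SsW: "set ts \<subseteq> OT ==> length ts = l ==> cmp (SsW w l fs) (map eo ts) = ea (ssA w l fs ts)"
 unfolding SsW_def using eo_pow by (simp del: pow_simps map_map)

text \<open>The values of the generators \<open>ccA\<close> are by definition the components of
  \<open>Cc\<close> in the vertices, so \<open>W_ntI\<close> applies.\<close>

lemma CcW:
 assumes c: "composable T w ws"
 shows "CcW w ws \<in> isos (opcat Wc (tot ws)) (PhiW (wgamma T w ws)) (gammaF Wc (PhiW w) (ars ws) (map PhiW ws))"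
  and "i \<in> Idx ==> rH i (tot ws) (CcW w ws) (Cc (vertex i) w ws)"
proof -
 note cd = composableD[OF c] and g = words_wgamma[OF c]
 have wi: "ws ! k \<in> words T" if "k < length ws" for k using cd(4) that by auto
 have F: "PhiW (wgamma T w ws) \<in> functors (pow Wc (tot ws)) Wc" using PhiW_functors[OF g(1)] g(2) by simp
 have G: "gammaF Wc (PhiW w) (ars ws) (map PhiW ws) \<in> functors (pow Wc (tot ws)) Wc"
  by (rule OW.gammaF_ph_functors[OF cd(4)]) (use PhiW_functors[OF cd(3)] cd(5) in simp)
 let ?A = "gammaF Wc (PhiW w) (ars ws) (map PhiW ws)" and ?B = "PhiW (wgamma T w ws)"
 have h: "cmp (CcW w ws) xs \<in> hom Wc (fo ?B xs) (fo ?A xs)"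
  if xs: "xs \<in> Obj (pow Wc (tot ws))" for xs
 proof -
  obtain ts where t: "set ts \<subseteq> OT" "length ts = tot ws" "xs = map eo ts" using xs by (rule Wc_pow_Obj)
  have "fo ?A xs = eo (Op w (map2 Op ws (blocks (ars ws) ts)))"
   unfolding OW.fo_gammaF_ph[OF xs] unfolding t(3) map2_PhiW_eo[OF cd(4) t(1,2)] by (rule fo_PhiW[OF map2_Op_OT[OF cd(4) t(1,2)]]) (simp add: cd(5))
  moreover have "fo ?B xs = eo (Op (wgamma T w ws) ts)" unfolding t(3) by (rule fo_PhiW[OF t(1)]) (simp add: t g)
  ultimately show ?thesis using ea_hom[OF ccA_AT[OF c t(1,2)]] cmp_CcW[OF t(1,2)] t(3) by (simp add: ccA_def)
 qed
 have rF: "rF i (tot ws) ?B (Phi (vertex i) (wgamma T w ws))" if "i \<in> Idx" for i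
  using rF_PhiW[OF that g(1)] g(2) by simp
 have rG: "rF i (tot ws) ?A
   (gammaF (VC i) (Phi (vertex i) w) (ars ws) (map (Phi (vertex i)) ws))" if "i \<in> Idx" for i
  by (rule strict_functor.relF_gammaF[OF strict[OF that]]) (use rF_PhiW[OF that wi] rF_PhiW[OF that cd(3)] cd(5) in auto)
 have e: "fa (PF i) (cmp (CcW w ws) xs) = cmp (Cc (vertex i) w ws) (map (fo (PF i)) xs)"
  if i: "i \<in> Idx" and xs: "xs \<in> Obj (pow Wc (tot ws))" for i xs
  using xs by (rule Wc_pow_Obj) (use ccA_AT[OF c] i in \<open>simp add: cmp_CcW del: map_map\<close>, simp add: ccA_def)
 note nt = W_ntI[OF F G _ _ _ h rF rG pseudo_algebra.Cc_iso[OF algX c] e]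
 show "CcW w ws \<in> isos (opcat Wc (tot ws)) ?B ?A"
  by (rule nt(1)) (auto simp: CcW_def simp del: pow_simps)
 show "rH i (tot ws) (CcW w ws) (Cc (vertex i) w ws)" if "i \<in> Idx"
  by (rule nt(2)) (auto simp: CcW_def that simp del: pow_simps)
qed

lemma IiW: "IiW \<in> isos (opcat Wc 1) (PhiW (wunit T)) (unitF Wc)" "i \<in> Idx ==> rH i 1 IiW (Ii (vertex i))"
proof -
 have F: "PhiW (wunit T) \<in> functors (pow Wc 1) Wc" using PhiW_functors[OF words_wunit(1)] words_wunit(2) by simp
 have h: "cmp IiW xs \<in> hom Wc (fo (PhiW (wunit T)) xs) (fo (unitF Wc) xs)" if xs: "xs \<in> Obj (pow Wc 1)" for xs
 proof -
  obtain t where t: "t \<in> OT" "xs = [eo t]" using xs by (cases xs) (auto simp: Wc_simps)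
  have "fo (PhiW (wunit T)) [eo t] = eo (Op (wunit T) [t])" using fo_PhiW[of "[t]" "wunit T"] t words_wunit by simp
  then show ?thesis using ea_hom[OF iiA_AT[OF t(1)]] t cmp_IiW[OF t(1)] by (simp add: iiA_def Wc_simps)
 qed
 have rF: "rF i 1 (PhiW (wunit T)) (Phi (vertex i) (wunit T))" if "i \<in> Idx" for i
  using rF_PhiW[OF that words_wunit(1)] words_wunit(2) by simp
 have e: "fa (PF i) (cmp IiW xs) = cmp (Ii (vertex i)) (map (fo (PF i)) xs)" if i: "i \<in> Idx" and xs: "xs \<in> Obj (pow Wc 1)" for i xs
 proof -
  obtain t where t: "t \<in> OT" "xs = [eo t]" using xs by (cases xs) (auto simp: Wc_simps)
  then show ?thesis using i iiA_AT[OF t(1)] by (simp add: cmp_IiW) (simp add: iiA_def)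
 qed
 note nt = W_ntI[OF F unitF_functors[OF category_Wc] _ _ _ h rF strict_functor.relF_unitF[OF strict] pseudo_algebra.Ii_iso[OF algX] e]
 show "IiW \<in> isos (opcat Wc 1) (PhiW (wunit T)) (unitF Wc)" by (rule nt(1)) (auto simp: IiW_def simp del: pow_simps)
 show "rH i 1 IiW (Ii (vertex i))" if "i \<in> Idx" by (rule nt(2)) (auto simp: IiW_def that simp del: pow_simps)
qed

lemma SsW:
 assumes w: "w \<in> words T" and fs: "length fs = arity T w" "set fs \<subseteq> {..<l}"
 shows "SsW w l fs \<in> isos (opcat Wc l) (PhiW (wsub T l fs w)) (subF Wc l fs (PhiW w))"
  and "i \<in> Idx ==> rH i l (SsW w l fs) (Ss (vertex i) w l fs)"
proof -
 note s = words_wsub[OF w fs]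
 have F: "PhiW (wsub T l fs w) \<in> functors (pow Wc l) Wc" using PhiW_functors[OF s(1)] s(2) by simp
 have G: "subF Wc l fs (PhiW w) \<in> functors (pow Wc l) Wc" using subF_functors[OF category_Wc _ fs(2)] PhiW_functors[OF w] fs(1) by simp
 let ?A = "subF Wc l fs (PhiW w)" and ?B = "PhiW (wsub T l fs w)"
 have h: "cmp (SsW w l fs) xs \<in> hom Wc (fo ?B xs) (fo ?A xs)" if xs: "xs \<in> Obj (pow Wc l)" for xs
 proof -
  obtain ts where t: "set ts \<subseteq> OT" "length ts = l" "xs = map eo ts" using xs by (rule Wc_pow_Obj)
  have m: "map ((!) (map eo ts)) fs = map eo (map ((!) ts) fs)" using fs t by (auto simp: subset_iff)
  have "set (map ((!) ts) fs) \<subseteq> OT" using map_nth_OT[OF t(1)] fs t by simp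
  from fo_PhiW[OF this, of w] have "fo ?A xs = eo (Op w (map ((!) ts) fs))"
   using xs fs t(3) m by (simp del: pow_simps map_map)
  moreover have "fo ?B xs = eo (Op (wsub T l fs w) ts)" unfolding t(3) by (rule fo_PhiW[OF t(1)]) (simp add: t s)
  ultimately show ?thesis using ea_hom[OF ssA_AT[OF w fs t(1,2)]] cmp_SsW[OF t(1,2)] t(3) by (simp add: ssA_def)
 qed
 have rF: "rF i l ?B (Phi (vertex i) (wsub T l fs w))" if "i \<in> Idx" for i
  using rF_PhiW[OF that s(1)] s(2) by simp
 have rG: "rF i l ?A (subF (VC i) l fs (Phi (vertex i) w))" if "i \<in> Idx" for i
  using strict_functor.relF_subF[OF strict[OF that] fs(2)] rF_PhiW[OF that w] fs(1) by simp
 have e: "fa (PF i) (cmp (SsW w l fs) xs) = cmp (Ss (vertex i) w l fs) (map (fo (PF i)) xs)" if i: "i \<in> Idx" and xs: "xs \<in> Obj (pow Wc l)" for i xs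
  using xs by (rule Wc_pow_Obj) (use ssA_AT[OF w fs] i in \<open>simp add: cmp_SsW del: map_map\<close>, simp add: ssA_def)
 note nt = W_ntI[OF F G _ _ _ h rF rG pseudo_algebra.Ss_iso[OF algX w fs] e]
 show "SsW w l fs \<in> isos (opcat Wc l) ?B ?A"
  by (rule nt(1)) (auto simp: SsW_def simp del: pow_simps)
 show "rH i l (SsW w l fs) (Ss (vertex i) w l fs)" if "i \<in> Idx"
  by (rule nt(2)) (auto simp: SsW_def that simp del: pow_simps)
qed

lemma strict_PF: assumes i: "i \<in> Idx" shows "strict_morphism T WA (vertex i) (PF i)"
proof -
 interpret S: strict_functor Wc "VC i" "PF i" by (rule strict[OF i])
 note a = algX[OF i]
 show ?thesis
  by (intro strict_morphism.intro strict_morphism_axioms.intro lawvere_theory_axioms; (simp only: WA_simps)?)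
   (use S.strict_functor_axioms rF_PhiW[OF i] CcW(2)[OF _ i] IiW(2)[OF i] SsW(2)[OF _ _ _ i] nt_homD(3,4)[OF Cc_hom[OF a]] nt_homD(3)[OF Ii_hom[OF a]] nt_homD(3,4)[OF Ss_hom[OF a]]
    in \<open>auto simp: CcW_def IiW_def SsW_def\<close>)
qed

text \<open>For the identity, the statement that a cell is related to itself still contains that it
  is well typed. So the lemmas about sides of axioms, read along the identity, supply the typing of
  these sides in \<open>WA\<close>.\<close>

lemma strict_id: "strict_morphism T WA WA (id_func Wc)"
proof -
 interpret S: strict_functor Wc Wc "id_func Wc"
  by (simp add: strict_functor_def strict_functor_axioms_def category_Wc id_func_functors)
 have m: "map (fo (id_func Wc)) xs = xs" if "xs \<in> Obj (pow Wc n)" for xs n using that by (auto intro: nth_equalityI simp: subset_iff)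
 have m': "map (fa (id_func Wc)) fs = fs" if "fs \<in> Arr (pow Wc n)" for fs n using that by (auto intro: nth_equalityI simp: subset_iff)
 have F: "S.relF n G G" if "G \<in> functors (pow Wc n) Wc" for n G
  using that fun_fo[OF that] fun_Arr[OF that] by (simp add: S.relF_def m m' del: pow_simps)
 have H: "S.relH n \<alpha> \<alpha>" if "\<alpha> \<in> isos (opcat Wc n) G G'" for n \<alpha> G G'
  using nt_homD[OF isos_hom[OF that]] isos_hom[OF that] homD(1)[OF nt_homD(6)[OF isos_hom[OF that]]]
  by (simp add: S.relH_def F m del: pow_simps)
 show ?thesis
  by (intro strict_morphism.intro strict_morphism_axioms.intro lawvere_theory_axioms; (simp only: WA_simps)?)
   (use S.strict_functor_axioms F[OF PhiW_functors] H[OF CcW(1)] H[OF IiW(1)] H[OF SsW(1)] in \<open>auto simp: CcW_def IiW_def SsW_def\<close>)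
qed

text \<open>Here \<gamma> and \<delta> are the interpretations of two sides of an axiom, equal
  because the vertex is an algebra. The first two hypotheses, along the identity, only express
  typing.\<close>

lemma W_cell_eqI:
 assumes "strict_functor.relH Wc Wc (id_func Wc) n \<alpha> \<alpha>" "strict_functor.relH Wc Wc (id_func Wc) n \<beta> \<beta>"
  and r: "\<And>i. i \<in> Idx ==> rH i n \<alpha> (\<gamma> i)" "\<And>i. i \<in> Idx ==> rH i n \<beta> (\<delta> i)" "\<And>i. i \<in> Idx ==> \<gamma> i = \<delta> i"
  and st: "src \<alpha> = src \<beta>" "tgt \<alpha> = tgt \<beta>"
 shows "\<alpha> = \<beta>"
proof -
 interpret S: strict_functor Wc Wc "id_func Wc"
  by (simp add: strict_functor_def strict_functor_axioms_def category_Wc id_func_functors)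
 have a: "\<alpha> \<in> hom (opcat Wc n) (src \<alpha>) (tgt \<alpha>)" and b: "\<beta> \<in> hom (opcat Wc n) (src \<alpha>) (tgt \<alpha>)"
  using assms(1,2) st by (auto simp: S.relH_def)
 show ?thesis
 proof (rule nt_eqI[OF a b W_eqI[OF nt_homD(6)[OF a] nt_homD(6)[OF b]]])
  fix xs i assume "xs \<in> Obj (pow Wc n)" "i \<in> Idx"
  then show "fa (PF i) (cmp \<alpha> xs) = fa (PF i) (cmp \<beta> xs)"
   using r[of i] by (simp add: strict_functor.relH_def[OF strict] del: pow_simps)
 qed
qed

lemma iPhi_WA: "src (iPhi T WA w) = PhiW w" "tgt (iPhi T WA w) = PhiW w"
 by (auto simp: iPhi_def)

text \<open>An axiom relates two cells of \<open>Wc\<close> whose interpretations are the two sides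
  of the same axiom in a vertex, where it is known to hold.\<close>

lemma WA_alg: "pseudo_algebra T WA"
proof -
 interpret I: strict_morphism T WA WA "id_func (Car WA)" using strict_id by simp
 \<comment> \<open>What remains after each use of \<open>E\<close> is that both sides have the same
   source, by a law of the theory, and the same target, by a law for functors on powers.\<close>
 note E = W_cell_eqI[folded WA_simps(1)]
 note P = strict_PF
 note gs = I.gammaN_simps
 have tC: "src (CcW w ws) = PhiW (wgamma T w ws)" "tgt (CcW w ws) = gammaF Wc (PhiW w) (ars ws) (map PhiW ws)" for w ws by (auto simp: CcW_def)
 have tS: "src (SsW w l fs) = PhiW (wsub T l fs w)" "tgt (SsW w l fs) = subF Wc l fs (PhiW w)" for w l fs by (auto simp: SsW_def)
 have tI: "src IiW = PhiW (wunit T)" "tgt IiW = unitF Wc" by (auto simp: IiW_def)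
 have mi: "map tgt (map (iPhi T WA) ws) = map PhiW ws" for ws by (auto simp: iPhi_WA)
 show ?thesis
 proof (rule pseudo_algebra.intro)
  fix w ws wss assume c: "composable T w ws" and l: "length wss = length ws"
   and "\<And>i. i < length ws ==> composable T (ws ! i) (wss ! i)"
  then have cs: "\<forall>i<length ws. composable T (ws ! i) (wss ! i)" by blast
  note a = composable_assoc[OF c l cs] and cd = composableD[OF c]
  have mC: "map tgt (map2 CcW ws wss) = map2 (\<lambda>v vs. gammaF Wc (PhiW v) (ars vs) (map PhiW vs)) ws wss" by (auto simp: tC)
  have wsp: "PhiW w \<in> functors (pow Wc (length ws)) Wc" using PhiW_functors[OF cd(3)] cd(5) by simp
  show "assoc_l WA w ws wss = assoc_r WA w ws wss"
  proof (rule E[OF I.assoc_rel[OF c l cs]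
   strict_morphism.assoc_rel[OF P c l cs]
   pseudo_algebra.Cc_assoc[OF algX c l cs[rule_format]]])
  qed (use wgamma_assoc[OF c l cs] OW.gammaF_assoc[OF cd(4) composableD(4)[OF a(1)] a(4)[symmetric] wsp]
   in \<open>simp_all only: fun_cat_simps gs tC mC mi iPhi_WA WA_simps\<close>)
 next
  fix w assume w: "w \<in> words T"
  show "unit_r WA w = iPhi T WA w"
  proof (rule E[OF I.unit_right_rel[OF w] I.iPhi_rel[OF w]
   strict_morphism.unit_right_rel[OF P w] strict_morphism.iPhi_rel[OF P w]
   pseudo_algebra.Cc_unit_right[OF algX w]])
  qed (use wgamma_unit_right[OF w] OW.gammaF_unit_right[OF PhiW_functors[OF w]] in \<open>simp_all add: gs tC tI iPhi_WA\<close>)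
  show "unit_l WA w = iPhi T WA w"
  proof (rule E[OF I.unit_left_rel[OF w] I.iPhi_rel[OF w]
   strict_morphism.unit_left_rel[OF P w] strict_morphism.iPhi_rel[OF P w]
   pseudo_algebra.Cc_unit_left[OF algX w]])
  qed (use wgamma_unit_left[OF w] OW.gammaF_unit_left[OF PhiW_functors[OF w]] in \<open>simp_all add: gs tC tI iPhi_WA\<close>)
  have fs: "length [0..<arity T w] = arity T w" "set [0..<arity T w] \<subseteq> {..<arity T w}" by auto
  show "Ss WA w (arity T w) [0..<arity T w] = iPhi T WA w"
  proof (rule E[OF I.Ss_rel[OF w fs] I.iPhi_rel[OF w]
   strict_morphism.Ss_rel[OF P w fs] strict_morphism.iPhi_rel[OF P w]
   pseudo_algebra.Ss_id[OF algX w]])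
  qed (use wsub_id[OF w] OW.subF_id[OF PhiW_functors[OF w]] in \<open>simp_all add: tS iPhi_WA\<close>)
 next
  fix w fs ws ns assume w: "w \<in> words T" and fs: "length fs = arity T w" "set fs \<subseteq> {..<length ws}" and ws: "set ws \<subseteq> words T" and ns: "ns = ars ws"
  note q = wsub_wgamma_left[OF w fs ws ns]
  show "sub_left_l WA w fs ws ns = sub_left_r WA w fs ws ns"
  proof (rule E[OF I.sub_left_rel[OF w fs ws ns]
   strict_morphism.sub_left_rel[OF P w fs ws ns]
   pseudo_algebra.Cc_Ss_left[OF algX w fs ws ns]])
  qed (use q OW.subF_gammaF_left[OF ws fs(2) _ ns, of "PhiW w"] PhiW_functors[OF w] fs(1) in \<open>simp_all add: gs tC tS mi del: map_map\<close>)
 next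
  fix w ws gss and ns :: "nat list" assume c: "composable T w ws" and l: "length gss = length ws" "length ns = length ws"
   and "\<And>i. i < length ws ==> length (gss ! i) = arity T (ws ! i) \<and> set (gss ! i) \<subseteq> {..<ns ! i}"
  then have g: "\<forall>i<length ws. length (gss ! i) = arity T (ws ! i) \<and> set (gss ! i) \<subseteq> {..<ns ! i}" by blast
  note q = wsub_wgamma_right[OF c l g] and cd = composableD[OF c]
  have wsp: "PhiW w \<in> functors (pow Wc (length ws)) Wc" using PhiW_functors[OF cd(3)] cd(5) by simp
  have mS: "map tgt (map (\<lambda>i. SsW (ws ! i) (ns ! i) (gss ! i)) [0..<length ws]) = map (\<lambda>i. subF Wc (ns ! i) (gss ! i) (PhiW (ws ! i))) [0..<length ws]" by (auto simp: tS)
  show "sub_right_l WA w ws gss ns = sub_right_r WA w ws gss ns"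
  proof (rule E[OF I.sub_right_rel[OF c l g]
   strict_morphism.sub_right_rel[OF P c l g]
   pseudo_algebra.Cc_Ss_right[OF algX c l g[rule_format]]])
  qed (use q OW.subF_gammaF_right[OF cd(4) wsp l g] in \<open>simp_all only: fun_cat_simps src_tgt_simps gs tC tS mS iPhi_WA WA_simps\<close>)
 next
  fix w fs gs' and m :: nat assume w: "w \<in> words T" and fs: "length fs = arity T w" "set fs \<subseteq> {..<length gs'}" and g: "set gs' \<subseteq> {..<m}"
  have fg: "length (map ((!) gs') fs) = arity T w" "set (map ((!) gs') fs) \<subseteq> {..<m}" using fs g by (auto simp: subset_iff)
  show "sub_sub WA w fs gs' m = Ss WA w m (map ((!) gs') fs)"
  proof (rule E[OF I.sub_sub_rel[OF w fs g] I.Ss_rel[OF w fg]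
   strict_morphism.sub_sub_rel[OF P w fs g] strict_morphism.Ss_rel[OF P w fg]
   pseudo_algebra.Ss_comp[OF algX w fs g]])
  qed (use wsub_wsub[OF w fs g] OW.subF_subF[OF _ fs(2) g, of "PhiW w"] PhiW_functors[OF w] fs(1) in \<open>simp_all add: tS\<close>)
 qed (use category_Wc PhiW_functors CcW(1) IiW(1) SsW(1) in auto)
qed

lemma WA_Ob: "WA \<in> Ob (Alg U T)"
 using WA_alg eo(2) ea(2) by (simp add: Wc_simps)

end

section \<open>The universal cocone\<close>

context free_bicolimit
begin

text \<open>Operations are interpreted strictly, so identities can be taken as the structure cells
  of the morphism.\<close>

definition Pm :: "'u cocone => ('u, 'u, 'u, 'u, 'u) amor" where
 "Pm i = \<lparr>Mf = PF i, Rho = (\<lambda>w\<in>words T. \<lparr>src = compF (pow Wc (arity T w)) (PF i) (PhiW w),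
   tgt = compF (pow Wc (arity T w)) (Phi (vertex i) w) (powF Wc (arity T w) (PF i)),
   cmp = (\<lambda>xs\<in>Obj (pow Wc (arity T w)). Ide (VC i) (fo (PF i) (fo (PhiW w) xs)))\<rparr>)\<rparr>"

lemma Mf_Pm [simp]: "Mf (Pm i) = PF i"
 and cmp_Rho_Pm: "w \<in> words T ==> xs \<in> Obj (pow Wc (arity T w)) ==>
  cmp (Rho (Pm i) w) xs = Ide (VC i) (fo (PF i) (fo (PhiW w) xs))"
 by (auto simp: Pm_def)

lemma rH_cmp: "i \<in> Idx ==> rH i n \<alpha> \<alpha>' ==> xs \<in> Obj (pow Wc n) ==> fa (PF i) (cmp \<alpha> xs) = cmp \<alpha>' (map (fo (PF i)) xs)"
 by (simp add: strict_functor.relH_def[OF strict] del: pow_simps)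

lemma Pm_data: assumes i: "i \<in> Idx" shows "mor_data WA (vertex i) (Pm i)"
proof -
 interpret X: category "VC i" by (rule catX[OF i])
 note fP = fun_fo[OF PF_functors[OF i]]
 show ?thesis
 proof (rule mor_dataI[OF WA_alg algX[OF i]]; (simp only: WA_simps Mf_Pm)?)
  fix w assume w: "w \<in> words T"
  show "cmp (Rho (Pm i) w) xs \<in> isos (VC i) (fo (PF i) (fo (PhiW w) xs)) (fo (Phi (vertex i) w) (map (fo (PF i)) xs))"
   if xs: "xs \<in> Obj (pow Wc (arity T w))" for xs
   using X.Ide_isos[OF fP[OF fun_fo[OF PhiW_functors[OF w] xs]]] PF_PhiW(1)[OF i w xs] cmp_Rho_Pm[OF w xs] by simp
  fix fs xs ys assume fs: "fs \<in> hom (pow Wc (arity T w)) xs ys"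
  note o = category.hom_Obj[OF category_pow[OF category_Wc] fs]
  note h = fun_fa[OF PF_functors[OF i] PhiW_hom[OF w fs]]
  show "cmp (Rho (Pm i) w) ys \<cdot>[VC i] fa (PF i) (fa (PhiW w) fs)
    = fa (Phi (vertex i) w) (map (fa (PF i)) fs) \<cdot>[VC i] cmp (Rho (Pm i) w) xs"
   unfolding cmp_Rho_Pm[OF w o(1)] cmp_Rho_Pm[OF w o(2)] X.Cmp_Ide_left[OF h] PF_PhiW(2)[OF i w fs, symmetric] X.Cmp_Ide_right[OF h] ..
 qed (auto simp: Pm_def PF_functors[OF i] simp del: pow_simps)
qed

text \<open>As the cells of \<open>Pm i\<close> are identities, each law reduces to the fact that
  \<open>PF i\<close> sends a coherence cell of \<open>WA\<close> to the one of the vertex.\<close>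

lemma Pm_mors: assumes i: "i \<in> Idx" shows "Pm i \<in> alg_mors T WA (vertex i)"
proof (rule alg_morsI[OF WA_alg algX[OF i] Pm_data[OF i]])
 interpret X: category "VC i" by (rule catX[OF i])
 interpret S: strict_functor Wc "VC i" "PF i" by (rule strict[OF i])
 note a = algX[OF i]
 note fP = fun_fo[OF PF_functors[OF i]]
 show "Cc_law WA (vertex i) (Pm i) w ws xs"
  if c: "composable T w ws" and xs': "xs \<in> Obj (pow (Car WA) (tot ws))" for w ws xs
 proof -
  note xs = xs'[unfolded WA_simps]
  note cd = composableD[OF c] and g = words_wgamma[OF c]
  let ?ys = "map2 (\<lambda>v. fo (PhiW v)) ws (blocks (ars ws) xs)"
  have wi: "ws ! k \<in> words T" if "k < length ws" for k using cd(4) that by auto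
  have b: "blocks (ars ws) xs ! k \<in> Obj (pow Wc (arity T (ws ! k)))" if "k < length ws" for k
   using blocks_Obj[OF xs, of k] that by (simp del: pow_simps)
  have "?ys ! k \<in> Obj Wc" if "k < length ws" for k using fun_fo[OF PhiW_functors[OF wi[OF that]] b[OF that]] that by simp
  then have ys: "?ys \<in> Obj (pow Wc (arity T w))" using cd(5) by (auto simp: set_conv_nth)
  note pys = S.P_Obj[OF ys]
  have m: "map (fo (PF i)) ?ys = PhiB (vertex i) ws (map (fo (PF i)) xs)"
   by (rule nth_equalityI) (use PF_PhiW(1)[OF i wi b] in \<open>auto simp: blocks_map\<close>)
  have "RhoB (Pm i) ws xs = map (Ide (VC i)) (map (fo (PF i)) ?ys)"
   by (rule nth_equalityI) (use cmp_Rho_Pm[OF wi b] in auto)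
  then have r: "fa (Phi (vertex i) w) (RhoB (Pm i) ws xs)
    = Ide (VC i) (fo (Phi (vertex i) w) (map (fo (PF i)) ?ys))"
   using fun_Ide[OF Phi_fun[OF a cd(3)] pys] by (simp del: map_map)
  note C = isos_hom[OF cmp_Cc[OF a c S.P_Obj[OF xs]], folded m]
  show ?thesis
   unfolding WA_simps Mf_Pm r cmp_Rho_Pm[OF cd(3) ys] PF_PhiW(1)[OF i cd(3) ys] rH_cmp[OF i CcW(2)[OF c i] xs] X.Cmp_Ide_left[OF C]
   using PF_PhiW(1)[OF i g(1)] cmp_Rho_Pm[OF g(1)] xs X.Cmp_Ide_right[OF C] g(2) by (simp del: pow_simps)
 qed
 show "Ii_law WA (vertex i) (Pm i) x" if x': "x \<in> Obj (Car WA)" for x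
 proof -
  note x = x'[unfolded WA_simps]
  have xs: "[x] \<in> Obj (pow Wc 1)" "[x] \<in> Obj (pow Wc (arity T (wunit T)))" using x words_wunit by auto
  show ?thesis
   using rH_cmp[OF i IiW(2)[OF i] xs(1)] cmp_Rho_Pm[OF words_wunit(1) xs(2)] PF_PhiW(1)[OF i words_wunit(1) xs(2)]
    X.Cmp_Ide_right[OF isos_hom[OF cmp_Ii[OF a fP[OF x]]]] by simp
 qed
 show "Ss_law WA (vertex i) (Pm i) w l fs xs"
  if w: "w \<in> words T" and fs: "length fs = arity T w" "set fs \<subseteq> {..<l}" and xs': "xs \<in> Obj (pow (Car WA) l)" for w l fs xs
 proof -
  note xs = xs'[unfolded WA_simps]
  note s = words_wsub[OF w fs]
  have m: "map ((!) (map (fo (PF i)) xs)) fs = map (fo (PF i)) (map ((!) xs) fs)" using fs xs by (auto simp: subset_iff)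
  have ys: "map ((!) xs) fs \<in> Obj (pow Wc (arity T w))" using map_nth_Obj[OF xs fs(2)] fs(1) by simp
  note C = isos_hom[OF cmp_Ss[OF a w fs S.P_Obj[OF xs]], unfolded m]
  show ?thesis
   unfolding WA_simps Mf_Pm cmp_Rho_Pm[OF w ys] PF_PhiW(1)[OF i w ys] rH_cmp[OF i SsW(2)[OF w fs i] xs] X.Cmp_Ide_left[OF C]
   using PF_PhiW(1)[OF i s(1)] cmp_Rho_Pm[OF s(1)] xs X.Cmp_Ide_right[OF C] s(2) by (simp del: pow_simps)
 qed
qed

text \<open>Only a pseudo morphism, although the operations of \<open>WA\<close> are formal: an
  operation of \<open>F d\<close> applied to elements gives a generator, whereas \<open>Op\<close>
  applied to generators is a compound term. The arrows \<open>rhoA\<close> connect the two.\<close>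

definition k0 :: "'u => 'u => ('u, 'u, 'u, 'u, 'u) amor" where
 "k0 d j = \<lparr>Mf = \<lparr>fo = (\<lambda>x\<in>Obj (FC d). eo (Gen d j x)), fa = (\<lambda>f\<in>Arr (FC d). ea (arrA d j f))\<rparr>,
   Rho = (\<lambda>w\<in>words T. \<lparr>src = compF (pw (P0 F d) w) \<lparr>fo = (\<lambda>x\<in>Obj (FC d). eo (Gen d j x)), fa = (\<lambda>f\<in>Arr (FC d). ea (arrA d j f))\<rparr> (Phi (P0 F d) w),
    tgt = compF (pw (P0 F d) w) (PhiW w) (powF (FC d) (arity T w) \<lparr>fo = (\<lambda>x\<in>Obj (FC d). eo (Gen d j x)), fa = (\<lambda>f\<in>Arr (FC d). ea (arrA d j f))\<rparr>),
    cmp = (\<lambda>xs\<in>Obj (pw (P0 F d) w). ea (rhoA d j w xs))\<rparr>)\<rparr>"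

definition "k1 d u = \<lparr>src = k0 d (Dom (P0 J d) u), tgt = k0 d (Cod (P0 J d) u), cmp = (\<lambda>x\<in>Obj (FC d). ea (wtA d u x))\<rparr>"

definition "k2 d e f j = \<lparr>src = acomp (P0 F e) (P0 F d) WA (k0 d j) (P1 F e d f), tgt = k0 e (fo (P1 J d e f) j),
  cmp = (\<lambda>x\<in>Obj (FC e). ea (sigA d e f j x))\<rparr>"

lemma k0_simps:
 "x \<in> Obj (FC d) ==> fo (Mf (k0 d j)) x = eo (Gen d j x)" "f \<in> Arr (FC d) ==> fa (Mf (k0 d j)) f = ea (arrA d j f)"
 "w \<in> words T ==> xs \<in> Obj (pw (P0 F d) w) ==> cmp (Rho (k0 d j) w) xs = ea (rhoA d j w xs)"
 by (auto simp: k0_def)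

context
 fixes d j assumes d: "d \<in> Ob D" and j: "j \<in> Obj (P0 J d)"
begin

abbreviation "ko == fo (Mf (k0 d j))"
abbreviation "ka == fa (Mf (k0 d j))"
abbreviation "kr w == cmp (Rho (k0 d j) w)"

lemma map_k0: "set xs \<subseteq> Obj (FC d) ==> map ko xs = map eo (map (Gen d j) xs)"
 by (auto simp: k0_simps subset_iff)

lemma Gen_OT: "set xs \<subseteq> Obj (FC d) ==> set (map (Gen d j) xs) \<subseteq> OT"
 using OT.Gen[OF d j] by auto

lemma k0_Obj: "x \<in> Obj (FC d) ==> ko x \<in> Obj Wc"
 using OT.Gen[OF d j] by (auto simp: k0_simps Wc_simps)

lemma k0_hom: "f \<in> hom (FC d) x y ==> ka f \<in> hom Wc (ko x) (ko y)"
 using ea_hom[OF AT.basic[OF BA.arr[OF d j]], of f] category.hom_Obj[OF catF[OF d], of f x y] by (auto simp: k0_simps hom_def arrA_def)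

lemma k0_rho:
 assumes w: "w \<in> words T" and xs: "xs \<in> Obj (pw (P0 F d) w)"
 shows "kr w xs \<in> hom Wc (ko (fo (Phi (P0 F d) w) xs)) (fo (PhiW w) (map ko xs))"
proof -
 have "set xs \<subseteq> Obj (FC d)" "length xs = arity T w" using xs by auto
 then show ?thesis
  using ea_hom[OF AT.basic[OF BA.rho[OF d j w xs]]] k0_simps(3)[OF w xs] fo_PhiW[OF Gen_OT, of xs w]
   fun_fo[OF Phi_fun[OF algF[OF d] w] xs]
  by (simp add: map_k0 del: map_map) (simp add: k0_simps rhoA_def)
qed

text \<open>Interpretation turns the universal leg into the leg of the given cocone, on objects,
  arrows and structure cells. Every law for \<open>k0\<close> is reflected along these
  equations.\<close>

lemma PF_k0: assumes i: "i \<in> Idx"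
 shows "x \<in> Obj (FC d) ==> fo (PF i) (ko x) = fo (Mf (fo (t1 (legs i) d) j)) x"
  and "f \<in> Arr (FC d) ==> fa (PF i) (ka f) = fa (Mf (fo (t1 (legs i) d) j)) f"
  and "w \<in> words T ==> xs \<in> Obj (pw (P0 F d) w) ==> fa (PF i) (kr w xs) = cmp (Rho (fo (t1 (legs i) d) j) w) xs"
 using OT.Gen[OF d j] AT.basic[OF BA.arr[OF d j]] AT.basic[OF BA.rho[OF d j]] i
 by (auto simp: k0_simps arrA_def rhoA_def simp del: pow_simps)

lemma map_PF_k0:
 assumes i: "i \<in> Idx"
 shows "set xs \<subseteq> Obj (FC d) ==> map (fo (PF i)) (map ko xs) = map (fo (Mf (fo (t1 (legs i) d) j))) xs"
  and "set fs \<subseteq> Arr (FC d) ==> map (fa (PF i)) (map ka fs) = map (fa (Mf (fo (t1 (legs i) d) j))) fs"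
 using PF_k0(1,2)[OF i] by (auto simp: subset_iff)

lemma k0_Mf: "Mf (k0 d j) \<in> functors (FC d) Wc"
proof (rule functorsI[OF _ _ k0_Obj k0_hom])
 interpret A: category "FC d" by (rule catF[OF d])
 show "ka (Ide (FC d) x) = Ide Wc (ko x)" if x: "x \<in> Obj (FC d)" for x
  by (rule W_eqI[OF k0_hom[OF A.Ide_hom[OF x]] W.Ide_hom[OF k0_Obj[OF x]]])
   (simp add: PF_k0(2)[OF _ homD(1)[OF A.Ide_hom[OF x]]] PF_k0(1) x fun_Ide[OF PF_functors k0_Obj[OF x]] fun_Ide[OF p_Mf[OF _ d j] x])
 show "ka (g \<cdot>[FC d] f) = ka g \<cdot>[Wc] ka f"
  if f: "f \<in> hom (FC d) x y" and g: "g \<in> hom (FC d) y z" for f g x y z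
  by (rule W_eqI[OF k0_hom[OF A.Cmp_hom[OF f g]] W.Cmp_hom[OF k0_hom[OF f] k0_hom[OF g]]])
   (simp add: PF_k0(2) homD(1)[OF f] homD(1)[OF g] homD(1)[OF A.Cmp_hom[OF f g]] fun_Cmp[OF PF_functors k0_hom[OF f] k0_hom[OF g]] fun_Cmp[OF p_Mf[OF _ d j] f g])
qed (auto simp: k0_def)

lemma k0_pow: "xs \<in> Obj (pow (FC d) n) ==> map ko xs \<in> Obj (pow Wc n)"
 using k0_Obj by auto

lemma k0_pow_hom: "fs \<in> hom (pow (FC d) n) xs ys ==> map ka fs \<in> hom (pow Wc n) (map ko xs) (map ko ys)"
 unfolding hom_pow_iff using k0_hom by auto

lemma k0_rho_isos:
 assumes w: "w \<in> words T" and xs: "xs \<in> Obj (pw (P0 F d) w)"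
 shows "kr w xs \<in> isos Wc (ko (fo (Phi (P0 F d) w) xs)) (fo (PhiW w) (map ko xs))"
proof (rule W_isosI[OF k0_rho[OF w xs]])
 fix i assume i: "i \<in> Idx"
 have "set xs \<subseteq> Obj (FC d)" using xs by simp
 then show "fa (PF i) (kr w xs) \<in> isos (VC i) (fo (PF i) (ko (fo (Phi (P0 F d) w) xs)))
   (fo (PF i) (fo (PhiW w) (map ko xs)))"
  using Rho_isos[OF algF[OF d] algX[OF i] p_data[OF i d j] w xs] PF_k0(3)[OF i w xs]
   PF_k0(1)[OF i fun_fo[OF Phi_fun[OF algF[OF d] w] xs]] PF_PhiW(1)[OF i w k0_pow[OF xs]] map_PF_k0(1)[OF i]
  by (simp del: map_map)
qed

lemma k0_data: "mor_data (P0 F d) WA (k0 d j)"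
proof (rule mor_dataI[OF algF[OF d] WA_alg k0_Mf[folded WA_simps(1)]]; (simp only: WA_simps)?)
 show "kr w xs \<in> isos Wc (ko (fo (Phi (P0 F d) w) xs)) (fo (PhiW w) (map ko xs))"
  if "w \<in> words T" "xs \<in> Obj (pw (P0 F d) w)" for w xs by (rule k0_rho_isos[OF that])
 fix w fs xs ys assume w: "w \<in> words T" and fs: "fs \<in> hom (pw (P0 F d) w) xs ys"
 note o = category.hom_Obj[OF category_pow[OF catF[OF d]] fs] and P = Phi_fun[OF algF[OF d] w]
 note a = k0_hom[OF fun_fa[OF P fs]] and b = PhiW_hom[OF w k0_pow_hom[OF fs]]
 note r = k0_rho[OF w o(1)] k0_rho[OF w o(2)]
 show "kr w ys \<cdot>[Wc] ka (fa (Phi (P0 F d) w) fs) = fa (PhiW w) (map ka fs) \<cdot>[Wc] kr w xs" (is "?l = ?r")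
 proof (rule W_eqI[OF W.Cmp_hom[OF a r(2)] W.Cmp_hom[OF r(1) b]])
  fix i assume i: "i \<in> Idx"
  have s: "set fs \<subseteq> Arr (FC d)" using homD(1)[OF fs] by simp
  show "fa (PF i) ?l = fa (PF i) ?r"
   unfolding fun_Cmp[OF PF_functors[OF i] a r(2)] fun_Cmp[OF PF_functors[OF i] r(1) b] PF_k0(3)[OF i w o(1)] PF_k0(3)[OF i w o(2)]
    PF_k0(2)[OF i homD(1)[OF fun_fa[OF P fs]]] PF_PhiW(2)[OF i w k0_pow_hom[OF fs]] map_PF_k0(2)[OF i s]
   by (rule Rho_nat[OF algF[OF d] algX[OF i] p_data[OF i d j] w fs])
 qed
qed (simp_all add: k0_def del: pow_simps)

text \<open>Both sides of each law are arrows of \<open>Wc\<close>. Their values in a cocone are the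
  two sides of the law for its leg, which is a morphism by hypothesis.\<close>

lemma k0_mors: "k0 d j \<in> alg_mors T (P0 F d) WA"
proof (rule alg_morsI[OF algF[OF d] WA_alg k0_data])
 interpret A: pseudo_algebra T "P0 F d" by (rule algF[OF d])
 interpret OA: operations "FC d" "arity T" "Phi (P0 F d)" "words T" by (rule alg_operations[OF algF[OF d]])
 note M = map_PF_k0
 show "Cc_law (P0 F d) WA (k0 d j) w ws xs"
  if c: "composable T w ws" and xs: "xs \<in> Obj (pow (FC d) (tot ws))" for w ws xs
 proof -
  note cd = composableD[OF c] and g = words_wgamma[OF c]
  let ?ys = "PhiB (P0 F d) ws xs" and ?rs = "RhoB (k0 d j) ws xs"
  have wi: "ws ! k \<in> words T" if "k < length ws" for k using cd(4) that by auto
  have b: "blocks (ars ws) xs ! k \<in> Obj (pow (FC d) (arity T (ws ! k)))" if "k < length ws" for k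
   using blocks_Obj[OF xs, of k] that by (simp del: pow_simps)
  have xg: "xs \<in> Obj (pow (FC d) (arity T (wgamma T w ws)))" using xs g(2) by simp
  note C = isos_hom[OF cmp_Cc[OF algF[OF d] c xs]]
  have ys: "?ys \<in> Obj (pw (P0 F d) w)"
   using fun_fo[OF A.Phi_functor[OF wi] b] cd(5) by (auto simp: set_conv_nth)
  have rs: "?rs \<in> hom (pow Wc (arity T w)) (map ko ?ys) (map2 (\<lambda>v. fo (PhiW v)) ws (blocks (ars ws) (map ko xs)))"
   using k0_rho[OF wi b] cd(5) by (auto simp: hom_pow_iff blocks_map)
  note h1 = k0_rho[OF cd(3) ys] and h2 = k0_hom[OF C] and h3 = PhiW_hom[OF cd(3) rs] and h4 = k0_rho[OF g(1) xg]
  have h5: "cmp (CcW w ws) (map ko xs) \<in> hom Wc (fo (PhiW (wgamma T w ws)) (map ko xs))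
    (fo (PhiW w) (map2 (\<lambda>v. fo (PhiW v)) ws (blocks (ars ws) (map ko xs))))"
   using isos_hom[OF cmp_Cc[OF WA_alg c, unfolded WA_simps, OF k0_pow[OF xs]]] .
  show ?thesis unfolding WA_simps
  proof (rule W_eqI[OF W.Cmp_hom[OF h4 h5] W.Cmp_hom[OF W.Cmp_hom[OF h2 h1] h3]], goal_cases)
   case i: (1 i)
   note E = fun_Cmp[OF PF_functors[OF i]]
   have s: "set xs \<subseteq> Obj (FC d)" using xs by simp
   have m: "map (fa (PF i)) ?rs = map2 (\<lambda>v. cmp (Rho (fo (t1 (legs i) d) j) v)) ws (blocks (ars ws) xs)"
    by (rule nth_equalityI) (use PF_k0(3)[OF i wi b] in auto)
   show ?case
    unfolding E[OF h4 h5] E[OF W.Cmp_hom[OF h2 h1] h3] E[OF h2 h1] PF_k0(3)[OF i cd(3) ys] PF_k0(3)[OF i g(1) xg] PF_k0(2)[OF i homD(1)[OF C]]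
     PF_PhiW(2)[OF i cd(3) rs] m rH_cmp[OF i CcW(2)[OF c i] k0_pow[OF xs]] M(1)[OF i s]
    by (rule alg_mors_Cc[OF algF[OF d] algX[OF i] p_mor[OF i d j] c xs])
  qed
 qed
 show "Ii_law (P0 F d) WA (k0 d j) x" if x: "x \<in> Obj (FC d)" for x
 proof -
  have xs: "[x] \<in> Obj (pow (FC d) 1)" "[x] \<in> Obj (pow (FC d) (arity T (wunit T)))" using x words_wunit by auto
  note C = isos_hom[OF cmp_Ii[OF algF[OF d] x]]
  note h1 = k0_rho[OF words_wunit(1) xs(2), unfolded list.map] and h2 = isos_hom[OF cmp_Ii[OF WA_alg, unfolded WA_simps, OF k0_Obj[OF x]]]
  show ?thesis unfolding WA_simps
   by (rule W_eqI[OF W.Cmp_hom[OF h1 h2] k0_hom[OF C]])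
    (use rH_cmp[OF _ IiW(2) k0_pow[OF xs(1)]] alg_mors_Ii[OF algF[OF d] algX p_mor[OF _ d j] x] in
     \<open>simp add: fun_Cmp[OF PF_functors h1 h2] PF_k0(1)[OF _ x] PF_k0(2)[OF _ homD(1)[OF C]] PF_k0(3)[OF _ words_wunit(1) xs(2)]\<close>)
 qed
 show "Ss_law (P0 F d) WA (k0 d j) w l fs xs"
  if w: "w \<in> words T" and fs: "length fs = arity T w" "set fs \<subseteq> {..<l}" and xs: "xs \<in> Obj (pow (FC d) l)" for w l fs xs
 proof -
  note s = words_wsub[OF w fs]
  have m: "map ((!) (map ko xs)) fs = map ko (map ((!) xs) fs)" using fs xs by (auto simp: subset_iff)
  have ys: "map ((!) xs) fs \<in> Obj (pw (P0 F d) w)" using map_nth_Obj[OF xs fs(2)] fs(1) by simp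
  have xg: "xs \<in> Obj (pow (FC d) (arity T (wsub T l fs w)))" using xs s(2) by simp
  note C = isos_hom[OF cmp_Ss[OF algF[OF d] w fs xs]]
  note h1 = k0_rho[OF w ys] and h2 = k0_hom[OF C] and h4 = k0_rho[OF s(1) xg]
  note h5 = isos_hom[OF cmp_Ss[OF WA_alg w fs, unfolded WA_simps, OF k0_pow[OF xs]], unfolded m]
  show ?thesis unfolding WA_simps
  proof (rule W_eqI[OF W.Cmp_hom[OF h4 h5] W.Cmp_hom[OF h2 h1]], goal_cases)
   case i: (1 i)
   note E = fun_Cmp[OF PF_functors[OF i]]
   have s': "set xs \<subseteq> Obj (FC d)" using xs by simp
   show ?case
    unfolding E[OF h4 h5] E[OF h2 h1] PF_k0(3)[OF i w ys] PF_k0(3)[OF i s(1) xg] PF_k0(2)[OF i homD(1)[OF C]]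
     rH_cmp[OF i SsW(2)[OF w fs i] k0_pow[OF xs]] M(1)[OF i s']
    by (rule alg_mors_Ss[OF algF[OF d] algX[OF i] p_mor[OF i d j] w fs xs])
  qed
 qed
qed

text \<open>The identity cells of \<open>Pm i\<close> drop out of the composite, so this is
  \<open>PF_k0\<close> restated for morphisms.\<close>

lemma Pm_k0: assumes i: "i \<in> Idx" shows "acomp (P0 F d) WA (vertex i) (Pm i) (k0 d j) = fo (t1 (legs i) d) j"
proof (rule amor_eqI[OF algF[OF d] algX[OF i] alg_comp_data[OF algF[OF d] WA_alg algX[OF i] k0_data Pm_data[OF i]] p_data[OF i d j]])
 interpret X: category "VC i" by (rule catX[OF i])
 let ?A = "acomp (P0 F d) WA (vertex i) (Pm i) (k0 d j)"
 show "Mf ?A = Mf (fo (t1 (legs i) d) j)"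
  unfolding Mf_alg_comp Mf_Pm
  by (rule func_eqI[OF compF_functors[OF catF[OF d] k0_Mf PF_functors[OF i]] p_Mf[OF i d j]]) (simp_all add: PF_k0[OF i])
 fix w xs assume w: "w \<in> words T" and xs: "xs \<in> Obj (pw (P0 F d) w)"
 note R = fun_fa[OF PF_functors[OF i] k0_rho[OF w xs]]
 show "cmp (Rho ?A w) xs = cmp (Rho (fo (t1 (legs i) d) j) w) xs"
  unfolding Rho_comp[OF algF[OF d] WA_alg algX[OF i] k0_data Pm_data[OF i] w xs] Mf_Pm cmp_Rho_Pm[OF w k0_pow[OF xs]]
   X.Cmp_Ide_left[OF R] by (rule PF_k0(3)[OF i w xs])
qed

end

lemma PF_cmp_wt: "i \<in> Idx ==> d \<in> Ob D ==> u \<in> Arr (P0 J d) ==> x \<in> Obj (FC d) ==> fa (PF i) (cmp (k1 d u) x) = cmp (fa (t1 (legs i) d) u) x"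
 using AT.basic[OF BA.wt[of d u x]] by (simp add: k1_def wtA_def)

lemma cmp_Pm_cell: "[|i \<in> Idx; d \<in> Ob D; \<alpha> \<in> hom (acat (P0 F d) WA) h k; x \<in> Obj (FC d)|] ==>
  cmp (acell_comp (P0 F d) WA (vertex i) (Ide (acat WA (vertex i)) (Pm i)) \<alpha>) x = fa (PF i) (cmp \<alpha> x)"
 using cmp_post_cell[OF algF WA_alg algX Pm_mors] by simp

text \<open>A family of arrows of \<open>Wc\<close> is a 2-cell of algebras as soon as its
  interpretations are. For the law with \<open>Rho\<close> one uses that composition with the strict
  \<open>Pm i\<close> just applies \<open>PF i\<close> to the cells of \<open>h\<close> and
  \<open>k\<close>.\<close>

lemma reflect_cell:
 assumes d: "d \<in> Ob D" and hk: "h \<in> alg_mors T (P0 F d) WA" "k \<in> alg_mors T (P0 F d) WA" "src \<alpha> = h" "tgt \<alpha> = k" "cmp \<alpha> \<in> extensional (Obj (FC d))"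
  and hom: "\<And>x. x \<in> Obj (FC d) ==> cmp \<alpha> x \<in> hom Wc (fo (Mf h) x) (fo (Mf k) x)"
  and \<beta>: "\<And>i. i \<in> Idx ==> \<beta> i \<in> hom (acat (P0 F d) (vertex i)) (acomp (P0 F d) WA (vertex i) (Pm i) h) (acomp (P0 F d) WA (vertex i) (Pm i) k)"
  and e: "\<And>i x. i \<in> Idx ==> x \<in> Obj (FC d) ==> fa (PF i) (cmp \<alpha> x) = cmp (\<beta> i) x"
 shows "\<alpha> \<in> hom (acat (P0 F d) WA) h k"
proof (rule acell_homI[OF algF[OF d] WA_alg hk]; (simp only: WA_simps)?)
 interpret A: pseudo_algebra T "P0 F d" by (rule algF[OF d])
 interpret cA: category "FC d" by (rule catF[OF d])
 note hd = mors_data[OF algF[OF d] WA_alg hk(1)] and kd = mors_data[OF algF[OF d] WA_alg hk(2)]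
 note H = mor_data_Mf[OF algF[OF d] WA_alg hd, unfolded WA_simps] and K = mor_data_Mf[OF algF[OF d] WA_alg kd, unfolded WA_simps]
 show "cmp \<alpha> x \<in> hom Wc (fo (Mf h) x) (fo (Mf k) x)" if "x \<in> Obj (FC d)" for x by (rule hom[OF that])
 show "cmp \<alpha> y \<cdot>[Wc] fa (Mf h) f = fa (Mf k) f \<cdot>[Wc] cmp \<alpha> x" if f: "f \<in> hom (FC d) x y" for f x y
 proof -
  note o = cA.hom_Obj[OF f] and hf = fun_fa[OF H f] and kf = fun_fa[OF K f]
  show ?thesis
  proof (rule W_eqI[OF W.Cmp_hom[OF hf hom[OF o(2)]] W.Cmp_hom[OF hom[OF o(1)] kf]])
   fix i assume i: "i \<in> Idx"
   show "fa (PF i) (cmp \<alpha> y \<cdot>[Wc] fa (Mf h) f) = fa (PF i) (fa (Mf k) f \<cdot>[Wc] cmp \<alpha> x)"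
    using acell_homD(7)[OF algF[OF d] algX[OF i] \<beta>[OF i] f] homD(1)[OF f]
    by (simp add: fun_Cmp[OF PF_functors[OF i] hf hom[OF o(2)]] fun_Cmp[OF PF_functors[OF i] hom[OF o(1)] kf] e[OF i] o)
  qed
 qed
 fix w xs assume w: "w \<in> words T" and xs: "xs \<in> Obj (pw (P0 F d) w)"
 note px = fun_fo[OF A.Phi_functor[OF w] xs]
 note rh = isos_hom[OF Rho_isos[OF algF[OF d] WA_alg hd w xs], unfolded WA_simps] and rk = isos_hom[OF Rho_isos[OF algF[OF d] WA_alg kd w xs], unfolded WA_simps]
 let ?A = "pow Wc (arity T w)"
 have m: "map (cmp \<alpha>) xs \<in> hom ?A (map (fo (Mf h)) xs) (map (fo (Mf k)) xs)"
  using xs hom by (auto simp: hom_pow_iff subset_iff)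
 have hx: "map (fo (Mf h)) xs \<in> Obj ?A" "map (fo (Mf k)) xs \<in> Obj ?A"
  using xs fun_fo[OF H] fun_fo[OF K] by auto
 note p = PhiW_hom[OF w m]
 show "cmp (Rho k w) xs \<cdot>[Wc] cmp \<alpha> (fo (Phi (P0 F d) w) xs) = fa (PhiW w) (map (cmp \<alpha>) xs) \<cdot>[Wc] cmp (Rho h w) xs" (is "?l = ?r")
 proof (rule W_eqI[OF W.Cmp_hom[OF hom[OF px] rk] W.Cmp_hom[OF rh p]])
  fix i assume i: "i \<in> Idx"
  interpret X: category "VC i" by (rule catX[OF i])
  have me: "map (fa (PF i)) (map (cmp \<alpha>) xs) = map (cmp (\<beta> i)) xs" using e[OF i] xs by (auto simp: subset_iff)
  have r: "cmp (Rho (acomp (P0 F d) WA (vertex i) (Pm i) g) w) xs = fa (PF i) (cmp (Rho g w) xs)"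
   if gd: "mor_data (P0 F d) WA g" and gh: "cmp (Rho g w) xs \<in> hom Wc (fo (Mf g) (fo (Phi (P0 F d) w) xs)) (fo (PhiW w) (map (fo (Mf g)) xs))"
    and gx: "map (fo (Mf g)) xs \<in> Obj ?A" for g
   using Rho_comp[OF algF[OF d] WA_alg algX[OF i] gd Pm_data[OF i] w xs] cmp_Rho_Pm[OF w gx]
    X.Cmp_Ide_left[OF fun_fa[OF PF_functors[OF i] gh]] by simp
  show "fa (PF i) ?l = fa (PF i) ?r"
   unfolding fun_Cmp[OF PF_functors[OF i] hom[OF px] rk] fun_Cmp[OF PF_functors[OF i] rh p] e[OF i px] PF_PhiW(2)[OF i w m] me
   using acell_homD(8)[OF algF[OF d] algX[OF i] \<beta>[OF i] w xs] unfolding r[OF hd rh hx(1)] r[OF kd rk hx(2)] .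
 qed
qed

lemma k1_hom:
 assumes d: "d \<in> Ob D" and u: "u \<in> hom (P0 J d) j j'"
 shows "k1 d u \<in> hom (acat (P0 F d) WA) (k0 d j) (k0 d j')"
proof -
 note o = category.hom_Obj[OF catJ[OF d] u]
 show ?thesis
 proof (rule reflect_cell[OF d k0_mors[OF d o(1)] k0_mors[OF d o(2)]])
  show "cmp (k1 d u) x \<in> hom Wc (fo (Mf (k0 d j)) x) (fo (Mf (k0 d j')) x)" if x: "x \<in> Obj (FC d)" for x
   using ea_hom[OF AT.basic[OF BA.wt[OF d homD(1)[OF u] x]]] x homD(2,3)[OF u] by (simp add: k1_def k0_simps wtA_def)
  show "fa (t1 (legs i) d) u \<in> hom (acat (P0 F d) (vertex i)) (acomp (P0 F d) WA (vertex i) (Pm i) (k0 d j)) (acomp (P0 F d) WA (vertex i) (Pm i) (k0 d j'))"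
   if "i \<in> Idx" for i using p_wt[OF that d u] Pm_k0[OF d o(1) that] Pm_k0[OF d o(2) that] by simp
  show "fa (PF i) (cmp (k1 d u) x) = cmp (fa (t1 (legs i) d) u) x" if "i \<in> Idx" "x \<in> Obj (FC d)" for i x
   by (rule PF_cmp_wt[OF that(1) d homD(1)[OF u] that(2)])
 qed (use homD(2,3)[OF u] in \<open>auto simp: k1_def\<close>)
qed

lemma PF_cmp_sig: "i \<in> Idx ==> one_cell D e d f ==> j \<in> Obj (P0 J d) ==> x \<in> Obj (FC e) ==>
  fa (PF i) (cmp (k2 d e f j) x) = cmp (cmp (t2 (legs i) d e f) j) x"
 using AT.basic[OF BA.sig[of e d f j x]] by (simp add: k2_def sigA_def)

text \<open>The 2-cell is reflected from the coherence cells of all cocones; these are invertible,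
  so its components are invertible by \<open>W_isosI\<close>.\<close>

lemma k2_isos:
 assumes f: "one_cell D e d f" and j: "j \<in> Obj (P0 J d)"
 shows "k2 d e f j \<in> isos (acat (P0 F e) WA) (acomp (P0 F e) (P0 F d) WA (k0 d j) (P1 F e d f)) (k0 e (fo (P1 J d e f) j))"
proof -
 note ob = one_cellD[OF f] and Fm = morF[OF f] and Jj = J1[OF f j] and MF = MfF[OF f]
 note A = algF[OF ob(1)] and B = algF[OF ob(2)] and Wp = WA_alg
 note cm = alg_comp_mors[OF A B Wp Fm k0_mors[OF ob(2) j]]
 have xe: "fo (Mf (P1 F e d f)) x \<in> Obj (FC d)" if "x \<in> Obj (FC e)" for x by (rule fun_fo[OF MF that])
 let ?A = "acomp (P0 F e) (P0 F d) WA (k0 d j) (P1 F e d f)" and ?B = "k0 e (fo (P1 J d e f) j)"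
 have h: "cmp (k2 d e f j) x \<in> hom Wc (fo (Mf ?A) x) (fo (Mf ?B) x)"
  if x: "x \<in> Obj (FC e)" for x
  using ea_hom[OF AT.basic[OF BA.sig[OF f j x]]] x xe[OF x] by (simp add: k2_def k0_simps sigA_def)
 have s: "acomp (P0 F e) WA (vertex i) (Pm i) ?A
   = acomp (P0 F e) (P0 F d) (vertex i) (fo (t1 (legs i) d) j) (P1 F e d f)" if i: "i \<in> Idx" for i
  using C.Hc1_assoc[OF F.P0_Ob[OF ob(1)] F.P0_Ob[OF ob(2)] WA_Ob Idx_Ob[OF i], of "P1 F e d f" "k0 d j" "Pm i"] Fm k0_mors[OF ob(2) j] Pm_mors[OF i]
   Pm_k0[OF ob(2) j i] by simp
 have hom: "k2 d e f j \<in> hom (acat (P0 F e) WA) ?A ?B"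
  by (rule reflect_cell[OF ob(1) cm k0_mors[OF ob(1) Jj] _ _ _ h _ PF_cmp_sig[OF _ f j]])
   (use isos_hom[OF p_sig[OF _ f j]] s Pm_k0[OF ob(1) Jj] in \<open>auto simp: k2_def\<close>)
 show ?thesis
 proof (rule isos_alg_hom_catI[OF A Wp hom]; (simp only: WA_simps)?)
  fix x assume x: "x \<in> Obj (FC e)"
  show "cmp (k2 d e f j) x \<in> isos Wc (fo (Mf ?A) x) (fo (Mf ?B) x)"
  proof (rule W_isosI[OF h[OF x]])
   fix i assume i: "i \<in> Idx"
   show "fa (PF i) (cmp (k2 d e f j) x) \<in> isos (VC i) (fo (PF i) (fo (Mf ?A) x))
     (fo (PF i) (fo (Mf ?B) x))"
    using isos_alg_hom_catD[OF p_sig[OF i f j] A algX[OF i] x] x xe[OF x] PF_cmp_sig[OF i f j x] PF_k0(1)[OF ob(1) Jj i x] PF_k0(1)[OF ob(2) j i xe[OF x]] by simp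
  qed
 qed
qed

text \<open>With all cocones as index family, joint faithfulness on 2-cells is \<open>W_eqI\<close>
  applied to each component.\<close>

sublocale UC: cone_lifting "Alg U T" D F J WA Idx vertex Pm legs k0 k1 k2
proof (intro cone_lifting.intro cone_lifting_axioms.intro bicolimit_data_axioms; (simp only: Alg_simps(2-))?)
 show "WA \<in> Ob (Alg U T)" by (rule WA_Ob)
 show "vertex i \<in> Ob (Alg U T)" "legs i \<in> cones (vertex i)" if "i \<in> Idx" for i using Idx_Ob Idx_cones that by auto
 show "Pm i \<in> Obj (acat WA (vertex i))" if "i \<in> Idx" for i using Pm_mors[OF that] by simp
 show "\<alpha> = \<beta>" if d: "d \<in> Ob D" and h: "\<alpha> \<in> hom (acat (P0 F d) WA) h k" "\<beta> \<in> hom (acat (P0 F d) WA) h k"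
  and e: "\<And>i. i \<in> Idx ==> acell_comp (P0 F d) WA (vertex i) (Ide (acat WA (vertex i)) (Pm i)) \<alpha>
    = acell_comp (P0 F d) WA (vertex i) (Ide (acat WA (vertex i)) (Pm i)) \<beta>" for d h k \<alpha> \<beta>
 proof (rule acell_eqI[OF algF[OF d] WA_alg h])
  fix x assume x: "x \<in> Obj (FC d)"
  show "cmp \<alpha> x = cmp \<beta> x"
   by (rule W_eqI[OF acell_homD(6)[OF algF[OF d] WA_alg h(1) x, unfolded WA_simps] acell_homD(6)[OF algF[OF d] WA_alg h(2) x, unfolded WA_simps]])
    (metis e cmp_Pm_cell[OF _ d h(1) x] cmp_Pm_cell[OF _ d h(2) x])
 qed
 show "k0 d j \<in> Obj (acat (P0 F d) WA)" if "d \<in> Ob D" "j \<in> Obj (P0 J d)" for d j using k0_mors[OF that] by simp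
 show "acomp (P0 F d) WA (vertex i) (Pm i) (k0 d j) = fo (t1 (legs i) d) j" if "i \<in> Idx" "d \<in> Ob D" "j \<in> Obj (P0 J d)" for i d j
  by (rule Pm_k0[OF that(2,3,1)])
 show "k1 d u \<in> hom (acat (P0 F d) WA) (k0 d j) (k0 d j')" if "d \<in> Ob D" "u \<in> hom (P0 J d) j j'" for d u j j' by (rule k1_hom[OF that])
 have I: "Ide (acat WA (vertex i)) (Pm i) \<in> hom (acat WA (vertex i)) (Pm i) (Pm i)" if "i \<in> Idx" for i
  using category.Ide_hom[OF category_acat[OF WA_alg algX[OF that]]] Pm_mors[OF that] by simp
 show "acell_comp (P0 F d) WA (vertex i) (Ide (acat WA (vertex i)) (Pm i)) (k1 d u) = fa (t1 (legs i) d) u"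
  if i: "i \<in> Idx" and d: "d \<in> Ob D" and u: "u \<in> hom (P0 J d) j j'" for i d u j j'
 proof -
  note o = category.hom_Obj[OF catJ[OF d] u]
  note c = acell_comp_hom[OF algF[OF d] WA_alg algX[OF i] k1_hom[OF d u] I[OF i], unfolded Pm_k0[OF d o(1) i] Pm_k0[OF d o(2) i]]
  show ?thesis
   by (rule acell_eqI[OF algF[OF d] algX[OF i] c p_wt[OF i d u]])
    (simp add: cmp_Pm_cell[OF i d k1_hom[OF d u]] PF_cmp_wt[OF i d homD(1)[OF u]])
 qed
 show "k2 d e f j \<in> isos (acat (P0 F e) WA) (acomp (P0 F e) (P0 F d) WA (k0 d j) (P1 F e d f)) (k0 e (fo (P1 J d e f) j))"
  if "one_cell D e d f" "j \<in> Obj (P0 J d)" for d e f j by (rule k2_isos[OF that])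
 show "acell_comp (P0 F e) WA (vertex i) (Ide (acat WA (vertex i)) (Pm i)) (k2 d e f j) = cmp (t2 (legs i) d e f) j"
  if i: "i \<in> Idx" and f: "one_cell D e d f" and j: "j \<in> Obj (P0 J d)" for i d e f j
 proof -
  note ob = one_cellD[OF f] and Jj = J1[OF f j] and Fm = morF[OF f] and hh = isos_hom[OF k2_isos[OF f j]]
  have s: "acomp (P0 F e) WA (vertex i) (Pm i) (acomp (P0 F e) (P0 F d) WA (k0 d j) (P1 F e d f))
    = acomp (P0 F e) (P0 F d) (vertex i) (fo (t1 (legs i) d) j) (P1 F e d f)"
   using C.Hc1_assoc[OF F.P0_Ob[OF ob(1)] F.P0_Ob[OF ob(2)] WA_Ob Idx_Ob[OF i], of "P1 F e d f" "k0 d j" "Pm i"] Fm k0_mors[OF ob(2) j] Pm_mors[OF i]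
    Pm_k0[OF ob(2) j i] by simp
  note c = acell_comp_hom[OF algF[OF ob(1)] WA_alg algX[OF i] hh I[OF i], unfolded s Pm_k0[OF ob(1) Jj i]]
  show ?thesis
   by (rule acell_eqI[OF algF[OF ob(1)] algX[OF i] c isos_hom[OF p_sig[OF i f j]]])
    (simp add: cmp_Pm_cell[OF i ob(1) hh] PF_cmp_sig[OF i f j])
 qed
qed

end

section \<open>The universal property\<close>

context category
begin

text \<open>Five faces of a cube commute, and the edge \<open>r'\<close> is invertible; hence so does the sixth.\<close>

lemma cube:
 assumes h: "s \<in> hom C a b" "r \<in> hom C c d" "s' \<in> hom C a' b'" "r' \<in> isos C c' d'"
   "u \<in> hom C a c" "u' \<in> hom C a' c'" "v \<in> hom C b d" "v' \<in> hom C b' d'"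
   "x \<in> hom C a a'" "y \<in> hom C b b'" "z \<in> hom C c c'" "q \<in> hom C d d'"
  and e: "v \<cdot>[C] s = r \<cdot>[C] u" "v' \<cdot>[C] s' = r' \<cdot>[C] u'" "s' \<cdot>[C] x = y \<cdot>[C] s" "r' \<cdot>[C] z = q \<cdot>[C] r" "v' \<cdot>[C] y = q \<cdot>[C] v"
 shows "z \<cdot>[C] u = u' \<cdot>[C] x"
proof (rule iso_cancel_left[OF h(4) Cmp_hom[OF h(5,11)] Cmp_hom[OF h(9,6)]])
 note r' = isos_hom[OF h(4)]
 have "r' \<cdot>[C] (z \<cdot>[C] u) = q \<cdot>[C] (r \<cdot>[C] u)"
  unfolding Cmp_assoc[OF h(5,11) r'] e(4) Cmp_assoc[OF h(5,2,12)] ..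
 also have "\<dots> = v' \<cdot>[C] (y \<cdot>[C] s)"
  unfolding e(1)[symmetric] Cmp_assoc[OF h(1,7,12)] e(5)[symmetric] Cmp_assoc[OF h(1,10,8)] ..
 also have "\<dots> = r' \<cdot>[C] (u' \<cdot>[C] x)"
  unfolding e(3)[symmetric] Cmp_assoc[OF h(9,3,8)] e(2) Cmp_assoc[OF h(9,6) r'] ..
 finally show "r' \<cdot>[C] (z \<cdot>[C] u) = r' \<cdot>[C] (u' \<cdot>[C] x)" .
qed

end

context free_bicolimit
begin

text \<open>Identifies the inverse in \<open>Wc\<close>, which is a mere choice, with the generated
  arrow \<open>invA\<close>. The induction over arrows needs this for the rule
  \<open>inv\<close>.\<close>

lemma inv_ea:
 assumes a: "a \<in> AT" and i: "iso_arrow a"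
 shows "ea a \<in> isos Wc (eo (dm a)) (eo (cd a))" "inv_arr Wc (ea a) = ea (invA a)" "invA a \<in> AT"
proof -
 show iA: "invA a \<in> AT" by (rule AT.inv[OF a i])
 show s: "ea a \<in> isos Wc (eo (dm a)) (eo (cd a))"
  by (rule W_isosI[OF ea_hom[OF a]]) (use i a AT_OT[OF a] in simp)
 show "inv_arr Wc (ea a) = ea (invA a)"
  by (rule W_eqI[OF inv_arr_hom[OF s] ea_hom[OF iA, unfolded arrow_simps]])
   (use a iA in \<open>simp add: fun_inv_arr[OF PF_functors category_Wc catX s]\<close>)
qed

section \<open>Uniqueness and existence of 2-cells between arbitrary morphisms out of
  \<open>WA\<close>\<close>

context
 fixes X h k
 assumes X: "X \<in> Ob (Alg U T)" and h: "h \<in> alg_mors T WA X" and k: "k \<in> alg_mors T WA X"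
begin

lemma Xp: "pseudo_algebra T X" using X by simp
lemmas Wp = WA_alg
interpretation X: category "Car X" by (rule cat_Car[OF Xp])
lemmas hd = mors_data[OF Wp Xp h] and kd = mors_data[OF Wp Xp k]
lemmas H = mor_data_Mf[OF Wp Xp hd, unfolded WA_simps] and K = mor_data_Mf[OF Wp Xp kd, unfolded WA_simps]
lemmas Rh = Rho_isos[OF Wp Xp hd, unfolded WA_simps] and Rk = Rho_isos[OF Wp Xp kd, unfolded WA_simps]
lemmas PX = Phi_fun[OF Xp]

text \<open>At a compound term the law with \<open>Rho\<close> expresses the component through those
  at the subterms, because \<open>Rho k w\<close> is invertible. So the components at generators
  decide.\<close>

lemma cells_eqI:
 assumes a: "\<alpha> \<in> hom (acat WA X) h k" and b: "\<beta> \<in> hom (acat WA X) h k"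
  and e: "\<And>d j x. d \<in> Ob D ==> j \<in> Obj (P0 J d) ==> x \<in> Obj (FC d) ==> cmp \<alpha> (eo (Gen d j x)) = cmp \<beta> (eo (Gen d j x))"
 shows "\<alpha> = \<beta>"
proof (rule acell_eqI[OF Wp Xp a b], unfold WA_simps)
 note ad = acell_homD[OF Wp Xp a, unfolded WA_simps] and bd = acell_homD[OF Wp Xp b, unfolded WA_simps]
 have "cmp \<alpha> (eo t) = cmp \<beta> (eo t)" if "t \<in> OT" for t
  using that
 proof induction
  case (Op w ts)
  have s: "set ts \<subseteq> OT" using Op(3) by blast
  note xs = eo_pow[OF s Op(2)] and f = fo_PhiW[OF s Op(2)]
  have o: "eo (Op w ts) \<in> Obj Wc" using fun_fo[OF PhiW_functors[OF Op(1)] xs] f by simp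
  have m: "map (cmp \<alpha>) (map eo ts) = map (cmp \<beta>) (map eo ts)" using Op(3) by simp
  show ?case
   using ad(8)[OF Op(1) xs] bd(8)[OF Op(1) xs] m
   by (intro X.iso_cancel_left[OF Rk[OF Op(1) xs, unfolded f] ad(6)[OF o, unfolded f] bd(6)[OF o, unfolded f]]) (simp add: f del: map_map)
 qed (rule e)
 then show "cmp \<alpha> x = cmp \<beta> x" if "x \<in> Obj Wc" for x using that by (auto simp: Wc_simps)
qed

text \<open>The only possible extension of given components at generators: the law of a 2-cell with
  respect to \<open>Rho\<close>, solved for the component at \<open>Op w ts\<close>. The unsolved
  form is \<open>am_square\<close>.\<close>

primrec al :: "('u => 'u => 'u => 'u) => 'u oterm => 'u" where
 "al m (Gen d j x) = m d j x"
| "al m (Op w ts) = inv_arr (Car X) (cmp (Rho k w) (map eo ts)) \<cdot>[Car X]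
  (fa (Phi X w) (map (al m) ts) \<cdot>[Car X] cmp (Rho h w) (map eo ts))"

lemma map_al_hom:
 assumes "\<And>t. t \<in> set ts ==> al m t \<in> hom (Car X) (fo (Mf h) (eo t)) (fo (Mf k) (eo t))" "length ts = n"
 shows "map (al m) ts \<in> hom (pow (Car X) n) (map (fo (Mf h)) (map eo ts)) (map (fo (Mf k)) (map eo ts))"
 using assms by (auto simp: hom_pow_iff)

text \<open>The content of a modification between the two pushed cocones: a 2-cell
  \<open>m d j\<close> for each pair, and two conditions. These are naturality of the intended
  extension at the generators \<open>wtA\<close> and \<open>sigA\<close>.\<close>

context
 fixes m
 assumes m: "\<And>d j. d \<in> Ob D ==> j \<in> Obj (P0 J d) ==> m d j \<in> hom (acat (P0 F d) X)
   (acomp (P0 F d) WA X h (k0 d j)) (acomp (P0 F d) WA X k (k0 d j))"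
  and m_wt: "\<And>d u j j' x. d \<in> Ob D ==> u \<in> hom (P0 J d) j j' ==> x \<in> Obj (FC d) ==>
   cmp (m d j') x \<cdot>[Car X] fa (Mf h) (ea (wtA d u x)) = fa (Mf k) (ea (wtA d u x)) \<cdot>[Car X] cmp (m d j) x"
  and m_sig: "\<And>d e f j x. one_cell D e d f ==> j \<in> Obj (P0 J d) ==> x \<in> Obj (FC e) ==>
   cmp (m e (fo (P1 J d e f) j)) x \<cdot>[Car X] fa (Mf h) (ea (sigA d e f j x))
   = fa (Mf k) (ea (sigA d e f j x)) \<cdot>[Car X] cmp (m d j) (fo (Mf (P1 F e d f)) x)"
begin

abbreviation "am == al (\<lambda>d j. cmp (m d j))"

lemma am_hom: "t \<in> OT ==> am t \<in> hom (Car X) (fo (Mf h) (eo t)) (fo (Mf k) (eo t))"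
proof (induction rule: OT.induct)
 case (Gen d j x)
 then show ?case using acell_homD(6)[OF algF[OF Gen(1)] Xp m[OF Gen(1,2)] Gen(3)] by (simp add: k0_simps)
next
 case (Op w ts)
 have s: "set ts \<subseteq> OT" using Op(3) by blast
 note xs = eo_pow[OF s Op(2)] and f = fo_PhiW[OF s Op(2)]
 have a: "map am ts \<in> hom (pw X w) (map (fo (Mf h)) (map eo ts)) (map (fo (Mf k)) (map eo ts))"
  by (rule map_al_hom) (use Op in auto)
 show ?case
  unfolding al.simps f[symmetric]
  by (rule X.Cmp_hom[OF X.Cmp_hom[OF isos_hom[OF Rh[OF Op(1) xs]] fun_fa[OF PX[OF Op(1)] a]] inv_arr_hom[OF Rk[OF Op(1) xs]]])
qed

context
 fixes w ts assumes w: "w \<in> words T" and ts: "set ts \<subseteq> OT" "length ts = arity T w"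
begin

lemma am_pow: "map am ts \<in> hom (pw X w) (map (fo (Mf h)) (map eo ts)) (map (fo (Mf k)) (map eo ts))"
 by (rule map_al_hom) (use am_hom ts in auto)

lemma Rh_ts: "cmp (Rho h w) (map eo ts) \<in> isos (Car X) (fo (Mf h) (eo (Op w ts))) (fo (Phi X w) (map (fo (Mf h)) (map eo ts)))"
 and Rk_ts: "cmp (Rho k w) (map eo ts) \<in> isos (Car X) (fo (Mf k) (eo (Op w ts))) (fo (Phi X w) (map (fo (Mf k)) (map eo ts)))"
 using Rh[OF w eo_pow[OF ts]] Rk[OF w eo_pow[OF ts]] unfolding fo_PhiW[OF ts] .

lemma am_square: "cmp (Rho k w) (map eo ts) \<cdot>[Car X] am (Op w ts) = fa (Phi X w) (map am ts) \<cdot>[Car X] cmp (Rho h w) (map eo ts)"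
proof -
 note r = X.Cmp_hom[OF isos_hom[OF Rh_ts] fun_fa[OF PX[OF w] am_pow]]
 show ?thesis
  unfolding al.simps X.Cmp_assoc[OF r inv_arr_hom[OF Rk_ts] isos_hom[OF Rk_ts]] inv_arr_right[OF Rk_ts] by (rule X.Cmp_Ide_left[OF r])
qed

end

text \<open>The generators \<open>arrA\<close> and \<open>rhoA\<close> are covered because
  \<open>m d j\<close> is a 2-cell of algebras, \<open>wtA\<close> and \<open>sigA\<close> by the
  two conditions on \<open>m\<close>, and the coherence generators by the laws of the morphisms
  \<open>h\<close> and \<open>k\<close> together with \<open>am_square\<close>. For compound arrows
  naturality is inherited.\<close>

lemma am_natural: "a \<in> AT ==> am (cd a) \<cdot>[Car X] fa (Mf h) (ea a) = fa (Mf k) (ea a) \<cdot>[Car X] am (dm a)"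
proof (induction rule: AT.induct)
 case (basic a)
 note a = ea_hom[OF AT.basic[OF basic]] and o = AT_OT[OF AT.basic[OF basic]]
 note ha = fun_fa[OF H a] and ka = fun_fa[OF K a]
 from basic show ?case
 proof cases
  case (ide s)
  have "eo s \<in> Obj Wc" "ea (ideA s) = Ide Wc (eo s)" using ide(2) by (auto simp: Wc_simps)
  then show ?thesis
   unfolding ide(1) using X.Cmp_Ide_left[OF am_hom[OF ide(2)]] X.Cmp_Ide_right[OF am_hom[OF ide(2)]] fun_Ide[OF H] fun_Ide[OF K] by simp
 next
  case (arr d j f)
  then show ?thesis
   using acell_homD(7)[OF algF[OF arr(2)] Xp m[OF arr(2,3)] Arr_hom[OF arr(4)]] by (simp add: k0_simps) (simp add: arrA_def)
 next
  case (wt d u x)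
  then show ?thesis using m_wt[OF wt(2) Arr_hom[OF wt(3)] wt(4)] by (simp add: wtA_def)
 next
  case (rho d j w xs)
  \<comment> \<open>Naturality at \<open>rhoA\<close> is the law of \<open>m d j\<close> with
    respect to \<open>Rho\<close>, with the components of \<open>Rho\<close> for the composites with
    \<open>k0\<close> written out. In the cube used below, the edges \<open>v\<close> and
    \<open>v'\<close> are identities.\<close>
  note A = algF[OF rho(2)] and c = k0_data[OF rho(2,3)]
  let ?ts = "map (Gen d j) xs"
  have s: "set xs \<subseteq> Obj (FC d)" "length ?ts = arity T w" using rho by auto
  note ts = Gen_OT[OF rho(2,3) s(1)] s(2) and mk = map_k0[OF rho(2,3) s(1)]
  have d: "dm a = Gen d j (fo (Phi (P0 F d) w) xs)" "cd a = Op w ?ts" unfolding rho(1) by (simp_all add: rhoA_def)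
  note h1 = ha[unfolded d] and k1 = ka[unfolded d]
  note q = fun_fa[OF PX[OF rho(4)] am_pow[OF rho(4) ts]] and Rh = Rh_ts[OF rho(4) ts] and Rk = Rk_ts[OF rho(4) ts]
  have e: "cmp (Rho (acomp (P0 F d) WA X g (k0 d j)) w) xs = cmp (Rho g w) (map eo ?ts) \<cdot>[Car X] fa (Mf g) (ea a)"
   if "mor_data WA X g" for g
   unfolding Rho_comp[OF A Wp Xp c that rho(4,5)] k0_simps(3)[OF rho(4,5)] mk rho(1) ..
  have s1: "(cmp (Rho k w) (map eo ?ts) \<cdot>[Car X] fa (Mf k) (ea a)) \<cdot>[Car X] am (dm a)
    = fa (Phi X w) (map am ?ts) \<cdot>[Car X] (cmp (Rho h w) (map eo ?ts) \<cdot>[Car X] fa (Mf h) (ea a))"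
   using acell_homD(8)[OF A Xp m[OF rho(2,3)] rho(4,5)] unfolding e[OF hd] e[OF kd] d by (simp add: comp_def)
  note Rk' = X.Cmp_hom[OF k1 isos_hom[OF Rk]] and Rh' = X.Cmp_hom[OF h1 isos_hom[OF Rh]]
  show ?thesis unfolding d
   by (rule X.cube[OF Rh' isos_hom[OF Rh] Rk' Rk h1 k1 X.Ide_hom X.Ide_hom am_hom q am_hom q])
    (use X.hom_Obj[OF q] X.Cmp_Ide_left[OF Rh'] X.Cmp_Ide_left[OF Rk'] s1[unfolded d(1)] am_square[OF rho(4) ts] X.Cmp_Ide_left[OF q] X.Cmp_Ide_right[OF q] o[unfolded d]
     in \<open>simp_all del: map_map\<close>)
 next
  case (sig e d f j x)
  then show ?thesis using m_sig[OF sig(2-4)] by (simp add: sigA_def)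
 next
  case (cc w ws ts)
  \<comment> \<open>A cube in \<open>X\<close>: two opposite faces are the laws of \<open>h\<close>
    and of \<open>k\<close> for \<open>Cc\<close>, two more come from the squares of
    \<open>am\<close> at the composite word and at the nested term, and the fifth is naturality of
    \<open>Cc X w ws\<close>. The sixth face is the claim.\<close>
  note cd = composableD[OF cc(2)] and g = words_wgamma[OF cc(2)]
  have lg: "length ts = arity T (wgamma T w ws)" using cc(4) g(2) by simp
  let ?b = "blocks (ars ws)" let ?us = "map2 Op ws (?b ts)" let ?xs = "map eo ts"
  have xs: "?xs \<in> Obj (pow Wc (tot ws))" by (rule eo_pow[OF cc(3,4)])
  have lu: "length ?us = arity T w" using cd(5) by simp
  note us = map2_Op_OT[OF cd(4) cc(3,4)]
  have d: "dm a = Op (wgamma T w ws) ts" "cd a = Op w ?us" unfolding cc(1) by (simp_all add: ccA_def)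
  have mu: "map2 (\<lambda>v. fo (PhiW v)) ws (?b ?xs) = map eo ?us" by (rule map2_PhiW_eo[OF cd(4) cc(3,4)])
  note h1 = ha[unfolded d] and k1 = ka[unfolded d]
  note Rhu = Rh_ts[OF cd(3) us lu] and Rku = Rk_ts[OF cd(3) us lu] and Rhg = Rh_ts[OF g(1) cc(3) lg] and Rkg = Rk_ts[OF g(1) cc(3) lg]
  note ag = am_pow[OF g(1) cc(3) lg, unfolded g(2)] and au = am_pow[OF cd(3) us lu]
  have B: "RhoB g ws ?xs \<in> isos (pow (Car X) (arity T w)) (map (fo (Mf g)) (map eo ?us)) (PhiB X ws (map (fo (Mf g)) ?xs))"
   if "mor_data WA X g" for g
   using map2_Rho_isos[OF Wp Xp that cd(4), unfolded WA_simps, OF xs] unfolding mu cd(5) .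
  note Bk = B[OF kd] and Bh = B[OF hd]
  note pX = category_pow[OF X.category_axioms]
  note Pk = fun_isos[OF PX[OF cd(3)] pX Bk] and Ph = fun_isos[OF PX[OF cd(3)] pX Bh]
  note Ck = isos_hom[OF cmp_Cc[OF Xp cc(2) Mf_Obj[OF Wp Xp kd, unfolded WA_simps, OF xs]]] and Ch = isos_hom[OF cmp_Cc[OF Xp cc(2) Mf_Obj[OF Wp Xp hd, unfolded WA_simps, OF xs]]]
  have wi: "ws ! n \<in> words T" if "n < length ws" for n using cd(4) that by auto
  have bi: "set (?b ts ! n) \<subseteq> OT" "length (?b ts ! n) = arity T (ws ! n)" if "n < length ws" for n
   using set_blocks_nth[of n "ars ws" ts] that cc(3,4) by auto
  have pp: "map2 (\<lambda>v. fa (Phi X v)) ws (?b (map am ts)) \<in> hom (pw X w) (PhiB X ws (map (fo (Mf h)) ?xs)) (PhiB X ws (map (fo (Mf k)) ?xs))"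
   unfolding hom_pow_iff using fun_fa[OF PX[OF wi] am_pow[OF wi bi]] cd(5) by (simp add: blocks_map)
  \<comment> \<open>The nested term needs \<open>am_square\<close> on two levels. These are the
    inner squares, one per block, combined into one square in the power of \<open>X\<close>; the
    outer one is pasted on at the end.\<close>
  have "RhoB k ws ?xs \<cdot>[pw X w] map am ?us
    = map2 (\<lambda>v. fa (Phi X v)) ws (?b (map am ts)) \<cdot>[pw X w] RhoB h ws ?xs"
   using am_square[OF wi bi] by (auto simp: blocks_map intro!: nth_equalityI simp del: al.simps)
  then have f: "fa (Phi X w) (RhoB k ws ?xs) \<cdot>[Car X] fa (Phi X w) (map am ?us)
    = fa (Phi X w) (map2 (\<lambda>v. fa (Phi X v)) ws (?b (map am ts))) \<cdot>[Car X] fa (Phi X w) (RhoB h ws ?xs)"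
   using fun_Cmp[OF PX[OF cd(3)] au isos_hom[OF Bk]] fun_Cmp[OF PX[OF cd(3)] isos_hom[OF Bh] pp] by simp
  have e: "cmp (Cc X w ws) (map (fo (Mf g)) ?xs) \<cdot>[Car X] cmp (Rho g (wgamma T w ws)) ?xs
    = fa (Phi X w) (RhoB g ws ?xs) \<cdot>[Car X] (cmp (Rho g w) (map eo ?us) \<cdot>[Car X] fa (Mf g) (ea a))"
   if "g \<in> alg_mors T WA X" for g
   using alg_mors_Cc[OF Wp Xp that cc(2), unfolded WA_simps, OF xs] unfolding mu cmp_CcW[OF cc(3,4)] cc(1) .
  note auX = fun_fa[OF PX[OF cd(3)] au] and ppX = fun_fa[OF PX[OF cd(3)] pp] and agX = fun_fa[OF PX[OF g(1)] am_pow[OF g(1) cc(3) lg]]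
  note o' = o[unfolded d] and sq = am_square[OF cd(3) us lu]
  show ?thesis unfolding d
   by (rule X.cube[OF isos_hom[OF Rhg] X.Cmp_hom[OF isos_hom[OF Rhu] isos_hom[OF Ph]] isos_hom[OF Rkg] X.isos_Cmp[OF Rku Pk] h1 k1 Ch Ck
     am_hom[OF o'(1)] agX am_hom[OF o'(2)] ppX e[OF h, unfolded X.Cmp_assoc[OF h1 isos_hom[OF Rhu] isos_hom[OF Ph]]]
     e[OF k, unfolded X.Cmp_assoc[OF k1 isos_hom[OF Rku] isos_hom[OF Pk]]] am_square[OF g(1) cc(3) lg]
     X.paste[OF am_hom[OF o'(2)] isos_hom[OF Rhu] isos_hom[OF Rku] auX isos_hom[OF Ph] isos_hom[OF Pk] ppX sq f] Cc_nat[OF Xp cc(2) ag]])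
 next
  case (ii t)
  \<comment> \<open>The same cube with the trivial operation at the end of the arrow: its edges
    \<open>r\<close> and \<open>r'\<close> are identities, and naturality of \<open>Ii X\<close> is
    the fifth face.\<close>
  note t = ii(2)
  have ts: "set [t] \<subseteq> OT" "length [t] = arity T (wunit T)" using t words_wunit by auto
  note u = words_wunit(1)
  have d: "dm a = Op (wunit T) [t]" "cd a = t" unfolding ii(1) by (simp_all add: iiA_def)
  have et: "eo t \<in> Obj Wc" using t by (simp add: Wc_simps)
  note h1 = ha[unfolded d] and k1 = ka[unfolded d] and q = am_hom[OF t]
  note Ck = isos_hom[OF cmp_Ii[OF Xp fun_fo[OF K et]]] and Ch = isos_hom[OF cmp_Ii[OF Xp fun_fo[OF H et]]]
  note Rhu = Rh_ts[OF u ts, unfolded list.map] and Rku = Rk_ts[OF u ts, unfolded list.map]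
  note au = fun_fa[OF PX[OF u] am_pow[OF u ts], unfolded list.map]
  have e: "cmp (Ii X) [fo (Mf g) (eo t)] \<cdot>[Car X] cmp (Rho g (wunit T)) [eo t] = fa (Mf g) (ea a)" if "g \<in> alg_mors T WA X" for g
   using alg_mors_Ii[OF Wp Xp that, unfolded WA_simps, OF et] unfolding cmp_IiW[OF t] ii(1) .
  show ?thesis unfolding d
   by (rule X.cube[OF isos_hom[OF Rhu] X.Ide_hom isos_hom[OF Rku] X.Ide_isos h1 k1 Ch Ck am_hom au q q])
    (use e[OF h] e[OF k] X.hom_Obj[OF q] X.Cmp_Ide_left[OF h1] X.Cmp_Ide_left[OF k1] X.Cmp_Ide_left[OF q] X.Cmp_Ide_right[OF q]
     am_square[OF u ts] Ii_nat[OF Xp q] o[unfolded d] in \<open>simp_all del: al.simps\<close>)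
 next
  case (ss w fs l ts)
  note w = ss(2) and fs = ss(3,4) and s = words_wsub[OF ss(2-4)]
  have lg: "length ts = arity T (wsub T l fs w)" using ss(6) s(2) by simp
  let ?us = "map ((!) ts) fs" let ?xs = "map eo ts"
  have us: "set ?us \<subseteq> OT" using map_nth_OT[OF ss(5)] ss(4,6) by simp
  have lu: "length ?us = arity T w" using fs by simp
  have xs: "?xs \<in> Obj (pow Wc l)" by (rule eo_pow[OF ss(5,6)])
  have mn: "map ((!) (map f ts)) fs = map f ?us" for f :: "'u oterm => 'u" using fs ss(6) by (auto simp: subset_iff)
  have mn': "map ((!) (map f ?xs)) fs = map f (map eo ?us)" for f :: "'u => 'u" using fs ss(6) by (auto simp: subset_iff)
  have d: "dm a = Op (wsub T l fs w) ts" "cd a = Op w ?us" unfolding ss(1) by (simp_all add: ssA_def)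
  note h1 = ha[unfolded d] and k1 = ka[unfolded d]
  note Rhu = Rh_ts[OF w us lu] and Rku = Rk_ts[OF w us lu] and Rhg = Rh_ts[OF s(1) ss(5) lg] and Rkg = Rk_ts[OF s(1) ss(5) lg]
  note ag = am_pow[OF s(1) ss(5) lg, unfolded s(2)] and au = fun_fa[OF PX[OF w] am_pow[OF w us lu]] and agX = fun_fa[OF PX[OF s(1)] am_pow[OF s(1) ss(5) lg]]
  note Ck = isos_hom[OF cmp_Ss[OF Xp w fs Mf_Obj[OF Wp Xp kd, unfolded WA_simps, OF xs]], unfolded mn']
   and Ch = isos_hom[OF cmp_Ss[OF Xp w fs Mf_Obj[OF Wp Xp hd, unfolded WA_simps, OF xs]], unfolded mn']
  have e: "cmp (Ss X w l fs) (map (fo (Mf g)) ?xs) \<cdot>[Car X] cmp (Rho g (wsub T l fs w)) ?xs = cmp (Rho g w) (map eo ?us) \<cdot>[Car X] fa (Mf g) (ea a)"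
   if "g \<in> alg_mors T WA X" for g
   using alg_mors_Ss[OF Wp Xp that w fs, unfolded WA_simps, OF xs] unfolding mn cmp_SsW[OF ss(5,6)] ss(1) .
  show ?thesis unfolding d
   by (rule X.cube[OF isos_hom[OF Rhg] isos_hom[OF Rhu] isos_hom[OF Rkg] Rku h1 k1 Ch Ck am_hom agX am_hom au e[OF h] e[OF k] am_square[OF s(1) ss(5) lg] am_square[OF w us lu]
      Ss_nat[OF Xp w fs ag, unfolded mn]])
    (use o d in auto)
 qed
next
 case (comp a b)
 note a = ea_hom[OF comp(1)] and b = ea_hom[OF comp(2), folded comp(3)]
 have ab: "ea (compA b a) = ea b \<cdot>[Wc] ea a" by (simp add: Wc_simps comp)
 note A = am_hom[OF AT_OT(1)[OF comp(1)]] am_hom[OF AT_OT(2)[OF comp(1)]] am_hom[OF AT_OT(2)[OF comp(2)]]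
 show ?case
  unfolding ab fun_Cmp[OF H a b] fun_Cmp[OF K a b] arrow_simps
  by (rule X.paste[OF A(1) fun_fa[OF H a] fun_fa[OF K a] A(2) fun_fa[OF H b] fun_fa[OF K b] A(3), symmetric])
   (use comp(4,5) in \<open>simp_all add: comp(3)\<close>)
next
 case (op w as)
 have as: "set as \<subseteq> AT" using op(3) by blast
 have ts: "set (map dm as) \<subseteq> OT" "length (map dm as) = arity T w" and us: "set (map cd as) \<subseteq> OT" "length (map cd as) = arity T w"
  using op AT_OT by auto
 have oA: "opA w as \<in> AT" by (rule AT.op[OF op(1,2)]) (use op(3) in blast)
 note a = ea_hom[OF oA, unfolded arrow_simps] and P = PX[OF op(1)] and fs = ea_pow[OF as op(2)]
 note o = AT_OT[OF oA, unfolded arrow_simps]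
 note hf = Mf_hom[OF Wp Xp hd, unfolded WA_simps, OF fs] and kf = Mf_hom[OF Wp Xp kd, unfolded WA_simps, OF fs]
 note ad = am_pow[OF op(1) ts] and ac = am_pow[OF op(1) us]
 have e: "fa (Phi X w) (map (fa (Mf g)) (map ea as)) \<cdot>[Car X] cmp (Rho g w) (map eo (map dm as)) = cmp (Rho g w) (map eo (map cd as)) \<cdot>[Car X] fa (Mf g) (ea (opA w as))"
  if "mor_data WA X g" for g
  using Rho_nat[OF Wp Xp that op(1), unfolded WA_simps, OF fs] unfolding fa_PhiW[OF as op(2)] by simp
 \<comment> \<open>The induction hypotheses for the arguments form one square in the power; applying
   the operation of \<open>X\<close> gives the fifth face of the cube, while the laws for
   \<open>h\<close> and \<open>k\<close> are naturality of their \<open>Rho\<close>.\<close>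
 have "map (fa (Mf k)) (map ea as) \<cdot>[pw X w] map am (map dm as) = map am (map cd as) \<cdot>[pw X w] map (fa (Mf h)) (map ea as)"
  using op(3) by (auto intro!: nth_equalityI)
 then have n: "fa (Phi X w) (map (fa (Mf k)) (map ea as)) \<cdot>[Car X] fa (Phi X w) (map am (map dm as)) = fa (Phi X w) (map am (map cd as)) \<cdot>[Car X] fa (Phi X w) (map (fa (Mf h)) (map ea as))"
  using fun_Cmp[OF P ad kf] fun_Cmp[OF P hf ac] by simp
 show ?case unfolding arrow_simps
  by (rule X.cube[OF isos_hom[OF Rh_ts[OF op(1) ts]] isos_hom[OF Rh_ts[OF op(1) us]] isos_hom[OF Rk_ts[OF op(1) ts]] Rk_ts[OF op(1) us]
   fun_fa[OF H a] fun_fa[OF K a] fun_fa[OF P hf] fun_fa[OF P kf] am_hom[OF o(1)] fun_fa[OF P ad] am_hom[OF o(2)] fun_fa[OF P ac]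
   e[OF hd] e[OF kd] am_square[OF op(1) ts] am_square[OF op(1) us] n])
next
 case (inv a)
 \<comment> \<open>Functors preserve inverses, so the naturality square of \<open>a\<close> can be
   inverted.\<close>
 note i = inv_ea[OF inv(1,2)] and A = am_hom[OF AT_OT(1)[OF inv(1)]] am_hom[OF AT_OT(2)[OF inv(1)]]
 note e = fun_inv_arr[OF H category_Wc X.category_axioms i(1)] fun_inv_arr[OF K category_Wc X.category_axioms i(1)]
 show ?case
  unfolding arrow_simps i(2)[symmetric] e
  by (rule X.inv_square[OF fun_isos[OF H category_Wc i(1)] fun_isos[OF K category_Wc i(1)] A inv(3)])
qed

text \<open>Fullness: naturality is \<open>am_natural\<close>, since every arrow of
  \<open>Wc\<close> encodes a generated one, and the law with \<open>Rho\<close> is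
  \<open>am_square\<close>, since every tuple of objects encodes a list of terms.\<close>

lemma cells_exist: "\<exists>\<alpha>\<in>hom (acat WA X) h k. \<forall>d\<in>Ob D. \<forall>j\<in>Obj (P0 J d). \<forall>x\<in>Obj (FC d). cmp \<alpha> (eo (Gen d j x)) = cmp (m d j) x"
proof
 let ?\<alpha> = "\<lparr>src = h, tgt = k, cmp = (\<lambda>x\<in>Obj Wc. am (ot x))\<rparr>"
 have c: "cmp ?\<alpha> (eo t) = am t" if "t \<in> OT" for t using that by (simp add: Wc_simps)
 show "?\<alpha> \<in> hom (acat WA X) h k"
 proof (rule acell_homI[OF Wp Xp h k]; (simp only: WA_simps)?)
  show "cmp ?\<alpha> x \<in> hom (Car X) (fo (Mf h) x) (fo (Mf k) x)" if "x \<in> Obj Wc" for x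
  proof -
   obtain t where t: "t \<in> OT" "x = eo t" using \<open>x \<in> Obj Wc\<close> by (auto simp: Wc_simps)
   show ?thesis unfolding t(2) c[OF t(1)] by (rule am_hom[OF t(1)])
  qed
  show "cmp ?\<alpha> y \<cdot>[Car X] fa (Mf h) f = fa (Mf k) f \<cdot>[Car X] cmp ?\<alpha> x" if f: "f \<in> hom Wc x y" for f x y
  proof -
   obtain a where a: "a \<in> AT" "f = ea a" "x = eo (dm a)" "y = eo (cd a)" using f by (rule Wc_homE)
   show ?thesis unfolding a(2-4) c[OF AT_OT(1)[OF a(1)]] c[OF AT_OT(2)[OF a(1)]] by (rule am_natural[OF a(1)])
  qed
  fix w xs assume w: "w \<in> words T" and xs: "xs \<in> Obj (pow Wc (arity T w))"
  obtain ts where t: "set ts \<subseteq> OT" "length ts = arity T w" "xs = map eo ts" using xs by (rule Wc_pow_Obj)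
  have "map (cmp ?\<alpha>) xs = map am ts" using t c by (auto simp: subset_iff)
  then show "cmp (Rho k w) xs \<cdot>[Car X] cmp ?\<alpha> (fo (PhiW w) xs) = fa (Phi X w) (map (cmp ?\<alpha>) xs) \<cdot>[Car X] cmp (Rho h w) xs"
   using am_square[OF w t(1,2)] unfolding t(3) fo_PhiW[OF t(1,2)] c[OF OT_Op[OF w t(2,1)]] by (simp only:)
 qed (auto)
 show "\<forall>d\<in>Ob D. \<forall>j\<in>Obj (P0 J d). \<forall>x\<in>Obj (FC d). cmp ?\<alpha> (eo (Gen d j x)) = cmp (m d j) x"
  using c OT.Gen by simp
qed

end

end

lemma weighted_bicolimit_WA: "weighted_bicolimit (Alg U T) D J F WA"
proof (rule weighted_bicolimitI[OF WA_Ob UC.\<kappa>_cones])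
 note Wp = WA_alg
 show "\<exists>h\<in>Obj (Hom (Alg U T) WA X). push WA X h UC.\<kappa> = \<tau>" if "X \<in> Ob (Alg U T)" "\<tau> \<in> cones X" for X \<tau>
 proof -
  \<comment> \<open>The given cocone is itself one of the indices, and its interpretation morphism
    \<open>Pm\<close> is the required 1-cell.\<close>
  have i: "Cocone X \<tau> \<in> Idx" using that by (simp add: Idx_def)
  show ?thesis using UC.push_\<kappa>[OF i] Pm_mors[OF i] by auto
 qed
 fix X h k assume X: "X \<in> Ob (Alg U T)"
 then have Xp: "pseudo_algebra T X" by simp
 let ?A = "Hom (Alg U T) WA X"
 show "\<alpha> = \<beta>" if "\<alpha> \<in> hom ?A h k" "\<beta> \<in> hom ?A h k"
  and e: "\<And>d j. d \<in> Ob D ==> j \<in> Obj (P0 J d) ==> Hc2 (Alg U T) (P0 F d) WA X \<alpha> (Ide (Hom (Alg U T) (P0 F d) WA) (fo (t1 UC.\<kappa> d) j))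
     = Hc2 (Alg U T) (P0 F d) WA X \<beta> (Ide (Hom (Alg U T) (P0 F d) WA) (fo (t1 UC.\<kappa> d) j))" for \<alpha> \<beta>
 proof -
  have a: "\<alpha> \<in> hom (acat WA X) h k" and b: "\<beta> \<in> hom (acat WA X) h k" using that(1,2) by auto
  note ad = acell_homD[OF Wp Xp a]
  show ?thesis
  proof (rule cells_eqI[OF X ad(1,2) a b])
   fix d j x assume d: "d \<in> Ob D" and j: "j \<in> Obj (P0 J d)" and x: "x \<in> Obj (FC d)"
   show "cmp \<alpha> (eo (Gen d j x)) = cmp \<beta> (eo (Gen d j x))"
    using e[OF d j, THEN arg_cong, of "\<lambda>\<gamma>. cmp \<gamma> x"] cmp_pre_cell[OF algF[OF d] Wp Xp k0_mors[OF d j] a x] cmp_pre_cell[OF algF[OF d] Wp Xp k0_mors[OF d j] b x] d j x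
    by (simp add: k0_simps)
  qed
 qed
 fix m assume "h \<in> Obj ?A" "k \<in> Obj ?A"
  and m: "m \<in> hom (PsHom (op2 D) J (K X)) (push WA X h UC.\<kappa>) (push WA X k UC.\<kappa>)"
 then have h: "h \<in> alg_mors T WA X" and k: "k \<in> alg_mors T WA X" by auto
 note md = cat_valued_pair.modif_homD[OF cat_valued_pair[OF X] m, unfolded op2_simps hom_into_simps]
 have hc: "cmp m d \<in> hom (fun_cat (P0 J d) (acat (P0 F d) X)) (t1 (push WA X h UC.\<kappa>) d) (t1 (push WA X k UC.\<kappa>) d)" if "d \<in> Ob D" for d
  using md(6)[OF that] by simp
 have f: "fo (t1 (push WA X g UC.\<kappa>) d) j = acomp (P0 F d) WA X g (k0 d j)" if "d \<in> Ob D" "j \<in> Obj (P0 J d)" for g d j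
  using fo_push[OF WA_Ob UC.\<kappa>_cones that] that by simp
 have mh: "cmp (cmp m d) j \<in> hom (acat (P0 F d) X) (acomp (P0 F d) WA X h (k0 d j)) (acomp (P0 F d) WA X k (k0 d j))"
  if d: "d \<in> Ob D" and j: "j \<in> Obj (P0 J d)" for d j
  using nt_homD(6)[OF hc[OF d] j] unfolding f[OF d j] .
 \<comment> \<open>Naturality of the transformation \<open>cmp m d\<close> in the weight, read at
   the object \<open>x\<close> of \<open>F d\<close>.\<close>
 have wt: "cmp (cmp (cmp m d) j') x \<cdot>[Car X] fa (Mf h) (ea (wtA d u x)) = fa (Mf k) (ea (wtA d u x)) \<cdot>[Car X] cmp (cmp (cmp m d) j) x"
  if d: "d \<in> Ob D" and u: "u \<in> hom (P0 J d) j j'" and x: "x \<in> Obj (FC d)" for d u j j' x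
 proof -
  have e: "cmp (fa (t1 (push WA X g UC.\<kappa>) d) u) x = fa (Mf g) (ea (wtA d u x))" if g: "g \<in> alg_mors T WA X" for g
   using cmp_post_cell[OF algF[OF d] Wp Xp g k1_hom[OF d u] x] homD(1)[OF u] homD(1)[OF k1_hom[OF d u]] d x by (simp add: k1_def)
  show ?thesis
   using nt_homD(7)[OF hc[OF d] u, THEN arg_cong, of "\<lambda>\<gamma>. cmp \<gamma> x"] x by (simp only: acat_simps e[OF h] e[OF k])
 qed
 \<comment> \<open>The modification axiom at the 1-cell \<open>f\<close>, read at \<open>x\<close>:
   on one side precomposition with \<open>F f\<close> evaluates the cell at the image of
   \<open>x\<close>, on the other the coherence cells of the pushed cocones are images of
   \<open>sigA\<close>.\<close>
 have sig: "cmp (cmp (cmp m e) (fo (P1 J d e f) j)) x \<cdot>[Car X] fa (Mf h) (ea (sigA d e f j x))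
   = fa (Mf k) (ea (sigA d e f j x)) \<cdot>[Car X] cmp (cmp (cmp m d) j) (fo (Mf (P1 F e d f)) x)"
  if f: "one_cell D e d f" and j: "j \<in> Obj (P0 J d)" and x: "x \<in> Obj (FC e)" for d e f j x
 proof -
  note ob = one_cellD[OF f]
  have s: "cmp (cmp (t2 (push WA X g UC.\<kappa>) d e f) j) x = fa (Mf g) (ea (sigA d e f j x))" if g: "g \<in> alg_mors T WA X" for g
   using cmp_post_cell[OF algF[OF ob(1)] Wp Xp g isos_hom[OF k2_isos[OF f j]] x] cmp_push_t2[OF WA_Ob X _ UC.\<kappa>_cones f j, of g] g f j x
   by (simp add: k2_def)
  have r: "cmp (acell_comp (P0 F e) (P0 F d) X (cmp (cmp m d) j) (Ide (acat (P0 F e) (P0 F d)) (P1 F e d f))) x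
    = cmp (cmp (cmp m d) j) (fo (Mf (P1 F e d f)) x)"
   by (rule cmp_pre_cell[OF algF[OF ob(1)] algF[OF ob(2)] Xp morF[OF f] mh[OF ob(2) j] x])
  show ?thesis
   using md(7)[OF f j, THEN arg_cong, of "\<lambda>\<gamma>. cmp \<gamma> x"] x s[OF h] s[OF k] r homD(1)[OF mh[OF ob(2) j]] by simp
 qed
 obtain \<alpha> where a: "\<alpha> \<in> hom (acat WA X) h k"
  and c: "\<forall>d\<in>Ob D. \<forall>j\<in>Obj (P0 J d). \<forall>x\<in>Obj (FC d). cmp \<alpha> (eo (Gen d j x)) = cmp (cmp (cmp m d) j) x"
  using cells_exist[OF X h k mh wt sig] by blast
 show "\<exists>\<alpha>\<in>hom ?A h k. \<forall>d\<in>Ob D. \<forall>j\<in>Obj (P0 J d).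
     Hc2 (Alg U T) (P0 F d) WA X \<alpha> (Ide (Hom (Alg U T) (P0 F d) WA) (fo (t1 UC.\<kappa> d) j)) = cmp (cmp m d) j"
 proof (intro bexI ballI)
  show "\<alpha> \<in> hom ?A h k" using a by simp
  fix d j assume d: "d \<in> Ob D" and j: "j \<in> Obj (P0 J d)"
  have "Ide (acat (P0 F d) WA) (k0 d j) \<in> hom (acat (P0 F d) WA) (k0 d j) (k0 d j)"
   using category.Ide_hom[OF category_acat[OF algF[OF d] Wp]] k0_mors[OF d j] by simp
  note ac = acell_comp_hom[OF algF[OF d] Wp Xp this a]
  have "acell_comp (P0 F d) WA X \<alpha> (Ide (acat (P0 F d) WA) (k0 d j)) = cmp (cmp m d) j"
   by (rule acell_eqI[OF algF[OF d] Xp ac mh[OF d j]])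
    (use c d j in \<open>simp add: cmp_pre_cell[OF algF[OF d] Wp Xp k0_mors[OF d j] a] k0_simps\<close>)
  then show "Hc2 (Alg U T) (P0 F d) WA X \<alpha> (Ide (Hom (Alg U T) (P0 F d) WA) (fo (t1 UC.\<kappa> d) j)) = cmp (cmp m d) j"
   using d j by simp
 qed
qed

end

theorem theorem11p8:
  fixes U :: "'u set set" and T :: "'u lawvere" and D :: "('u, 'u, 'u) twocat"
    and J :: "('u, 'u, 'u, 'u, 'u) catfun"
    and F :: "('u, 'u, 'u, ('u, 'u, 'u) alg, ('u, 'u, 'u, 'u, 'u) amor, ('u, 'u, 'u, 'u, 'u) acell) pfun"
  assumes "universe U"
    and "lawvere_theory T" and "Arr (Tcat T) \<in> U"
    and "two_category D" and "small_twocat U D"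
    and "pseudo_functor (op2 D) (Cat U) J"
    and "pseudo_functor D (Alg U T) F"
  shows "\<exists>W. weighted_bicolimit (Alg U T) D J F W"
proof -
  interpret lawvere_theory T by fact
  have "free_bicolimit U T D F J"
    using assms two_category_Alg pseudo_functor_Cat_cat_valued[OF assms(6)]
    by (intro free_bicolimit.intro free_bicolimit_axioms.intro bicolimit_data.intro) auto
  then show ?thesis using free_bicolimit.weighted_bicolimit_WA by blast
qed

end
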